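(* Let $N\ge1$ be an integer, let $\mathbb{F}$ be $\mathbb{R}$, $\mathbb{C}$ or the quaternions $\mathbb{H}$, with $d=\dim_{\mathbb{R}}\mathbb{F}\in\{1,2,4\}$, and let $x,w\in C_N^B$ and $t\ge0$. For every integer $M\ge N$ put $\kappa_M:=(M-N+1)d/2-1/2$, choose some matrix $\Lambda_M\in\mathbb{F}^{M\times N}$ with $p(\Lambda_M)=w$, and let $(B^M_s)_{s\ge0}$ be a Brownian motion (without drift) on $\mathbb{F}^{M\times N}$ with initial distribution $\sigma_{M,x,\kappa_M\Lambda_M}$. Then, for $M\to\infty$, the random variables $p\big(B^M_{t/\kappa_M}+t\Lambda_M\big)$ tend in probability to $$y_{x,w,t}=\Big(\sqrt{x_i^2+w_i^2t^2+2t\sqrt{x_i^2w_i^2+1}}\Big)_{i=1,\ldots,N}\in C_N^B,$$ where the convergence is locally uniform with respect to $x,w\in C_N^B$ and $t>0$.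
   Context: $C_N^B:=\{x\in\mathbb{R}^N: x_1\ge\ldots\ge x_N\ge0\}$. For $M\ge N$, $\mathbb{F}^{M\times N}$ is a real Euclidean space with scalar product $\langle A,B\rangle=\mathrm{Re}\,\mathrm{tr}(A^*B)$. The map $p:\mathbb{F}^{M\times N}\to C_N^B$ sends $A$ to its ordered singular values, $p(A)=\sqrt{\sigma_N(A^*A)}$, where $\sigma_N$ is the decreasingly ordered spectrum and the root is taken componentwise. For $x\in C_N^B$ let $\Sigma_x=(\mathrm{diag}(x),0)^T\in\mathbb{F}^{M\times N}$, and let $\sigma_{M,x}$ be the push-forward of the product of the normalized Haar measures on the unitary groups $U_M(\mathbb{F})$ and $U_N(\mathbb{F})$ under $(U,V)\mapsto U\Sigma_xV^*$; it is supported on $p^{-1}(\{x\})$. For $\Lambda\in\mathbb{F}^{M\times N}$, $\sigma_{M,x,\Lambda}$ is the probability measure $d\sigma_{M,x,\Lambda}(y)=\frac1Z e^{\langle\Lambda,y\rangle}d\sigma_{M,x}(y)$ with $Z=\int e^{\langle\Lambda,y\rangle}d\sigma_{M,x}(y)$ (which equals the type $B_N$ Bessel function $J^B_{(\kappa_M,d/2)}(x,p(\Lambda))$). A Brownian motion on $\mathbb{F}^{M\times N}$ with initial distribution $\mu$ is $B_0+W_s$ with $B_0\sim\mu$ independent of a standard Brownian motion $W$ of the Euclidean space $\mathbb{F}^{M\times N}$ started at $0$. "Locally uniform" means: for every $\epsilon>0$ and compact $U\subset C_N^B\times C_N^B\times\,]0,\infty[$, the supremum over $(x,w,t)\in U$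 of the probabilities of deviating from $y_{x,w,t}$ by at least $\epsilon$ tends to $0$ as $M\to\infty$. *)

theory Defs
  imports "HOL-Probability.Probability"
begin

section \<open>The division algebras R, C and H\<close>

text \<open>
  By the theorem of Frobenius, a finite-dimensional associative real division algebra is isomorphic
  to R, C or H, and the only multiplicative norm on these is the usual one.  So, up to isometric
  isomorphism, the members of the following class are exactly R, C and H; all three are shown
  to be instances below.  The number \<open>d\<close> is \<open>DIM('a)\<close>.
\<close>

class real_complex_quat = real_normed_div_algebra + euclidean_space

instance real :: real_complex_quat ..

instance complex :: real_complex_quat ..

text \<open>The orthogonal projection onto the line spanned by 1 is the real part, so the following is the
  usual conjugation; see the three lemmas on it below.\<close>

definition re_part :: "'a::real_complex_quat \<Rightarrow> real" where
  "re_part a = a \<bullet> 1"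

definition conjugation :: "'a::real_complex_quat \<Rightarrow> 'a" where
  "conjugation a = of_real (2 * re_part a) - a"

lemma conjugation_real: "conjugation (a::real) = a"
  by (simp add: conjugation_def re_part_def)

lemma conjugation_complex: "conjugation (a::complex) = cnj a"
  by (simp add: conjugation_def re_part_def complex_eq_iff)

datatype quat = Quat (QRe: real) (QI: real) (QJ: real) (QK: real)

lemma quat_eq_iff: "a = b \<longleftrightarrow> QRe a = QRe b \<and> QI a = QI b \<and> QJ a = QJ b \<and> QK a = QK b"
  by (cases a; cases b) simp

instantiation quat :: ab_group_add
begin

definition "0 = Quat 0 0 0 0"
definition "a + b = Quat (QRe a + QRe b) (QI a + QI b) (QJ a + QJ b) (QK a + QK b)"
definition "- a = Quat (- QRe a) (- QI a) (- QJ a) (- QK a)"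
definition "a - b = Quat (QRe a - QRe b) (QI a - QI b) (QJ a - QJ b) (QK a - QK b)"

instance
  by standard
    (simp_all add: quat_eq_iff zero_quat_def plus_quat_def uminus_quat_def minus_quat_def)

end

instantiation quat :: real_algebra_1
begin

definition "1 = Quat 1 0 0 0"

definition "a * b = Quat
  (QRe a * QRe b - QI a * QI b - QJ a * QJ b - QK a * QK b)
  (QRe a * QI b + QI a * QRe b + QJ a * QK b - QK a * QJ b)
  (QRe a * QJ b - QI a * QK b + QJ a * QRe b + QK a * QI b)
  (QRe a * QK b + QI a * QJ b - QJ a * QI b + QK a * QRe b)"

definition "r *\<^sub>R a = Quat (r * QRe a) (r * QI a) (r * QJ a) (r * QK a)"

instance
proof
  fix a b c :: quat and r s :: real
  show "a * b * c = a * (b * c)"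
    by (simp add: quat_eq_iff times_quat_def algebra_simps)
  show "1 * a = a" "a * 1 = a"
    by (simp_all add: quat_eq_iff times_quat_def one_quat_def)
  show "(a + b) * c = a * c + b * c" "a * (b + c) = a * b + a * c"
    by (simp_all add: quat_eq_iff times_quat_def plus_quat_def algebra_simps)
  show "(0::quat) \<noteq> 1"
    by (simp add: zero_quat_def one_quat_def)
  show "r *\<^sub>R (a + b) = r *\<^sub>R a + r *\<^sub>R b" "(r + s) *\<^sub>R a = r *\<^sub>R a + s *\<^sub>R a"
    "r *\<^sub>R s *\<^sub>R a = (r * s) *\<^sub>R a" "1 *\<^sub>R a = a"
    "r *\<^sub>R a * b = r *\<^sub>R (a * b)" "a * r *\<^sub>R b = r *\<^sub>R (a * b)"
    by (simp_all add: quat_eq_iff times_quat_def plus_quat_def scaleR_quat_def algebra_simps)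
qed

end

instantiation quat :: real_div_algebra
begin

definition "inverse a =
  inverse ((QRe a)\<^sup>2 + (QI a)\<^sup>2 + (QJ a)\<^sup>2 + (QK a)\<^sup>2) *\<^sub>R
    Quat (QRe a) (- QI a) (- QJ a) (- QK a)"

definition "a div b = a * inverse b" for a b :: quat

instance
proof
  fix a b :: quat
  show "a div b = a * inverse b"
    by (simp add: divide_quat_def)
  show "inverse (0::quat) = 0"
    by (simp add: quat_eq_iff inverse_quat_def scaleR_quat_def zero_quat_def)
  assume "a \<noteq> 0"
  define n where "n = (QRe a)\<^sup>2 + (QI a)\<^sup>2 + (QJ a)\<^sup>2 + (QK a)\<^sup>2"
  define c where "c = Quat (QRe a) (- QI a) (- QJ a) (- QK a)"
  have "n \<noteq> 0"
    using \<open>a \<noteq> 0\<close> unfolding n_def quat_eq_iff zero_quat_def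
    by (simp add: add_nonneg_eq_0_iff)
  have "c * a = n *\<^sub>R 1" "a * c = n *\<^sub>R 1"
    by (simp_all add: quat_eq_iff times_quat_def one_quat_def scaleR_quat_def n_def c_def
        power2_eq_square)
  moreover have "inverse a = inverse n *\<^sub>R c"
    by (simp only: inverse_quat_def n_def c_def)
  ultimately show "inverse a * a = 1" "a * inverse a = 1"
    using \<open>n \<noteq> 0\<close> by simp_all
qed

end

instantiation quat :: real_inner
begin

definition "a \<bullet> b = QRe a * QRe b + QI a * QI b + QJ a * QJ b + QK a * QK b"
definition "norm (a::quat) = sqrt (a \<bullet> a)"
definition "sgn (a::quat) = a /\<^sub>R norm a"
definition "dist (a::quat) b = norm (a - b)"
definition "(uniformity :: (quat \<times> quat) filter)
  = (INF e\<in>{0<..}. principal {(x, y). dist x y < e})"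
definition "open (U :: quat set)
  \<longleftrightarrow> (\<forall>x\<in>U. eventually (\<lambda>(x', y). x' = x \<longrightarrow> y \<in> U) uniformity)"

instance
proof
  fix a b c :: quat and r :: real
  show "a \<bullet> b = b \<bullet> a"
    by (simp add: inner_quat_def mult.commute)
  show "(a + b) \<bullet> c = a \<bullet> c + b \<bullet> c" "(r *\<^sub>R a) \<bullet> b = r * (a \<bullet> b)"
    by (simp_all add: inner_quat_def plus_quat_def scaleR_quat_def algebra_simps)
  show "0 \<le> a \<bullet> a"
    by (simp add: inner_quat_def)
  show "a \<bullet> a = 0 \<longleftrightarrow> a = 0"
    unfolding inner_quat_def quat_eq_iff zero_quat_def
    by (simp add: add_nonneg_eq_0_iff)
qed (rule norm_quat_def sgn_quat_def dist_quat_def uniformity_quat_def open_quat_def)+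

end

instantiation quat :: euclidean_space
begin

definition "Basis = {Quat 1 0 0 0, Quat 0 1 0 0, Quat 0 0 1 0, Quat 0 0 0 1}"

instance
proof
  fix a u v :: quat
  show "(Basis :: quat set) \<noteq> {}" "finite (Basis :: quat set)"
    by (simp_all add: Basis_quat_def)
  show "u \<in> Basis \<Longrightarrow> v \<in> Basis \<Longrightarrow> u \<bullet> v = (if u = v then 1 else 0)"
    unfolding Basis_quat_def inner_quat_def by (elim insertE emptyE) simp_all
  show "(\<forall>u\<in>Basis. a \<bullet> u = 0) \<longleftrightarrow> a = 0"
    unfolding quat_eq_iff by (simp add: Basis_quat_def inner_quat_def zero_quat_def)
qed

end

instance quat :: real_complex_quat
proof
  fix a b :: quat
  have "(a * b) \<bullet> (a * b) = (a \<bullet> a) * (b \<bullet> b)"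
    by (simp add: inner_quat_def times_quat_def algebra_simps)
  then show "norm (a * b) = norm a * norm b"
    by (simp add: norm_quat_def real_sqrt_mult)
qed

lemma DIM_quat: "DIM(quat) = 4"
  by (simp add: Basis_quat_def)

lemma conjugation_quat: "conjugation (Quat a b c e) = Quat a (- b) (- c) (- e)"
  by (simp add: conjugation_def re_part_def quat_eq_iff inner_quat_def of_real_def scaleR_quat_def
      minus_quat_def one_quat_def)


section \<open>Matrices\<close>

text \<open>
  Matrices have to have a variable number of rows, so an \<open>m \<times> n\<close> matrix is an
  extensional function on the index set \<open>{..<m} \<times> {..<n}\<close>; indices start at 0.
  Similarly \<open>n\<close>-vectors are extensional functions on \<open>{..<n}\<close>.  The measurable space
  \<open>mat_space m n\<close> is the matrix space with its Borel sets.
\<close>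

type_synonym 'a fmat = "nat \<times> nat \<Rightarrow> 'a"

definition mats :: "nat \<Rightarrow> nat \<Rightarrow> 'a fmat set" where
  "mats m n = {..<m} \<times> {..<n} \<rightarrow>\<^sub>E UNIV"

definition mat_space :: "nat \<Rightarrow> nat \<Rightarrow> ('a::real_complex_quat) fmat measure" where
  "mat_space m n = (\<Pi>\<^sub>M k\<in>{..<m} \<times> {..<n}. borel)"

definition mat_mult :: "nat \<Rightarrow> nat \<Rightarrow> nat \<Rightarrow> ('a::real_complex_quat) fmat \<Rightarrow> 'a fmat \<Rightarrow> 'a fmat" where
  "mat_mult m k n A B = (\<lambda>(i, j)\<in>{..<m} \<times> {..<n}. \<Sum>l<k. A (i, l) * B (l, j))"

definition mat_adj :: "nat \<Rightarrow> nat \<Rightarrow> ('a::real_complex_quat) fmat \<Rightarrow> 'a fmat" where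
  "mat_adj m n A = (\<lambda>(i, j)\<in>{..<n} \<times> {..<m}. conjugation (A (j, i)))"

definition mat_add :: "nat \<Rightarrow> nat \<Rightarrow> ('a::real_complex_quat) fmat \<Rightarrow> 'a fmat \<Rightarrow> 'a fmat" where
  "mat_add m n A B = (\<lambda>k\<in>{..<m} \<times> {..<n}. A k + B k)"

definition mat_scale :: "nat \<Rightarrow> nat \<Rightarrow> real \<Rightarrow> ('a::real_complex_quat) fmat \<Rightarrow> 'a fmat" where
  "mat_scale m n c A = (\<lambda>k\<in>{..<m} \<times> {..<n}. c *\<^sub>R A k)"

definition mat_one :: "nat \<Rightarrow> ('a::real_complex_quat) fmat" where
  "mat_one n = (\<lambda>(i, j)\<in>{..<n} \<times> {..<n}. if i = j then 1 else 0)"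

definition mat_trace :: "nat \<Rightarrow> ('a::real_complex_quat) fmat \<Rightarrow> 'a" where
  "mat_trace n A = (\<Sum>i<n. A (i, i))"

definition mat_inner :: "nat \<Rightarrow> nat \<Rightarrow> ('a::real_complex_quat) fmat \<Rightarrow> 'a fmat \<Rightarrow> real" where
  "mat_inner m n A B = re_part (mat_trace n (mat_mult n m n (mat_adj m n A) B))"

definition unitary_group :: "nat \<Rightarrow> ('a::real_complex_quat) fmat set" where
  "unitary_group n = {U \<in> mats n n.
     mat_mult n n n (mat_adj n n U) U = mat_one n \<and> mat_mult n n n U (mat_adj n n U) = mat_one n}"


section \<open>Ordered spectrum and singular values\<close>

text \<open>Column vectors over a possibly noncommutative field form a right vector space, so
  scalars of the field act from the right.\<close>

definition right_independent :: "nat \<Rightarrow> nat \<Rightarrow> (nat \<Rightarrow> nat \<Rightarrow> 'a::real_complex_quat) \<Rightarrow> bool" where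
  "right_independent n k v \<longleftrightarrow>
     (\<forall>c. (\<forall>i<n. (\<Sum>l<k. v l i * c l) = 0) \<longrightarrow> (\<forall>l<k. c l = 0))"

definition right_dim :: "nat \<Rightarrow> (nat \<Rightarrow> 'a::real_complex_quat) set \<Rightarrow> nat" where
  "right_dim n S = (GREATEST k. \<exists>v. (\<forall>l<k. v l \<in> S) \<and> right_independent n k v)"

definition eigenspace :: "nat \<Rightarrow> ('a::real_complex_quat) fmat \<Rightarrow> real \<Rightarrow> (nat \<Rightarrow> 'a) set" where
  "eigenspace n A r = {v \<in> {..<n} \<rightarrow>\<^sub>E UNIV. \<forall>i<n. (\<Sum>j<n. A (i, j) * v j) = v i * of_real r}"

text \<open>Only used for Hermitian \<open>n \<times> n\<close> matrices: their eigenvalues are real, and the dimensions of the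
  eigenspaces add up to \<open>n\<close>.\<close>

definition ordered_spectrum :: "nat \<Rightarrow> ('a::real_complex_quat) fmat \<Rightarrow> nat \<Rightarrow> real" where
  "ordered_spectrum n A = (THE s. s \<in> {..<n} \<rightarrow>\<^sub>E UNIV \<and> antimono_on {..<n} s \<and>
     (\<forall>r. card {i\<in>{..<n}. s i = r} = right_dim n (eigenspace n A r)))"

definition sing_vals :: "nat \<Rightarrow> nat \<Rightarrow> ('a::real_complex_quat) fmat \<Rightarrow> nat \<Rightarrow> real" where
  "sing_vals M N A = (\<lambda>i\<in>{..<N}. sqrt (ordered_spectrum N (mat_mult N M N (mat_adj M N A) A) i))"

text \<open>On extensional functions the product topology of \<^typ>\<open>nat \<Rightarrow> real\<close> is the Euclidean one, so
  \<^const>\<open>compact\<close> has the usual meaning for subsets of the following chamber and of its products.\<close>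

definition chamber_B :: "nat \<Rightarrow> (nat \<Rightarrow> real) set" where
  "chamber_B N = {x \<in> {..<N} \<rightarrow>\<^sub>E {0..}. antimono_on {..<N} x}"


section \<open>Haar measure and the distributions on the orbits\<close>

text \<open>The normalized Haar measure on the compact group of unitary matrices is the only
  measure with this property.\<close>

definition normalized_haar :: "nat \<Rightarrow> ('a::real_complex_quat) fmat measure \<Rightarrow> bool" where
  "normalized_haar n \<mu> \<longleftrightarrow>
     prob_space \<mu> \<and> sets \<mu> = sets (restrict_space (mat_space n n) (unitary_group n)) \<and>
     (\<forall>U\<in>unitary_group n. distr \<mu> \<mu> (mat_mult n n n U) = \<mu>)"

definition sigma_mat :: "nat \<Rightarrow> nat \<Rightarrow> (nat \<Rightarrow> real) \<Rightarrow> ('a::real_complex_quat) fmat" where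
  "sigma_mat M N x = (\<lambda>(i, j)\<in>{..<M} \<times> {..<N}. if i = j then of_real (x i) else 0)"

text \<open>In the next two definitions \<open>H n\<close> is the Haar measure on the unitary \<open>n \<times> n\<close> matrices.\<close>

definition orbit_measure ::
  "(nat \<Rightarrow> ('a::real_complex_quat) fmat measure) \<Rightarrow> nat \<Rightarrow> nat \<Rightarrow> (nat \<Rightarrow> real) \<Rightarrow> 'a fmat measure" where
  "orbit_measure H M N x = distr (H M \<Otimes>\<^sub>M H N) (mat_space M N)
     (\<lambda>(U, V). mat_mult M N N (mat_mult M M N U (sigma_mat M N x)) (mat_adj N N V))"

definition tilted_orbit_measure ::
  "(nat \<Rightarrow> ('a::real_complex_quat) fmat measure) \<Rightarrow> nat \<Rightarrow> nat \<Rightarrow> (nat \<Rightarrow> real) \<Rightarrow> 'a fmat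
     \<Rightarrow> 'a fmat measure" where
  "tilted_orbit_measure H M N x L =
     (let Z = (\<integral>y. exp (mat_inner M N L y) \<partial>orbit_measure H M N x)
      in density (orbit_measure H M N x) (\<lambda>y. ennreal (exp (mat_inner M N L y) / Z)))"


section \<open>Brownian motion\<close>

definition real_brownian_motion :: "'w measure \<Rightarrow> (real \<Rightarrow> 'w \<Rightarrow> real) \<Rightarrow> bool" where
  "real_brownian_motion P W \<longleftrightarrow>
     prob_space P \<and>
     (\<forall>s\<ge>0. W s \<in> borel_measurable P) \<and>
     (AE \<omega> in P. W 0 \<omega> = 0) \<and>
     (\<forall>s\<ge>0. \<forall>t>s. distributed P lborel (\<lambda>\<omega>. W t \<omega> - W s \<omega>) (normal_density 0 (sqrt (t - s)))) \<and>
     (\<forall>(n::nat) \<tau>. 0 \<le> \<tau> 0 \<and> mono_on {..n} \<tau> \<longrightarrow>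
        prob_space.indep_vars P (\<lambda>_. borel) (\<lambda>k \<omega>. W (\<tau> (Suc k)) \<omega> - W (\<tau> k) \<omega>) {..<n}) \<and>
     (AE \<omega> in P. continuous_on {0..} (\<lambda>s. W s \<omega>))"

text \<open>The matrices with a single nonzero entry, taken from \<^const>\<open>Basis\<close>, form an orthonormal basis of
  the matrix space with the scalar product \<^const>\<open>mat_inner\<close>.  A standard Brownian motion of this
  Euclidean space is a process with independent standard real Brownian motions as coordinates.\<close>

definition mat_brownian_motion ::
  "'w measure \<Rightarrow> nat \<Rightarrow> nat \<Rightarrow> (real \<Rightarrow> 'w \<Rightarrow> ('a::real_complex_quat) fmat) \<Rightarrow> bool" where
  "mat_brownian_motion P M N W \<longleftrightarrow>
     prob_space P \<and>
     (\<forall>s\<ge>0. W s \<in> P \<rightarrow>\<^sub>M mat_space M N) \<and>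
     (\<forall>k\<in>{..<M} \<times> {..<N}. \<forall>b\<in>Basis. real_brownian_motion P (\<lambda>s \<omega>. W s \<omega> k \<bullet> b)) \<and>
     prob_space.indep_vars P (\<lambda>_. \<Pi>\<^sub>M s\<in>{0..}. borel) (\<lambda>(k, b) \<omega>. \<lambda>s\<in>{0..}. W s \<omega> k \<bullet> b)
       (({..<M} \<times> {..<N}) \<times> Basis)"

definition mat_brownian_motion_from ::
  "'w measure \<Rightarrow> nat \<Rightarrow> nat \<Rightarrow> ('a::real_complex_quat) fmat measure
     \<Rightarrow> (real \<Rightarrow> 'w \<Rightarrow> 'a fmat) \<Rightarrow> bool" where
  "mat_brownian_motion_from P M N \<mu> B \<longleftrightarrow>
     (\<exists>B0 W. mat_brownian_motion P M N W \<and>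
        B0 \<in> P \<rightarrow>\<^sub>M mat_space M N \<and> distr P (mat_space M N) B0 = \<mu> \<and>
        prob_space.indep_set P
          {B0 -` A \<inter> space P | A. A \<in> sets (mat_space M N)}
          {(\<lambda>\<omega>. \<lambda>s\<in>{0..}. W s \<omega>) -` A \<inter> space P | A. A \<in> sets (\<Pi>\<^sub>M s\<in>{0..}. mat_space M N)} \<and>
        (\<forall>s\<ge>0. \<forall>\<omega>\<in>space P. B s \<omega> = mat_add M N (B0 \<omega>) (W s \<omega>)))"


section \<open>The quantities of the limit theorem\<close>

definition kappa :: "nat \<Rightarrow> nat \<Rightarrow> nat \<Rightarrow> real" where
  "kappa d N M = (real M - real N + 1) * real d / 2 - 1 / 2"

definition limit_point :: "nat \<Rightarrow> (nat \<Rightarrow> real) \<Rightarrow> (nat \<Rightarrow> real) \<Rightarrow> real \<Rightarrow> nat \<Rightarrow> real" where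
  "limit_point N x w t = (\<lambda>i\<in>{..<N}.
     sqrt ((x i)\<^sup>2 + (w i)\<^sup>2 * t\<^sup>2 + 2 * t * sqrt ((x i)\<^sup>2 * (w i)\<^sup>2 + 1)))"

definition deviation_prob ::
  "'w measure \<Rightarrow> nat \<Rightarrow> ('w \<Rightarrow> nat \<Rightarrow> real) \<Rightarrow> (nat \<Rightarrow> real) \<Rightarrow> real \<Rightarrow> ennreal" where
  "deviation_prob P N Y y \<epsilon> = emeasure P {\<omega> \<in> space P. \<epsilon> \<le> L2_set (\<lambda>i. Y \<omega> i - y i) {..<N}}"

end

theory Submission
  imports Defs
begin

text \<open>
  By the formula of Cameron and Martin, the tilt of the starting distribution and the drift combine (\<open>law_formula\<close>): up to
  normalization, the matrix \<open>z\<close> at time \<open>t / \<kappa>\<close> has the Gaussian law of variance \<open>t / \<kappa>\<close>, weighted by \<open>exp (\<kappa> * (\<Lambda>, z))\<close> and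
  by the average of \<open>exp (\<kappa> / t * (z, y))\<close> over the orbit of the starting point.  The Gaussian law is invariant under the
  left action, so the first weight may be averaged as well, and both become Bessel functions of the singular values of \<open>z\<close>.

  These are estimated on the exponential scale \<open>\<kappa>\<close>.  Only an upper left corner of the unitary matrix matters, and its size
  stays fixed.  A trace inequality for three matrices (\<open>trilinear_inequality\<close>) and a finite net in the small unitary group reduce the
  average to a diagonal one, \<open>haar_K\<close>.  The latter is compared with a Gaussian matrix with small entries, whose columns are almost
  orthonormal by the law of large numbers; a shift of this Gaussian produces the exponential.  One obtains the upper bound
  \<open>haar_K_upper\<close> for every choice of column variances, and the matching lower bound \<open>haar_K_lower\<close> for the optimal one.

  Inserting the upper bounds with the variances that are optimal at the expected limit turns the weight into a centred Gaussian in
  which the \<open>j\<close>-th squared singular value has the coefficient \<open>- \<kappa> / y_j^2\<close> (\<open>coordinate_identities\<close>).  The right singular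
  basis may again be taken from a finite net, and then the singular values are column norms of a Gaussian matrix with \<open>m\<close>
  rows.  Those concentrate at \<open>y_j\<close>, because \<open>m d / 2\<close> is \<open>\<kappa>\<close> plus a constant.  A Chernoff bound (\<open>deviation_bound\<close>) gives an
  exponentially small probability for deviations, with constants that are uniform over bounded parameters; this yields both
  claims for positive times, and at time zero the singular values do not deviate at all.
\<close>

abbreviation \<U> where
  "\<U> \<equiv> unitary_group"

section \<open>Conjugation\<close>

lemma inner_mult_left_self: "((a::'a::real_complex_quat) * b) \<bullet> (a * c) = (norm a)^2 * (b \<bullet> c)"
proof -
 have "(norm (a * (b + c)))^2 = (norm a)^2 * (norm (b + c))^2"
  by (simp add: norm_mult power_mult_distrib)
 moreover have "(norm (a * b))^2 = (norm a)^2 * (norm b)^2" "(norm (a * c))^2 = (norm a)^2 * (norm c)^2"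
  by (simp_all add: norm_mult power_mult_distrib)
 ultimately show ?thesis
  by (simp add: power2_norm_eq_inner distrib_left inner_add_left inner_add_right inner_commute algebra_simps)
qed

lemma inner_mult_exchange:
 "((a::'a::real_complex_quat) * b) \<bullet> (c * d) + (a * d) \<bullet> (c * b) = 2 * (a \<bullet> c) * (b \<bullet> d)"
proof -
 have "((a + c) * b) \<bullet> ((a + c) * d) = (norm (a + c))^2 * (b \<bullet> d)"
  by (rule inner_mult_left_self)
 moreover have "(a * b) \<bullet> (a * d) = (norm a)^2 * (b \<bullet> d)" "(c * b) \<bullet> (c * d) = (norm c)^2 * (b \<bullet> d)"
  by (rule inner_mult_left_self)+
 ultimately show ?thesis
  by (simp add: power2_norm_eq_inner distrib_right inner_add_left inner_add_right inner_commute algebra_simps)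
qed

lemma inner_mult_adjoint_left: "((a::'a::real_complex_quat) * b) \<bullet> c = b \<bullet> (conjugation a * c)"
 using inner_mult_exchange[of a b 1 c]
 by (simp add: conjugation_def re_part_def inner_diff_right left_diff_distrib of_real_def inner_commute)

lemma norm_one_inner: "(1::'a::real_complex_quat) \<bullet> 1 = 1"
 by (metis norm_eq_1 norm_one)

lemma conjugation_conjugation [simp]: "conjugation (conjugation a) = a"
 by (simp add: conjugation_def re_part_def inner_diff_left of_real_def norm_one_inner)

lemma conjugation_add: "conjugation (a + b) = conjugation a + conjugation b"
 by (simp add: conjugation_def re_part_def inner_add_left distrib_left)

lemma conjugation_diff: "conjugation (a - b) = conjugation a - conjugation b"
 by (simp add: conjugation_def re_part_def inner_diff_left right_diff_distrib)

lemma conjugation_scaleR: "conjugation (r *\<^sub>R a) = r *\<^sub>R conjugation a"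
 by (simp add: conjugation_def re_part_def of_real_def algebra_simps)

lemma conjugation_0 [simp]: "conjugation 0 = 0"
 by (simp add: conjugation_def re_part_def)

lemma conjugation_of_real [simp]: "conjugation (of_real r) = of_real r"
 by (simp add: conjugation_def re_part_def of_real_def norm_one_inner flip: scaleR_left_diff_distrib)

lemma conjugation_1 [simp]: "conjugation 1 = 1"
 using conjugation_of_real[of 1] by simp

lemma conjugation_sum: "conjugation (sum f A) = (\<Sum>i\<in>A. conjugation (f i))"
 by (induction A rule: infinite_finite_induct) (simp_all add: conjugation_add)

lemma inner_conjugation: "conjugation a \<bullet> conjugation b = a \<bullet> b"
 by (simp add: conjugation_def re_part_def inner_diff_left inner_diff_right of_real_def
   norm_one_inner inner_commute algebra_simps)

lemma norm_conjugation [simp]: "norm (conjugation a) = norm a"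
 by (simp add: norm_eq_sqrt_inner inner_conjugation)

lemma conjugation_mult: "conjugation ((a::'a::real_complex_quat) * b) = conjugation b * conjugation a"
proof -
 have *: "x \<bullet> (conjugation (a * b) * 1) = x \<bullet> (conjugation b * conjugation a * 1)" for x
  by (simp only: inner_mult_adjoint_left[symmetric] mult.assoc)
 show ?thesis
  by (rule vector_eq_ldot[THEN iffD1]) (use * in auto)
qed

lemma conjugation_mult_self: "conjugation (a::'a::real_complex_quat) * a = of_real ((norm a)^2)"
proof -
 have *: "x \<bullet> (conjugation a * a) = x \<bullet> of_real ((norm a)^2)" for x
  using inner_mult_left_self[of a x 1]
  by (simp add: inner_mult_adjoint_left[symmetric] of_real_def)
 show ?thesis
  by (rule vector_eq_ldot[THEN iffD1]) (use * in blast)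
qed

lemma mult_conjugation_self: "(a::'a::real_complex_quat) * conjugation a = of_real ((norm a)^2)"
 using conjugation_mult_self[of "conjugation a"] by simp

lemma re_part_conjugation_mult: "re_part (conjugation (a::'a::real_complex_quat) * b) = a \<bullet> b"
 using inner_mult_adjoint_left[of a 1 b] by (simp add: re_part_def inner_commute)

lemma re_part_mult: "re_part ((a::'a::real_complex_quat) * b) = conjugation a \<bullet> b"
 using re_part_conjugation_mult[of "conjugation a" b] by simp

lemma re_part_conjugation [simp]: "re_part (conjugation a) = re_part a"
 using inner_conjugation[of a 1] by (simp add: re_part_def)

lemma re_part_mult_commute: "re_part ((a::'a::real_complex_quat) * b) = re_part (b * a)"
 using inner_conjugation[of "conjugation a" b] by (simp add: re_part_mult inner_commute)

lemma re_part_add: "re_part (a + b) = re_part a + re_part b"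
 by (simp add: re_part_def inner_add_left)

lemma re_part_0 [simp]: "re_part 0 = 0"
 by (simp add: re_part_def)

lemma re_part_of_real [simp]: "re_part (of_real r) = r"
 by (simp add: re_part_def of_real_def norm_one_inner)

lemma re_part_scaleR: "re_part (r *\<^sub>R a) = r * re_part a"
 by (simp add: re_part_def)

lemma re_part_sum: "re_part (sum f A) = (\<Sum>i\<in>A. re_part (f i))"
 by (simp add: re_part_def inner_sum_left)

lemma re_part_le_norm: "\<bar>re_part a\<bar> <= norm a"
 unfolding re_part_def using Cauchy_Schwarz_ineq2[of a 1] by simp

section \<open>Matrix algebra\<close>

lemma mat_mult_mats [simp]: "mat_mult m k n A B \<in> mats m n"
 and mat_adj_mats [simp]: "mat_adj m n A \<in> mats n m"
 and mat_add_mats [simp]: "mat_add m n A B \<in> mats m n"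
 and mat_scale_mats [simp]: "mat_scale m n c A \<in> mats m n"
 and mat_one_mats [simp]: "mat_one n \<in> mats n n"
 and sigma_mat_mats [simp]: "sigma_mat m n x \<in> mats m n"
 by (auto simp: mats_def mat_mult_def mat_adj_def mat_add_def mat_scale_def mat_one_def sigma_mat_def)

lemma mat_eqI:
 assumes "A \<in> mats m n" "B \<in> mats m n" "!!i j. i < m ==> j < n ==> A (i, j) = B (i, j)"
 shows "A = B"
 using assms unfolding mats_def by (intro PiE_ext) auto

lemma mat_mult_entry [simp]:
 "i < m ==> j < n ==> mat_mult m k n A B (i, j) = (\<Sum>l<k. A (i, l) * B (l, j))"
 by (simp add: mat_mult_def)

lemma mat_adj_entry [simp]: "i < n ==> j < m ==> mat_adj m n A (i, j) = conjugation (A (j, i))"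
 by (simp add: mat_adj_def)

lemma mat_add_entry [simp]: "i < m ==> j < n ==> mat_add m n A B (i, j) = A (i, j) + B (i, j)"
 by (simp add: mat_add_def)

lemma mat_scale_entry [simp]: "i < m ==> j < n ==> mat_scale m n c A (i, j) = c *\<^sub>R A (i, j)"
 by (simp add: mat_scale_def)

lemma mat_one_entry [simp]: "i < n ==> j < n ==> mat_one n (i, j) = (if i = j then 1 else 0)"
 by (simp add: mat_one_def)

lemma sigma_mat_entry [simp]:
 "i < m ==> j < n ==> sigma_mat m n x (i, j) = (if i = j then of_real (x i) else 0)"
 by (simp add: sigma_mat_def)

lemma mat_mult_assoc:
 "mat_mult m l n (mat_mult m k l A B) C = mat_mult m k n A (mat_mult k l n B C)"
proof (rule mat_eqI)
 fix i j assume "i < m" "j < n"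
 then have "mat_mult m l n (mat_mult m k l A B) C (i, j)
   = (\<Sum>q<l. \<Sum>p<k. A (i, p) * B (p, q) * C (q, j))"
  by (simp add: sum_distrib_right)
 also have "... = (\<Sum>p<k. \<Sum>q<l. A (i, p) * B (p, q) * C (q, j))"
  by (rule sum.swap)
 also have "... = mat_mult m k n A (mat_mult k l n B C) (i, j)"
  using \<open>i < m\<close> \<open>j < n\<close> by (simp add: sum_distrib_left mult.assoc)
 finally show "mat_mult m l n (mat_mult m k l A B) C (i, j) = mat_mult m k n A (mat_mult k l n B C) (i, j)" .
qed auto

lemma mat_adj_mult:
 "mat_adj m n (mat_mult m k n A B) = mat_mult n k m (mat_adj k n B) (mat_adj m k A)"
 by (rule mat_eqI[of _ n m]) (auto simp: conjugation_sum conjugation_mult)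

lemma mat_adj_adj: "A \<in> mats m n ==> mat_adj n m (mat_adj m n A) = A"
 by (rule mat_eqI[of _ m n]) auto

lemma mat_adj_one [simp]: "mat_adj n n (mat_one n) = mat_one n"
 by (rule mat_eqI[of _ n n]) auto

lemma mat_mult_one_left: "A \<in> mats m n ==> mat_mult m m n (mat_one m) A = A"
 by (rule mat_eqI[of _ m n]) (auto simp: if_distrib[of "%x. x * _"] cong: if_cong)

lemma mat_mult_one_right: "A \<in> mats m n ==> mat_mult m n n A (mat_one n) = A"
 by (rule mat_eqI[of _ m n]) (auto simp: if_distrib[of "%x. _ * x"] cong: if_cong)

lemma unitaryD:
 assumes "U \<in> \<U> n"
 shows "U \<in> mats n n" "mat_mult n n n (mat_adj n n U) U = mat_one n"
  "mat_mult n n n U (mat_adj n n U) = mat_one n"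
 using assms by (auto simp: unitary_group_def)

lemma unitary_one [simp]: "mat_one n \<in> \<U> n"
 by (simp add: unitary_group_def mat_mult_one_left)

lemma unitary_adj: "U \<in> \<U> n ==> mat_adj n n U \<in> \<U> n"
 by (auto simp: unitary_group_def mat_adj_adj)

lemma mat_mult_cancel_left:
 assumes "mat_mult n k n A B = mat_one n" "C \<in> mats n m"
 shows "mat_mult n k m A (mat_mult k n m B C) = C"
 using assms by (simp add: mat_mult_assoc[symmetric] mat_mult_one_left)

lemma unitary_cancel:
 assumes "U \<in> \<U> n" "C \<in> mats n m"
 shows "mat_mult n n m (mat_adj n n U) (mat_mult n n m U C) = C"
  "mat_mult n n m U (mat_mult n n m (mat_adj n n U) C) = C"
 using assms by (auto intro!: mat_mult_cancel_left unitaryD)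

lemma unitary_cancel_right:
 assumes "U \<in> \<U> n" "C \<in> mats m n"
 shows "mat_mult m n n (mat_mult m n n C (mat_adj n n U)) U = C"
  "mat_mult m n n (mat_mult m n n C U) (mat_adj n n U) = C"
 using assms by (auto simp: mat_mult_assoc unitaryD mat_mult_one_right)

lemma unitary_mult:
 assumes "U \<in> \<U> n" "V \<in> \<U> n"
 shows "mat_mult n n n U V \<in> \<U> n"
 using assms by (simp add: unitary_group_def mat_adj_mult mat_mult_assoc mat_mult_cancel_left)

lemma mat_mult_add_left:
 "mat_mult m k n (mat_add m k A B) C = mat_add m n (mat_mult m k n A C) (mat_mult m k n B C)"
 by (rule mat_eqI[of _ m n]) (auto simp: distrib_right sum.distrib)

lemma mat_mult_add_right:
 "mat_mult m k n A (mat_add k n B C) = mat_add m n (mat_mult m k n A B) (mat_mult m k n A C)"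
 by (rule mat_eqI[of _ m n]) (auto simp: distrib_left sum.distrib)

lemma mat_inner_eq: "mat_inner m n A B = (\<Sum>k\<in>{..<m} \<times> {..<n}. A k \<bullet> B k)"
proof -
 have "mat_inner m n A B = (\<Sum>i<n. \<Sum>l<m. A (l, i) \<bullet> B (l, i))"
  by (simp add: mat_inner_def mat_trace_def re_part_sum re_part_conjugation_mult)
 also have "... = (\<Sum>l<m. \<Sum>i<n. A (l, i) \<bullet> B (l, i))"
  by (rule sum.swap)
 also have "... = (\<Sum>k\<in>{..<m} \<times> {..<n}. A k \<bullet> B k)"
  by (simp add: sum.cartesian_product)
 finally show ?thesis .
qed

lemma mat_inner_eq2: "mat_inner m n A B = (\<Sum>i<m. \<Sum>j<n. A (i, j) \<bullet> B (i, j))"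
 by (simp add: mat_inner_eq sum.cartesian_product)

lemma mat_inner_adjoint_left:
 "mat_inner m n (mat_mult m k n A B) C = mat_inner k n B (mat_mult k m n (mat_adj m k A) C)"
proof -
 have "mat_inner m n (mat_mult m k n A B) C
   = (\<Sum>i<m. \<Sum>j<n. \<Sum>l<k. B (l, j) \<bullet> (conjugation (A (i, l)) * C (i, j)))"
  by (simp add: mat_inner_eq2 inner_sum_left inner_mult_adjoint_left)
 also have "... = (\<Sum>i<m. \<Sum>l<k. \<Sum>j<n. B (l, j) \<bullet> (conjugation (A (i, l)) * C (i, j)))"
  by (intro sum.cong refl sum.swap)
 also have "... = (\<Sum>l<k. \<Sum>i<m. \<Sum>j<n. B (l, j) \<bullet> (conjugation (A (i, l)) * C (i, j)))"
  by (rule sum.swap)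
 also have "... = (\<Sum>l<k. \<Sum>j<n. \<Sum>i<m. B (l, j) \<bullet> (conjugation (A (i, l)) * C (i, j)))"
  by (intro sum.cong refl sum.swap)
 also have "... = mat_inner k n B (mat_mult k m n (mat_adj m k A) C)"
  by (simp add: mat_inner_eq2 inner_sum_right)
 finally show ?thesis .
qed

lemma mat_inner_commute: "mat_inner m n A B = mat_inner m n B A"
 by (simp add: mat_inner_eq inner_commute)

lemma mat_inner_adj: "mat_inner n m (mat_adj m n A) (mat_adj m n B) = mat_inner m n A B"
 by (simp add: mat_inner_eq2 inner_conjugation) (rule sum.swap)

lemma mat_inner_adjoint_right:
 assumes "A \<in> mats m k"
 shows "mat_inner m n (mat_mult m k n A B) C = mat_inner m k A (mat_mult m n k C (mat_adj k n B))"
proof -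
 have "mat_inner m n (mat_mult m k n A B) C
  = mat_inner n m (mat_mult n k m (mat_adj k n B) (mat_adj m k A)) (mat_adj m n C)"
  by (simp add: mat_inner_adj[symmetric, of m n] mat_adj_mult)
 also have "... = mat_inner k m (mat_adj m k A) (mat_mult k n m (mat_adj n k (mat_adj k n B)) (mat_adj m n C))"
  by (rule mat_inner_adjoint_left)
 also have "... = mat_inner k m (mat_adj m k A) (mat_adj m k (mat_mult m n k C (mat_adj k n B)))"
  by (simp add: mat_adj_mult)
 finally show ?thesis
  by (simp add: mat_inner_adj)
qed

lemma mat_inner_add_left: "mat_inner m n (mat_add m n A B) C = mat_inner m n A C + mat_inner m n B C"
 by (simp add: mat_inner_eq2 inner_add_left sum.distrib)

lemma mat_inner_add_right: "mat_inner m n C (mat_add m n A B) = mat_inner m n C A + mat_inner m n C B"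
 by (simp add: mat_inner_eq2 inner_add_right sum.distrib)

lemma mat_inner_scale_left: "mat_inner m n (mat_scale m n r A) C = r * mat_inner m n A C"
 by (simp add: mat_inner_eq2 sum_distrib_left)

lemma mat_inner_scale_right: "mat_inner m n C (mat_scale m n r A) = r * mat_inner m n C A"
 by (simp add: mat_inner_eq2 sum_distrib_left)

definition mat_norm :: "nat => nat => ('a::real_complex_quat) fmat => real" where
 "mat_norm m n A = sqrt (mat_inner m n A A)"

lemma mat_norm_L2: "mat_norm m n A = L2_set (%k. norm (A k)) ({..<m} \<times> {..<n})"
 by (simp add: mat_norm_def mat_inner_eq L2_set_def power2_norm_eq_inner)

lemma mat_norm_ge_0 [simp]: "0 <= mat_norm m n A"
 by (simp add: mat_norm_L2)

lemma mat_inner_self: "mat_inner m n A A = (mat_norm m n A)^2"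
 by (simp add: mat_norm_def mat_inner_eq sum_nonneg)

lemma mat_norm_sq: "(mat_norm m n A)^2 = (\<Sum>i<m. \<Sum>j<n. (norm (A (i, j)))\<^sup>2)"
 by (simp add: mat_inner_self[symmetric] mat_inner_eq2 power2_norm_eq_inner)

lemma mat_norm_sq_prod: "(mat_norm m n A)^2 = (\<Sum>k\<in>{..<m} \<times> {..<n}. (norm (A k))\<^sup>2)"
 by (simp add: mat_norm_sq sum.cartesian_product)

lemma mat_norm_entry: "i < m ==> j < n ==> norm (A (i, j)) <= mat_norm m n A"
 unfolding mat_norm_L2
 by (rule member_le_L2_set[of "{..<m} \<times> {..<n}" "(i, j)" "%k. norm (A k)", simplified]) auto

lemma mat_inner_le: "\<bar>mat_inner m n A B\<bar> <= mat_norm m n A * mat_norm m n B"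
proof -
 have "\<bar>mat_inner m n A B\<bar> <= (\<Sum>k\<in>{..<m} \<times> {..<n}. \<bar>norm (A k)\<bar> * \<bar>norm (B k)\<bar>)"
  unfolding mat_inner_eq by (rule order.trans[OF sum_abs]) (auto intro!: sum_mono Cauchy_Schwarz_ineq2)
 also have "... <= mat_norm m n A * mat_norm m n B"
  unfolding mat_norm_L2 by (rule L2_set_mult_ineq)
 finally show ?thesis .
qed

lemma mat_norm_adj: "mat_norm n m (mat_adj m n A) = mat_norm m n A"
 by (simp add: mat_norm_def mat_inner_adj)

lemma mat_inner_unitary_left:
 assumes "U \<in> \<U> m" "B \<in> mats m n"
 shows "mat_inner m n (mat_mult m m n U A) (mat_mult m m n U B) = mat_inner m n A B"
 using assms by (simp add: mat_inner_adjoint_left unitary_cancel)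

lemma mat_inner_unitary_right:
 assumes "V \<in> \<U> n" "A \<in> mats m n" "B \<in> mats m n"
 shows "mat_inner m n (mat_mult m n n A V) (mat_mult m n n B V) = mat_inner m n A B"
 using assms by (simp add: mat_inner_adjoint_right unitary_cancel_right)

lemma mat_norm_unitary_left:
 "U \<in> \<U> m ==> A \<in> mats m n ==> mat_norm m n (mat_mult m m n U A) = mat_norm m n A"
 by (simp add: mat_norm_def mat_inner_unitary_left)

lemma mat_norm_unitary_right:
 "V \<in> \<U> n ==> A \<in> mats m n ==> mat_norm m n (mat_mult m n n A V) = mat_norm m n A"
 by (simp add: mat_norm_def mat_inner_unitary_right)

lemma mat_norm_add: "mat_norm m n (mat_add m n A B) <= mat_norm m n A + mat_norm m n B"
proof -
 have "mat_norm m n (mat_add m n A B)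
  <= L2_set (%k. norm (A k) + norm (B k)) ({..<m} \<times> {..<n})"
  unfolding mat_norm_L2 by (rule L2_set_mono) (auto simp: norm_triangle_ineq)
 also have "... <= mat_norm m n A + mat_norm m n B"
  unfolding mat_norm_L2 by (rule L2_set_triangle_ineq)
 finally show ?thesis .
qed

lemma mat_norm_scale: "mat_norm m n (mat_scale m n r A) = \<bar>r\<bar> * mat_norm m n A"
 by (simp add: mat_norm_def mat_inner_scale_left mat_inner_scale_right real_sqrt_mult
   mult.assoc[symmetric])

lemma mat_norm_mult: "mat_norm m n (mat_mult m k n A B) <= mat_norm m k A * mat_norm k n B"
proof -
 have entry: "(norm (mat_mult m k n A B (i, j)))^2
   <= (\<Sum>l<k. (norm (A (i, l)))\<^sup>2) * (\<Sum>l<k. (norm (B (l, j)))\<^sup>2)" if "i < m" "j < n" for i j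
 proof -
  have "norm (mat_mult m k n A B (i, j)) <= (\<Sum>l<k. \<bar>norm (A (i, l))\<bar> * \<bar>norm (B (l, j))\<bar>)"
   using that by (auto intro!: order.trans[OF norm_sum] sum_mono simp: norm_mult)
  also have "... <= L2_set (%l. norm (A (i, l))) {..<k} * L2_set (%l. norm (B (l, j))) {..<k}"
   by (rule L2_set_mult_ineq)
  finally have "(norm (mat_mult m k n A B (i, j)))^2
    <= (L2_set (%l. norm (A (i, l))) {..<k} * L2_set (%l. norm (B (l, j))) {..<k})^2"
   by (intro power_mono) auto
  then show ?thesis
   by (simp add: L2_set_def power_mult_distrib sum_nonneg)
 qed
 have "(mat_norm m n (mat_mult m k n A B))^2
  <= (\<Sum>i<m. \<Sum>j<n. (\<Sum>l<k. (norm (A (i, l)))\<^sup>2) * (\<Sum>l<k. (norm (B (l, j)))\<^sup>2))"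
  unfolding mat_norm_sq using entry by (auto intro!: sum_mono)
 also have "... = (\<Sum>i<m. \<Sum>l<k. (norm (A (i, l)))\<^sup>2) * (\<Sum>j<n. \<Sum>l<k. (norm (B (l, j)))\<^sup>2)"
  by (simp add: sum_product)
 also have "(\<Sum>j<n. \<Sum>l<k. (norm (B (l, j)))\<^sup>2) = (\<Sum>l<k. \<Sum>j<n. (norm (B (l, j)))\<^sup>2)"
  by (rule sum.swap)
 finally have "(mat_norm m n (mat_mult m k n A B))^2 <= (mat_norm m k A * mat_norm k n B)^2"
  by (simp add: mat_norm_sq power_mult_distrib)
 then show ?thesis
  by (rule power2_le_imp_le) simp
qed

lemma sigma_mat_adj_mult:
 assumes "n <= m"
 shows "mat_mult n m n (mat_adj m n (sigma_mat m n a)) (sigma_mat m n b) = sigma_mat n n (%i. a i * b i)"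
proof (rule mat_eqI)
 fix i j assume "i < n" "j < n"
 then have "mat_mult n m n (mat_adj m n (sigma_mat m n a)) (sigma_mat m n b) (i, j)
  = (\<Sum>l<m. if l = i then (if i = j then of_real (a i * b i) else 0) else 0)"
  unfolding mat_mult_entry[OF \<open>i < n\<close> \<open>j < n\<close>]
  by (intro sum.cong refl) (use assms \<open>i < n\<close> \<open>j < n\<close> in auto)
 also have "... = sigma_mat n n (%i. a i * b i) (i, j)"
  using assms \<open>i < n\<close> \<open>j < n\<close> by simp
 finally show "mat_mult n m n (mat_adj m n (sigma_mat m n a)) (sigma_mat m n b) (i, j)
   = sigma_mat n n (%i. a i * b i) (i, j)" .
qed auto

lemma mat_inner_sigma:
 assumes "n <= m"
 shows "mat_inner m n (sigma_mat m n a) B = (\<Sum>i<n. a i * re_part (B (i, i)))"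
proof -
 have "mat_inner m n (sigma_mat m n a) B = (\<Sum>i<m. \<Sum>j<n. if j = i then a i * re_part (B (i, i)) else 0)"
  unfolding mat_inner_eq2
  by (intro sum.cong refl) (auto simp: of_real_def re_part_def inner_commute)
 also have "... = (\<Sum>i<m. if i < n then a i * re_part (B (i, i)) else 0)"
  by (intro sum.cong) auto
 also have "... = (\<Sum>i<n. a i * re_part (B (i, i)))"
  using assms by (simp add: sum.If_cases Int_absorb1 flip: lessThan_def)
 finally show ?thesis .
qed

lemma mat_norm_sigma: "n <= m ==> mat_norm m n (sigma_mat m n a) = L2_set a {..<n}"
 by (simp add: mat_norm_def mat_inner_sigma L2_set_def power2_eq_square)

section \<open>Compactness of the unitary groups\<close>

lemma continuous_on_entry:
 assumes "continuous_on S (f :: 'b::topological_space => 'c => 'd::topological_space)"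
 shows "continuous_on S (%x. f x k)"
 using continuous_on_product_then_coordinatewise[OF assms] .

lemma continuous_on_mat_mult [continuous_intros]:
 fixes f g :: "'b::topological_space => ('a::real_complex_quat) fmat"
 assumes "continuous_on S f" "continuous_on S g"
 shows "continuous_on S (%x. mat_mult m k n (f x) (g x))"
proof (rule continuous_on_coordinatewise_then_product)
 fix p :: "nat \<times> nat"
 obtain i j where p: "p = (i, j)" by (cases p)
 show "continuous_on S (%x. mat_mult m k n (f x) (g x) p)"
 proof (cases "i < m & j < n")
  case True
  then show ?thesis
   using assms unfolding p by (simp add: continuous_intros continuous_on_entry)
 next
  case False
  then have eq: "(%x. mat_mult m k n (f x) (g x) p) = (%x. undefined)"
   unfolding p by (auto simp: mat_mult_def)
  show ?thesis unfolding eq by (rule continuous_on_const)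
 qed
qed

lemma continuous_on_conjugation [continuous_intros]:
 assumes "continuous_on S f"
 shows "continuous_on S (%x. conjugation (f x :: 'a::real_complex_quat))"
 unfolding conjugation_def re_part_def by (intro continuous_intros assms)

lemma continuous_on_re_part [continuous_intros]:
 assumes "continuous_on S f"
 shows "continuous_on S (%x. re_part (f x :: 'a::real_complex_quat))"
 unfolding re_part_def by (intro continuous_intros assms)

lemma continuous_on_mat_adj [continuous_intros]:
 fixes f :: "'b::topological_space => ('a::real_complex_quat) fmat"
 assumes "continuous_on S f"
 shows "continuous_on S (%x. mat_adj m n (f x))"
proof (rule continuous_on_coordinatewise_then_product)
 fix p :: "nat \<times> nat"
 obtain i j where p: "p = (i, j)" by (cases p)
 show "continuous_on S (%x. mat_adj m n (f x) p)"
 proof (cases "i < n & j < m")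
  case True
  then show ?thesis
   using assms unfolding p by (simp add: continuous_intros continuous_on_entry)
 next
  case False
  then have eq: "(%x. mat_adj m n (f x) p) = (%x. undefined)"
   unfolding p by (auto simp: mat_adj_def)
  show ?thesis unfolding eq by (rule continuous_on_const)
 qed
qed

lemma continuous_on_sigma_mat [continuous_intros]:
 fixes f :: "'b::topological_space => nat => real"
 assumes "continuous_on S f"
 shows "continuous_on S (%x. sigma_mat m n (f x) :: ('a::real_complex_quat) fmat)"
proof (rule continuous_on_coordinatewise_then_product)
 fix p :: "nat \<times> nat"
 obtain i j where p: "p = (i, j)" by (cases p)
 show "continuous_on S (%x. sigma_mat m n (f x) p :: 'a)"
  unfolding p sigma_mat_def using assms
  by (cases "i < m & j < n"; cases "i = j") (auto simp: continuous_on_entry intro!: continuous_on_of_real)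
qed

lemma closed_mats: "closed (mats m n :: ('a::real_complex_quat) fmat set)"
proof -
 have "mats m n = (\<Inter>k\<in>- ({..<m} \<times> {..<n}). {A :: 'a fmat. A k = undefined})"
  by (auto simp: mats_def PiE_def extensional_def)
 moreover have "closed {A :: 'a fmat. A k = undefined}" for k
  by (intro closed_Collect_eq continuous_intros continuous_on_product_coordinates)
 ultimately show ?thesis
  by auto
qed

lemma compact_PiE_UNIV:
 fixes S :: "'b => ('c::topological_space) set"
 assumes "!!i. compact (S i)"
 shows "compact (PiE UNIV S)"
 using assms compactin_PiE[of "%_::'b. euclidean :: 'c topology" UNIV S]
 by (auto simp: euclidean_product_topology)

lemma unitary_mat_norm: "U \<in> \<U> n ==> (mat_norm n n (U :: ('a::real_complex_quat) fmat))\<^sup>2 = real n"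
proof -
 assume U: "U \<in> \<U> n"
 have "mat_inner n n U U = mat_inner n n (mat_one n) (mat_mult n n n (mat_adj n n U) U)"
  using mat_inner_adjoint_left[of n n n U "mat_one n" U] U
  by (simp add: mat_mult_one_right unitaryD)
 also have "... = mat_inner n n (mat_one n) (mat_one n :: 'a fmat)"
  using U by (simp add: unitaryD)
 also have "... = (\<Sum>i<n. \<Sum>j<n. if j = i then 1 else 0)"
  unfolding mat_inner_eq2 by (intro sum.cong refl) (auto simp: norm_one_inner)
 also have "... = real n" by simp
 finally show ?thesis by (simp add: mat_inner_self)
qed

lemma unitary_entry_le:
 assumes "U \<in> \<U> n" "i < n" "j < n"
 shows "norm (U (i, j)) <= sqrt (real n)"
 using mat_norm_entry[OF assms(2,3), of U] unitary_mat_norm[OF assms(1)]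
 by (metis mat_norm_ge_0 real_sqrt_unique)

lemma compact_unitary_group: "compact (\<U> n :: ('a::real_complex_quat) fmat set)"
proof -
 define K :: "'a fmat set" where
  "K = PiE UNIV (%k. if k \<in> {..<n} \<times> {..<n} then cball 0 (sqrt (real n)) else {undefined})"
 have "compact K"
  unfolding K_def by (rule compact_PiE_UNIV) auto
 moreover have "closed (\<U> n :: 'a fmat set)"
 proof -
  have "\<U> n = mats n n \<inter> {U. mat_mult n n n (mat_adj n n U) U = mat_one n}
   \<inter> {U :: 'a fmat. mat_mult n n n U (mat_adj n n U) = mat_one n}"
   by (auto simp: unitary_group_def)
  moreover have "continuous_on UNIV (%U :: 'a fmat. mat_mult n n n (mat_adj n n U) U)"
   "continuous_on UNIV (%U :: 'a fmat. mat_mult n n n U (mat_adj n n U))"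
   by (intro continuous_on_mat_mult continuous_on_mat_adj continuous_on_id)+
  ultimately show ?thesis
   by (simp add: closed_Int closed_mats closed_Collect_eq)
 qed
 moreover have "\<U> n \<subseteq> K"
 proof
  fix U :: "'a fmat" assume U: "U \<in> \<U> n"
  then have "U k = undefined" if "k \<notin> {..<n} \<times> {..<n}" for k
   using that by (cases k) (auto simp: unitary_group_def mats_def PiE_def extensional_def)
  then show "U \<in> K"
   using unitary_entry_le[OF U] unfolding K_def by (intro PiE_I) (auto split: if_splits)
 qed
 ultimately show ?thesis
  by (metis compact_Int_closed inf.absorb2)
qed

section \<open>Singular value decomposition\<close>

text \<open>A rotation of the plane spanned by the coordinates \<open>i\<close> and \<open>j\<close>; \<open>q\<close> is a unit of the
  division algebra and \<open>c\<close>, \<open>s\<close> are cosine and sine of the angle.\<close>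

definition plane_rotation ::
 "nat => nat => nat => 'a => real => real => ('a::real_complex_quat) fmat" where
 "plane_rotation n i j q c s = (\<lambda>(k, l)\<in>{..<n} \<times> {..<n}.
  if k = i & l = i \<or> k = j & l = j then of_real c
  else if k = i & l = j then s *\<^sub>R q
  else if k = j & l = i then - s *\<^sub>R conjugation q
  else if k = l then 1 else 0)"

lemma plane_rotation_mult:
 assumes "i < m" "j < m" "i ~= j" "k < m" "l < n"
 shows "mat_mult m m n (plane_rotation m i j q c s) B (k, l) =
  (if k = i then c *\<^sub>R B (i, l) + s *\<^sub>R (q * B (j, l))
  else if k = j then c *\<^sub>R B (j, l) - s *\<^sub>R (conjugation q * B (i, l))
  else B (k, l))"
proof -
 have *: "plane_rotation m i j q c s (k, p) * B (p, l) =
  (if p = i then (if k = i then c *\<^sub>R B (i, l) else if k = j then - s *\<^sub>R (conjugation q * B (i, l)) else 0) else 0)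
 + (if p = j then (if k = i then s *\<^sub>R (q * B (j, l)) else if k = j then c *\<^sub>R B (j, l) else 0) else 0)
 + (if p = k then (if k = i \<or> k = j then 0 else B (k, l)) else 0)" if "p < m" for p
  using that assms by (auto simp: plane_rotation_def scaleR_conv_of_real[symmetric])
 show ?thesis
  unfolding mat_mult_entry[OF assms(4,5)]
  using assms by (simp add: * sum.distrib)
qed

lemma plane_rotation_adj:
 assumes "i < n" "j < n" "i ~= j"
 shows "mat_adj n n (plane_rotation n i j q c s) = plane_rotation n i j (- q) c s"
proof (rule mat_eqI[of _ n n])
 show "plane_rotation n i j (- q) c s \<in> mats n n"
  by (auto simp: plane_rotation_def mats_def)
 have *: "conjugation (- a) = - conjugation a" for a :: 'a
  using conjugation_scaleR[of "-1" a] by simp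
 fix k l assume "k < n" "l < n"
 then show "mat_adj n n (plane_rotation n i j q c s) (k, l) = plane_rotation n i j (- q) c s (k, l)"
  using assms by (cases "k = i"; cases "k = j"; cases "l = i"; cases "l = j")
   (simp_all add: plane_rotation_def conjugation_scaleR *)
qed auto

lemma unitary_plane_rotation:
 assumes "i < n" "j < n" "i ~= j" "norm q = 1" "c^2 + s^2 = 1"
 shows "plane_rotation n i j (q :: 'a::real_complex_quat) c s \<in> \<U> n"
proof -
 have *: "conjugation (- a) = - conjugation a" for a :: 'a
  using conjugation_scaleR[of "-1" a] by simp
 have inv: "mat_mult n n n (plane_rotation n i j (- q) c s) (plane_rotation n i j q c s) = mat_one n"
  if q: "norm q = 1" for q :: 'a
 proof (rule mat_eqI[of _ n n])
  fix k l assume kl: "k < n" "l < n"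
  have 1: "c * c + s * s = 1" using assms by (simp add: power2_eq_square)
  have 2: "(c * c) *\<^sub>R x + (s * s) *\<^sub>R x = x" for x :: 'a
   by (metis 1 scaleR_left_distrib scaleR_one)
  have 3: "q * (conjugation q * x) = x" "conjugation q * (q * x) = x" for x
   using q by (simp_all add: mult.assoc[symmetric] mult_conjugation_self conjugation_mult_self)
  have 4: "q * conjugation q = 1" "conjugation q * q = 1"
   using q by (simp_all add: mult_conjugation_self conjugation_mult_self)
  show "mat_mult n n n (plane_rotation n i j (- q) c s) (plane_rotation n i j q c s) (k, l) = mat_one n (k, l)"
   unfolding plane_rotation_mult[OF assms(1,2,3) kl] using kl assms(1,2,3) 2[of 1]
   by (auto simp: plane_rotation_def * 4 of_real_def algebra_simps)
 qed auto
 have "plane_rotation n i j q c s \<in> mats n n"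
  by (auto simp: plane_rotation_def mats_def)
 then show ?thesis
  using assms inv[of q] inv[of "- q"] by (simp add: unitary_group_def plane_rotation_adj)
qed

text \<open>Maximising this functional over the orbit of a matrix under the two unitary groups, with
  strictly decreasing positive weights, diagonalises the matrix.\<close>

definition weighted_trace :: "nat => (nat => real) => ('a::real_complex_quat) fmat => real" where
 "weighted_trace n w A = (\<Sum>i<n. w i * re_part (A (i, i)))"

lemma weighted_trace_adj:
 "r <= m ==> r <= n ==> weighted_trace r w (mat_adj m n A) = weighted_trace r w A"
 by (simp add: weighted_trace_def)

lemma weighted_trace_rotation:
 assumes "i < r" "j < m" "i ~= j" "r <= m" "r <= n" and w: "!!k. k >= r ==> w k = 0"
 shows "weighted_trace r w (mat_mult m m n (plane_rotation m i j q c s) A) =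
  weighted_trace r w A + (c - 1) * (w i * re_part (A (i, i)) + w j * re_part (A (j, j)))
   + s * (w i * re_part (q * A (j, i)) - w j * re_part (conjugation q * A (i, j)))"
proof -
 have re: "re_part (a - b) = re_part a - re_part b" for a b :: 'a
  by (simp add: re_part_def inner_diff_left)
 have "w k * re_part (mat_mult m m n (plane_rotation m i j q c s) A (k, k)) = w k * re_part (A (k, k))
  + (if k = i then (c - 1) * (w i * re_part (A (i, i))) + s * (w i * re_part (q * A (j, i))) else 0)
  + (if k = j then (c - 1) * (w j * re_part (A (j, j))) - s * (w j * re_part (conjugation q * A (i, j))) else 0)"
  if "k < r" for k
  using that assms(1-5)
  by (subst plane_rotation_mult) (auto simp: re re_part_add re_part_scaleR algebra_simps)
 then show ?thesis
  using assms(1-5) w[of j] unfolding weighted_trace_def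
  by (cases "j < r") (simp_all add: sum.distrib algebra_simps)
qed

lemma maximal_angle_zero:
 fixes a b :: real
 assumes "!!c s. c\<^sup>2 + s^2 = 1 ==> (c - 1) * a + s * b <= 0"
 shows "b = 0"
proof (rule ccontr)
 assume b: "b ~= 0"
 define u where "u = b / (\<bar>a\<bar> + 1)"
 define v where "v = 1 + u^2"
 have v: "v > 0" unfolding v_def by (simp add: add_pos_nonneg)
 have "((1 - u\<^sup>2) / v)^2 + (2 * u / v)^2 = 1"
 proof -
  have "(1 - u\<^sup>2)^2 + (2 * u)^2 = v^2"
   by (simp add: v_def power2_eq_square algebra_simps)
  then show ?thesis
   using v unfolding power_divide add_divide_distrib[symmetric] by simp
 qed
 then have "((1 - u\<^sup>2) / v - 1) * a + 2 * u / v * b <= 0"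
  by (rule assms)
 moreover have "((1 - u\<^sup>2) / v - 1) * a + 2 * u / v * b = (2 * u * b - 2 * u^2 * a) / v"
 proof -
  have u: "u^2 = v - 1" by (simp add: v_def)
  show ?thesis unfolding u using v by (simp add: field_simps)
 qed
 ultimately have "(2 * u * b - 2 * u^2 * a) / v <= 0"
  by simp
 then have "u * b <= u^2 * a"
  using v by (simp add: divide_le_0_iff)
 also have "... <= u^2 * \<bar>a\<bar>" by (simp add: mult_left_mono)
 finally have "b * b / (\<bar>a\<bar> + 1) <= b * b * \<bar>a\<bar> / (\<bar>a\<bar> + 1)^2"
  by (simp add: u_def power2_eq_square)
 then have "b * b * (\<bar>a\<bar> + 1) <= b * b * \<bar>a\<bar>"
  by (simp add: divide_simps power2_eq_square add_pos_nonneg split: if_splits)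
 then show False
  using b by (simp add: algebra_simps) (metis not_real_square_gt_zero not_less)
qed

lemma re_part_unit_zero:
 assumes "!!q. norm q = 1 ==> re_part (q * (a::'a::real_complex_quat)) = 0"
 shows "a = 0"
proof (rule ccontr)
 assume a: "a ~= 0"
 have "re_part ((1 / norm a) *\<^sub>R conjugation a * a) = 0"
  by (rule assms) (use a in simp)
 then have "1 / norm a * (norm a)^2 = 0"
  using conjugation_mult_self[of a] by (simp add: re_part_scaleR del: of_real_power)
 with a show False by simp
qed

lemma maximal_off_diagonal:
 assumes "i < r" "j < m" "i ~= j" "r <= m" "r <= n" and w: "!!k. k >= r ==> w k = 0"
  and max: "!!U. U \<in> \<U> m ==> weighted_trace r w (mat_mult m m n U A) <= weighted_trace r w A"
 shows "w i *\<^sub>R A (j, i) = w j *\<^sub>R conjugation (A (i, j) :: 'a::real_complex_quat)"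
proof -
 have "re_part (q * (w i *\<^sub>R A (j, i) - w j *\<^sub>R conjugation (A (i, j)))) = 0" if q: "norm q = 1" for q
 proof -
  have "w i * re_part (q * A (j, i)) - w j * re_part (conjugation q * A (i, j)) = 0"
  proof (rule maximal_angle_zero)
   fix c s :: real assume "c^2 + s^2 = 1"
   then have "plane_rotation m i j q c s \<in> \<U> m"
    using assms q by (intro unitary_plane_rotation) auto
   from max[OF this] show "(c - 1) * (w i * re_part (A (i, i)) + w j * re_part (A (j, j)))
    + s * (w i * re_part (q * A (j, i)) - w j * re_part (conjugation q * A (i, j))) <= 0"
    using assms(1-6) by (simp add: weighted_trace_rotation)
  qed
  moreover have "re_part (conjugation q * A (i, j)) = re_part (q * conjugation (A (i, j)))"
   using re_part_conjugation[of "conjugation q * A (i, j)"] re_part_mult_commute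
   by (metis conjugation_conjugation conjugation_mult)
  ultimately show ?thesis
   by (simp add: right_diff_distrib re_part_def inner_diff_left)
 qed
 then have "w i *\<^sub>R A (j, i) - w j *\<^sub>R conjugation (A (i, j)) = 0"
  by (rule re_part_unit_zero)
 then show ?thesis by simp
qed

lemma re_part_eq_norm:
 assumes "norm (a::'a::real_complex_quat) <= re_part a"
 shows "a = of_real (norm a)"
proof -
 have n: "re_part a = norm a"
  using assms re_part_le_norm[of a] by linarith
 have "(norm (a - of_real (norm a)))^2 = a \<bullet> a - 2 * norm a * (a \<bullet> 1) + (norm a)^2"
  unfolding power2_norm_eq_inner[of "a - of_real (norm a)"]
  by (simp add: inner_diff_left inner_diff_right of_real_def inner_commute[of 1 a] norm_one_inner
    power2_eq_square algebra_simps)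
 also have "... = 0"
  using n unfolding power2_norm_eq_inner[of a, symmetric] re_part_def by (simp add: power2_eq_square)
 finally have "(norm (a - of_real (norm a)))^2 = 0" .
 then show ?thesis by simp
qed

lemma unitary_diag_unit:
 assumes "norm (q::'a::real_complex_quat) = 1"
 shows "(\<lambda>(k, l)\<in>{..<n} \<times> {..<n}. if k = l then (if k = i then q else 1) else 0) \<in> \<U> n"
  (is "?U \<in> _")
proof -
 have 4: "q * conjugation q = 1" "conjugation q * q = 1"
  using assms by (simp_all add: mult_conjugation_self conjugation_mult_self)
 have "mat_mult n n n (mat_adj n n ?U) ?U = mat_one n"
 proof (rule mat_eqI[of _ n n])
  fix k l assume kl: "k < n" "l < n"
  have "mat_mult n n n (mat_adj n n ?U) ?U (k, l) = (\<Sum>p<n. if p = k then mat_one n (k, l) else 0)"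
   unfolding mat_mult_entry[OF kl] by (intro sum.cong refl) (use kl 4 in auto)
  then show "mat_mult n n n (mat_adj n n ?U) ?U (k, l) = mat_one n (k, l)"
   using kl by simp
 qed auto
 moreover have "mat_mult n n n ?U (mat_adj n n ?U) = mat_one n"
 proof (rule mat_eqI[of _ n n])
  fix k l assume kl: "k < n" "l < n"
  have "mat_mult n n n ?U (mat_adj n n ?U) (k, l) = (\<Sum>p<n. if p = k then mat_one n (k, l) else 0)"
   unfolding mat_mult_entry[OF kl] by (intro sum.cong refl) (use kl 4 in auto)
  then show "mat_mult n n n ?U (mat_adj n n ?U) (k, l) = mat_one n (k, l)"
   using kl by simp
 qed auto
 moreover have "?U \<in> mats n n" by (auto simp: mats_def)
 ultimately show ?thesis by (simp add: unitary_group_def)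
qed

lemma maximal_diagonal:
 assumes "i < r" "r <= m" "r <= n" "w i > 0"
  and max: "!!U. U \<in> \<U> m ==> weighted_trace r w (mat_mult m m n U A) <= weighted_trace r w A"
 shows "A (i, i) = of_real (norm (A (i, i) :: 'a::real_complex_quat))"
proof (cases "A (i, i) = 0")
 case False
 define q where "q = (1 / norm (A (i, i))) *\<^sub>R conjugation (A (i, i))"
 have q: "norm q = 1" using False by (simp add: q_def)
 define U where "U = (\<lambda>(k, l)\<in>{..<m} \<times> {..<m}. if k = l then (if k = i then q else 1) else 0)"
 have "re_part (mat_mult m m n U A (k, k)) = re_part (A (k, k)) +
  (if k = i then re_part (q * A (i, i)) - re_part (A (i, i)) else 0)" if "k < r" for k
 proof -
  have "mat_mult m m n U A (k, k) = (\<Sum>l<m. if l = k then (if k = i then q else 1) * A (k, k) else 0)"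
proof -
   have k: "k < m" "k < n" using that assms by auto
   show ?thesis
    unfolding mat_mult_entry[OF k] by (intro sum.cong refl) (use k in \<open>auto simp: U_def\<close>)
  qed
  then show ?thesis using that assms by simp
 qed
 then have "w k * re_part (mat_mult m m n U A (k, k)) = w k * re_part (A (k, k)) +
  (if k = i then w i * (re_part (q * A (i, i)) - re_part (A (i, i))) else 0)" if "k < r" for k
  using that by (auto simp: algebra_simps simp del: mat_mult_entry)
 then have "weighted_trace r w (mat_mult m m n U A)
  = weighted_trace r w A + w i * (re_part (q * A (i, i)) - re_part (A (i, i)))"
  using assms(1) by (simp add: weighted_trace_def sum.distrib del: mat_mult_entry)
 moreover have "U \<in> \<U> m"
  unfolding U_def using q by (rule unitary_diag_unit)
 ultimately have "w i * (re_part (q * A (i, i)) - re_part (A (i, i))) <= 0"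
  using max[of U] by simp
 then have "re_part (q * A (i, i)) <= re_part (A (i, i))"
  using \<open>w i > 0\<close> by (simp add: mult_le_0_iff)
 moreover have "re_part (q * A (i, i)) = norm (A (i, i))"
  using False conjugation_mult_self[of "A (i, i)"]
  by (simp add: q_def re_part_scaleR power2_eq_square del: of_real_power of_real_mult)
 ultimately show ?thesis by (intro re_part_eq_norm) simp
qed simp

lemma maximal_sorted:
 assumes "i < j" "j < r" "r <= m" "r <= n" "w j < w i" and w: "!!k. k >= r ==> w k = 0"
  and A: "A \<in> mats m n" "A (i, j) = 0" "A (j, i) = 0"
  and max: "!!U V. U \<in> \<U> m ==> V \<in> \<U> n ==>
   weighted_trace r w (mat_mult m n n (mat_mult m m n U A) V) <= weighted_trace r w A"
 shows "re_part (A (j, j)) <= re_part (A (i, i) :: 'a::real_complex_quat)"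
proof -
 define U :: "'a fmat" where "U = plane_rotation m i j 1 0 1"
 define V :: "'a fmat" where "V = plane_rotation n i j 1 0 1"
 define X where "X = mat_mult m m n U A"
 have UV: "U \<in> \<U> m" "V \<in> \<U> n"
  using assms by (auto simp: U_def V_def intro!: unitary_plane_rotation)
 have m1: "conjugation (- a) = - conjugation a" "re_part (- a) = - re_part a" for a :: 'a
  using conjugation_scaleR[of "-1" a] re_part_scaleR[of "-1" a] by simp_all
 have "weighted_trace r w X = weighted_trace r w A
  - (w i * re_part (A (i, i)) + w j * re_part (A (j, j)))"
  unfolding X_def U_def using assms by (subst weighted_trace_rotation) auto
 moreover have "weighted_trace r w (mat_mult m n n X (mat_adj n n V)) =
   weighted_trace r w (mat_mult n n m V (mat_adj m n X))"
  using assms weighted_trace_adj[of r n m w "mat_mult n n m V (mat_adj m n X)"] UV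
  by (simp add: mat_adj_mult mat_adj_adj X_def unitaryD)
 moreover have "... = weighted_trace r w (mat_adj m n X) + w i * re_part (A (j, j)) + w j * re_part (A (i, i))"
  unfolding V_def using assms
  by (subst weighted_trace_rotation) (auto simp: X_def U_def plane_rotation_mult m1 simp del: mat_mult_entry)
 moreover have "weighted_trace r w (mat_adj m n X) = weighted_trace r w X"
  using assms by (simp add: weighted_trace_adj)
 moreover have "weighted_trace r w (mat_mult m n n X (mat_adj n n V)) <= weighted_trace r w A"
  unfolding X_def using UV by (intro max unitary_adj)
 ultimately have "(w i - w j) * (re_part (A (j, j)) - re_part (A (i, i))) <= 0"
  by (simp add: algebra_simps)
 then show ?thesis using \<open>w j < w i\<close> by (simp add: mult_le_0_iff)
qed

lemma mem_chamber_B_iff: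
 "x \<in> chamber_B N \<longleftrightarrow> x \<in> extensional {..<N} & (\<forall>i<N. 0 <= x i) & (\<forall>i j. i <= j --> j < N --> x j <= x i)"
 by (auto simp: chamber_B_def PiE_def monotone_on_def)

text \<open>A maximum of \<open>weighted_trace\<close> over the two compact groups is diagonal, nonnegative and ordered, since otherwise a plane rotation
  or a diagonal unit would increase the trace. This argument works uniformly over the three division algebras.\<close>

theorem singular_value_decomposition:
 fixes A :: "('a::real_complex_quat) fmat"
 assumes A: "A \<in> mats m n" and "n <= m"
 obtains U V x where "U \<in> \<U> m" "V \<in> \<U> n" "x \<in> chamber_B n"
  "A = mat_mult m n n (mat_mult m m n U (sigma_mat m n x)) (mat_adj n n V)"
proof -
 define w where "w i = real (n - i)" for i
 define F where "F = (%(U, V). weighted_trace n w (mat_mult m n n (mat_mult m m n U A) V))"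
 have cont: "continuous_on (\<U> m \<times> \<U> n)
   (%p. mat_mult m n n (mat_mult m m n (fst p) A) (snd p))"
  by (intro continuous_intros)
 have "continuous_on (\<U> m \<times> \<U> n) F"
  unfolding F_def weighted_trace_def case_prod_beta
  by (intro continuous_on_sum continuous_on_mult continuous_on_const continuous_on_re_part
    continuous_on_entry[OF cont])
 then obtain UV where UV: "UV \<in> \<U> m \<times> \<U> n"
  and max: "!!Z. Z \<in> \<U> m \<times> \<U> n ==> F Z <= F UV"
  using continuous_attains_sup[of "\<U> m \<times> \<U> n" F]
   compact_Times[OF compact_unitary_group compact_unitary_group] unitary_one by blast
 obtain U V where [simp]: "UV = (U, V)" by (cases UV)
 have U: "U \<in> \<U> m" and V: "V \<in> \<U> n" using UV by auto
 define B where "B = mat_mult m n n (mat_mult m m n U A) V"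
 have B: "B \<in> mats m n" by (simp add: B_def)
 have max2: "weighted_trace n w (mat_mult m n n (mat_mult m m n U' B) V') <= weighted_trace n w B"
  if "U' \<in> \<U> m" "V' \<in> \<U> n" for U' V'
  using max[of "(mat_mult m m m U' U, mat_mult n n n V V')"] that U V
  by (simp add: F_def unitary_mult B_def mat_mult_assoc)
 have maxL: "weighted_trace n w (mat_mult m m n U' B) <= weighted_trace n w B"
  if "U' \<in> \<U> m" for U'
  using max2[OF that unitary_one] by (simp add: mat_mult_one_right)
 have maxR: "weighted_trace n w (mat_mult n n m V' (mat_adj m n B)) <= weighted_trace n w (mat_adj m n B)"
  if "V' \<in> \<U> n" for V'
  using max2[OF unitary_one unitary_adj[OF that]] that \<open>n <= m\<close> B
   weighted_trace_adj[of n n m w "mat_mult n n m V' (mat_adj m n B)"]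
  by (simp add: mat_mult_one_left weighted_trace_adj mat_adj_mult mat_adj_adj)
 have w0: "w k = 0" if "n <= k" for k using that by (simp add: w_def)
 have wpos: "w k > 0" if "k < n" for k using that by (simp add: w_def)
 have off: "B (j, i) = 0" if "i < n" "j < m" "i ~= j" for i j
 proof -
  have 1: "w i *\<^sub>R B (j, i) = w j *\<^sub>R conjugation (B (i, j))"
   by (rule maximal_off_diagonal[where r = n and m = m and n = n]) (use that \<open>n <= m\<close> w0 maxL in auto)
  show ?thesis
  proof (cases "j < n")
   case True
   have "w i *\<^sub>R mat_adj m n B (j, i) = w j *\<^sub>R conjugation (mat_adj m n B (i, j))"
    by (rule maximal_off_diagonal[where r = n and m = n and n = m]) (use that \<open>n <= m\<close> w0 maxR True in auto)
   then have 2: "w i *\<^sub>R conjugation (B (i, j)) = w j *\<^sub>R B (j, i)"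
    using that True \<open>n <= m\<close> by simp
   have "(w i * w i) *\<^sub>R B (j, i) = (w j * w j) *\<^sub>R B (j, i)"
    using 1 2 by (metis mult.commute scaleR_scaleR)
   moreover have "w i * w i ~= w j * w j"
    using that True wpos[of i] wpos[of j] by (auto simp: w_def square_eq_iff)
   ultimately show ?thesis by simp
  next
   case False
   then show ?thesis using 1 w0[of j] wpos[OF that(1)] by simp
  qed
 qed
 have diag: "B (i, i) = of_real (norm (B (i, i)))" if "i < n" for i
  by (rule maximal_diagonal[of _ n m n w]) (use that \<open>n <= m\<close> wpos maxL in auto)
 define x where "x = (\<lambda>i\<in>{..<n}. norm (B (i, i)))"
 have sorted: "norm (B (j, j)) <= norm (B (i, i))" if "i <= j" "j < n" for i j
 proof (cases "i = j")
  case False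
  have "re_part (B (j, j)) <= re_part (B (i, i))"
   by (rule maximal_sorted[of _ _ n m n w]) (use that False \<open>n <= m\<close> off B w0 max2 in \<open>auto simp: w_def\<close>)
  then show ?thesis
   using diag[of i] diag[of j] that by (metis re_part_of_real le_less_trans)
 qed simp
 have "x \<in> chamber_B n"
  using sorted by (auto simp: mem_chamber_B_iff x_def)
 moreover have B_eq: "B = sigma_mat m n x"
  by (rule mat_eqI[OF B]) (use off diag in \<open>auto simp: x_def\<close>)
 have "A = mat_mult m n n (mat_mult m m n (mat_adj m m U) B) (mat_adj n n V)"
  using U V A by (simp add: B_def mat_mult_assoc unitaryD mat_mult_one_right unitary_cancel)
 then have "A = mat_mult m n n (mat_mult m m n (mat_adj m m U) (sigma_mat m n x)) (mat_adj n n V)"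
  unfolding B_eq .
 ultimately show ?thesis
  using that unitary_adj[OF U] V by blast
qed

section \<open>Singular values\<close>

lemma right_dependent:
 fixes v :: "'l => 'i => 'a::real_complex_quat"
 assumes "finite I" "finite L" "card I < card L"
 shows "\<exists>c. (\<exists>l\<in>L. c l ~= 0) & (\<forall>i\<in>I. (\<Sum>l\<in>L. v l i * c l) = 0)"
 using assms
proof (induction I arbitrary: L v rule: finite_induct)
 case empty
 then obtain l where "l \<in> L" by (metis card_gt_0_iff card.empty ex_in_conv)
 then show ?case by (intro exI[of _ "%_. 1"]) auto
next
 case (insert n I)
 show ?case
 proof (cases "\<forall>l\<in>L. v l n = 0")
  case True
  then show ?thesis using insert.IH[of L v] insert.prems insert.hyps by auto
 next
  case False
  then obtain p where p: "p \<in> L" "v p n ~= 0" by blast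
  define v' where "v' l i = v l i - v p i * (inverse (v p n) * v l n)" for l i
  have "card I < card (L - {p})"
   using insert.prems insert.hyps p by simp
  then obtain c where c: "\<exists>l\<in>L - {p}. c l ~= 0" "\<forall>i\<in>I. (\<Sum>l\<in>L - {p}. v' l i * c l) = 0"
   using insert.IH[of "L - {p}" v'] insert.prems by blast
  define S where "S = (\<Sum>l\<in>L - {p}. v l n * c l)"
  define c' where "c' = c(p := - (inverse (v p n) * S))"
  have sum: "(\<Sum>l\<in>L. v l i * c' l) = v p i * c' p + (\<Sum>l\<in>L - {p}. v l i * c l)" for i
   using p insert.prems by (simp add: sum.remove[of L p] c'_def)
  have "(\<Sum>l\<in>L. v l i * c' l) = 0" if "i \<in> insert n I" for i
  proof (cases "i = n")
   case True
   have "v p n * (inverse (v p n) * S) = S"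
    using p by (simp add: mult.assoc[symmetric])
   then show ?thesis unfolding sum True by (simp add: c'_def S_def[symmetric])
  next
   case False
   then have "0 = (\<Sum>l\<in>L - {p}. v' l i * c l)" using c that by simp
   also have "... = (\<Sum>l\<in>L - {p}. v l i * c l) - v p i * (inverse (v p n) * S)"
    by (simp add: v'_def left_diff_distrib sum_subtractf mult.assoc S_def sum_distrib_left)
   finally show ?thesis unfolding sum by (simp add: c'_def)
  qed
  moreover have "\<exists>l\<in>L. c' l ~= 0"
   using c by (auto simp: c'_def)
  ultimately show ?thesis by blast
 qed
qed

lemma right_dim_eigenspace:
 fixes V :: "('a::real_complex_quat) fmat"
 assumes V: "V \<in> \<U> n"
 shows "right_dim n (eigenspace n (mat_mult n n n (mat_mult n n n V (sigma_mat n n h)) (mat_adj n n V)) r)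
  = card {i\<in>{..<n}. h i = r}"
proof -
 define I where "I = {i\<in>{..<n}. h i = r}"
 define H where "H = mat_mult n n n (mat_mult n n n V (sigma_mat n n h)) (mat_adj n n V)"
 have finI: "finite I" by (simp add: I_def)
 have "right_dim n (eigenspace n H r) = card I"
  unfolding right_dim_def
 proof (rule Greatest_equality)
  obtain e where e: "bij_betw e {..<card I} I"
   using ex_bij_betw_nat_finite[OF finI] by (auto simp: atLeast0LessThan)
  have eI: "e l \<in> I" "e l < n" if "l < card I" for l
   using e that by (auto simp: bij_betw_def I_def)
  define v where "v l = (\<lambda>i\<in>{..<n}. V (i, e l))" for l
  have HV: "mat_mult n n n H V = mat_mult n n n V (sigma_mat n n h)"
   using V by (simp add: H_def mat_mult_assoc unitaryD mat_mult_one_right)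
  have "v l \<in> eigenspace n H r" if "l < card I" for l
  proof -
   have "(\<Sum>j<n. H (i, j) * v l j) = v l i * of_real r" if i: "i < n" for i
   proof -
    have "(\<Sum>j<n. H (i, j) * v l j) = mat_mult n n n H V (i, e l)"
     using i eI[OF \<open>l < card I\<close>] by (simp add: v_def)
    also have "... = (\<Sum>j<n. if j = e l then V (i, e l) * of_real r else 0)"
     unfolding HV mat_mult_entry[OF i eI(2)[OF \<open>l < card I\<close>]]
     by (intro sum.cong refl) (use i eI[OF \<open>l < card I\<close>] in \<open>auto simp: I_def\<close>)
    also have "... = v l i * of_real r"
     using i eI[OF \<open>l < card I\<close>] by (simp add: v_def)
    finally show ?thesis .
   qed
   then show ?thesis by (auto simp: eigenspace_def v_def)
  qed
  moreover have "right_independent n (card I) v"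
   unfolding right_independent_def
  proof (intro allI impI)
   fix c l assume c: "\<forall>i<n. (\<Sum>l<card I. v l i * c l) = 0" and l: "l < card I"
   define C where "C = (\<lambda>(j, k)\<in>{..<n} \<times> {..<1::nat}. if j \<in> I then c (the_inv_into {..<card I} e j) else 0)"
   have "mat_mult n n 1 V C (i, 0) = 0" if i: "i < n" for i
   proof -
    have "mat_mult n n 1 V C (i, 0) = (\<Sum>j\<in>I. V (i, j) * c (the_inv_into {..<card I} e j))"
     using i unfolding C_def I_def
     by (simp add: if_distrib[of "%x. _ * x"] sum.If_cases Int_def lessThan_def cong: if_cong) 
    also have "... = (\<Sum>l<card I. V (i, e l) * c l)"
     using e by (subst sum.reindex_bij_betw[OF e, symmetric])
      (auto intro!: sum.cong simp: the_inv_into_f_f bij_betw_def)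
    also have "... = 0" using c i by (simp add: v_def)
    finally show ?thesis .
   qed
   then have z: "mat_mult n n 1 V C = (\<lambda>k\<in>{..<n} \<times> {..<1}. 0)"
    by (intro mat_eqI[OF mat_mult_mats]) (auto simp: mats_def PiE_def extensional_def simp del: mat_mult_entry)
   have "C \<in> mats n 1" by (auto simp: C_def mats_def)
   then have "C = mat_mult n n 1 (mat_adj n n V) (mat_mult n n 1 V C)"
    using unitary_cancel(1)[OF V] by simp
   then have "C (e l, 0) = mat_mult n n 1 (mat_adj n n V) (\<lambda>k\<in>{..<n} \<times> {..<1}. 0) (e l, 0)"
    unfolding z by simp
   then have "C (e l, 0) = 0"
    using eI[OF l] by simp
   then show "c l = 0"
    using eI[OF l] e l by (simp add: C_def the_inv_into_f_f bij_betw_def)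
  qed
  ultimately show "\<exists>v. (\<forall>l<card I. v l \<in> eigenspace n H r) & right_independent n (card I) v"
   by blast
 next
  fix k assume "\<exists>v. (\<forall>l<k. v l \<in> eigenspace n H r) & right_independent n k v"
  then obtain v where v: "!!l. l < k ==> v l \<in> eigenspace n H r" and ind: "right_independent n k v"
   by blast
  show "k <= card I"
  proof (rule ccontr)
   assume "\<not> k <= card I"
   define X where "X = (\<lambda>(i, l)\<in>{..<n} \<times> {..<k}. v l i)"
   define Y where "Y = mat_mult n n k (mat_adj n n V) X"
   have X: "X \<in> mats n k" by (auto simp: X_def mats_def)
   have HX: "mat_mult n n k H X = mat_scale n k r X"
   proof (rule mat_eqI[of _ n k])
    fix i l assume "i < n" "l < k"
    then show "mat_mult n n k H X (i, l) = mat_scale n k r X (i, l)"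
     using v[of l] by (simp add: X_def eigenspace_def of_real_def)
   qed auto
   have "mat_mult n n k (sigma_mat n n h) Y = mat_mult n n k (mat_adj n n V) (mat_mult n n k H X)"
    using V by (simp add: H_def Y_def mat_mult_assoc unitary_cancel)
   also have "... = mat_scale n k r Y"
    unfolding HX Y_def by (rule mat_eqI[of _ n k]) (auto simp: scaleR_sum_right)
   finally have SY: "mat_mult n n k (sigma_mat n n h) Y = mat_scale n k r Y" .
   have Y0: "Y (i, l) = 0" if "i < n" "l < k" "i \<notin> I" for i l
   proof -
    have "mat_mult n n k (sigma_mat n n h) Y (i, l) = (\<Sum>j<n. if j = i then h i *\<^sub>R Y (i, l) else 0)"
     unfolding mat_mult_entry[OF that(1,2)]
     by (intro sum.cong refl) (use that in \<open>auto simp: scaleR_conv_of_real\<close>)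
    then have "mat_scale n k r Y (i, l) = h i *\<^sub>R Y (i, l)"
     unfolding SY using that by simp
    then have "h i *\<^sub>R Y (i, l) = r *\<^sub>R Y (i, l)"
     unfolding mat_scale_entry[OF that(1,2)] by (rule sym)
    moreover have "h i ~= r" using that by (auto simp: I_def)
    ultimately show ?thesis by (simp only: scaleR_cancel_right) blast
   qed
   obtain c where c: "\<exists>l\<in>{..<k}. c l ~= 0" "\<forall>i\<in>I. (\<Sum>l<k. Y (i, l) * c l) = 0"
    using right_dependent[of I "{..<k}" "%l i. Y (i, l)"] finI \<open>\<not> k <= card I\<close> by auto
   define C where "C = (\<lambda>(l, j)\<in>{..<k} \<times> {..<1::nat}. c l)"
   have "mat_mult n k 1 Y C = (\<lambda>k\<in>{..<n} \<times> {..<1}. 0)"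
   proof (rule mat_eqI[OF mat_mult_mats])
    fix i j assume ij: "i < n" "j < (1::nat)"
    then have "(\<Sum>l<k. Y (i, l) * c l) = 0"
     using c(2) Y0 by (cases "i \<in> I") auto
    then show "mat_mult n k 1 Y C (i, j) = (\<lambda>k\<in>{..<n} \<times> {..<1}. 0) (i, j)"
     using ij by (simp add: C_def)
   qed (auto simp: mats_def)
   moreover have "mat_mult n n 1 V (mat_mult n k 1 Y C) = mat_mult n k 1 X C"
    unfolding Y_def mat_mult_assoc using V by (simp add: unitary_cancel)
   ultimately have XC: "mat_mult n k 1 X C = mat_mult n n 1 V (\<lambda>k\<in>{..<n} \<times> {..<1}. 0)"
    by simp
   have "(\<Sum>l<k. v l i * c l) = 0" if i: "i < n" for i
   proof -
    have "(\<Sum>l<k. v l i * c l) = mat_mult n k 1 X C (i, 0)"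
     using i by (simp add: X_def C_def)
    also have "... = 0" unfolding XC using i by simp
    finally show ?thesis .
   qed
   then show False
    using ind c(1) unfolding right_independent_def by blast
  qed
 qed
 then show ?thesis by (simp add: H_def I_def)
qed

lemma antimono_eq_by_multiplicity:
 fixes s t :: "nat => real"
 assumes "s \<in> extensional {..<n}" "t \<in> extensional {..<n}"
  and "antimono_on {..<n} s" "antimono_on {..<n} t"
  and card: "!!r. card {i\<in>{..<n}. s i = r} = card {i\<in>{..<n}. t i = r}"
 shows "s = t"
proof -
 have count: "count (mset (map f [0..<n])) r = card {i\<in>{..<n}. f i = r}" for f :: "nat => real" and r
 proof -
  have "mset (map f [0..<n]) = image_mset f (mset_set {..<n})"
   by (metis atLeast0LessThan mset_map mset_upt)
  then show ?thesis
   using count_image_mset_eq_card_vimage[of "{..<n}" f r] by (simp only: finite_lessThan)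
 qed
 have sorted: "sorted (rev (map f [0..<n]))" if "antimono_on {..<n} f" for f :: "nat => real"
  using that unfolding sorted_rev_iff_nth_mono by (auto simp: monotone_on_def)
 have "mset (map s [0..<n]) = mset (map t [0..<n])"
  using card by (intro multiset_eqI) (simp only: count)
 then have "mset (rev (map s [0..<n])) = mset (rev (map t [0..<n]))"
  by (simp only: mset_rev)
 then have "rev (map s [0..<n]) = rev (map t [0..<n])"
  using properties_for_sort[OF _ sorted[OF assms(3)], of "rev (map t [0..<n])"]
   properties_for_sort[OF refl sorted[OF assms(4)]] by simp
 then have "map s [0..<n] = map t [0..<n]"
  by (simp only: rev_is_rev_conv)
 then have "s i = t i" if "i < n" for i
  using that by (simp add: map_eq_conv)
 then show ?thesis
  using assms(1,2) by (intro extensionalityI[of s "{..<n}" t]) auto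
qed

text \<open>A unitary change of basis reduces the eigenspaces to coordinate subspaces, so multiplicities can be counted.\<close>

lemma ordered_spectrum_eq:
 assumes "V \<in> \<U> n" "h \<in> extensional {..<n}" "antimono_on {..<n} h"
 shows "ordered_spectrum n (mat_mult n n n (mat_mult n n n V (sigma_mat n n h)) (mat_adj n n V)) = h"
 unfolding ordered_spectrum_def right_dim_eigenspace[OF assms(1)]
proof (rule the_equality)
 show "h \<in> {..<n} \<rightarrow>\<^sub>E UNIV & antimono_on {..<n} h &
  (\<forall>r. card {i \<in> {..<n}. h i = r} = card {i \<in> {..<n}. h i = r})"
  using assms by (auto simp: PiE_def)
 fix s assume "s \<in> {..<n} \<rightarrow>\<^sub>E UNIV & antimono_on {..<n} s &
  (\<forall>r. card {i \<in> {..<n}. s i = r} = card {i \<in> {..<n}. h i = r})"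
 then show "s = h"
  using assms by (intro antimono_eq_by_multiplicity[of s n h]) (auto simp: PiE_def)
qed

abbreviation usv :: "nat => nat => ('a::real_complex_quat) fmat => (nat => real) => 'a fmat => 'a fmat" where
 "usv m n U x V \<equiv> mat_mult m n n (mat_mult m m n U (sigma_mat m n x)) (mat_adj n n V)"

lemma gram_usv:
 assumes "n <= m" "U \<in> \<U> m"
 shows "mat_mult n m n (mat_adj m n (usv m n U x V)) (usv m n U x V)
  = usv n n (mat_adj n n (mat_adj n n V)) (%i. x i * x i) V"
 using assms by (simp add: mat_adj_mult mat_mult_assoc unitary_cancel)
  (simp add: mat_mult_assoc[symmetric] sigma_mat_adj_mult)

lemma sigma_mat_restrict: "sigma_mat m n (restrict x {..<n}) = sigma_mat m n x"
 by (auto simp: sigma_mat_def)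

theorem sing_vals_usv:
 assumes "n <= m" "U \<in> \<U> m" "V \<in> \<U> n" "x \<in> chamber_B n"
 shows "sing_vals m n (usv m n U x V) = x"
proof -
 define h where "h = (\<lambda>i\<in>{..<n}. x i * x i)"
 have x: "x \<in> extensional {..<n}" "!!i. i < n ==> 0 <= x i" "!!i j. i <= j ==> j < n ==> x j <= x i"
  using assms(4) by (auto simp: mem_chamber_B_iff)
 have h: "h \<in> extensional {..<n}" "antimono_on {..<n} h"
  using x by (auto simp: h_def monotone_on_def intro!: mult_mono)
 have "sing_vals m n (usv m n U x V) = (\<lambda>i\<in>{..<n}. sqrt (h i))"
  unfolding sing_vals_def gram_usv[OF assms(1,2)]
  using assms(3) ordered_spectrum_eq[OF assms(3) h]
  by (simp add: mat_adj_adj unitaryD h_def sigma_mat_restrict)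
 also have "... = x"
  using x by (intro extensionalityI[of _ "{..<n}"]) (auto simp: h_def)
 finally show ?thesis .
qed

corollary svd_sing_vals:
 fixes A :: "('a::real_complex_quat) fmat"
 assumes "A \<in> mats m n" "n <= m"
 obtains U V where "U \<in> \<U> m" "V \<in> \<U> n" "A = usv m n U (sing_vals m n A) V"
  "sing_vals m n A \<in> chamber_B n"
 using singular_value_decomposition[OF assms] sing_vals_usv[OF assms(2)] by metis

lemma sing_vals_unitary:
 fixes A :: "('a::real_complex_quat) fmat"
 assumes "A \<in> mats m n" "n <= m" "U \<in> \<U> m" "V \<in> \<U> n"
 shows "sing_vals m n (mat_mult m n n (mat_mult m m n U A) V) = sing_vals m n A"
proof -
 obtain U0 V0 where *: "U0 \<in> \<U> m" "V0 \<in> \<U> n" "A = usv m n U0 (sing_vals m n A) V0"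
  "sing_vals m n A \<in> chamber_B n"
  using svd_sing_vals[OF assms(1,2)] .
 have "mat_mult m n n (mat_mult m m n U (usv m n U0 (sing_vals m n A) V0)) V
  = usv m n (mat_mult m m m U U0) (sing_vals m n A) (mat_mult n n n (mat_adj n n V) V0)"
  using assms(4) by (simp add: mat_mult_assoc mat_adj_mult mat_adj_adj unitaryD)
 then show ?thesis
  using * sing_vals_usv[OF assms(2)] assms(3,4) by (metis unitary_mult unitary_adj)
qed

lemma sing_vals_unitary_left:
 assumes "A \<in> mats m n" "n <= m" "U \<in> \<U> m"
 shows "sing_vals m n (mat_mult m m n U A) = sing_vals m n A"
 using sing_vals_unitary[OF assms unitary_one] by (simp add: mat_mult_one_right)

section \<open>A trace inequality for three diagonal matrices\<close>

lemma abel_inequality: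
 fixes b u v :: "nat => real"
 assumes part: "!!m. m <= n ==> (\<Sum>i<m. u i) <= (\<Sum>i<m. v i)"
  and b: "!!i. i < n ==> 0 <= b i" "!!i j. i <= j ==> j < n ==> b j <= b i"
 shows "(\<Sum>i<n. b i * u i) <= (\<Sum>i<n. b i * v i)"
proof -
 define D where "D m = (\<Sum>i<m. v i) - (\<Sum>i<m. u i)" for m
 have D: "0 <= D m" if "m <= n" for m using part[OF that] by (simp add: D_def)
 have "m < n ==> b m * D (Suc m) <= (\<Sum>i<Suc m. b i * (v i - u i))" for m
 proof (induction m)
  case 0
  then show ?case by (simp add: D_def)
 next
  case (Suc m)
  have "b (Suc m) * D (Suc m) <= b m * D (Suc m)"
   using Suc.prems D[of "Suc m"] b(2)[of m "Suc m"] by (intro mult_right_mono) auto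
  moreover have "D (Suc (Suc m)) = D (Suc m) + (v (Suc m) - u (Suc m))"
   by (simp add: D_def)
  then have "b (Suc m) * D (Suc (Suc m)) = b (Suc m) * D (Suc m) + b (Suc m) * (v (Suc m) - u (Suc m))"
   by (simp add: distrib_left)
  moreover have "b m * D (Suc m) <= (\<Sum>i<Suc m. b i * (v i - u i))"
   using Suc by simp
  ultimately show ?case by simp
 qed
 then have "0 <= (\<Sum>i<n. b i * (v i - u i))"
  using D b by (cases n) (auto intro: order.trans[OF mult_nonneg_nonneg])
 then show ?thesis by (simp add: algebra_simps sum_subtractf)
qed

lemma unitary_column_norm:
 assumes V: "V \<in> \<U> n" and i: "i < n"
 shows "(\<Sum>k<n. (norm (V (k, i) :: 'a::real_complex_quat))\<^sup>2) = 1"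
proof -
 have "mat_mult n n n (mat_adj n n V) V (i, i) = 1"
  using V i by (simp add: unitaryD)
 then have "(\<Sum>k<n. of_real ((norm (V (k, i)))^2) :: 'a) = 1"
  using i by (simp add: conjugation_mult_self)
 then have "(of_real (\<Sum>k<n. (norm (V (k, i)))\<^sup>2) :: 'a) = of_real 1"
  by simp
 then show ?thesis by (simp only: of_real_eq_iff)
qed

lemma contraction_trace_bound:
 fixes P Q V :: "('a::real_complex_quat) fmat"
 assumes P: "P \<in> \<U> n" and Q: "Q \<in> \<U> n" and V: "V \<in> \<U> n"
  and m: "m1 <= n" "m2 <= n" "m3 <= n"
 shows "(\<Sum>i<m1. \<Sum>j<m2. \<Sum>k<m3. re_part (P (i, j) * Q (j, k) * V (k, i))) <= real m1"
proof -
 have "(\<Sum>j<m2. \<Sum>k<m3. re_part (P (i, j) * Q (j, k) * V (k, i))) <= 1" if "i < m1" for i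
 proof -
  have i: "i < n" using that m by simp
  define X where "X = (\<lambda>(k, l)\<in>{..<n} \<times> {..<1::nat}. if k < m3 then V (k, i) else 0)"
  define Y where "Y = mat_mult n n 1 Q X"
  have XY: "X \<in> mats n 1" by (auto simp: X_def mats_def)
  have "(mat_norm n 1 X)^2 = (\<Sum>k<n. (norm (if k < m3 then V (k, i) else 0))\<^sup>2)"
   by (simp add: mat_norm_sq X_def)
  also have "... <= (\<Sum>k<n. (norm (V (k, i)))\<^sup>2)" by (intro sum_mono) auto
  finally have "(mat_norm n 1 Y)^2 <= 1"
   unfolding Y_def using unitary_column_norm[OF V i] Q XY by (simp add: mat_norm_unitary_left)
  then have Ysum: "(\<Sum>j<n. (norm (Y (j, 0)))\<^sup>2) <= 1" by (simp add: mat_norm_sq)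
  have Yj: "Y (j, 0) = (\<Sum>k<m3. Q (j, k) * V (k, i))" if "j < n" for j
  proof -
   have "Y (j, 0) = (\<Sum>k<n. if k < m3 then Q (j, k) * V (k, i) else 0)"
    unfolding Y_def using that by (subst mat_mult_entry) (auto simp: X_def intro!: sum.cong)
   also have "... = (\<Sum>k<m3. Q (j, k) * V (k, i))"
    using m by (intro sum.mono_neutral_cong_right) auto
   finally show ?thesis .
  qed
  have "(\<Sum>j<m2. \<Sum>k<m3. re_part (P (i, j) * Q (j, k) * V (k, i))) = re_part (\<Sum>j<m2. P (i, j) * Y (j, 0))"
   using m by (simp add: re_part_sum sum_distrib_left mult.assoc Yj)
  also have "... <= norm (\<Sum>j<m2. P (i, j) * Y (j, 0))"
   using re_part_le_norm by (rule order.trans[OF abs_ge_self])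
  also have "... <= (\<Sum>j<m2. \<bar>norm (P (i, j))\<bar> * \<bar>norm (Y (j, 0))\<bar>)"
   by (auto intro!: order.trans[OF norm_sum] sum_mono simp: norm_mult)
  also have "... <= (\<Sum>j<n. \<bar>norm (P (i, j))\<bar> * \<bar>norm (Y (j, 0))\<bar>)"
   using m by (intro sum_mono2) auto
  also have "... <= L2_set (%j. norm (P (i, j))) {..<n} * L2_set (%j. norm (Y (j, 0))) {..<n}"
   by (rule L2_set_mult_ineq)
  also have "... <= 1 * 1"
  proof (intro mult_mono)
   have "(\<Sum>j<n. (norm (P (i, j)))\<^sup>2) = 1"
    using unitary_column_norm[OF unitary_adj[OF P] i] i by simp
   then show "L2_set (%j. norm (P (i, j))) {..<n} <= 1" by (simp add: L2_set_def)
   show "L2_set (%j. norm (Y (j, 0))) {..<n} <= 1" using Ysum by (simp add: L2_set_def)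
  qed auto
  finally show ?thesis by simp
 qed
 then have "(\<Sum>i<m1. \<Sum>j<m2. \<Sum>k<m3. re_part (P (i, j) * Q (j, k) * V (k, i))) <= (\<Sum>i<m1. 1)"
  by (intro sum_mono) auto
 then show ?thesis by simp
qed

lemma trilinear_partial_sums:
 fixes P Q V :: "('a::real_complex_quat) fmat"
 assumes P: "P \<in> \<U> n" and Q: "Q \<in> \<U> n" and V: "V \<in> \<U> n"
  and m: "m1 <= n" "m2 <= n" "m3 <= n"
 shows "(\<Sum>i<m1. \<Sum>j<m2. \<Sum>k<m3. re_part (P (i, j) * Q (j, k) * V (k, i)))
  <= (\<Sum>i<m1. \<Sum>j<m2. \<Sum>k<m3. if i = j & j = k then 1 else 0)"
proof -
 define t where "t i j k = re_part (P (i, j) * Q (j, k) * V (k, i))" for i j k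
 have t2: "t i j k = re_part (Q (j, k) * V (k, i) * P (i, j))" for i j k
  unfolding t_def by (metis mult.assoc re_part_mult_commute)
 have t3: "t i j k = re_part (V (k, i) * P (i, j) * Q (j, k))" for i j k
  unfolding t_def by (metis mult.assoc re_part_mult_commute)
 have r1: "(\<Sum>i<m1. \<Sum>j<m2. \<Sum>k<m3. t i j k) = (\<Sum>j<m2. \<Sum>k<m3. \<Sum>i<m1. t i j k)"
 proof -
  have "(\<Sum>i<m1. \<Sum>j<m2. \<Sum>k<m3. t i j k) = (\<Sum>j<m2. \<Sum>i<m1. \<Sum>k<m3. t i j k)"
   by (rule sum.swap)
  also have "... = (\<Sum>j<m2. \<Sum>k<m3. \<Sum>i<m1. t i j k)"
   by (intro sum.cong refl sum.swap)
  finally show ?thesis .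
 qed
 have r2: "(\<Sum>j<m2. \<Sum>k<m3. \<Sum>i<m1. t i j k) = (\<Sum>k<m3. \<Sum>i<m1. \<Sum>j<m2. t i j k)"
 proof -
  have "(\<Sum>j<m2. \<Sum>k<m3. \<Sum>i<m1. t i j k) = (\<Sum>k<m3. \<Sum>j<m2. \<Sum>i<m1. t i j k)"
   by (rule sum.swap)
  also have "... = (\<Sum>k<m3. \<Sum>i<m1. \<Sum>j<m2. t i j k)"
   by (intro sum.cong refl sum.swap)
  finally show ?thesis .
 qed
 have b1: "(\<Sum>i<m1. \<Sum>j<m2. \<Sum>k<m3. t i j k) <= real m1"
  unfolding t_def by (rule contraction_trace_bound[OF P Q V m])
 have b2: "(\<Sum>i<m1. \<Sum>j<m2. \<Sum>k<m3. t i j k) <= real m2"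
  unfolding r1 using contraction_trace_bound[OF Q V P m(2,3,1)] by (simp only: t2[symmetric])
 have b3: "(\<Sum>i<m1. \<Sum>j<m2. \<Sum>k<m3. t i j k) <= real m3"
  unfolding r1 r2 using contraction_trace_bound[OF V P Q m(3,1,2)] by (simp only: t3[symmetric])
 have "(\<Sum>i<m1. \<Sum>j<m2. \<Sum>k<m3. if i = j & j = k then 1 else (0::real))
   = (\<Sum>i<m1. \<Sum>j<m2. if j = i then (if i < m3 then 1 else 0) else 0)"
 proof (intro sum.cong refl)
  fix i j
  show "(\<Sum>k<m3. if i = j & j = k then 1 else (0::real)) = (if j = i then (if i < m3 then 1 else 0) else 0)"
   by (cases "i = j") auto
 qed
 also have "... = (\<Sum>i<m1. if i < min m2 m3 then 1 else 0)"
  by (intro sum.cong refl) auto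
 also have "... = (\<Sum>i<min m1 (min m2 m3). 1)"
  by (intro sum.mono_neutral_cong_right) auto
 finally show ?thesis
  using b1 b2 b3 unfolding t_def[symmetric] by simp
qed

text \<open>Horn's problem enters only through this inequality, in which an arbitrary third diagonal
  matrix takes part; summation by parts in each of the three weights reduces it to the fact that
  the trace of a contraction is at most its rank.\<close>

lemma trilinear_inequality:
 fixes P Q V :: "('a::real_complex_quat) fmat"
 assumes P: "P \<in> \<U> n" and Q: "Q \<in> \<U> n" and V: "V \<in> \<U> n"
  and a: "a \<in> chamber_B n" and b: "b \<in> chamber_B n" and s: "s \<in> chamber_B n"
 shows "(\<Sum>i<n. \<Sum>j<n. \<Sum>k<n. b i * s j * a k * re_part (P (i, j) * Q (j, k) * V (k, i)))
  <= (\<Sum>i<n. b i * s i * a i)"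
proof -
 define t where "t i j k = re_part (P (i, j) * Q (j, k) * V (k, i))" for i j k
 define e where "e i j k = (if i = j & j = k then 1 else (0::real))" for i j k :: nat
 have c: "!!i. i < n ==> 0 <= x i" "!!i j. i <= j ==> j < n ==> x j <= x i" if "x \<in> chamber_B n" for x
  using that by (auto simp: mem_chamber_B_iff)
 have 1: "(\<Sum>i<n. b i * (\<Sum>j<m2. \<Sum>k<m3. t i j k)) <= (\<Sum>i<n. b i * (\<Sum>j<m2. \<Sum>k<m3. e i j k))"
  if "m2 <= n" "m3 <= n" for m2 m3
  by (rule abel_inequality) (use trilinear_partial_sums[OF P Q V _ that] c[OF b] in \<open>auto simp: t_def e_def\<close>)
 have sw: "(\<Sum>i<n. b i * (\<Sum>j<m2. F i j)) = (\<Sum>j<m2. \<Sum>i<n. b i * F i j)" for F m2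
  unfolding sum_distrib_left by (rule sum.swap)
 have 2: "(\<Sum>j<n. s j * (\<Sum>i<n. b i * (\<Sum>k<m3. t i j k))) <= (\<Sum>j<n. s j * (\<Sum>i<n. b i * (\<Sum>k<m3. e i j k)))"
  if "m3 <= n" for m3
  by (rule abel_inequality) (use 1[OF _ that] c[OF s] in \<open>auto simp: sw\<close>)
 have sw2: "(\<Sum>j<n. s j * (\<Sum>i<n. b i * (\<Sum>k<m3. F i j k))) = (\<Sum>k<m3. \<Sum>j<n. s j * (\<Sum>i<n. b i * F i j k))" for F m3
 proof -
  have "(\<Sum>j<n. s j * (\<Sum>i<n. b i * (\<Sum>k<m3. F i j k))) = (\<Sum>j<n. \<Sum>k<m3. s j * (\<Sum>i<n. b i * F i j k))"
   unfolding sw by (simp add: sum_distrib_left)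
  also have "... = (\<Sum>k<m3. \<Sum>j<n. s j * (\<Sum>i<n. b i * F i j k))"
   by (rule sum.swap)
  finally show ?thesis .
 qed
 have 3: "(\<Sum>k<n. a k * (\<Sum>j<n. s j * (\<Sum>i<n. b i * t i j k))) <= (\<Sum>k<n. a k * (\<Sum>j<n. s j * (\<Sum>i<n. b i * e i j k)))"
  by (rule abel_inequality) (use 2 c[OF a] in \<open>auto simp: sw2\<close>)
 have re: "(\<Sum>k<n. a k * (\<Sum>j<n. s j * (\<Sum>i<n. b i * F i j k))) = (\<Sum>i<n. \<Sum>j<n. \<Sum>k<n. b i * s j * a k * F i j k)" for F
 proof -
  have "(\<Sum>k<n. a k * (\<Sum>j<n. s j * (\<Sum>i<n. b i * F i j k))) = (\<Sum>k<n. \<Sum>j<n. \<Sum>i<n. b i * s j * a k * F i j k)"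
   by (simp add: sum_distrib_left mult_ac)
  also have "... = (\<Sum>j<n. \<Sum>k<n. \<Sum>i<n. b i * s j * a k * F i j k)"
   by (rule sum.swap)
  also have "... = (\<Sum>j<n. \<Sum>i<n. \<Sum>k<n. b i * s j * a k * F i j k)"
   by (intro sum.cong refl sum.swap)
  also have "... = (\<Sum>i<n. \<Sum>j<n. \<Sum>k<n. b i * s j * a k * F i j k)"
   by (rule sum.swap)
  finally show ?thesis .
 qed
 have "(\<Sum>i<n. \<Sum>j<n. \<Sum>k<n. b i * s j * a k * e i j k) = (\<Sum>i<n. \<Sum>j<n. if j = i then b i * s i * a i else 0)"
 proof (intro sum.cong refl)
  fix i j assume "i \<in> {..<n}" "j \<in> {..<n}"
  have "(\<Sum>k<n. b i * s j * a k * e i j k) = (\<Sum>k<n. if k = j then (if j = i then b i * s i * a i else 0) else 0)"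
   by (intro sum.cong refl) (auto simp: e_def)
  then show "(\<Sum>k<n. b i * s j * a k * e i j k) = (if j = i then b i * s i * a i else 0)"
   using \<open>j \<in> {..<n}\<close> by simp
 qed
 then show ?thesis
  using 3 unfolding re t_def by simp
qed

definition corner :: "nat => ('a::real_complex_quat) fmat => 'a fmat" where
 "corner n U = (\<lambda>k\<in>{..<n} \<times> {..<n}. U k)"

lemma corner_mats [simp]: "corner n U \<in> mats n n"
 by (auto simp: corner_def mats_def)

lemma inner_usv_le_corner:
 fixes U V :: "('a::real_complex_quat) fmat"
 assumes "n <= m" "V \<in> \<U> n" "a \<in> chamber_B n" "b \<in> chamber_B n"
 obtains P Q where "P \<in> \<U> n" "Q \<in> \<U> n"
  "mat_inner m n (sigma_mat m n b) (usv m n U a V)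
   <= mat_inner n n (sigma_mat n n (%i. a i * b i)) (mat_mult n n n (mat_mult n n n P (corner n U)) Q)"
proof -
 obtain P Q s where PQ: "P \<in> \<U> n" "Q \<in> \<U> n" "s \<in> chamber_B n"
  and C: "corner n U = usv n n P s Q"
  using singular_value_decomposition[of "corner n U" n n] by auto
 have C_entry: "U (i, k) = (\<Sum>j<n. s j *\<^sub>R (P (i, j) * mat_adj n n Q (j, k)))" if "i < n" "k < n" for i k
 proof -
  have "mat_mult n n n P (sigma_mat n n s) (i, j) = s j *\<^sub>R P (i, j)" if "j < n" for j
  proof -
   have "mat_mult n n n P (sigma_mat n n s) (i, j) = (\<Sum>l<n. if l = j then s j *\<^sub>R P (i, j) else 0)"
    unfolding mat_mult_entry[OF \<open>i < n\<close> that]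
    by (intro sum.cong refl) (use \<open>i < n\<close> that in \<open>auto simp: of_real_def\<close>)
   then show ?thesis using that by simp
  qed
  moreover have "U (i, k) = usv n n P s Q (i, k)"
   unfolding C[symmetric] using that by (simp add: corner_def)
  ultimately show ?thesis using that
   by (simp add: mat_mult_entry[of i n k n n "mat_mult n n n P (sigma_mat n n s)"] del: mat_mult_entry mat_adj_entry)
 qed
 have "mat_inner m n (sigma_mat m n b) (usv m n U a V) = (\<Sum>i<n. b i * re_part (usv m n U a V (i, i)))"
  using assms(1) by (rule mat_inner_sigma)
 also have "... = (\<Sum>i<n. \<Sum>k<n. b i * a k * re_part (U (i, k) * mat_adj n n V (k, i)))"
 proof (intro sum.cong refl)
  fix i assume "i \<in> {..<n}"
  then have i: "i < n" "i < m" using assms(1) by auto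
  have "mat_mult m m n U (sigma_mat m n a) (i, k) = a k *\<^sub>R U (i, k)" if "k < n" for k
  proof -
   have "mat_mult m m n U (sigma_mat m n a) (i, k) = (\<Sum>l<m. if l = k then a k *\<^sub>R U (i, k) else 0)"
    unfolding mat_mult_entry[OF i(2) that]
    by (intro sum.cong refl) (use i that in \<open>auto simp: of_real_def\<close>)
   then show ?thesis using that assms(1) by simp
  qed
  then have "usv m n U a V (i, i) = (\<Sum>k<n. a k *\<^sub>R (U (i, k) * mat_adj n n V (k, i)))"
   using i by (simp add: mat_mult_entry[of i m i n n "mat_mult m m n U (sigma_mat m n a)"] del: mat_mult_entry mat_adj_entry)
  then show "b i * re_part (usv m n U a V (i, i)) = (\<Sum>k<n. b i * a k * re_part (U (i, k) * mat_adj n n V (k, i)))"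
   by (simp add: re_part_sum re_part_scaleR sum_distrib_left mult.assoc)
 qed
 also have "... = (\<Sum>i<n. \<Sum>k<n. \<Sum>j<n. b i * s j * a k * re_part (P (i, j) * mat_adj n n Q (j, k) * mat_adj n n V (k, i)))"
  by (intro sum.cong refl)
   (auto simp: C_entry sum_distrib_right sum_distrib_left re_part_sum re_part_scaleR mult_ac
    simp del: mat_adj_entry intro!: sum.cong)
 also have "... = (\<Sum>i<n. \<Sum>j<n. \<Sum>k<n. b i * s j * a k * re_part (P (i, j) * mat_adj n n Q (j, k) * mat_adj n n V (k, i)))"
  by (intro sum.cong refl sum.swap)
 also have "... <= (\<Sum>i<n. b i * s i * a i)"
  by (rule trilinear_inequality[OF PQ(1) unitary_adj[OF PQ(2)] unitary_adj[OF assms(2)] assms(3,4) PQ(3)])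
 also have "... = mat_inner n n (sigma_mat n n (%i. a i * b i)) (sigma_mat n n s)"
  by (simp add: mat_inner_sigma mult_ac)
 also have "sigma_mat n n s = mat_mult n n n (mat_mult n n n (mat_adj n n P) (corner n U)) Q"
  unfolding C using PQ by (simp add: mat_mult_assoc unitary_cancel unitaryD mat_mult_one_right)
 finally show ?thesis
  using that unitary_adj[OF PQ(1)] PQ(2) by blast
qed

section \<open>Lebesgue measure on the matrix space\<close>

abbreviation idx :: "nat => nat => (nat \<times> nat) set" where
 "idx m n \<equiv> {..<m} \<times> {..<n}"

definition lebesgue_mat :: "nat => nat => ('a::real_complex_quat) fmat measure" where
 "lebesgue_mat m n = PiM (idx m n) (%_. lborel)"

lemma sets_lebesgue_mat [simp, measurable_cong]: "sets (lebesgue_mat m n) = sets (mat_space m n)"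
 unfolding lebesgue_mat_def mat_space_def by (intro sets_PiM_cong) auto

lemma space_lebesgue_mat [simp]: "space (lebesgue_mat m n) = mats m n"
 by (simp add: lebesgue_mat_def space_PiM mats_def)

lemma space_mat_space [simp]: "space (mat_space m n) = mats m n"
 by (simp add: mat_space_def space_PiM mats_def)

interpretation lborel_fmat: product_sigma_finite "%_. lborel :: ('a::euclidean_space) measure"
 by standard

lemma sigma_finite_lebesgue_mat: "sigma_finite_measure (lebesgue_mat m n)"
 unfolding lebesgue_mat_def by (rule lborel_fmat.sigma_finite) auto

lemma measurable_mat_entry [measurable (raw)]:
 assumes "f \<in> M \<rightarrow>\<^sub>M mat_space m n" "i < m" "j < n"
 shows "(%x. f x (i, j) :: 'a::real_complex_quat) \<in> M \<rightarrow>\<^sub>M borel"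
 using assms unfolding mat_space_def
 by (intro measurable_compose[OF assms(1)[unfolded mat_space_def] measurable_component_singleton]) auto

lemma measurable_conjugation [measurable]:
 "(conjugation :: 'a::real_complex_quat => 'a) \<in> borel \<rightarrow>\<^sub>M borel"
 by (intro borel_measurable_continuous_onI continuous_on_conjugation continuous_on_id)

lemma measurable_re_part [measurable]:
 "(re_part :: 'a::real_complex_quat => real) \<in> borel \<rightarrow>\<^sub>M borel"
 by (intro borel_measurable_continuous_onI continuous_on_re_part continuous_on_id)

lemma measurable_matI:
 assumes "!!x. x \<in> space M ==> f x \<in> mats m n"
  and "!!i j. i < m ==> j < n ==> (%x. f x (i, j) :: 'a::real_complex_quat) \<in> M \<rightarrow>\<^sub>M borel"
 shows "f \<in> M \<rightarrow>\<^sub>M mat_space m n"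
 unfolding mat_space_def
proof (rule measurable_PiM_single')
 fix k assume "k \<in> idx m n"
 then show "(%x. f x k) \<in> M \<rightarrow>\<^sub>M borel" using assms(2) by (cases k) auto
next
 show "f \<in> space M \<rightarrow> (\<Pi>\<^sub>E i\<in>idx m n. space borel)"
  using assms(1) by (auto simp: mats_def)
qed

lemma measurable_mat_mult [measurable (raw)]:
 assumes [measurable]: "f \<in> M \<rightarrow>\<^sub>M mat_space m k" "g \<in> M \<rightarrow>\<^sub>M mat_space k n"
 shows "(%x. mat_mult m k n (f x) (g x)) \<in> M \<rightarrow>\<^sub>M mat_space m n"
 by (rule measurable_matI) simp_all

lemma measurable_mat_adj [measurable (raw)]:
 assumes [measurable]: "f \<in> M \<rightarrow>\<^sub>M mat_space m n"
 shows "(%x. mat_adj m n (f x)) \<in> M \<rightarrow>\<^sub>M mat_space n m"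
 by (rule measurable_matI) simp_all

lemma measurable_mat_add [measurable (raw)]:
 assumes [measurable]: "f \<in> M \<rightarrow>\<^sub>M mat_space m n" "g \<in> M \<rightarrow>\<^sub>M mat_space m n"
 shows "(%x. mat_add m n (f x) (g x)) \<in> M \<rightarrow>\<^sub>M mat_space m n"
 by (rule measurable_matI) simp_all

lemma measurable_mat_scale [measurable (raw)]:
 assumes [measurable]: "f \<in> M \<rightarrow>\<^sub>M mat_space m n"
 shows "(%x. mat_scale m n r (f x)) \<in> M \<rightarrow>\<^sub>M mat_space m n"
 by (rule measurable_matI) simp_all

lemma measurable_mat_inner [measurable (raw)]:
 assumes [measurable]: "f \<in> M \<rightarrow>\<^sub>M mat_space m n" "g \<in> M \<rightarrow>\<^sub>M mat_space m n"
 shows "(%x. mat_inner m n (f x) (g x)) \<in> borel_measurable M"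
 unfolding mat_inner_eq2 by measurable

lemma measurable_mat_norm [measurable (raw)]:
 assumes [measurable]: "f \<in> M \<rightarrow>\<^sub>M mat_space m n"
 shows "(%x. mat_norm m n (f x)) \<in> borel_measurable M"
 unfolding mat_norm_def by measurable

lemma measurable_const_mat [measurable]: "A \<in> mats m n ==> (%_. A) \<in> M \<rightarrow>\<^sub>M mat_space m n"
 by (rule measurable_const) simp

definition mat_affine :: "nat => nat => ('a::real_complex_quat) fmat => (nat \<times> nat => real) => 'a fmat => 'a fmat" where
 "mat_affine m n A r z = (\<lambda>k\<in>idx m n. A k + r k *\<^sub>R z k)"

lemma mat_affine_mats [simp]: "mat_affine m n A r z \<in> mats m n"
 by (auto simp: mat_affine_def mats_def)

lemma mat_affine_entry [simp]:
 "i < m ==> j < n ==> mat_affine m n A r z (i, j) = A (i, j) + r (i, j) *\<^sub>R z (i, j)"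
 by (simp add: mat_affine_def)

lemma measurable_mat_affine [measurable (raw)]:
 assumes [measurable]: "f \<in> M \<rightarrow>\<^sub>M mat_space m n"
 shows "(%x. mat_affine m n A r (f x)) \<in> M \<rightarrow>\<^sub>M mat_space m n"
 by (rule measurable_matI) simp_all

lemma nn_integral_lebesgue_affine:
 fixes F :: "('a::real_complex_quat) fmat => ennreal"
 assumes F [measurable]: "F \<in> borel_measurable (mat_space m n)" and r: "!!k. k \<in> idx m n ==> r k > 0"
 shows "(\<integral>\<^sup>+z. F z \<partial>lebesgue_mat m n)
  = ennreal (\<Prod>k\<in>idx m n. r k ^ DIM('a)) * (\<integral>\<^sup>+z. F (mat_affine m n A r z) \<partial>lebesgue_mat m n)"
proof -
 define C where "C = ennreal (\<Prod>k\<in>idx m n. r k ^ DIM('a))"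
 define D where "D = density (distr (lebesgue_mat m n) (lebesgue_mat m n) (mat_affine m n A r)) (%_. C)"
 have [measurable]: "mat_affine m n A r \<in> mat_space m n \<rightarrow>\<^sub>M mat_space m n"
  using measurable_mat_affine[OF measurable_ident] by simp
 have "D = PiM (idx m n) (%_. lborel)"
 proof (rule lborel_fmat.PiM_eqI)
  show "sets D = sets (PiM (idx m n) (%_. lborel :: 'a measure))"
   by (simp add: D_def lebesgue_mat_def)
  fix S assume S: "!!k. k \<in> idx m n ==> S k \<in> sets (lborel :: 'a measure)"
  have SS: "Pi\<^sub>E (idx m n) S \<in> sets (mat_space m n)"
   unfolding mat_space_def using S by (intro sets_PiM_I_finite) auto
  have vim: "mat_affine m n A r -` Pi\<^sub>E (idx m n) S \<inter> mats m n
    = Pi\<^sub>E (idx m n) (%k. (%x. A k + r k *\<^sub>R x) -` S k)"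
   by (auto simp: mat_affine_def mats_def PiE_def Pi_def extensional_def)
  have scale: "ennreal (r k ^ DIM('a)) * emeasure lborel ((%x. A k + r k *\<^sub>R x) -` S k) = emeasure lborel (S k)"
   if k: "k \<in> idx m n" for k
  proof -
   have [measurable]: "S k \<in> sets borel" using S[OF k] by simp
   have "emeasure lborel (S k) = emeasure (density (distr lborel borel (%x. A k + r k *\<^sub>R x)) (%_. \<bar>r k\<bar>^DIM('a))) (S k)"
    using lborel_affine[of "r k" "A k"] r[OF k] by simp
   also have "... = ennreal (r k ^ DIM('a)) * emeasure (distr lborel borel (%x. A k + r k *\<^sub>R x)) (S k)"
    using r[OF k] by (simp add: emeasure_density nn_integral_cmult)
   also have "emeasure (distr lborel borel (%x. A k + r k *\<^sub>R x)) (S k)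
     = emeasure lborel ((%x. A k + r k *\<^sub>R x) -` S k)"
    by (subst emeasure_distr) auto
   finally show ?thesis ..
  qed
  have "emeasure D (Pi\<^sub>E (idx m n) S) = C * emeasure (lebesgue_mat m n) (mat_affine m n A r -` Pi\<^sub>E (idx m n) S \<inter> mats m n)"
   unfolding D_def using SS by (simp add: emeasure_density nn_integral_cmult emeasure_distr)
  also have "... = C * (\<Prod>k\<in>idx m n. emeasure lborel ((%x. A k + r k *\<^sub>R x) -` S k))"
   unfolding vim lebesgue_mat_def
  proof (subst lborel_fmat.emeasure_PiM)
   fix k assume "k \<in> idx m n"
   then have [measurable]: "S k \<in> sets borel" using S by simp
   have "(%x. A k + r k *\<^sub>R x) -` S k \<inter> space borel \<in> sets borel"
    by measurable
   then show "(%x. A k + r k *\<^sub>R x) -` S k \<in> sets lborel" by simp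
  qed auto
  also have "... = (\<Prod>k\<in>idx m n. emeasure lborel (S k))"
  proof -
   have "C = (\<Prod>k\<in>idx m n. ennreal (r k ^ DIM('a)))"
    unfolding C_def by (rule prod_ennreal[symmetric]) (use r in \<open>auto intro: less_imp_le\<close>)
   then show ?thesis by (simp add: prod.distrib[symmetric] scale cong: prod.cong)
  qed
  finally show "emeasure D (Pi\<^sub>E (idx m n) S) = (\<Prod>k\<in>idx m n. emeasure lborel (S k))" .
 qed auto
 then have "(\<integral>\<^sup>+z. F z \<partial>lebesgue_mat m n) = (\<integral>\<^sup>+z. F z \<partial>D)"
  by (simp add: lebesgue_mat_def)
 also have "... = C * (\<integral>\<^sup>+z. F (mat_affine m n A r z) \<partial>lebesgue_mat m n)"
  unfolding D_def by (simp add: nn_integral_density nn_integral_cmult nn_integral_distr)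
 finally show ?thesis by (simp add: C_def)
qed

lemma nn_integral_lebesgue_translate:
 fixes F :: "('a::real_complex_quat) fmat => ennreal"
 assumes [measurable]: "F \<in> borel_measurable (mat_space m n)"
 shows "(\<integral>\<^sup>+z. F (mat_add m n A z) \<partial>lebesgue_mat m n) = (\<integral>\<^sup>+z. F z \<partial>lebesgue_mat m n)"
 using nn_integral_lebesgue_affine[of F m n "%_. 1" A]
 by (simp add: mat_affine_def mat_add_def)

section \<open>Gaussian matrices\<close>

lemma density_PiM:
 fixes M :: "'i => 'b measure"
 assumes "product_sigma_finite M" "product_sigma_finite (%i. density (M i) (f i))" "finite I"
  and [measurable]: "!!i. f i \<in> borel_measurable (M i)"
 shows "PiM I (%i. density (M i) (f i)) = density (PiM I M) (%x. \<Prod>i\<in>I. f i (x i))"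
proof (rule product_sigma_finite.PiM_eqI[OF assms(2,3), symmetric])
 interpret product_sigma_finite M by fact
 show "sets (density (PiM I M) (%x. \<Prod>i\<in>I. f i (x i))) = sets (PiM I (%i. density (M i) (f i)))"
  by (auto intro!: sets_PiM_cong)
 fix A assume "!!i. i \<in> I ==> A i \<in> sets (density (M i) (f i))"
 then have A: "!!i. i \<in> I ==> A i \<in> sets (M i)" by simp
 have "emeasure (density (PiM I M) (%x. \<Prod>i\<in>I. f i (x i))) (Pi\<^sub>E I A)
  = (\<integral>\<^sup>+x. (\<Prod>i\<in>I. f i (x i)) * indicator (Pi\<^sub>E I A) x \<partial>PiM I M)"
  using A \<open>finite I\<close> by (intro emeasure_density) (auto intro!: sets_PiM_I_finite)
 also have "... = (\<integral>\<^sup>+x. (\<Prod>i\<in>I. f i (x i) * indicator (A i) (x i)) \<partial>PiM I M)"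
 proof (rule nn_integral_cong)
  fix x assume "x \<in> space (PiM I M)"
  then have "indicator (Pi\<^sub>E I A) x = (\<Prod>i\<in>I. indicator (A i) (x i) :: ennreal)"
   using \<open>finite I\<close> by (auto simp: space_PiM PiE_def indicator_def prod_zero_iff intro!: prod.neutral)
  then show "(\<Prod>i\<in>I. f i (x i)) * indicator (Pi\<^sub>E I A) x = (\<Prod>i\<in>I. f i (x i) * indicator (A i) (x i))"
   by (simp add: prod.distrib)
 qed
 also have "... = (\<Prod>i\<in>I. \<integral>\<^sup>+x. f i x * indicator (A i) x \<partial>M i)"
  using A \<open>finite I\<close> by (intro product_nn_integral_prod) auto
 also have "... = (\<Prod>i\<in>I. emeasure (density (M i) (f i)) (A i))"
  using A by (intro prod.cong refl) (simp add: emeasure_density)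
 finally show "emeasure (density (PiM I M) (%x. \<Prod>i\<in>I. f i (x i))) (Pi\<^sub>E I A)
  = (\<Prod>i\<in>I. emeasure (density (M i) (f i)) (A i))" .
qed

definition gauss_density :: "real => 'a::euclidean_space => ennreal" where
 "gauss_density s x = ennreal ((2 * pi * s) powr (- real DIM('a) / 2) * exp (- (norm x)\<^sup>2 / (2 * s)))"

lemma measurable_gauss_density [measurable]: "gauss_density s \<in> borel_measurable borel"
 unfolding gauss_density_def[abs_def] by measurable

lemma gauss_density_prod:
 assumes "s > 0"
 shows "(\<Prod>b\<in>Basis. ennreal (normal_density 0 (sqrt s) (x \<bullet> b))) = gauss_density s (x :: 'a::euclidean_space)"
proof -
 have *: "normal_density 0 (sqrt s) u = (2 * pi * s) powr (- 1 / 2) * exp (- u\<^sup>2 / (2 * s))" for u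
 proof -
  have "2 * pi * s >= 0" using assms by simp
  then have "(2 * pi * s) powr (- 1 / 2) = 1 / sqrt (2 * pi * s)"
   by (metis minus_divide_left powr_half_sqrt powr_minus_divide)
  then show ?thesis
   unfolding normal_density_def using assms by (simp only: real_sqrt_pow2 less_imp_le diff_0_right)
 qed
 have "(\<Prod>b\<in>Basis. ennreal (normal_density 0 (sqrt s) (x \<bullet> b)))
  = ennreal (\<Prod>b\<in>(Basis :: 'a set). (2 * pi * s) powr (- 1 / 2) * exp (- (x \<bullet> b)\<^sup>2 / (2 * s)))"
  unfolding * by (rule prod_ennreal) simp
 also have "(\<Prod>b\<in>(Basis :: 'a set). (2 * pi * s) powr (- 1 / 2) * exp (- (x \<bullet> b)\<^sup>2 / (2 * s)))
  = ((2 * pi * s) powr (- 1 / 2)) ^ DIM('a) * exp (\<Sum>b\<in>Basis. - (x \<bullet> b)\<^sup>2 / (2 * s))"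
  by (simp add: prod.distrib exp_sum)
 also have "(\<Sum>b\<in>Basis. - (x \<bullet> b)\<^sup>2 / (2 * s)) = - (norm x)\<^sup>2 / (2 * s)"
 proof -
  have "(norm x)^2 = (\<Sum>b\<in>Basis. (x \<bullet> b)\<^sup>2)"
   using power2_norm_eq_inner[of x] euclidean_inner[of x x] by (simp only: power2_eq_square)
  then show ?thesis
   by (simp only: sum_negf sum_divide_distrib[symmetric])
 qed
 also have "((2 * pi * s) powr (- 1 / 2)) ^ DIM('a) = (2 * pi * s) powr (- real DIM('a) / 2)"
  using assms by (simp add: powr_powr flip: powr_realpow)
 finally show ?thesis unfolding gauss_density_def .
qed

lemma distr_normal_coordinates:
 assumes "s > 0"
 shows "distr (PiM Basis (%_. density lborel (%u. ennreal (normal_density 0 (sqrt s) u)))) borel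
   (%f. \<Sum>b\<in>Basis. f b *\<^sub>R b) = density lborel (gauss_density s :: 'a::euclidean_space => _)"
proof -
 let ?N = "density lborel (%u. ennreal (normal_density 0 (sqrt s) u))"
 let ?h = "%f. \<Sum>b\<in>Basis. f b *\<^sub>R b :: 'a"
 interpret N: prob_space ?N using assms by (intro prob_space_normal_density) auto
 have [measurable]: "?h \<in> PiM Basis (%_. borel) \<rightarrow>\<^sub>M borel" by measurable
 have 1: "PiM Basis (%_. ?N) = density (PiM Basis (%_. lborel)) (%f. \<Prod>b\<in>(Basis :: 'a set). ennreal (normal_density 0 (sqrt s) (f b)))"
  by (intro density_PiM) (auto simp: product_sigma_finite_def N.sigma_finite_measure_axioms intro: lborel.sigma_finite_measure_axioms)
 have "density (PiM Basis (%_. lborel)) (%f. \<Prod>b\<in>(Basis :: 'a set). ennreal (normal_density 0 (sqrt s) (f b)))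
  = density (PiM Basis (%_. lborel)) (%f. gauss_density s (?h f))"
 proof (rule density_cong)
  show "(%f. \<Prod>b\<in>(Basis :: 'a set). ennreal (normal_density 0 (sqrt s) (f b))) \<in> borel_measurable (PiM Basis (%_. lborel))"
   by (intro borel_measurable_prod_ennreal measurable_compose[OF measurable_component_singleton]) auto
  show "(%f. gauss_density s (?h f)) \<in> borel_measurable (PiM Basis (%_. lborel))"
   by (intro measurable_compose[OF _ measurable_gauss_density]) simp
 qed (auto simp: gauss_density_prod[OF assms, symmetric] intro!: prod.cong AE_I2)
 then have "distr (PiM Basis (%_. ?N)) borel ?h = distr (density (PiM Basis (%_. lborel)) (%f. gauss_density s (?h f))) borel ?h"
  unfolding 1 by simp
 also have "... = density (distr (PiM Basis (%_. lborel)) borel ?h) (gauss_density s)"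
  by (subst density_distr) auto
 also have "... = density lborel (gauss_density s)"
  by (simp only: lborel_eq[symmetric])
 finally show ?thesis .
qed

lemma prob_space_gauss: "s > 0 ==> prob_space (density lborel (gauss_density s :: 'a::euclidean_space => _))"
proof -
 assume s: "s > 0"
 let ?N = "density lborel (%u. ennreal (normal_density 0 (sqrt s) u))"
 have "(%f. \<Sum>b\<in>Basis. f b *\<^sub>R b :: 'a) \<in> PiM Basis (%_. borel) \<rightarrow>\<^sub>M borel"
  by measurable
 moreover have "sets (PiM (Basis :: 'a set) (%_. ?N)) = sets (PiM Basis (%_. borel))"
  by (intro sets_PiM_cong) auto
 ultimately have "(%f. \<Sum>b\<in>Basis. f b *\<^sub>R b :: 'a) \<in> PiM Basis (%_. ?N) \<rightarrow>\<^sub>M borel"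
  by (simp cong: measurable_cong_sets)
 then show ?thesis
  unfolding distr_normal_coordinates[OF s, symmetric]
  by (intro prob_space.prob_space_distr prob_space_PiM prob_space_normal_density) (use s in auto)
qed

definition gauss_mat :: "nat => nat => ('a::real_complex_quat) fmat measure" where
 "gauss_mat m n = PiM (idx m n) (%_. density lborel (gauss_density 1))"

lemma sets_gauss_mat [simp, measurable_cong]: "sets (gauss_mat m n) = sets (mat_space m n)"
 unfolding gauss_mat_def mat_space_def by (intro sets_PiM_cong) auto

lemma space_gauss_mat [simp]: "space (gauss_mat m n) = mats m n"
 by (simp add: gauss_mat_def space_PiM mats_def)

lemma prob_space_gauss_mat: "prob_space (gauss_mat m n)"
 unfolding gauss_mat_def by (intro prob_space_PiM prob_space_gauss) auto

definition gauss_const :: "'a::real_complex_quat itself => nat => nat => real" where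
 "gauss_const _ m n = ((2 * pi) powr (- real DIM('a) / 2)) ^ (m * n)"

lemma PiM_gauss_density:
 assumes "s > 0"
 shows "PiM (idx m n) (%_. density lborel (gauss_density s :: 'a::real_complex_quat => _))
  = density (lebesgue_mat m n) (%z. ennreal (((2 * pi * s) powr (- real DIM('a) / 2)) ^ (m * n)
    * exp (- (mat_norm m n z)\<^sup>2 / (2 * s))))"
proof -
 have "PiM (idx m n) (%_. density lborel (gauss_density s :: 'a => _))
  = density (lebesgue_mat m n) (%z. \<Prod>k\<in>idx m n. gauss_density s (z k))"
  unfolding lebesgue_mat_def using prob_space_gauss[OF assms, where 'a='a]
  by (intro density_PiM)
   (auto simp: product_sigma_finite_def prob_space_imp_sigma_finite intro: lborel.sigma_finite_measure_axioms)
 also have "(%z. \<Prod>k\<in>idx m n. gauss_density s (z k :: 'a))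
  = (%z. ennreal (((2 * pi * s) powr (- real DIM('a) / 2)) ^ (m * n) * exp (- (mat_norm m n z)\<^sup>2 / (2 * s))))"
  unfolding gauss_density_def
  by (intro ext, subst prod_ennreal)
   (auto simp: prod.distrib mat_norm_sq_prod exp_sum[symmetric] sum_negf sum_divide_distrib)
 finally show ?thesis .
qed

abbreviation eexp :: "real => ennreal" where
 "eexp r \<equiv> ennreal (exp r)"

lemma nn_integral_gauss_mat:
 fixes F :: "('a::real_complex_quat) fmat => ennreal"
 assumes [measurable]: "F \<in> borel_measurable (mat_space m n)"
 shows "(\<integral>\<^sup>+z. F z \<partial>gauss_mat m n) = ennreal (gauss_const TYPE('a) m n) *
  (\<integral>\<^sup>+z. eexp (- (mat_norm m n z)\<^sup>2 / 2) * F z \<partial>lebesgue_mat m n)"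
 unfolding gauss_mat_def PiM_gauss_density[OF zero_less_one]
 by (simp add: nn_integral_density nn_integral_cmult gauss_const_def ennreal_mult mult.assoc)

lemma gauss_const_pos: "gauss_const TYPE('a::real_complex_quat) m n > 0"
 by (simp add: gauss_const_def)

lemma nn_integral_PiM_gauss_density:
 fixes F :: "('a::real_complex_quat) fmat => ennreal"
 assumes [measurable]: "F \<in> borel_measurable (mat_space m n)" and s: "s > 0"
 shows "(\<integral>\<^sup>+z. F z \<partial>PiM (idx m n) (%_. density lborel (gauss_density s)))
  = (\<integral>\<^sup>+z. F (mat_scale m n (sqrt s) z) \<partial>gauss_mat m n)"
proof -
 define C where "C = ((2 * pi * s) powr (- real DIM('a) / 2)) ^ (m * n)"
 have "(\<integral>\<^sup>+z. F z \<partial>PiM (idx m n) (%_. density lborel (gauss_density s)))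
  = (\<integral>\<^sup>+z. ennreal (C * exp (- (mat_norm m n z)\<^sup>2 / (2 * s))) * F z \<partial>lebesgue_mat m n)"
  unfolding PiM_gauss_density[OF s] C_def by (simp add: nn_integral_density)
 also have "... = ennreal (\<Prod>k\<in>idx m n. sqrt s ^ DIM('a)) * (\<integral>\<^sup>+z.
   ennreal (C * exp (- (mat_norm m n (mat_scale m n (sqrt s) z))\<^sup>2 / (2 * s))) * F (mat_scale m n (sqrt s) z) \<partial>lebesgue_mat m n)"
 proof -
  have eq: "mat_affine m n (%_. 0) (%_. sqrt s) z = mat_scale m n (sqrt s) z" for z :: "'a fmat"
   by (simp add: mat_affine_def mat_scale_def)
  show ?thesis
   using nn_integral_lebesgue_affine[of "%z. ennreal (C * exp (- (mat_norm m n z)\<^sup>2 / (2 * s))) * F z" m n "%_. sqrt s" "%_. 0"] s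
   by (simp add: eq)
 qed
 also have "... = ennreal ((sqrt s ^ DIM('a)) ^ (m * n) * C) * (\<integral>\<^sup>+z.
   eexp (- (mat_norm m n z)\<^sup>2 / 2) * F (mat_scale m n (sqrt s) z) \<partial>lebesgue_mat m n)"
  using s by (simp add: mat_norm_scale power_mult_distrib nn_integral_cmult[symmetric] ennreal_mult C_def mult_ac)
 also have "(sqrt s ^ DIM('a)) ^ (m * n) * C = gauss_const TYPE('a) m n"
 proof -
  have "sqrt s ^ DIM('a) * (2 * pi * s) powr (- real DIM('a) / 2) = (2 * pi) powr (- real DIM('a) / 2)"
   using s by (simp add: powr_mult powr_half_sqrt[symmetric] powr_power powr_add[symmetric])
  then show ?thesis
   by (simp add: C_def gauss_const_def power_mult_distrib[symmetric])
 qed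
 finally show ?thesis
  by (simp add: nn_integral_gauss_mat)
qed

text \<open>The Cameron--Martin formula for the Gaussian matrix.\<close>

lemma nn_integral_gauss_shift:
 fixes F :: "('a::real_complex_quat) fmat => ennreal"
 assumes [measurable]: "F \<in> borel_measurable (mat_space m n)" and A [measurable]: "A \<in> mats m n"
 shows "(\<integral>\<^sup>+g. F (mat_add m n A g) \<partial>gauss_mat m n)
  = (\<integral>\<^sup>+g. eexp (mat_inner m n A g - (mat_norm m n A)\<^sup>2 / 2) * F g \<partial>gauss_mat m n)"
proof -
 define h where "h z = (mat_norm m n z)^2 - 2 * mat_inner m n A z + (mat_norm m n A)^2" for z :: "'a fmat"
 have [measurable]: "h \<in> borel_measurable (mat_space m n)"
  unfolding h_def by measurable
 have h: "h (mat_add m n A z) = (mat_norm m n z)^2" for z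
  by (simp add: h_def mat_inner_self[symmetric] mat_inner_add_left mat_inner_add_right mat_inner_commute)
 have [measurable]: "(%g. F (mat_add m n A g)) \<in> borel_measurable (mat_space m n)"
  by (rule measurable_compose[OF measurable_mat_add]) simp_all
 have "(\<integral>\<^sup>+g. eexp (mat_inner m n A g - (mat_norm m n A)\<^sup>2 / 2) * F g \<partial>gauss_mat m n)
  = ennreal (gauss_const TYPE('a) m n) * (\<integral>\<^sup>+z. eexp (- h z / 2) * F z \<partial>lebesgue_mat m n)"
  by (simp add: nn_integral_gauss_mat h_def mult.assoc[symmetric] ennreal_mult[symmetric] exp_add[symmetric]
    algebra_simps add_divide_distrib diff_divide_distrib)
 also have "(\<integral>\<^sup>+z. eexp (- h z / 2) * F z \<partial>lebesgue_mat m n)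
  = (\<integral>\<^sup>+z. eexp (- (mat_norm m n z)\<^sup>2 / 2) * F (mat_add m n A z) \<partial>lebesgue_mat m n)"
  using nn_integral_lebesgue_translate[of "%z. eexp (- h z / 2) * F z" m n A] by (simp add: h)
 finally show ?thesis by (simp add: nn_integral_gauss_mat)
qed

lemma nn_integral_gauss_scale:
 fixes F :: "('a::real_complex_quat) fmat => ennreal"
 assumes [measurable]: "F \<in> borel_measurable (mat_space m n)" and s: "!!k. k \<in> idx m n ==> s k > 0"
 shows "ennreal (\<Prod>k\<in>idx m n. s k ^ DIM('a)) * (\<integral>\<^sup>+g. F (mat_affine m n (%_. 0) s g) \<partial>gauss_mat m n)
  = (\<integral>\<^sup>+g. eexp ((\<Sum>k\<in>idx m n. (1 - 1 / (s k)^2) * (norm (g k))^2) / 2) * F g \<partial>gauss_mat m n)"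
proof -
 define h where "h z = (\<Sum>k\<in>idx m n. (norm (z k))\<^sup>2 / (s k)^2)" for z :: "'a fmat"
 have [measurable]: "(%z. z k) \<in> borel_measurable (mat_space m n)" if "k \<in> idx m n" for k
  using that measurable_mat_entry[OF measurable_ident, of "fst k" m "snd k" n] by auto
 have [measurable]: "h \<in> borel_measurable (mat_space m n)"
  unfolding h_def by measurable
 have h: "h (mat_affine m n (%_. 0) s z) = (mat_norm m n z)^2" for z
  unfolding h_def mat_norm_sq_prod
 proof (intro sum.cong refl)
  fix k assume k: "k \<in> idx m n"
  then show "(norm (mat_affine m n (%_. 0) s z k))^2 / (s k)^2 = (norm (z k))^2"
   using s[OF k] by (simp add: mat_affine_def power_mult_distrib del: mem_Sigma_iff)
 qed
 have [measurable]: "(%g. F (mat_affine m n (%_. 0) s g)) \<in> borel_measurable (mat_space m n)"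
  by (rule measurable_compose[OF measurable_mat_affine]) simp_all
 have "(\<integral>\<^sup>+g. eexp ((\<Sum>k\<in>idx m n. (1 - 1 / (s k)^2) * (norm (g k))^2) / 2) * F g \<partial>gauss_mat m n)
  = ennreal (gauss_const TYPE('a) m n) * (\<integral>\<^sup>+z. eexp (- h z / 2) * F z \<partial>lebesgue_mat m n)"
  by (simp add: nn_integral_gauss_mat h_def mult.assoc[symmetric] ennreal_mult[symmetric] exp_add[symmetric]
    left_diff_distrib sum_subtractf mat_norm_sq_prod diff_divide_distrib)
 also have "(\<integral>\<^sup>+z. eexp (- h z / 2) * F z \<partial>lebesgue_mat m n)
  = ennreal (\<Prod>k\<in>idx m n. s k ^ DIM('a)) * (\<integral>\<^sup>+z. eexp (- (mat_norm m n z)\<^sup>2 / 2) * F (mat_affine m n (%_. 0) s z) \<partial>lebesgue_mat m n)"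
  using nn_integral_lebesgue_affine[of "%z. eexp (- h z / 2) * F z" m n s "%_. 0"] s by (simp add: h)
 finally show ?thesis by (simp add: nn_integral_gauss_mat mult_ac)
qed

text \<open>A quadratic exponential is the density of a rescaled Gaussian, up to the factor on the right.\<close>

lemma nn_integral_gauss_quadratic:
 assumes "!!k. k \<in> idx m n ==> s k > 0"
 shows "(\<integral>\<^sup>+g. eexp ((\<Sum>k\<in>idx m n. (1 - 1 / (s k)^2) * (norm (g k))^2) / 2)
  \<partial>(gauss_mat m n :: ('a::real_complex_quat) fmat measure)) = ennreal (\<Prod>k\<in>idx m n. s k ^ DIM('a))"
 using nn_integral_gauss_scale[of "%_ :: 'a fmat. 1 :: ennreal" m n s] assms
  prob_space.emeasure_space_1[OF prob_space_gauss_mat[where 'a='a, of m n]]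
 by simp

section \<open>Invariance of Gaussian matrices under isometries\<close>

lemma nn_integral_gauss_fun_pos:
 "(\<integral>\<^sup>+z. eexp (- (mat_norm m n z)\<^sup>2 / 2) \<partial>(lebesgue_mat m n :: ('a::real_complex_quat) fmat measure)) ~= 0"
 "(\<integral>\<^sup>+z. eexp (- (mat_norm m n z)\<^sup>2 / 2) \<partial>(lebesgue_mat m n :: ('a::real_complex_quat) fmat measure)) ~= \<infinity>"
proof -
 have "1 = ennreal (gauss_const TYPE('a) m n) *
  (\<integral>\<^sup>+z. eexp (- (mat_norm m n z)\<^sup>2 / 2) \<partial>(lebesgue_mat m n :: 'a fmat measure))"
  using nn_integral_gauss_mat[of "%_ :: 'a fmat. 1 :: ennreal" m n]
   prob_space.emeasure_space_1[OF prob_space_gauss_mat[where 'a='a, of m n]] by simp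
 moreover have "ennreal (gauss_const TYPE('a) m n) ~= 0"
  using gauss_const_pos[where 'a='a, of m n] by simp
 ultimately show "(\<integral>\<^sup>+z. eexp (- (mat_norm m n z)\<^sup>2 / 2) \<partial>(lebesgue_mat m n :: 'a fmat measure)) ~= 0"
  "(\<integral>\<^sup>+z. eexp (- (mat_norm m n z)\<^sup>2 / 2) \<partial>(lebesgue_mat m n :: 'a fmat measure)) ~= \<infinity>"
  by (auto simp: ennreal_mult_eq_top_iff) 
qed

text \<open>A linear isometry \<open>L\<close> maps Lebesgue measure to a translation invariant measure, so to a multiple
  of Lebesgue measure; the factor is 1 because a radial Gaussian has the same integral for both.
  The proof of uniqueness is the usual one by Fubini's theorem, with the Gaussian as second function.\<close>

lemma nn_integral_lebesgue_isometry:
 fixes F :: "('a::real_complex_quat) fmat => ennreal" and L L' :: "'a fmat => 'a fmat"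
 assumes F [measurable]: "F \<in> borel_measurable (mat_space m n)"
  and L [measurable]: "L \<in> mat_space m n \<rightarrow>\<^sub>M mat_space m n"
  and add: "!!A B. A \<in> mats m n ==> B \<in> mats m n ==> L (mat_add m n A B) = mat_add m n (L A) (L B)"
  and neg: "!!A. A \<in> mats m n ==> L (mat_scale m n (-1) A) = mat_scale m n (-1) (L A)"
  and inv: "!!A. A \<in> mats m n ==> L' A \<in> mats m n" "!!A. A \<in> mats m n ==> L (L' A) = A"
  and norm: "!!A. A \<in> mats m n ==> mat_norm m n (L A) = mat_norm m n A"
 shows "(\<integral>\<^sup>+z. F (L z) \<partial>lebesgue_mat m n) = (\<integral>\<^sup>+z. F z \<partial>lebesgue_mat m n)"
proof -
 let ?\<mu> = "lebesgue_mat m n :: 'a fmat measure"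
 interpret sigma_finite_measure ?\<mu> by (rule sigma_finite_lebesgue_mat)
 interpret pair: pair_sigma_finite ?\<mu> ?\<mu> ..
 define f where "f z = eexp (- (mat_norm m n z)\<^sup>2 / 2)" for z :: "'a fmat"
 have [measurable]: "f \<in> borel_measurable (mat_space m n)" unfolding f_def by measurable
 have Lm: "L z \<in> mats m n" if "z \<in> mats m n" for z
  using measurable_space[OF L, of z] that by simp
 have fm: "f \<in> borel_measurable (mat_space m n)" by measurable
 have m2: "(%p. fst p) \<in> ?\<mu> \<Otimes>\<^sub>M ?\<mu> \<rightarrow>\<^sub>M mat_space m n" "(%p. snd p) \<in> ?\<mu> \<Otimes>\<^sub>M ?\<mu> \<rightarrow>\<^sub>M mat_space m n"
  using measurable_fst[of ?\<mu> ?\<mu>] measurable_snd[of ?\<mu> ?\<mu>] by (simp_all cong: measurable_cong_sets)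
 have m1: "(%x. x) \<in> ?\<mu> \<rightarrow>\<^sub>M mat_space m n" "(%x. x) \<in> mat_space m n \<rightarrow>\<^sub>M mat_space m n"
  by (rule measurable_ident_sets, simp)+
 note meas = borel_measurable_times_ennreal measurable_compose[OF _ F] measurable_compose[OF _ fm]
  measurable_compose[OF _ L] measurable_mat_add measurable_mat_scale m1 m2 measurable_const_mat measurable_const
 let ?If = "\<integral>\<^sup>+z. f z \<partial>?\<mu>"
 have "?If * (\<integral>\<^sup>+z. F (L z) \<partial>?\<mu>) = (\<integral>\<^sup>+x. \<integral>\<^sup>+y. f x * F (mat_add m n x (L y)) \<partial>?\<mu> \<partial>?\<mu>)"
 proof -
  have "(\<integral>\<^sup>+y. f x * F (mat_add m n x (L y)) \<partial>?\<mu>) = f x * (\<integral>\<^sup>+z. F (L z) \<partial>?\<mu>)" if x: "x \<in> mats m n" for x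
  proof -
   have "(\<integral>\<^sup>+y. F (L y) \<partial>?\<mu>) = (\<integral>\<^sup>+y. F (L (mat_add m n (L' x) y)) \<partial>?\<mu>)"
    by (rule nn_integral_lebesgue_translate[symmetric]) (intro meas)
   also have "... = (\<integral>\<^sup>+y. F (mat_add m n x (L y)) \<partial>?\<mu>)"
    by (intro nn_integral_cong) (simp add: add inv x)
   finally show ?thesis
    using x by (subst nn_integral_cmult) (auto intro!: meas)
  qed
  then show ?thesis
   by (subst nn_integral_multc[symmetric]) (auto intro!: nn_integral_cong meas)
 qed
 also have "... = (\<integral>\<^sup>+y. \<integral>\<^sup>+x. f x * F (mat_add m n x (L y)) \<partial>?\<mu> \<partial>?\<mu>)"
  by (rule pair.Fubini'[symmetric]) (simp only: case_prod_beta', intro meas)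
 also have "... = (\<integral>\<^sup>+y. \<integral>\<^sup>+x. f (mat_add m n (mat_scale m n (-1) (L y)) x) * F x \<partial>?\<mu> \<partial>?\<mu>)"
 proof (rule nn_integral_cong)
  fix y assume "y \<in> space ?\<mu>"
  then have y: "L y \<in> mats m n" by (simp add: Lm)
  have "(\<integral>\<^sup>+x. f x * F (mat_add m n x (L y)) \<partial>?\<mu>)
   = (\<integral>\<^sup>+x. f (mat_add m n (mat_scale m n (-1) (L y)) x) *
     F (mat_add m n (mat_add m n (mat_scale m n (-1) (L y)) x) (L y)) \<partial>?\<mu>)"
   by (rule nn_integral_lebesgue_translate[symmetric]) (use y in \<open>intro meas\<close>)
  also have "... = (\<integral>\<^sup>+x. f (mat_add m n (mat_scale m n (-1) (L y)) x) * F x \<partial>?\<mu>)"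
  proof (intro nn_integral_cong)
   fix x assume "x \<in> space ?\<mu>"
   then have "mat_add m n (mat_add m n (mat_scale m n (-1) (L y)) x) (L y) = x"
    by (intro mat_eqI[of _ m n]) auto
   then show "f (mat_add m n (mat_scale m n (-1) (L y)) x) *
     F (mat_add m n (mat_add m n (mat_scale m n (-1) (L y)) x) (L y))
    = f (mat_add m n (mat_scale m n (-1) (L y)) x) * F x" by simp
  qed
  finally show "(\<integral>\<^sup>+x. f x * F (mat_add m n x (L y)) \<partial>?\<mu>)
   = (\<integral>\<^sup>+x. f (mat_add m n (mat_scale m n (-1) (L y)) x) * F x \<partial>?\<mu>)" .
 qed
 also have "... = (\<integral>\<^sup>+x. \<integral>\<^sup>+y. f (mat_add m n (mat_scale m n (-1) (L y)) x) * F x \<partial>?\<mu> \<partial>?\<mu>)"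
  by (rule pair.Fubini') (simp only: case_prod_beta', intro meas)
 also have "... = (\<integral>\<^sup>+x. ?If * F x \<partial>?\<mu>)"
 proof (intro nn_integral_cong)
  fix x assume "x \<in> space ?\<mu>"
  then have x: "x \<in> mats m n" by simp
  have "(\<integral>\<^sup>+y. f (mat_add m n (mat_scale m n (-1) (L y)) x) \<partial>?\<mu>)
   = (\<integral>\<^sup>+y. f (mat_add m n (mat_scale m n (-1) (L' x)) y) \<partial>?\<mu>)"
  proof (intro nn_integral_cong)
   fix y assume "y \<in> space ?\<mu>"
   then have y: "y \<in> mats m n" by simp
   have "mat_norm m n (mat_add m n (mat_scale m n (-1) (L y)) x)
    = mat_norm m n (L (mat_add m n (mat_scale m n (-1) y) (L' x)))"
    using x y by (simp add: add neg inv)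
   also have "... = mat_norm m n (mat_add m n (mat_scale m n (-1) y) (L' x))"
    by (simp add: norm)
   also have "... = mat_norm m n (mat_scale m n (-1) (mat_add m n (mat_scale m n (-1) (L' x)) y))"
    by (intro arg_cong[of _ _ "mat_norm m n"] mat_eqI[of _ m n]) (auto simp: algebra_simps)
   also have "... = mat_norm m n (mat_add m n (mat_scale m n (-1) (L' x)) y)"
    by (simp add: mat_norm_scale)
   finally show "f (mat_add m n (mat_scale m n (-1) (L y)) x) = f (mat_add m n (mat_scale m n (-1) (L' x)) y)"
    by (simp add: f_def)
  qed
  also have "... = ?If"
   by (rule nn_integral_lebesgue_translate) (intro meas)
  finally show "(\<integral>\<^sup>+y. f (mat_add m n (mat_scale m n (-1) (L y)) x) * F x \<partial>?\<mu>) = ?If * F x"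
   using x by (subst nn_integral_multc) (auto intro!: meas)
 qed
 also have "... = ?If * (\<integral>\<^sup>+x. F x \<partial>?\<mu>)"
  by (rule nn_integral_cmult) (intro meas)
 finally show ?thesis
  using nn_integral_gauss_fun_pos[where 'a='a, of m n] unfolding f_def
  by (simp add: ennreal_mult_cancel_left)
qed

lemma nn_integral_gauss_unitary_left:
 fixes F :: "('a::real_complex_quat) fmat => ennreal"
 assumes F [measurable]: "F \<in> borel_measurable (mat_space m n)" and U: "U \<in> \<U> m"
 shows "(\<integral>\<^sup>+g. F (mat_mult m m n U g) \<partial>gauss_mat m n) = (\<integral>\<^sup>+g. F g \<partial>gauss_mat m n)"
proof -
 define G where "G g = eexp (- (mat_norm m n g)\<^sup>2 / 2) * F g" for g
 have L [measurable]: "mat_mult m m n U \<in> mat_space m n \<rightarrow>\<^sub>M mat_space m n"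
  using U by (intro measurable_mat_mult measurable_const_mat) (auto simp: unitaryD)
 have [measurable]: "(%g. F (mat_mult m m n U g)) \<in> borel_measurable (mat_space m n)"
  by (rule measurable_compose[OF L F])
 have "(\<integral>\<^sup>+z. G (mat_mult m m n U z) \<partial>lebesgue_mat m n) = (\<integral>\<^sup>+z. G z \<partial>lebesgue_mat m n)"
  using U by (intro nn_integral_lebesgue_isometry[where L' = "mat_mult m m n (mat_adj m m U)"])
   (auto simp: G_def mat_mult_add_right unitary_cancel mat_norm_unitary_left unitaryD
    intro!: mat_eqI[of _ m n] simp: sum_negf)
 moreover have "(\<integral>\<^sup>+z. G (mat_mult m m n U z) \<partial>lebesgue_mat m n)
   = (\<integral>\<^sup>+z. eexp (- (mat_norm m n z)\<^sup>2 / 2) * F (mat_mult m m n U z) \<partial>lebesgue_mat m n)"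
  by (intro nn_integral_cong) (use U in \<open>simp add: G_def mat_norm_unitary_left\<close>)
 ultimately show ?thesis
  by (simp add: nn_integral_gauss_mat G_def)
qed

lemma nn_integral_gauss_unitary_right:
 fixes F :: "('a::real_complex_quat) fmat => ennreal"
 assumes F [measurable]: "F \<in> borel_measurable (mat_space m n)" and V: "V \<in> \<U> n"
 shows "(\<integral>\<^sup>+g. F (mat_mult m n n g V) \<partial>gauss_mat m n) = (\<integral>\<^sup>+g. F g \<partial>gauss_mat m n)"
proof -
 define G where "G g = eexp (- (mat_norm m n g)\<^sup>2 / 2) * F g" for g
 have L [measurable]: "(%g. mat_mult m n n g V) \<in> mat_space m n \<rightarrow>\<^sub>M mat_space m n"
  using V by (intro measurable_mat_mult measurable_const_mat) (auto simp: unitaryD)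
 have [measurable]: "(%g. F (mat_mult m n n g V)) \<in> borel_measurable (mat_space m n)"
  by (rule measurable_compose[OF L F])
 have "(\<integral>\<^sup>+z. G (mat_mult m n n z V) \<partial>lebesgue_mat m n) = (\<integral>\<^sup>+z. G z \<partial>lebesgue_mat m n)"
  using V by (intro nn_integral_lebesgue_isometry[where L' = "%z. mat_mult m n n z (mat_adj n n V)"])
   (auto simp: G_def mat_mult_add_left unitary_cancel_right mat_norm_unitary_right unitaryD
    intro!: mat_eqI[of _ m n] simp: sum_negf)
 moreover have "(\<integral>\<^sup>+z. G (mat_mult m n n z V) \<partial>lebesgue_mat m n)
   = (\<integral>\<^sup>+z. eexp (- (mat_norm m n z)\<^sup>2 / 2) * F (mat_mult m n n z V) \<partial>lebesgue_mat m n)"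
  by (intro nn_integral_cong) (use V in \<open>simp add: G_def mat_norm_unitary_right\<close>)
 ultimately show ?thesis
  by (simp add: nn_integral_gauss_mat G_def)
qed

section \<open>Haar measure\<close>

lemma haar_space: "normalized_haar n \<mu> ==> space (\<mu> :: ('a::real_complex_quat) fmat measure) = \<U> n"
proof -
 assume "normalized_haar n \<mu>"
 then have "space \<mu> = space (restrict_space (mat_space n n) (\<U> n))"
  by (intro sets_eq_imp_space_eq) (simp add: normalized_haar_def)
 also have "... = \<U> n"
  by (auto simp: space_restrict_space unitary_group_def)
 finally show ?thesis .
qed

lemma haar_prob: "normalized_haar n \<mu> ==> prob_space \<mu>"
 by (simp add: normalized_haar_def)

lemma measurable_haar_ident:
 assumes "normalized_haar n (\<mu> :: ('a::real_complex_quat) fmat measure)"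
 shows "(%U. U) \<in> \<mu> \<rightarrow>\<^sub>M mat_space n n"
proof -
 have "(%U. U) \<in> restrict_space (mat_space n n) (\<U> n) \<rightarrow>\<^sub>M mat_space n n"
  by (intro measurable_restrict_space1 measurable_ident_sets refl)
 then show ?thesis
  using assms unfolding normalized_haar_def by (metis measurable_cong_sets)
qed

lemma measurable_into_haar:
 assumes \<mu>: "normalized_haar n (\<mu> :: ('a::real_complex_quat) fmat measure)"
  and f: "f \<in> M \<rightarrow>\<^sub>M mat_space n n" "!!x. x \<in> space M ==> f x \<in> \<U> n"
 shows "f \<in> M \<rightarrow>\<^sub>M \<mu>"
proof -
 have "f \<in> M \<rightarrow>\<^sub>M restrict_space (mat_space n n) (\<U> n)"
  using f by (intro measurable_restrict_space2) auto
 then show ?thesis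
  using \<mu> unfolding normalized_haar_def by (metis measurable_cong_sets)
qed

lemma haar_left:
 assumes \<mu>: "normalized_haar n (\<mu> :: ('a::real_complex_quat) fmat measure)"
  and F [measurable]: "F \<in> borel_measurable \<mu>" and U: "U \<in> \<U> n"
 shows "(\<integral>\<^sup>+X. F (mat_mult n n n U X) \<partial>\<mu>) = (\<integral>\<^sup>+X. F X \<partial>\<mu>)"
proof -
 have [measurable]: "mat_mult n n n U \<in> \<mu> \<rightarrow>\<^sub>M \<mu>"
  using U measurable_haar_ident[OF \<mu>] haar_space[OF \<mu>]
  by (intro measurable_into_haar[OF \<mu>] measurable_mat_mult measurable_const_mat) (auto simp: unitaryD unitary_mult)
 have "distr \<mu> \<mu> (mat_mult n n n U) = \<mu>"
  using \<mu> U by (simp add: normalized_haar_def)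
 then have "(\<integral>\<^sup>+X. F X \<partial>\<mu>) = (\<integral>\<^sup>+X. F X \<partial>distr \<mu> \<mu> (mat_mult n n n U))"
  by simp
 then show ?thesis by (simp add: nn_integral_distr)
qed

text \<open>A left-invariant probability measure on a compact group is also invariant under inversion, by Fubini for the product of two copies.\<close>

lemma haar_inverse:
 assumes \<mu>: "normalized_haar n (\<mu> :: ('a::real_complex_quat) fmat measure)"
  and F [measurable]: "F \<in> borel_measurable \<mu>"
 shows "(\<integral>\<^sup>+X. F (mat_adj n n X) \<partial>\<mu>) = (\<integral>\<^sup>+X. F X \<partial>\<mu>)"
proof -
 interpret prob_space \<mu> by (rule haar_prob[OF \<mu>])
 interpret pair: pair_sigma_finite \<mu> \<mu> ..
 note [measurable] = measurable_haar_ident[OF \<mu>]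
 have adj [measurable]: "mat_adj n n \<in> \<mu> \<rightarrow>\<^sub>M \<mu>"
  using measurable_haar_ident[OF \<mu>] haar_space[OF \<mu>]
  by (intro measurable_into_haar[OF \<mu>] measurable_mat_adj) (auto simp: unitary_adj)
 have Fadj: "(%X. F (mat_adj n n X)) \<in> borel_measurable \<mu>"
  by (rule measurable_compose[OF adj F])
 have quot [measurable]: "(%p. mat_mult n n n (mat_adj n n (fst p)) (snd p)) \<in> \<mu> \<Otimes>\<^sub>M \<mu> \<rightarrow>\<^sub>M \<mu>"
  by (intro measurable_into_haar[OF \<mu>] measurable_mat_mult measurable_mat_adj
    measurable_compose[OF measurable_fst measurable_haar_ident[OF \<mu>]]
    measurable_compose[OF measurable_snd measurable_haar_ident[OF \<mu>]])
   (simp add: space_pair_measure haar_space[OF \<mu>] mem_Times_iff unitary_adj unitary_mult)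
 have "(\<integral>\<^sup>+X. F X \<partial>\<mu>) = (\<integral>\<^sup>+V. \<integral>\<^sup>+U. F (mat_mult n n n (mat_adj n n V) U) \<partial>\<mu> \<partial>\<mu>)"
 proof -
  have "(\<integral>\<^sup>+V. \<integral>\<^sup>+U. F (mat_mult n n n (mat_adj n n V) U) \<partial>\<mu> \<partial>\<mu>) = (\<integral>\<^sup>+V. (\<integral>\<^sup>+X. F X \<partial>\<mu>) \<partial>\<mu>)"
   by (intro nn_integral_cong haar_left[OF \<mu> F]) (simp add: haar_space[OF \<mu>] unitary_adj)
  then show ?thesis by (simp add: emeasure_space_1)
 qed
 also have "... = (\<integral>\<^sup>+U. \<integral>\<^sup>+V. F (mat_mult n n n (mat_adj n n V) U) \<partial>\<mu> \<partial>\<mu>)"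
  using measurable_compose[OF quot F] by (intro pair.Fubini'[symmetric]) (simp add: case_prod_beta')
 also have "... = (\<integral>\<^sup>+U. \<integral>\<^sup>+V. F (mat_adj n n (mat_mult n n n (mat_adj n n U) V)) \<partial>\<mu> \<partial>\<mu>)"
  using haar_space[OF \<mu>] by (intro nn_integral_cong) (simp add: mat_adj_mult mat_adj_adj unitaryD)
 also have "... = (\<integral>\<^sup>+X. F (mat_adj n n X) \<partial>\<mu>)"
 proof -
  have "(\<integral>\<^sup>+U. \<integral>\<^sup>+V. F (mat_adj n n (mat_mult n n n (mat_adj n n U) V)) \<partial>\<mu> \<partial>\<mu>)
    = (\<integral>\<^sup>+U. (\<integral>\<^sup>+X. F (mat_adj n n X) \<partial>\<mu>) \<partial>\<mu>)"
   by (intro nn_integral_cong haar_left[OF \<mu> Fadj]) (simp add: haar_space[OF \<mu>] unitary_adj)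
  then show ?thesis by (simp add: emeasure_space_1)
 qed
 finally show ?thesis ..
qed

lemma haar_right:
 assumes \<mu>: "normalized_haar n (\<mu> :: ('a::real_complex_quat) fmat measure)"
  and F [measurable]: "F \<in> borel_measurable \<mu>" and U: "U \<in> \<U> n"
 shows "(\<integral>\<^sup>+X. F (mat_mult n n n X U) \<partial>\<mu>) = (\<integral>\<^sup>+X. F X \<partial>\<mu>)"
proof -
 have adj: "mat_adj n n \<in> \<mu> \<rightarrow>\<^sub>M \<mu>"
  using measurable_haar_ident[OF \<mu>] haar_space[OF \<mu>]
  by (intro measurable_into_haar[OF \<mu>] measurable_mat_adj) (auto simp: unitary_adj)
 have mul: "(%X. mat_mult n n n (mat_adj n n U) X) \<in> \<mu> \<rightarrow>\<^sub>M \<mu>"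
  using U measurable_haar_ident[OF \<mu>] haar_space[OF \<mu>]
  by (intro measurable_into_haar[OF \<mu>] measurable_mat_mult measurable_const_mat) (auto simp: unitary_adj unitary_mult)
 have Fadj: "(%X. F (mat_adj n n X)) \<in> borel_measurable \<mu>"
  by (rule measurable_compose[OF adj F])
 have "(\<integral>\<^sup>+X. F (mat_mult n n n X U) \<partial>\<mu>) = (\<integral>\<^sup>+X. F (mat_adj n n (mat_mult n n n (mat_adj n n U) (mat_adj n n X))) \<partial>\<mu>)"
  using haar_space[OF \<mu>] U by (intro nn_integral_cong) (simp add: mat_adj_mult mat_adj_adj unitaryD)
 also have "... = (\<integral>\<^sup>+X. F (mat_adj n n (mat_mult n n n (mat_adj n n U) X)) \<partial>\<mu>)"
  by (rule haar_inverse[OF \<mu> measurable_compose[OF mul Fadj]])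
 also have "... = (\<integral>\<^sup>+X. F (mat_adj n n X) \<partial>\<mu>)"
  by (rule haar_left[OF \<mu> Fadj unitary_adj[OF U]])
 also have "... = (\<integral>\<^sup>+X. F X \<partial>\<mu>)"
  by (rule haar_inverse[OF \<mu> F])
 finally show ?thesis .
qed

text \<open>Gaussian matrices are invariant under the left action, so averaging over the unitary group changes nothing. This is how the
  Haar integrals of the Bessel functions enter a Gaussian integral.\<close>

lemma gauss_left_average:
 fixes F :: "('a::real_complex_quat) fmat => ennreal"
 assumes \<mu>: "normalized_haar m \<mu>" and F: "F \<in> borel_measurable (mat_space m n)"
 shows "(\<integral>\<^sup>+g. F g \<partial>gauss_mat m n) = (\<integral>\<^sup>+g. \<integral>\<^sup>+U. F (mat_mult m m n U g) \<partial>\<mu> \<partial>gauss_mat m n)"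
proof -
 interpret \<mu>: prob_space \<mu> by (rule haar_prob[OF \<mu>])
 interpret G: prob_space "gauss_mat m n :: 'a fmat measure" by (rule prob_space_gauss_mat)
 interpret pair: pair_sigma_finite \<mu> "gauss_mat m n :: 'a fmat measure" ..
 have "(%p. mat_mult m m n (fst p) (snd p)) \<in> \<mu> \<Otimes>\<^sub>M gauss_mat m n \<rightarrow>\<^sub>M mat_space m n"
  by (intro measurable_mat_mult measurable_compose[OF measurable_fst measurable_haar_ident[OF \<mu>]])
   (use measurable_snd[of \<mu> "gauss_mat m n"] in \<open>simp cong: measurable_cong_sets\<close>)
 from measurable_compose[OF this F]
 have "(\<integral>\<^sup>+g. \<integral>\<^sup>+U. F (mat_mult m m n U g) \<partial>\<mu> \<partial>gauss_mat m n)
  = (\<integral>\<^sup>+U. \<integral>\<^sup>+g. F (mat_mult m m n U g) \<partial>gauss_mat m n \<partial>\<mu>)"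
  by (intro pair.Fubini') (simp add: case_prod_beta')
 also have "... = (\<integral>\<^sup>+g. F g \<partial>gauss_mat m n)"
 proof -
  have "(\<integral>\<^sup>+U. \<integral>\<^sup>+g. F (mat_mult m m n U g) \<partial>gauss_mat m n \<partial>\<mu>)
    = (\<integral>\<^sup>+U. (\<integral>\<^sup>+g. F g \<partial>gauss_mat m n) \<partial>\<mu>)"
   by (intro nn_integral_cong nn_integral_gauss_unitary_left[OF F]) (simp add: haar_space[OF \<mu>])
  then show ?thesis by (simp add: \<mu>.emeasure_space_1)
 qed
 finally show ?thesis ..
qed

section \<open>Averages over the unitary group\<close>

abbreviation mat_minus :: "nat => nat => ('a::real_complex_quat) fmat => 'a fmat => 'a fmat" where
 "mat_minus m n A B \<equiv> mat_add m n A (mat_scale m n (-1) B)"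

text \<open>Compactness; the size of the net does not depend on \<open>m\<close>, so it disappears on the exponential scale.\<close>

lemma unitary_net:
 assumes "e > 0"
 obtains \<V> :: "('a::real_complex_quat) fmat set" where "finite \<V>" "\<V> \<subseteq> \<U> n" "\<V> ~= {}"
  "!!V. V \<in> \<U> n ==> \<exists>V'\<in>\<V>. mat_norm n n (mat_minus n n V V') <= e"
proof -
 define S where "S V' = {V :: 'a fmat. mat_norm n n (mat_minus n n V V') < e}" for V'
 have "open (S V')" for V'
 proof -
  have "continuous_on UNIV (%V :: 'a fmat. \<Sum>i<n. \<Sum>j<n. (norm (V (i, j) - V' (i, j)))\<^sup>2)"
   by (intro continuous_on_sum continuous_on_power continuous_on_norm continuous_on_diff
     continuous_on_const continuous_on_product_coordinates)
  then have "open {V :: 'a fmat. (\<Sum>i<n. \<Sum>j<n. (norm (V (i, j) - V' (i, j)))\<^sup>2) < e\<^sup>2}"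
   by (intro open_Collect_less continuous_on_const)
  moreover have "(mat_norm n n (mat_minus n n V V') < e) \<longleftrightarrow> (\<Sum>i<n. \<Sum>j<n. (norm (V (i, j) - V' (i, j)))\<^sup>2) < e\<^sup>2" for V
  proof -
   have "(mat_norm n n (mat_minus n n V V'))^2 = (\<Sum>i<n. \<Sum>j<n. (norm (V (i, j) - V' (i, j)))\<^sup>2)"
    by (simp add: mat_norm_sq)
   then show ?thesis
    using power_mono_iff[of e "mat_norm n n (mat_minus n n V V')" 2] assms by (auto simp del: power_mono_iff)
  qed
  ultimately show ?thesis by (simp add: S_def)
 qed
 moreover have "\<U> n \<subseteq> (\<Union>V'\<in>\<U> n. S V')"
 proof
  fix V :: "'a fmat" assume V: "V \<in> \<U> n"
  have "(mat_norm n n (mat_minus n n V V))^2 = 0" by (simp add: mat_norm_sq)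
  then have "V \<in> S V" using assms by (simp add: S_def)
  then show "V \<in> (\<Union>V'\<in>\<U> n. S V')" using V by blast
 qed
 ultimately obtain C where C: "C \<subseteq> \<U> n" "finite C" "\<U> n \<subseteq> (\<Union>V'\<in>C. S V')"
  by (rule compactE_image[OF compact_unitary_group])
 show ?thesis
 proof (rule that[of C])
  show "C ~= {}"
  proof
   assume "C = {}"
   then have "\<U> n \<subseteq> ({} :: 'a fmat set)" using C(3) by simp
   then show False using unitary_one by blast
  qed
  fix V :: "'a fmat" assume "V \<in> \<U> n"
  then have "V \<in> (\<Union>V'\<in>C. S V')" using C(3) by (rule subsetD[rotated])
  then obtain V' where "V' \<in> C" "V \<in> S V'" by (rule UN_E)
  then show "\<exists>V'\<in>C. mat_norm n n (mat_minus n n V V') <= e"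
   unfolding S_def by (intro bexI[of _ V']) simp_all
 qed (use C in auto)
qed

abbreviation iso_mat :: "nat => nat => ('a::real_complex_quat) fmat" where
 "iso_mat m n \<equiv> sigma_mat m n (%_. 1)"

definition block_embed :: "nat => nat => ('a::real_complex_quat) fmat => 'a fmat" where
 "block_embed m n V = (\<lambda>(i, j)\<in>{..<m} \<times> {..<m}. if i < n & j < n then V (i, j) else if i = j then 1 else 0)"

lemma block_embed_mats [simp]: "block_embed m n V \<in> mats m m"
 by (auto simp: block_embed_def mats_def)

lemma block_embed_mult:
 assumes "n <= m"
 shows "mat_mult m m m (block_embed m n A) (block_embed m n B) = block_embed m n (mat_mult n n n A B)"
proof (rule mat_eqI[of _ m m])
 fix i j assume ij: "i < m" "j < m"
 show "mat_mult m m m (block_embed m n A) (block_embed m n B) (i, j) = block_embed m n (mat_mult n n n A B) (i, j)"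
 proof (cases "i < n")
  case True
  have "mat_mult m m m (block_embed m n A) (block_embed m n B) (i, j)
   = (\<Sum>l<m. if l < n then A (i, l) * (if j < n then B (l, j) else 0) else 0)"
   unfolding mat_mult_entry[OF ij]
   by (intro sum.cong refl) (use ij True assms in \<open>auto simp: block_embed_def\<close>)
  also have "... = (\<Sum>l<n. A (i, l) * (if j < n then B (l, j) else 0))"
   using assms by (intro sum.mono_neutral_cong_right) auto
  finally show ?thesis
   using True ij by (auto simp: block_embed_def)
 next
  case False
  have "mat_mult m m m (block_embed m n A) (block_embed m n B) (i, j)
   = (\<Sum>l<m. if l = i then (if i = j then 1 else 0) else 0)"
   unfolding mat_mult_entry[OF ij]
   by (intro sum.cong refl) (use ij False assms in \<open>auto simp: block_embed_def\<close>)
  then show ?thesis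
   using False ij by (auto simp: block_embed_def)
 qed
qed auto

lemma block_embed_adj: "n <= m ==> mat_adj m m (block_embed m n V) = block_embed m n (mat_adj n n V)"
 by (rule mat_eqI[OF mat_adj_mats block_embed_mats]) (auto simp: block_embed_def)

lemma block_embed_one: "block_embed m n (mat_one n) = mat_one m"
 by (rule mat_eqI[OF block_embed_mats mat_one_mats]) (auto simp: block_embed_def)

lemma unitary_block_embed:
 "n <= m ==> V \<in> \<U> n ==> block_embed m n V \<in> \<U> m"
 unfolding unitary_group_def
 by (simp add: block_embed_adj block_embed_mult) (simp add: block_embed_one)

lemma block_embed_iso:
 assumes "n <= m"
 shows "mat_mult m m n (block_embed m n V) (iso_mat m n) = mat_mult m n n (iso_mat m n) V"
proof (rule mat_eqI[of _ m n])
 fix i j assume ij: "i < m" "j < n"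
 have "mat_mult m m n (block_embed m n V) (iso_mat m n) (i, j)
  = (\<Sum>l<m. if l = j then (if i < n then V (i, j) else 0) else 0)"
  unfolding mat_mult_entry[OF ij]
  by (intro sum.cong refl) (use ij assms in \<open>auto simp: block_embed_def\<close>)
 moreover have "mat_mult m n n (iso_mat m n) V (i, j)
  = (\<Sum>l<n. if l = i then V (i, j) else 0)"
  unfolding mat_mult_entry[OF ij]
  by (intro sum.cong refl) (use ij assms in auto)
 ultimately show "mat_mult m m n (block_embed m n V) (iso_mat m n) (i, j) = mat_mult m n n (iso_mat m n) V (i, j)"
  using ij assms by simp
qed auto

lemma iso_mult_sigma:
 assumes "n <= m"
 shows "mat_mult m n n (iso_mat m n) (sigma_mat n n d) = sigma_mat m n d"
proof (rule mat_eqI[of _ m n])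
 fix i j assume ij: "i < m" "j < n"
 have "mat_mult m n n (iso_mat m n) (sigma_mat n n d) (i, j)
  = (\<Sum>l<n. if l = i then (if i = j then of_real (d i) else 0) else 0)"
  unfolding mat_mult_entry[OF ij]
  by (intro sum.cong refl) (use ij in auto)
 then show "mat_mult m n n (iso_mat m n) (sigma_mat n n d) (i, j) = sigma_mat m n d (i, j)"
  using ij by auto
qed auto

lemma corner_eq:
 assumes "n <= m" "U \<in> mats m m"
 shows "corner n U = mat_mult n m n (mat_adj m n (iso_mat m n)) (mat_mult m m n U (iso_mat m n))"
proof (rule mat_eqI[of _ n n])
 fix i j assume ij: "i < n" "j < n"
 have 1: "mat_mult m m n U (iso_mat m n) (l, j) = U (l, j)" if "l < m" for l
 proof -
  have "mat_mult m m n U (iso_mat m n) (l, j) = (\<Sum>p<m. if p = j then U (l, j) else 0)"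
   unfolding mat_mult_entry[OF that ij(2)] by (intro sum.cong refl) (use ij in auto)
  then show ?thesis using ij assms by simp
 qed
 have "mat_mult n m n (mat_adj m n (iso_mat m n)) (mat_mult m m n U (iso_mat m n)) (i, j)
  = (\<Sum>l<m. if l = i then U (i, j) else 0)"
  unfolding mat_mult_entry[OF ij]
  by (intro sum.cong refl) (use ij 1 in \<open>auto simp del: mat_mult_entry\<close>)
 then show "corner n U (i, j) = mat_mult n m n (mat_adj m n (iso_mat m n)) (mat_mult m m n U (iso_mat m n)) (i, j)"
  using ij assms by (simp add: corner_def)
qed auto

lemma inner_corner:
 assumes "n <= m" "U \<in> \<U> m" "P \<in> \<U> n" "Q \<in> \<U> n"
 shows "mat_inner n n (sigma_mat n n d) (mat_mult n n n (mat_mult n n n P (corner n U)) Q)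
  = mat_inner m n (sigma_mat m n d)
    (mat_mult m m n (mat_mult m m m (mat_mult m m m (block_embed m n P) U) (block_embed m n Q)) (iso_mat m n))"
  (is "_ = mat_inner m n _ ?X")
proof -
 have 1: "mat_mult n m m (mat_adj m n (iso_mat m n)) (block_embed m n P)
  = mat_mult n n m P (mat_adj m n (iso_mat m n))"
 proof -
  have "mat_mult n m m (mat_adj m n (iso_mat m n)) (block_embed m n P)
   = mat_adj m n (mat_mult m m n (block_embed m n (mat_adj n n P)) (iso_mat m n))"
   using assms by (simp add: mat_adj_mult block_embed_adj mat_adj_adj unitaryD)
  also have "... = mat_mult n n m P (mat_adj m n (iso_mat m n))"
   using assms by (simp add: block_embed_iso mat_adj_mult mat_adj_adj unitaryD)
  finally show ?thesis .
 qed
 have "mat_inner m n (sigma_mat m n d) ?X = mat_inner n n (sigma_mat n n d) (mat_mult n m n (mat_adj m n (iso_mat m n)) ?X)"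
  using mat_inner_adjoint_left[of m n n "iso_mat m n" "sigma_mat n n d" ?X] assms(1) by (simp add: iso_mult_sigma)
 also have "mat_mult n m n (mat_adj m n (iso_mat m n)) ?X
  = mat_mult n m n (mat_mult n m m (mat_adj m n (iso_mat m n)) (block_embed m n P))
    (mat_mult m m n U (mat_mult m m n (block_embed m n Q) (iso_mat m n)))"
  by (simp add: mat_mult_assoc)
 also have "... = mat_mult n n n (mat_mult n n n P (corner n U)) Q"
  using assms unfolding 1 by (simp add: corner_eq unitaryD block_embed_iso mat_mult_assoc)
 finally show ?thesis ..
qed

abbreviation kexp where
 "kexp m n k d U z \<equiv> k * mat_inner m n (sigma_mat m n d :: ('a::real_complex_quat) fmat) (mat_mult m m n U z)"

text \<open>The average of an exponential over the Stiefel manifold, with the diagonal matrix \<open>d\<close> as its argument. All other orbit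
  averages are compared with it.\<close>

definition haar_K :: "('a::real_complex_quat) fmat measure => nat => nat => real => (nat => real) => ennreal" where
 "haar_K \<mu> m n k d = (\<integral>\<^sup>+U. eexp (kexp m n k d U (iso_mat m n)) \<partial>\<mu>)"

lemma measurable_haar_exp:
 assumes \<mu>: "normalized_haar m (\<mu> :: ('a::real_complex_quat) fmat measure)" and "A \<in> mats m n" "B \<in> mats m n"
 shows "(%U. eexp (k * mat_inner m n B (mat_mult m m n U A))) \<in> borel_measurable \<mu>"
proof -
 note [measurable] = measurable_haar_ident[OF \<mu>]
 have [measurable]: "A \<in> mats m n" "B \<in> mats m n" by fact+
 show ?thesis by measurable
qed

lemma haar_exp_two_sided:
 assumes \<mu>: "normalized_haar m (\<mu> :: ('a::real_complex_quat) fmat measure)"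
  and AB: "A \<in> mats m n" "B \<in> mats m n" and U: "U1 \<in> \<U> m" "U2 \<in> \<U> m"
 shows "(\<integral>\<^sup>+U. eexp (k * mat_inner m n B (mat_mult m m n (mat_mult m m m (mat_mult m m m U1 U) U2) A)) \<partial>\<mu>)
  = (\<integral>\<^sup>+U. eexp (k * mat_inner m n B (mat_mult m m n U A)) \<partial>\<mu>)"
proof -
 let ?F = "%U. eexp (k * mat_inner m n B (mat_mult m m n U A))"
 have F: "?F \<in> borel_measurable \<mu>" by (rule measurable_haar_exp[OF \<mu> AB])
 have mul: "(%X. mat_mult m m m X U2) \<in> \<mu> \<rightarrow>\<^sub>M \<mu>"
  using U measurable_haar_ident[OF \<mu>] haar_space[OF \<mu>]
  by (intro measurable_into_haar[OF \<mu>] measurable_mat_mult measurable_const_mat) (auto simp: unitaryD unitary_mult)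
 have "(\<integral>\<^sup>+U. ?F (mat_mult m m m (mat_mult m m m U1 U) U2) \<partial>\<mu>) = (\<integral>\<^sup>+U. ?F (mat_mult m m m U U2) \<partial>\<mu>)"
  by (rule haar_left[OF \<mu> measurable_compose[OF mul F] U(1)])
 also have "... = (\<integral>\<^sup>+U. ?F U \<partial>\<mu>)"
  by (rule haar_right[OF \<mu> F U(2)])
 finally show ?thesis .
qed

lemma corner_norm:
 assumes "n <= m" "U \<in> \<U> m"
 shows "mat_norm n n (corner n U) <= sqrt (real n)"
proof -
 have "(mat_norm n n (corner n U))^2 = (\<Sum>i<n. \<Sum>j<n. (norm (U (i, j)))\<^sup>2)"
  by (simp add: mat_norm_sq corner_def)
 also have "... = (\<Sum>j<n. \<Sum>i<n. (norm (U (i, j)))\<^sup>2)" by (rule sum.swap)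
 also have "... <= (\<Sum>j<n. \<Sum>i<m. (norm (U (i, j)))\<^sup>2)"
  using assms(1) by (intro sum_mono sum_mono2) auto
 also have "... = real n"
  using unitary_column_norm[OF assms(2)] assms(1) by simp
 finally show ?thesis by (simp add: real_le_rsqrt)
qed

lemma mat_minus_split:
 assumes "A \<in> mats m n" shows "A = mat_add m n B (mat_minus m n A B)"
 by (rule mat_eqI[OF assms]) auto

text \<open>The trace inequality bounds the exponent by \<open>Re tr (P D Q C)\<close>, where \<open>C\<close> is the upper corner of \<open>U\<close> and \<open>P, Q\<close> are the unitary
  matrices which make its singular values appear. They depend on \<open>U\<close>, but only through a compact group whose dimension does
  not grow with \<open>m\<close>. So a finite net can replace them, at the price of a constant factor and of an arbitrarily small exponent, and
  each term of the sum is \<open>haar_K\<close> by invariance of the Haar measure.\<close>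

lemma haar_exp_le:
 fixes \<V> :: "('a::real_complex_quat) fmat set" and \<mu> :: "'a fmat measure"
 assumes \<mu>: "normalized_haar m \<mu>" and "n <= m" and AB: "A \<in> mats m n" "B \<in> mats m n" and k: "k >= 0"
  and net: "finite \<V>" "\<V> \<subseteq> \<U> n"
   "!!V. V \<in> \<U> n ==> \<exists>V'\<in>\<V>. mat_norm n n (mat_minus n n V V') <= e"
 shows "(\<integral>\<^sup>+U. eexp (k * mat_inner m n B (mat_mult m m n U A)) \<partial>\<mu>)
  <= ennreal ((real (card \<V>))^2 * exp (2 * k * real n * e * L2_set (%i. sing_vals m n A i * sing_vals m n B i) {..<n}))
    * haar_K \<mu> m n k (%i. sing_vals m n A i * sing_vals m n B i)"
proof -
 obtain UA VA where A: "UA \<in> \<U> m" "VA \<in> \<U> n" "A = usv m n UA (sing_vals m n A) VA"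
  and a: "sing_vals m n A \<in> chamber_B n"
  using svd_sing_vals[OF AB(1) \<open>n <= m\<close>] .
 obtain UB VB where B: "UB \<in> \<U> m" "VB \<in> \<U> n" "B = usv m n UB (sing_vals m n B) VB"
  and b: "sing_vals m n B \<in> chamber_B n"
  using svd_sing_vals[OF AB(2) \<open>n <= m\<close>] .
 define a b where "a = sing_vals m n A" and "b = sing_vals m n B"
 define d where "d i = a i * b i" for i
 define D :: "'a fmat" where "D = sigma_mat n n d"
 define l where "l = L2_set d {..<n}"
 have Dn: "mat_norm n n D = l" by (simp add: D_def l_def mat_norm_sigma)
 define R where "R U = mat_mult m m m (mat_mult m m m (mat_adj m m UB) U) UA" for U :: "'a fmat"
 have RU: "R U \<in> \<U> m" if "U \<in> \<U> m" for U
  unfolding R_def using A B that by (intro unitary_mult unitary_adj)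
 define Z where "Z P Q U = mat_inner n n D (mat_mult n n n (mat_mult n n n P (corner n (R U))) Q)" for P Q U :: "'a fmat"
 have inner_eq: "mat_inner m n B (mat_mult m m n U A)
   = mat_inner m n (sigma_mat m n b) (usv m n (R U) a (mat_mult n n n (mat_adj n n VB) VA))"
  if U: "U \<in> \<U> m" for U
 proof -
  have "mat_inner m n B (mat_mult m m n U A)
   = mat_inner m n (mat_mult m n n (mat_mult m m n UB (sigma_mat m n b)) (mat_adj n n VB)) (mat_mult m m n U A)"
   using B(3) by (simp add: b_def)
  also have "... = mat_inner m n (mat_mult m m n UB (sigma_mat m n b)) (mat_mult m n n (mat_mult m m n U A) VB)"
   using B by (subst mat_inner_adjoint_right) (simp_all add: mat_adj_adj unitaryD)
  also have "... = mat_inner m n (sigma_mat m n b) (mat_mult m m n (mat_adj m m UB) (mat_mult m n n (mat_mult m m n U A) VB))"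
   by (rule mat_inner_adjoint_left)
  also have "mat_mult m m n (mat_adj m m UB) (mat_mult m n n (mat_mult m m n U A) VB)
   = mat_mult m m n (mat_adj m m UB) (mat_mult m n n (mat_mult m m n U (usv m n UA a VA)) VB)"
   using A(3) by (simp add: a_def)
  also have "... = usv m n (R U) a (mat_mult n n n (mat_adj n n VB) VA)"
   using B by (simp add: R_def mat_mult_assoc mat_adj_mult mat_adj_adj unitaryD)
  finally show ?thesis .
 qed
 have bound: "eexp (k * mat_inner m n B (mat_mult m m n U A))
   <= (\<Sum>P\<in>\<V>. \<Sum>Q\<in>\<V>. eexp (2 * k * real n * e * l) * eexp (k * Z P Q U))"
  if U: "U \<in> \<U> m" for U
 proof -
  obtain P Q where PQ: "P \<in> \<U> n" "Q \<in> \<U> n"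
   "mat_inner m n (sigma_mat m n b) (usv m n (R U) a (mat_mult n n n (mat_adj n n VB) VA)) <= Z P Q U"
   using inner_usv_le_corner[OF \<open>n <= m\<close> unitary_mult[OF unitary_adj[OF B(2)] A(2)] a b, of "R U"]
   unfolding Z_def D_def d_def a_def b_def by blast
  obtain P' where P': "P' \<in> \<V>" "mat_norm n n (mat_minus n n P P') <= e" using net(3)[OF PQ(1)] by blast
  obtain Q' where Q': "Q' \<in> \<V>" "mat_norm n n (mat_minus n n Q Q') <= e" using net(3)[OF PQ(2)] by blast
  have PQ'u: "P' \<in> \<U> n" "Q' \<in> \<U> n" using P' Q' net by auto
  have e: "e >= 0" using P'(2) mat_norm_ge_0 order.trans by blast
  define C where "C = corner n (R U)"
  have un: "mat_norm n n V = sqrt (real n)" if "V \<in> \<U> n" for V :: "'a fmat"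
   using unitary_mat_norm[OF that] by (metis mat_norm_ge_0 real_sqrt_unique)
  have Cn: "mat_norm n n C <= sqrt (real n)"
   unfolding C_def by (rule corner_norm[OF \<open>n <= m\<close> RU[OF U]])
  have 1: "mat_mult n n n (mat_mult n n n P C) Q = mat_add n n (mat_mult n n n (mat_mult n n n P' C) Q)
   (mat_mult n n n (mat_mult n n n (mat_minus n n P P') C) Q)"
   by (subst mat_minus_split[OF unitaryD(1)[OF PQ(1)], of P']) (simp add: mat_mult_add_left)
  have 2: "mat_mult n n n (mat_mult n n n P' C) Q = mat_add n n (mat_mult n n n (mat_mult n n n P' C) Q')
   (mat_mult n n n (mat_mult n n n P' C) (mat_minus n n Q Q'))"
   by (subst mat_minus_split[OF unitaryD(1)[OF PQ(2)], of Q']) (simp add: mat_mult_add_right)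
  have n1: "mat_norm n n (mat_mult n n n (mat_mult n n n (mat_minus n n P P') C) Q) <= real n * e"
  proof -
   have "mat_norm n n (mat_mult n n n (mat_mult n n n (mat_minus n n P P') C) Q)
    <= (mat_norm n n (mat_minus n n P P') * mat_norm n n C) * mat_norm n n Q"
    by (rule order.trans[OF mat_norm_mult mult_right_mono[OF mat_norm_mult]]) simp
   also have "... <= (e * sqrt (real n)) * sqrt (real n)"
    using P'(2) Cn un[OF PQ(2)] e by (intro mult_mono) auto
   also have "... = real n * e" by simp
   finally show ?thesis .
  qed
  have n2: "mat_norm n n (mat_mult n n n (mat_mult n n n P' C) (mat_minus n n Q Q')) <= real n * e"
  proof -
   have "mat_norm n n (mat_mult n n n (mat_mult n n n P' C) (mat_minus n n Q Q'))
    <= (mat_norm n n P' * mat_norm n n C) * mat_norm n n (mat_minus n n Q Q')"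
    by (rule order.trans[OF mat_norm_mult mult_right_mono[OF mat_norm_mult]]) simp
   also have "... <= (sqrt (real n) * sqrt (real n)) * e"
    using Q'(2) Cn un[OF PQ'u(1)] e by (intro mult_mono) auto
   also have "... = real n * e" by simp
   finally show ?thesis .
  qed
  have in_le: "mat_inner n n D X <= l * (real n * e)" if "mat_norm n n X <= real n * e" for X
   using mat_inner_le[of n n D X] mult_left_mono[OF that, of l] by (simp add: Dn l_def)
  have "Z P Q U = Z P' Q' U + mat_inner n n D (mat_mult n n n (mat_mult n n n P' C) (mat_minus n n Q Q'))
   + mat_inner n n D (mat_mult n n n (mat_mult n n n (mat_minus n n P P') C) Q)"
   unfolding Z_def C_def[symmetric] by (subst 1, subst 2) (simp only: mat_inner_add_right)
  also have "... <= Z P' Q' U + 2 * real n * e * l"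
   using in_le[OF n1] in_le[OF n2] by (simp add: mult_ac)
  finally have "mat_inner m n B (mat_mult m m n U A) <= Z P' Q' U + 2 * real n * e * l"
   using PQ(3) inner_eq[OF U] by simp
  then have "k * mat_inner m n B (mat_mult m m n U A) <= 2 * k * real n * e * l + k * Z P' Q' U"
   using mult_left_mono[of _ _ k] k by (fastforce simp: algebra_simps)
  then have "eexp (k * mat_inner m n B (mat_mult m m n U A))
    <= eexp (2 * k * real n * e * l) * eexp (k * Z P' Q' U)"
   by (simp add: ennreal_mult[symmetric] exp_add[symmetric])
  also have "... <= (\<Sum>Q\<in>\<V>. eexp (2 * k * real n * e * l) * eexp (k * Z P' Q U))"
   using Q' net by (intro member_le_sum) auto
  also have "... <= (\<Sum>P\<in>\<V>. \<Sum>Q\<in>\<V>. eexp (2 * k * real n * e * l) * eexp (k * Z P Q U))"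
   using P' net by (intro member_le_sum[where f = "%P. \<Sum>Q\<in>\<V>. eexp (2 * k * real n * e * l) * eexp (k * Z P Q U)"]) auto
  finally show ?thesis .
 qed
 have Zeq: "(\<integral>\<^sup>+U. eexp (k * Z P Q U) \<partial>\<mu>) = haar_K \<mu> m n k d"
  and Zmeas: "(%U. eexp (k * Z P Q U)) \<in> borel_measurable \<mu>"
  if "P \<in> \<U> n" "Q \<in> \<U> n" for P Q
 proof -
  define U1 where "U1 = mat_mult m m m (block_embed m n P) (mat_adj m m UB)"
  define U2 where "U2 = mat_mult m m m UA (block_embed m n Q)"
  have U12: "U1 \<in> \<U> m" "U2 \<in> \<U> m"
   unfolding U1_def U2_def using that A B \<open>n <= m\<close> by (auto intro!: unitary_mult unitary_block_embed unitary_adj)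
  have Z: "Z P Q U = mat_inner m n (sigma_mat m n d) (mat_mult m m n (mat_mult m m m (mat_mult m m m U1 U) U2) (iso_mat m n))"
   if U: "U \<in> \<U> m" for U
   unfolding Z_def D_def inner_corner[OF \<open>n <= m\<close> RU[OF U] \<open>P \<in> \<U> n\<close> \<open>Q \<in> \<U> n\<close>]
   by (simp add: R_def U1_def U2_def mat_mult_assoc)
  have "(\<integral>\<^sup>+U. eexp (k * Z P Q U) \<partial>\<mu>)
   = (\<integral>\<^sup>+U. eexp (k * mat_inner m n (sigma_mat m n d) (mat_mult m m n (mat_mult m m m (mat_mult m m m U1 U) U2) (iso_mat m n))) \<partial>\<mu>)"
   by (intro nn_integral_cong) (simp add: haar_space[OF \<mu>] Z)
  also have "... = haar_K \<mu> m n k d"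
   unfolding haar_K_def by (rule haar_exp_two_sided[OF \<mu> _ _ U12]) auto
  finally show "(\<integral>\<^sup>+U. eexp (k * Z P Q U) \<partial>\<mu>) = haar_K \<mu> m n k d" .
  have "(%U. eexp (k * mat_inner m n (sigma_mat m n d) (mat_mult m m n (mat_mult m m m (mat_mult m m m U1 U) U2) (iso_mat m n)))) \<in> borel_measurable \<mu>"
  proof -
   note [measurable] = measurable_haar_ident[OF \<mu>] unitaryD(1)[OF U12(1)] unitaryD(1)[OF U12(2)]
   have [measurable]: "iso_mat m n \<in> mats m n" "(sigma_mat m n d :: 'a fmat) \<in> mats m n" by simp_all
   show ?thesis by measurable
  qed
  moreover have "(%U. eexp (k * Z P Q U)) \<in> borel_measurable \<mu> \<longleftrightarrow>
   (%U. eexp (k * mat_inner m n (sigma_mat m n d) (mat_mult m m n (mat_mult m m m (mat_mult m m m U1 U) U2) (iso_mat m n)))) \<in> borel_measurable \<mu>"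
   by (rule measurable_cong) (simp add: haar_space[OF \<mu>] Z)
  ultimately show "(%U. eexp (k * Z P Q U)) \<in> borel_measurable \<mu>"
   by (rule iffD2[rotated])
 qed
 have "(\<integral>\<^sup>+U. eexp (k * mat_inner m n B (mat_mult m m n U A)) \<partial>\<mu>)
  <= (\<integral>\<^sup>+U. (\<Sum>P\<in>\<V>. \<Sum>Q\<in>\<V>. eexp (2 * k * real n * e * l) * eexp (k * Z P Q U)) \<partial>\<mu>)"
  by (intro nn_integral_mono bound) (simp add: haar_space[OF \<mu>])
 also have "... = (\<Sum>P\<in>\<V>. \<Sum>Q\<in>\<V>. eexp (2 * k * real n * e * l) * haar_K \<mu> m n k d)"
 proof -
  have I: "(\<integral>\<^sup>+U. eexp (2 * k * real n * e * l) * eexp (k * Z P Q U) \<partial>\<mu>)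
   = eexp (2 * k * real n * e * l) * haar_K \<mu> m n k d" if "P \<in> \<V>" "Q \<in> \<V>" for P Q
  proof -
   have PQ: "P \<in> \<U> n" "Q \<in> \<U> n" using that net(2) by auto
   show ?thesis
    by (subst nn_integral_cmult[OF Zmeas[OF PQ]]) (simp only: Zeq[OF PQ])
  qed
  have W: "(%U. eexp (2 * k * real n * e * l) * eexp (k * Z P Q U)) \<in> borel_measurable \<mu>"
   if "P \<in> \<V>" "Q \<in> \<V>" for P Q
   using that net(2) by (intro borel_measurable_times_ennreal measurable_const Zmeas) auto
  have "(\<integral>\<^sup>+U. (\<Sum>P\<in>\<V>. \<Sum>Q\<in>\<V>. eexp (2 * k * real n * e * l) * eexp (k * Z P Q U)) \<partial>\<mu>)
   = (\<Sum>P\<in>\<V>. \<integral>\<^sup>+U. (\<Sum>Q\<in>\<V>. eexp (2 * k * real n * e * l) * eexp (k * Z P Q U)) \<partial>\<mu>)"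
   by (rule nn_integral_sum) (intro borel_measurable_sum W)
  also have "... = (\<Sum>P\<in>\<V>. \<Sum>Q\<in>\<V>. \<integral>\<^sup>+U. eexp (2 * k * real n * e * l) * eexp (k * Z P Q U) \<partial>\<mu>)"
   by (intro sum.cong refl nn_integral_sum W)
  also have "... = (\<Sum>P\<in>\<V>. \<Sum>Q\<in>\<V>. eexp (2 * k * real n * e * l) * haar_K \<mu> m n k d)"
   by (intro sum.cong refl I)
  finally show ?thesis .
 qed
 also have "... = ennreal ((real (card \<V>))^2 * exp (2 * k * real n * e * l)) * haar_K \<mu> m n k d"
  by (simp add: power2_eq_square ennreal_mult ennreal_of_nat_eq_real_of_nat[symmetric] mult.assoc)
 finally show ?thesis
  by (simp add: l_def d_def[abs_def] a_def b_def)
qed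

section \<open>Concentration of Gaussian matrices\<close>

lemma prod_indicator_column:
 fixes c :: real
 assumes "j < n"
 shows "(\<Prod>k\<in>idx m n. (if snd k = j then c else 1)) = c ^ m"
proof -
 have "(\<Prod>k\<in>idx m n. (if snd k = j then c else 1)) = (\<Prod>i<m. \<Prod>l<n. if l = j then c else 1)"
  by (simp only: prod.cartesian_product case_prod_beta' snd_conv)
 also have "... = (\<Prod>i<m. c)"
  using assms by (intro prod.cong refl) (simp add: prod.delta)
 finally show ?thesis by simp
qed

definition col_sq :: "nat => ('a::real_complex_quat) fmat => nat => real" where
 "col_sq m g j = (\<Sum>i<m. (norm (g (i, j)))\<^sup>2)"

lemma measurable_col_sq [measurable (raw)]:
 assumes "f \<in> M \<rightarrow>\<^sub>M mat_space m n" "j < n"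
 shows "(%x. col_sq m (f x) j) \<in> borel_measurable M"
proof -
 note [measurable] = assms(1)
 show ?thesis unfolding col_sq_def using assms(2) by measurable
qed

lemma sum_idx_column:
 assumes "j < n"
 shows "(\<Sum>k\<in>idx m n. if snd k = j then f (fst k) else (0::real)) = (\<Sum>i<m. f i)"
proof -
 have "(\<Sum>k\<in>idx m n. if snd k = j then f (fst k) else 0) = (\<Sum>i<m. \<Sum>l<n. if l = j then f i else 0)"
  by (simp only: sum.cartesian_product case_prod_beta' snd_conv)
 then show ?thesis using assms by simp
qed

lemma gauss_col_mgf:
 assumes "j < n" "\<theta> < 1 / 2"
 shows "(\<integral>\<^sup>+g. eexp (\<theta> * col_sq m g j) \<partial>(gauss_mat m n :: ('a::real_complex_quat) fmat measure))
  = ennreal ((1 - 2 * \<theta>) powr (- (real (m * DIM('a)) / 2)))"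
proof -
 define u where "u = 1 - 2 * \<theta>"
 have u: "u > 0" using assms by (simp add: u_def)
 define s where "s k = (if snd k = j then u powr (- 1 / 2) else 1)" for k :: "nat \<times> nat"
 have s2: "1 - 1 / (s k)^2 = (if snd k = j then 2 * \<theta> else 0)" for k
  using u by (simp add: s_def powr_power) (simp add: u_def powr_minus)
 have sum: "(\<Sum>k\<in>idx m n. (1 - 1 / (s k)^2) * (norm (g k))^2) / 2 = \<theta> * col_sq m g j" for g :: "'a fmat"
 proof -
  have "(\<Sum>k\<in>idx m n. (1 - 1 / (s k)^2) * (norm (g k))^2)
   = (\<Sum>k\<in>idx m n. if snd k = j then 2 * \<theta> * (norm (g (fst k, j)))^2 else 0)"
   unfolding s2 by (intro sum.cong refl) auto
  also have "... = (\<Sum>i<m. 2 * \<theta> * (norm (g (i, j)))^2)"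
   by (rule sum_idx_column[OF assms(1)])
  finally show ?thesis by (simp add: col_sq_def flip: sum_distrib_left)
 qed
 have "(\<integral>\<^sup>+g. eexp (\<theta> * col_sq m g j) \<partial>(gauss_mat m n :: 'a fmat measure))
  = ennreal (\<Prod>k\<in>idx m n. s k ^ DIM('a))"
  unfolding sum[symmetric] by (rule nn_integral_gauss_quadratic) (use u in \<open>simp add: s_def\<close>)
 also have "(\<Prod>k\<in>idx m n. s k ^ DIM('a)) = (\<Prod>k\<in>idx m n. if snd k = j then (u powr (- 1 / 2)) ^ DIM('a) else 1)"
  by (intro prod.cong) (auto simp: s_def)
 also have "... = ((u powr (- 1 / 2)) ^ DIM('a)) ^ m"
  by (rule prod_indicator_column[OF assms(1)])
 also have "... = u powr (- (real (m * DIM('a)) / 2))"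
  using u by (simp add: powr_powr mult.commute flip: power_mult powr_realpow)
 finally show ?thesis by (simp add: u_def)
qed

lemma gauss_entry_mgf:
 assumes "i < m" "j < n"
 shows "(\<integral>\<^sup>+g. eexp ((norm (g (i, j)))^2 / 4) \<partial>(gauss_mat m n :: ('a::real_complex_quat) fmat measure))
  = ennreal (sqrt 2 ^ DIM('a))"
proof -
 define s where "s k = (if k = (i, j) then sqrt 2 else 1)" for k :: "nat \<times> nat"
 have k: "(i, j) \<in> idx m n" using assms by simp
 have sum: "(\<Sum>k\<in>idx m n. (1 - 1 / (s k)^2) * (norm (g k))^2) / 2 = (norm (g (i, j)))^2 / 4" for g :: "'a fmat"
 proof -
  have "(\<Sum>k\<in>idx m n. (1 - 1 / (s k)^2) * (norm (g k))^2)
   = (\<Sum>k\<in>idx m n. if k = (i, j) then (norm (g (i, j)))\<^sup>2 / 2 else 0)"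
   by (intro sum.cong refl) (auto simp: s_def)
  then show ?thesis using k by (simp del: mem_Sigma_iff)
 qed
 have "(\<integral>\<^sup>+g. eexp ((norm (g (i, j)))^2 / 4) \<partial>(gauss_mat m n :: 'a fmat measure))
  = ennreal (\<Prod>k\<in>idx m n. s k ^ DIM('a))"
  unfolding sum[symmetric] by (rule nn_integral_gauss_quadratic) (simp add: s_def)
 also have "(\<Prod>k\<in>idx m n. s k ^ DIM('a)) = (\<Prod>k\<in>idx m n. if k = (i, j) then sqrt 2 ^ DIM('a) else 1)"
  by (intro prod.cong) (auto simp: s_def)
 also have "... = sqrt 2 ^ DIM('a)"
  using k by (simp del: mem_Sigma_iff)
 finally show ?thesis .
qed

lemma exponential_markov:
 assumes [measurable]: "X \<in> borel_measurable M"
 shows "emeasure M {x \<in> space M. c <= X x} <= eexp (- c) * (\<integral>\<^sup>+x. eexp (X x) \<partial>M)"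
proof -
 have "emeasure M {x \<in> space M. c <= X x} = (\<integral>\<^sup>+x. indicator {x \<in> space M. c <= X x} x \<partial>M)"
  by simp
 also have "... <= (\<integral>\<^sup>+x. eexp (- c) * eexp (X x) \<partial>M)"
  by (intro nn_integral_mono) (auto simp: indicator_def ennreal_mult[symmetric] exp_add[symmetric])
 also have "... = eexp (- c) * (\<integral>\<^sup>+x. eexp (X x) \<partial>M)"
  by (rule nn_integral_cmult) measurable
 finally show ?thesis .
qed

lemma kappa_eq:
 assumes "n <= m"
 shows "real m * real d / 2 = kappa d n m + ((real n - 1) * real d / 2 + 1 / 2)"
 by (simp add: kappa_def field_simps)

lemma kappa_nonneg:
 assumes "n <= m" "d >= 1"
 shows "0 <= kappa d n m"
proof -
 have "1 <= (real m - real n + 1) * real d"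
  using assms mult_mono[of 1 "real m - real n + 1" 1 "real d"] by simp
 then show ?thesis by (simp add: kappa_def)
qed

lemma kappa_at_top:
 assumes "d >= 1"
 shows "filterlim (%m. kappa d n m) at_top sequentially"
proof -
 have "filterlim (%m. real d / 2 * real m) at_top sequentially"
  using assms by (intro filterlim_tendsto_pos_mult_at_top[OF tendsto_const] filterlim_real_sequentially) auto
 then have "filterlim (%m. (real d / 2 * (1 - real n) - 1 / 2) + real d / 2 * real m) at_top sequentially"
  by (rule filterlim_tendsto_add_at_top[OF tendsto_const])
 then show ?thesis
  by (simp add: kappa_def[abs_def] field_simps)
qed

lemma col_tail_exponent:
 fixes \<eta> :: real
 assumes "0 < \<eta>"
 obtains \<theta> r where "0 < \<theta>" "\<theta> <= 1 / 4" "0 < r"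
  "- ln (1 - 2 * \<theta>) - 2 * \<theta> - \<theta> * \<eta> <= - r" "- ln (1 + 2 * \<theta>) + 2 * \<theta> - \<theta> * \<eta> <= - r"
proof -
 define \<theta> where "\<theta> = min (\<eta> / 16) (1 / 4)"
 have t: "0 < \<theta>" "\<theta> <= 1 / 4" "16 * \<theta> <= \<eta>" using assms by (auto simp: \<theta>_def)
 have sq: "16 * (\<theta> * \<theta>) <= \<theta> * \<eta>"
  using mult_left_mono[OF t(3), of \<theta>] t(1) by (simp add: mult_ac)
 have "- (2 * \<theta>) - 8 * (\<theta> * \<theta>) <= ln (1 - 2 * \<theta>)"
  using ln_one_minus_pos_lower_bound[of "2 * \<theta>"] t by (simp add: power2_eq_square)
 moreover have "2 * \<theta> - 4 * (\<theta> * \<theta>) <= ln (1 + 2 * \<theta>)"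
  using ln_one_plus_pos_lower_bound[of "2 * \<theta>"] t by (simp add: power2_eq_square)
 moreover have "0 <= \<theta> * \<eta>" using t assms by simp
 ultimately show ?thesis
  using sq t assms by (intro that[of \<theta> "\<theta> * \<eta> / 2"]; (linarith | simp))
qed

definition kappa_shift :: "nat => nat => real" where
 "kappa_shift d n = (real n - 1) * real d / 2 + 1 / 2"

lemma kappa_shift_nonneg: "n >= 1 ==> 0 <= kappa_shift d n"
 by (simp add: kappa_shift_def)

lemma kappa_eq_shift: "n <= m ==> real (m * d) / 2 = kappa d n m + kappa_shift d n"
 using kappa_eq[of n m d] by (simp add: kappa_shift_def)

lemma col_concentration:
 assumes "0 < \<eta>" and n: "n >= 1"
 obtains C r where "0 < r" "0 <= C"
  "!!m j. n <= m ==> j < n ==>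
   emeasure (gauss_mat m n) {g \<in> mats m n. \<not> \<bar>col_sq m (g :: ('a::real_complex_quat) fmat) j - 2 * kappa DIM('a) n m\<bar> <= \<eta> * kappa DIM('a) n m}
    <= ennreal (C * exp (- r * kappa DIM('a) n m))"
proof -
 obtain \<theta> r where t: "0 < \<theta>" "\<theta> <= 1 / 4" "0 < r"
  and up: "- ln (1 - 2 * \<theta>) - 2 * \<theta> - \<theta> * \<eta> <= - r" and lo: "- ln (1 + 2 * \<theta>) + 2 * \<theta> - \<theta> * \<eta> <= - r"
  using col_tail_exponent[OF assms(1)] .
 define c where "c = kappa_shift DIM('a) n"
 have c: "c >= 0" using n by (simp add: c_def kappa_shift_nonneg)
 have "emeasure (gauss_mat m n) {g \<in> mats m n. \<not> \<bar>col_sq m (g :: 'a fmat) j - 2 * kappa DIM('a) n m\<bar> <= \<eta> * kappa DIM('a) n m}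
    <= ennreal ((2 powr c + 1) * exp (- r * kappa DIM('a) n m))" if mj: "n <= m" "j < n" for m j
 proof -
  define k where "k = kappa DIM('a) n m"
  have k: "k >= 0" unfolding k_def by (rule kappa_nonneg[OF mj(1)]) (simp add: Suc_leI)
  have dm: "real m * real DIM('a) / 2 = k + c"
   using kappa_eq_shift[OF mj(1), of "DIM('a)"] by (simp add: k_def c_def)
  have [measurable]: "(%g. col_sq m g j) \<in> borel_measurable (gauss_mat m n :: 'a fmat measure)"
   using mj(2) by (intro measurable_col_sq) (auto intro: measurable_ident_sets)
  let ?A = "{g \<in> space (gauss_mat m n :: 'a fmat measure). \<theta> * (2 + \<eta>) * k <= \<theta> * col_sq m g j}"
  let ?B = "{g \<in> space (gauss_mat m n :: 'a fmat measure). - \<theta> * (2 - \<eta>) * k <= - \<theta> * col_sq m g j}"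
  have A: "emeasure (gauss_mat m n) ?A <= ennreal (2 powr c * exp (- r * k))"
  proof -
   have "emeasure (gauss_mat m n) ?A <= eexp (- (\<theta> * (2 + \<eta>) * k)) *
     (\<integral>\<^sup>+g. eexp (\<theta> * col_sq m g j) \<partial>(gauss_mat m n :: 'a fmat measure))"
    by (rule exponential_markov) measurable
   also have "... = ennreal (exp (- (\<theta> * (2 + \<eta>) * k)) * (1 - 2 * \<theta>) powr (- (k + c)))"
    using t by (subst gauss_col_mgf[OF mj(2)]) (auto simp: dm ennreal_mult)
   also have "exp (- (\<theta> * (2 + \<eta>) * k)) * (1 - 2 * \<theta>) powr (- (k + c))
    = (1 - 2 * \<theta>) powr (- c) * exp (k * (- ln (1 - 2 * \<theta>) - 2 * \<theta> - \<theta> * \<eta>))"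
    using t by (simp add: powr_def exp_add[symmetric] algebra_simps)
   also have "... <= 2 powr c * exp (- r * k)"
   proof (intro mult_mono)
    have "(1 - 2 * \<theta>) powr (- c) <= (1 / 2) powr (- c)"
     using t c by (intro powr_mono2') auto
    also have "... = 2 powr c" by (simp add: powr_minus powr_divide)
    finally show "(1 - 2 * \<theta>) powr (- c) <= 2 powr c" .
    show "exp (k * (- ln (1 - 2 * \<theta>) - 2 * \<theta> - \<theta> * \<eta>)) <= exp (- r * k)"
     using mult_left_mono[OF up k] by (simp add: mult.commute)
   qed auto
   finally show ?thesis by (simp add: ennreal_leI)
  qed
  have B: "emeasure (gauss_mat m n) ?B <= ennreal (1 * exp (- r * k))"
  proof -
   have "emeasure (gauss_mat m n) ?B <= eexp (- (- \<theta> * (2 - \<eta>) * k)) *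
     (\<integral>\<^sup>+g. eexp (- \<theta> * col_sq m g j) \<partial>(gauss_mat m n :: 'a fmat measure))"
    by (rule exponential_markov) measurable
   also have "... = ennreal (exp (\<theta> * (2 - \<eta>) * k) * (1 + 2 * \<theta>) powr (- (k + c)))"
    using t by (subst gauss_col_mgf[OF mj(2)]) (auto simp: dm ennreal_mult)
   also have "exp (\<theta> * (2 - \<eta>) * k) * (1 + 2 * \<theta>) powr (- (k + c))
    = (1 + 2 * \<theta>) powr (- c) * exp (k * (- ln (1 + 2 * \<theta>) + 2 * \<theta> - \<theta> * \<eta>))"
    using t by (simp add: powr_def exp_add[symmetric] algebra_simps)
   also have "... <= 1 * exp (- r * k)"
   proof (intro mult_mono)
    have "(1 + 2 * \<theta>) powr (- c) <= (1 + 2 * \<theta>) powr 0"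
     using t c by (intro powr_mono) auto
    then show "(1 + 2 * \<theta>) powr (- c) <= 1" using t by simp
    show "exp (k * (- ln (1 + 2 * \<theta>) + 2 * \<theta> - \<theta> * \<eta>)) <= exp (- r * k)"
     using mult_left_mono[OF lo k] by (simp add: mult.commute)
   qed auto
   finally show ?thesis by (simp add: ennreal_leI)
  qed
  have "{g \<in> mats m n. \<not> \<bar>col_sq m (g :: 'a fmat) j - 2 * k\<bar> <= \<eta> * k} \<subseteq> ?A \<union> ?B"
  proof
   fix g :: "'a fmat" assume g: "g \<in> {g \<in> mats m n. \<not> \<bar>col_sq m g j - 2 * k\<bar> <= \<eta> * k}"
   then consider "(2 + \<eta>) * k <= col_sq m g j" | "col_sq m g j <= (2 - \<eta>) * k"
    by (fastforce simp: algebra_simps abs_le_iff)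
   then show "g \<in> ?A \<union> ?B"
   proof cases
    case 1
    then show ?thesis using g mult_left_mono[OF 1, of \<theta>] t by (simp add: mult.assoc)
   next
    case 2
    then show ?thesis using g mult_left_mono[OF 2, of \<theta>] t by (simp add: mult.assoc)
   qed
  qed
  then have "emeasure (gauss_mat m n) {g \<in> mats m n. \<not> \<bar>col_sq m (g :: 'a fmat) j - 2 * k\<bar> <= \<eta> * k}
   <= emeasure (gauss_mat m n) (?A \<union> ?B)"
   by (rule emeasure_mono) measurable
  also have "... <= emeasure (gauss_mat m n) ?A + emeasure (gauss_mat m n) ?B"
   by (rule emeasure_subadditive) measurable
  also have "... <= ennreal (2 powr c * exp (- r * k)) + ennreal (1 * exp (- r * k))"
   by (rule add_mono[OF A B])
  also have "... = ennreal ((2 powr c + 1) * exp (- r * k))"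
   by (subst ennreal_plus[symmetric]) (simp_all add: distrib_right)
  finally show ?thesis by (simp add: k_def)
 qed
 then show ?thesis
  using t by (intro that[of r "2 powr c + 1"]) auto
qed

definition mixing_rotation :: "nat => nat => nat => 'a => ('a::real_complex_quat) fmat" where
 "mixing_rotation n j l b = plane_rotation n j l (conjugation b) (1 / sqrt 2) (1 / sqrt 2)"

definition gram :: "nat => nat => ('a::real_complex_quat) fmat => 'a fmat" where
 "gram m n z = mat_mult n m n (mat_adj m n z) z"

lemma gram_entry: "j < n ==> l < n ==> gram m n z (j, l) = (\<Sum>i<m. conjugation (z (i, j)) * z (i, l))"
 by (simp add: gram_def)

lemma gram_diag: "j < n ==> gram m n z (j, j) = of_real (col_sq m z j)"
 by (simp add: gram_entry conjugation_mult_self col_sq_def)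

lemma unitary_mixing:
 "j < n ==> l < n ==> j ~= l ==> b \<in> Basis ==> mixing_rotation n j l b \<in> \<U> n"
 unfolding mixing_rotation_def by (intro unitary_plane_rotation) (auto simp: power_divide)

text \<open>Off-diagonal entries of the Gram matrix are read off from diagonal ones after a rotation of
  two columns, so the concentration of column norms suffices.\<close>

lemma col_sq_mixing:
 fixes g :: "('a::real_complex_quat) fmat"
 assumes jl: "j < n" "l < n" "j ~= l" and b: "b \<in> Basis"
 shows "col_sq m (mat_mult m n n g (mixing_rotation n j l b)) j
  = (col_sq m g j + col_sq m g l) / 2 - b \<bullet> gram m n g (l, j)"
proof -
 have entry: "mat_mult m n n g (mixing_rotation n j l b) (i, j) = (1 / sqrt 2) *\<^sub>R (g (i, j) - g (i, l) * b)"
  if i: "i < m" for i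
 proof -
  have "mat_mult m n n g (mixing_rotation n j l b) (i, j)
   = (\<Sum>p<n. (if p = j then (1 / sqrt 2) *\<^sub>R g (i, j) else 0) + (if p = l then - (1 / sqrt 2) *\<^sub>R (g (i, l) * b) else 0))"
   unfolding mat_mult_entry[OF i jl(1)]
   by (intro sum.cong refl) (use jl in \<open>auto simp: mixing_rotation_def plane_rotation_def of_real_def\<close>)
  then show ?thesis using jl by (simp add: sum.distrib scaleR_diff_right)
 qed
 have "(norm (mat_mult m n n g (mixing_rotation n j l b) (i, j)))^2
   = ((norm (g (i, j)))^2 + (norm (g (i, l)))^2) / 2 - b \<bullet> (conjugation (g (i, l)) * g (i, j))" if i: "i < m" for i
 proof -
  have "(norm (g (i, j) - g (i, l) * b))^2
    = (norm (g (i, j)))^2 + (norm (g (i, l) * b))^2 - 2 * ((g (i, l) * b) \<bullet> g (i, j))"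
   by (simp only: power2_norm_eq_inner) (simp add: inner_diff_left inner_diff_right inner_commute)
  also have "(norm (g (i, l) * b))^2 = (norm (g (i, l)))^2"
   using b by (simp add: norm_mult)
  finally show ?thesis
   unfolding entry[OF i] by (simp add: inner_mult_adjoint_left power_mult_distrib power_divide)
 qed
 then show ?thesis
  using jl unfolding col_sq_def
  by (simp add: gram_entry inner_sum_right sum_subtractf sum.distrib sum_divide_distrib[symmetric] del: mat_mult_entry)
qed

definition good_gauss :: "nat => nat => real => real => ('a::real_complex_quat) fmat set" where
 "good_gauss m n k \<eta> = {g \<in> mats m n. (\<forall>j<n. \<bar>col_sq m g j - 2 * k\<bar> <= \<eta> * k) &
  (\<forall>j<n. \<forall>l<n. \<forall>b\<in>Basis. j ~= l --> \<bar>col_sq m (mat_mult m n n g (mixing_rotation n j l b)) j - 2 * k\<bar> <= \<eta> * k) &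
  (\<forall>i<n. \<forall>j<n. (norm (g (i, j)))\<^sup>2 <= \<eta> * k)}"

text \<open>All columns have squared norm near the expected value, and so have the columns after rotating pairs of them by 45 degrees;
  the latter controls the inner products. Only Chernoff bounds for sums of squares are needed.\<close>

lemma gauss_good_prob:
 assumes n: "n >= 1" and \<eta>: "\<eta> > 0"
 shows "\<forall>\<^sub>F m in sequentially. (good_gauss m n (kappa DIM('a) n m) \<eta> :: 'a fmat set) \<in> sets (mat_space m n) &
  ennreal (1 / 2) <= emeasure (gauss_mat m n) (good_gauss m n (kappa DIM('a) n m) \<eta> :: ('a::real_complex_quat) fmat set)"
proof -
 obtain r C where r: "0 < r" "0 <= C" and conc: "!!m j. n <= m ==> j < n ==>
   emeasure (gauss_mat m n) {g \<in> mats m n. \<not> \<bar>col_sq m (g :: 'a fmat) j - 2 * kappa DIM('a) n m\<bar> <= \<eta> * kappa DIM('a) n m}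
    <= ennreal (C * exp (- r * kappa DIM('a) n m))"
  by (rule col_concentration[OF \<eta> n, where 'a='a], rule that)
 define Bd where "Bd k = real n * (C * exp (- r * k)) + real (n * (n * DIM('a))) * (C * exp (- r * k))
  + real (n * n) * (sqrt 2 ^ DIM('a) * exp (- (\<eta> / 4) * k))" for k
 have good: "(good_gauss m n k \<eta> :: 'a fmat set) \<in> sets (mat_space m n) &
   1 - ennreal (Bd k) <= emeasure (gauss_mat m n) (good_gauss m n k \<eta> :: 'a fmat set)"
  if mn: "n <= m" and k_def: "k = kappa DIM('a) n m" for m k
 proof -
  interpret prob_space "gauss_mat m n :: 'a fmat measure" by (rule prob_space_gauss_mat)
  define J where "J = {(j, l, b). j < n & l < n & j ~= l & b \<in> (Basis :: 'a set)}"
  have J: "J \<subseteq> {..<n} \<times> {..<n} \<times> Basis" by (auto simp: J_def)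
  have finJ: "finite J" by (rule finite_subset[OF J]) auto
  have cardJ: "card J <= n * (n * DIM('a))"
   using card_mono[OF _ J] by (simp add: card_cartesian_product)
  define S1 where "S1 j = {g \<in> mats m n. \<not> \<bar>col_sq m (g :: 'a fmat) j - 2 * k\<bar> <= \<eta> * k}" for j
  define S2 where "S2 p = (case p of (j, l, b) =>
   {g \<in> mats m n. \<not> \<bar>col_sq m (mat_mult m n n (g :: 'a fmat) (mixing_rotation n j l b)) j - 2 * k\<bar> <= \<eta> * k})" for p
  define S3 where "S3 p = {g \<in> mats m n. \<not> (norm (g p :: 'a))\<^sup>2 <= \<eta> * k}" for p :: "nat \<times> nat"
  have idm: "(%g. g) \<in> mat_space m n \<rightarrow>\<^sub>M (mat_space m n :: 'a fmat measure)"
   by (rule measurable_ident_sets) simp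
  have S1m: "S1 j \<in> sets (mat_space m n)" if "j < n" for j
  proof -
   have [measurable]: "(%g. col_sq m g j) \<in> borel_measurable (mat_space m n :: 'a fmat measure)"
    by (rule measurable_col_sq[OF idm that])
   have "{g \<in> space (mat_space m n). \<not> \<bar>col_sq m (g :: 'a fmat) j - 2 * k\<bar> <= \<eta> * k} \<in> sets (mat_space m n)"
    by measurable
   then show ?thesis by (simp add: S1_def)
  qed
  have S2m: "S2 p \<in> sets (mat_space m n)" and S2e: "emeasure (gauss_mat m n) (S2 p) <= ennreal (C * exp (- r * k))"
   if "p \<in> J" for p
  proof -
   obtain j l b where p: "p = (j, l, b)" by (cases p)
   have jl: "j < n" "l < n" "j ~= l" "b \<in> Basis" using that by (auto simp: J_def p)
   define V where "V = mixing_rotation n j l b"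
   have V: "V \<in> \<U> n" unfolding V_def by (rule unitary_mixing[OF jl])
   have Lm: "(%g. mat_mult m n n g V) \<in> mat_space m n \<rightarrow>\<^sub>M mat_space m n"
    using V by (intro measurable_mat_mult idm measurable_const_mat) (simp add: unitaryD)
   have [measurable]: "(%g. col_sq m (mat_mult m n n g V) j) \<in> borel_measurable (mat_space m n :: 'a fmat measure)"
    by (rule measurable_col_sq[OF Lm jl(1)])
   have "{g \<in> space (mat_space m n). \<not> \<bar>col_sq m (mat_mult m n n (g :: 'a fmat) V) j - 2 * k\<bar> <= \<eta> * k} \<in> sets (mat_space m n)"
    by measurable
   then show 1: "S2 p \<in> sets (mat_space m n)" by (simp add: S2_def p V_def)
   have "emeasure (gauss_mat m n) (S2 p) = (\<integral>\<^sup>+g. indicator (S2 p) g \<partial>gauss_mat m n)"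
    using 1 by simp
   also have "... = (\<integral>\<^sup>+g. indicator (S1 j) (mat_mult m n n g V) \<partial>gauss_mat m n)"
    by (intro nn_integral_cong) (auto simp: indicator_def S1_def S2_def p V_def)
   also have "... = (\<integral>\<^sup>+g. indicator (S1 j) g \<partial>gauss_mat m n)"
    using S1m[OF jl(1)] by (intro nn_integral_gauss_unitary_right[OF _ V]) simp
   also have "... = emeasure (gauss_mat m n) (S1 j)"
    using S1m[OF jl(1)] by simp
   also have "... <= ennreal (C * exp (- r * k))"
    unfolding S1_def k_def by (rule conc[OF mn jl(1)])
   finally show "emeasure (gauss_mat m n) (S2 p) <= ennreal (C * exp (- r * k))" .
  qed
  have S3m: "S3 p \<in> sets (mat_space m n)" and S3e: "emeasure (gauss_mat m n) (S3 p) <= ennreal (sqrt 2 ^ DIM('a) * exp (- (\<eta> / 4) * k))"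
   if p_in: "p \<in> idx n n" for p
  proof -
   obtain i j where p: "p = (i, j)" "i < m" "j < n" using p_in mn by auto
   have [measurable]: "(%g. g (i, j)) \<in> borel_measurable (mat_space m n :: 'a fmat measure)"
    by (rule measurable_mat_entry[OF idm p(2,3)])
   have "{g \<in> space (mat_space m n). \<not> (norm (g (i, j) :: 'a))\<^sup>2 <= \<eta> * k} \<in> sets (mat_space m n)"
    by measurable
   then show "S3 p \<in> sets (mat_space m n)" by (simp add: S3_def p)
   have "{g \<in> space (mat_space m n). \<eta> / 4 * k <= (norm (g (i, j) :: 'a))^2 / 4} \<in> sets (mat_space m n)"
    by measurable
   then have 1: "{g \<in> space (gauss_mat m n). \<eta> / 4 * k <= (norm (g (i, j) :: 'a))^2 / 4} \<in> sets (mat_space m n)"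
    by simp
   have "emeasure (gauss_mat m n) (S3 p) <= emeasure (gauss_mat m n) {g \<in> space (gauss_mat m n). \<eta> / 4 * k <= (norm (g (i, j) :: 'a))^2 / 4}"
    using 1 by (intro emeasure_mono) (auto simp: S3_def p)
   also have "... <= eexp (- (\<eta> / 4 * k)) * (\<integral>\<^sup>+g. eexp ((norm (g (i, j)))^2 / 4) \<partial>(gauss_mat m n :: 'a fmat measure))"
    by (rule exponential_markov) measurable
   also have "... = ennreal (sqrt 2 ^ DIM('a) * exp (- (\<eta> / 4) * k))"
    by (subst gauss_entry_mgf[OF p(2,3)]) (simp add: ennreal_mult mult.commute)
   finally show "emeasure (gauss_mat m n) (S3 p) <= ennreal (sqrt 2 ^ DIM('a) * exp (- (\<eta> / 4) * k))" .
  qed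
  let ?U1 = "\<Union>j\<in>{..<n}. S1 j" and ?U2 = "\<Union>p\<in>J. S2 p" and ?U3 = "\<Union>p\<in>idx n n. S3 p"
  have Um: "?U1 \<in> sets (mat_space m n)" "?U2 \<in> sets (mat_space m n)" "?U3 \<in> sets (mat_space m n)"
   using S1m S2m S3m finJ by (auto intro!: sets.finite_UN)
  have eq: "good_gauss m n k \<eta> = space (gauss_mat m n) - (?U1 \<union> (?U2 \<union> ?U3))"
   unfolding good_gauss_def S1_def S2_def S3_def J_def by auto
  have e1: "emeasure (gauss_mat m n) ?U1 <= ennreal (real n * (C * exp (- r * k)))"
  proof -
   have "emeasure (gauss_mat m n) ?U1 <= (\<Sum>j<n. emeasure (gauss_mat m n) (S1 j))"
    using S1m by (intro emeasure_subadditive_finite) auto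
   also have "... <= (\<Sum>j<n. ennreal (C * exp (- r * k)))"
    unfolding S1_def k_def by (intro sum_mono conc[OF mn]) simp
   also have "... = ennreal (real n * (C * exp (- r * k)))"
    by (simp add: ennreal_mult' ennreal_of_nat_eq_real_of_nat)
   finally show ?thesis .
  qed
  have e2: "emeasure (gauss_mat m n) ?U2 <= ennreal (real (n * (n * DIM('a))) * (C * exp (- r * k)))"
  proof -
   have "emeasure (gauss_mat m n) ?U2 <= (\<Sum>p\<in>J. emeasure (gauss_mat m n) (S2 p))"
    using S2m finJ by (intro emeasure_subadditive_finite) auto
   also have "... <= (\<Sum>p\<in>J. ennreal (C * exp (- r * k)))"
    by (intro sum_mono S2e)
   also have "... = ennreal (real (card J) * (C * exp (- r * k)))"
    by (simp add: ennreal_mult' ennreal_of_nat_eq_real_of_nat)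
   also have "... <= ennreal (real (n * (n * DIM('a))) * (C * exp (- r * k)))"
    using r by (intro ennreal_leI mult_right_mono of_nat_mono cardJ) auto
   finally show ?thesis .
  qed
  have e3: "emeasure (gauss_mat m n) ?U3 <= ennreal (real (n * n) * (sqrt 2 ^ DIM('a) * exp (- (\<eta> / 4) * k)))"
  proof -
   have "emeasure (gauss_mat m n) ?U3 <= (\<Sum>p\<in>idx n n. emeasure (gauss_mat m n) (S3 p))"
    using S3m by (intro emeasure_subadditive_finite) auto
   also have "... <= (\<Sum>p\<in>idx n n. ennreal (sqrt 2 ^ DIM('a) * exp (- (\<eta> / 4) * k)))"
    by (intro sum_mono S3e)
   also have "... = ennreal (real (n * n) * (sqrt 2 ^ DIM('a) * exp (- (\<eta> / 4) * k)))"
    by (simp add: ennreal_mult' ennreal_of_nat_eq_real_of_nat card_cartesian_product)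
   finally show ?thesis .
  qed
  have "emeasure (gauss_mat m n) (?U1 \<union> (?U2 \<union> ?U3))
   <= emeasure (gauss_mat m n) ?U1 + (emeasure (gauss_mat m n) ?U2 + emeasure (gauss_mat m n) ?U3)"
   using Um by (intro order.trans[OF emeasure_subadditive] add_left_mono emeasure_subadditive) auto
  also have "... <= ennreal (real n * (C * exp (- r * k))) + (ennreal (real (n * (n * DIM('a))) * (C * exp (- r * k)))
   + ennreal (real (n * n) * (sqrt 2 ^ DIM('a) * exp (- (\<eta> / 4) * k))))"
   by (intro add_mono e1 e2 e3)
  also have "... = ennreal (Bd k)"
   using r by (simp add: Bd_def ennreal_plus add.assoc)
  finally have bad: "emeasure (gauss_mat m n) (?U1 \<union> (?U2 \<union> ?U3)) <= ennreal (Bd k)" .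
  have "emeasure (gauss_mat m n) (good_gauss m n k \<eta> :: 'a fmat set) = 1 - emeasure (gauss_mat m n) (?U1 \<union> (?U2 \<union> ?U3))"
   unfolding eq using Um emeasure_space_1 by (subst emeasure_compl) (auto simp: emeasure_eq_measure)
  moreover have "(good_gauss m n k \<eta> :: 'a fmat set) \<in> sets (mat_space m n)"
   unfolding eq using Um by (auto simp: space_mat_space[symmetric] simp del: space_mat_space)
  ultimately show ?thesis
   using bad by (auto intro: ennreal_minus_mono)
 qed
 have "(Bd \<longlongrightarrow> real n * (C * 0) + real (n * (n * DIM('a))) * (C * 0) + real (n * n) * (sqrt 2 ^ DIM('a) * 0)) at_top"
 proof -
  have ex: "((%k. exp (- s * k)) \<longlongrightarrow> 0) at_top" if "s > 0" for s :: real
  proof -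
   have "filterlim (%k. s * k) at_top at_top"
    by (rule filterlim_tendsto_pos_mult_at_top[OF tendsto_const that filterlim_ident])
   then have "filterlim (%k. - s * k) at_bot at_top"
    by (simp add: filterlim_uminus_at_bot)
   then show ?thesis by (rule filterlim_compose[OF exp_at_bot])
  qed
  show ?thesis
   unfolding Bd_def by (intro tendsto_add tendsto_mult tendsto_const ex) (use r \<eta> in auto)
 qed
 then have "((%m. Bd (kappa DIM('a) n m)) \<longlongrightarrow> 0) sequentially"
  by (intro filterlim_compose[OF _ kappa_at_top]) (simp_all add: Suc_leI)
 then have "\<forall>\<^sub>F m in sequentially. Bd (kappa DIM('a) n m) < 1 / 2"
  by (rule order_tendstoD) simp
 then show ?thesis
  using eventually_ge_at_top[of n]
 proof eventually_elim
  case (elim m)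
  have "ennreal (1 / 2) = 1 - ennreal (1 / 2)"
   using ennreal_minus[of "1 / 2" 1] by (simp del: ennreal_minus)
  also have "... <= 1 - ennreal (Bd (kappa DIM('a) n m))"
   using elim(1) by (intro ennreal_minus_mono ennreal_leI) auto
  finally show ?case
   using good[OF elim(2) refl] by (auto intro: order.trans)
 qed
qed

section \<open>Matrices close to isometries\<close>

text \<open>Matrices whose columns are orthonormal up to \<open>\<delta>\<close>. At scale \<open>1 / \<kappa>\<close> a Gaussian matrix with suitable column variances
  lies here with high probability.\<close>

definition near_iso :: "nat => nat => real => ('a::real_complex_quat) fmat set" where
 "near_iso m n \<delta> = {z \<in> mats m n. \<forall>j<n. \<forall>l<n. norm (gram m n z (j, l) - (if j = l then 1 else 0)) <= \<delta>}"

lemma sets_near_iso [measurable]: "near_iso m n \<delta> \<in> sets (mat_space m n :: ('a::real_complex_quat) fmat measure)"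
proof -
 have idm: "(%g. g) \<in> mat_space m n \<rightarrow>\<^sub>M (mat_space m n :: 'a fmat measure)"
  by (rule measurable_ident_sets) simp
 have gm: "(%z. gram m n z) \<in> mat_space m n \<rightarrow>\<^sub>M (mat_space n n :: 'a fmat measure)"
  unfolding gram_def by (intro measurable_mat_mult measurable_mat_adj idm)
 have mem: "{z \<in> space (mat_space m n). norm (gram m n z (j, l) - (if j = l then 1 else (0::'a))) <= \<delta>} \<in> sets (mat_space m n)"
  if "j < n" "l < n" for j l
 proof -
  have [measurable]: "(%z. gram m n z (j, l)) \<in> borel_measurable (mat_space m n :: 'a fmat measure)"
   by (rule measurable_mat_entry[OF gm that])
  show ?thesis by measurable
 qed
 have "{z \<in> space (mat_space m n). \<forall>j\<in>{..<n}. \<forall>l\<in>{..<n}. norm (gram m n z (j, l) - (if j = l then 1 else (0::'a))) <= \<delta>}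
   \<in> sets (mat_space m n)"
  by (intro sets.sets_Collect_finite_All finite_lessThan mem) (simp_all only: lessThan_iff)
 then show ?thesis
  by (simp only: near_iso_def space_mat_space lessThan_iff Ball_def)
qed

lemma gram_unitary_left:
 "U \<in> \<U> m ==> z \<in> mats m n ==> gram m n (mat_mult m m n U z) = gram m n z"
 by (simp add: gram_def mat_adj_mult mat_mult_assoc unitary_cancel)

lemma near_iso_unitary_left:
 "U \<in> \<U> m ==> z \<in> mats m n ==> mat_mult m m n U z \<in> near_iso m n \<delta> \<longleftrightarrow> z \<in> near_iso m n \<delta>"
 by (simp add: near_iso_def gram_unitary_left)

lemma near_iso_col_sq:
 assumes "z \<in> near_iso m n \<delta>" "j < n"
 shows "\<bar>col_sq m z j - 1\<bar> <= \<delta>"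
proof -
 have "\<forall>j<n. \<forall>l<n. norm (gram m n z (j, l) - (if j = l then 1 else 0)) <= \<delta>"
  using assms(1) by (simp add: near_iso_def)
 from this[rule_format, OF assms(2) assms(2)] have "norm (of_real (col_sq m z j - 1) :: 'a) <= \<delta>"
  using assms(2) by (simp add: gram_diag)
 then show ?thesis by (simp only: norm_of_real)
qed

lemma near_iso_polar:
 fixes z :: "('a::real_complex_quat) fmat"
 assumes "n <= m" "z \<in> near_iso m n \<delta>" "\<delta> >= 0"
 obtains W where "W \<in> \<U> m"
  "mat_norm m n (mat_minus m n z (mat_mult m m n W (iso_mat m n))) <= real n * \<delta>"
proof -
 have z: "z \<in> mats m n" using assms by (simp add: near_iso_def)
 define a where "a = sing_vals m n z"
 obtain U V where UV: "U \<in> \<U> m" "V \<in> \<U> n" "z = usv m n U a V" "a \<in> chamber_B n"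
  using svd_sing_vals[OF z assms(1)] unfolding a_def .
 define b where "b i = a i - 1" for i
 define c where "c i = a i * a i - 1" for i
 define W where "W = mat_mult m m m U (block_embed m n (mat_adj n n V))"
 have W: "W \<in> \<U> m"
  unfolding W_def using UV assms(1) by (intro unitary_mult unitary_block_embed unitary_adj)
 have sm: "mat_minus m n (sigma_mat m n f) (sigma_mat m n g) = sigma_mat m n (%i. f i - g i)" for m f g
  by (rule mat_eqI[of _ m n]) auto
 have lin: "mat_minus m n (usv m n U' f V) (usv m n U' g V) = usv m n U' (%i. f i - g i) V" for m U' f g
 proof -
  have neg: "mat_scale m n (-1) (usv m n U' g V) = usv m n U' (%i. - g i) V"
  proof -
   have "sigma_mat m n (%i. - g i) = mat_scale m n (-1) (sigma_mat m n g :: 'a fmat)"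
    by (rule mat_eqI[of _ m n]) auto
   moreover have "mat_mult m m n U' (mat_scale m n (-1) X) = mat_scale m n (-1) (mat_mult m m n U' X)" for X
    by (rule mat_eqI[of _ m n]) (auto simp: sum_negf)
   moreover have "mat_mult m n n (mat_scale m n (-1) X) Y = mat_scale m n (-1) (mat_mult m n n X Y)" for X Y :: "'a fmat"
    by (rule mat_eqI[of _ m n]) (auto simp: sum_negf)
   ultimately show ?thesis by simp
  qed
  have add: "mat_add m n (sigma_mat m n f) (sigma_mat m n (%i. - g i)) = (sigma_mat m n (%i. f i - g i) :: 'a fmat)"
   by (rule mat_eqI[of _ m n]) auto
  show ?thesis
   unfolding neg mat_mult_add_left[symmetric] mat_mult_add_right[symmetric] add ..
 qed
 have gram: "gram m n z = usv n n V (%i. a i * a i) V"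
  unfolding gram_def UV(3) gram_usv[OF assms(1) UV(1)] using UV(2) by (simp add: mat_adj_adj unitaryD)
 have one: "mat_one n = usv n n V (%_. 1) V"
 proof -
  have "(sigma_mat n n (%_. 1) :: 'a fmat) = mat_one n" by (rule mat_eqI[of _ n n]) auto
  then show ?thesis using UV(2) by (simp add: mat_mult_one_right unitaryD)
 qed
 have "L2_set c {..<n} = mat_norm n n (mat_minus n n (gram m n z) (mat_one n))"
  unfolding gram one lin using UV(2)
  by (simp add: mat_norm_unitary_right unitary_adj mat_norm_unitary_left mat_norm_sigma c_def[abs_def])
 moreover have "mat_norm n n (mat_minus n n (gram m n z) (mat_one n)) <= real n * \<delta>"
 proof (rule power2_le_imp_le)
  have "(mat_norm n n (mat_minus n n (gram m n z) (mat_one n)))^2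
   = (\<Sum>i<n. \<Sum>j<n. (norm (gram m n z (i, j) - (if i = j then 1 else 0)))\<^sup>2)"
   unfolding mat_norm_sq by (intro sum.cong refl) (auto simp: if_distrib)
  also have "... <= (\<Sum>i<n. \<Sum>j<n. \<delta>\<^sup>2)"
   using assms(2) by (intro sum_mono power_mono) (auto simp: near_iso_def)
  also have "... = (real n * \<delta>)^2" by (simp add: power2_eq_square)
  finally show "(mat_norm n n (mat_minus n n (gram m n z) (mat_one n)))^2 <= (real n * \<delta>)^2" .
 qed (use assms(3) in simp)
 moreover have "mat_norm m n (mat_minus m n z (mat_mult m m n W (iso_mat m n))) = L2_set b {..<n}"
 proof -
  have "mat_mult m m n W (iso_mat m n) = usv m n U (%_. 1) V"
   unfolding W_def using assms(1) by (simp add: mat_mult_assoc block_embed_iso)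
  then have "mat_minus m n z (mat_mult m m n W (iso_mat m n)) = usv m n U b V"
   unfolding UV(3) by (simp only: lin b_def[abs_def])
  then show ?thesis
   using UV(1,2) assms(1) by (simp add: mat_norm_unitary_right unitary_adj mat_norm_unitary_left mat_norm_sigma)
 qed
 moreover have "L2_set b {..<n} <= L2_set c {..<n}"
 proof -
  have "L2_set b {..<n} = L2_set (%i. \<bar>b i\<bar>) {..<n}" by (simp add: L2_set_def)
  also have "... <= L2_set (%i. \<bar>c i\<bar>) {..<n}"
  proof (rule L2_set_mono)
   fix i assume "i \<in> {..<n}"
   then have ai: "0 <= a i" using UV(4) by (auto simp: mem_chamber_B_iff)
   have "\<bar>c i\<bar> = \<bar>a i - 1\<bar> * \<bar>a i + 1\<bar>"
    unfolding abs_mult[symmetric] c_def by (simp add: algebra_simps)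
   then show "\<bar>b i\<bar> <= \<bar>c i\<bar>"
    using ai mult_left_mono[of 1 "\<bar>a i + 1\<bar>" "\<bar>a i - 1\<bar>"] by (simp add: b_def)
  qed auto
  also have "... = L2_set c {..<n}" by (simp add: L2_set_def)
  finally show ?thesis .
 qed
 ultimately show ?thesis
  using that[OF W] by linarith
qed

text \<open>On the set of matrices close to isometries, the average over the unitary group is close to the
  average \<^const>\<open>haar_K\<close> over the Stiefel manifold.\<close>

lemma haar_near_iso:
 fixes z :: "('a::real_complex_quat) fmat" and \<mu> :: "'a fmat measure"
 assumes \<mu>: "normalized_haar m \<mu>" and "n <= m" "z \<in> near_iso m n \<delta>" "\<delta> >= 0" "k >= 0"
 shows "eexp (- k * real n * \<delta> * L2_set d {..<n}) * haar_K \<mu> m n k d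
   <= (\<integral>\<^sup>+U. eexp (kexp m n k d U z) \<partial>\<mu>)" (is ?lower)
  and "(\<integral>\<^sup>+U. eexp (kexp m n k d U z) \<partial>\<mu>)
   <= eexp (k * real n * \<delta> * L2_set d {..<n}) * haar_K \<mu> m n k d" (is ?upper)
proof -
 have z: "z \<in> mats m n" using assms by (simp add: near_iso_def)
 obtain W where W: "W \<in> \<U> m"
  and near: "mat_norm m n (mat_minus m n z (mat_mult m m n W (iso_mat m n))) <= real n * \<delta>"
  using near_iso_polar[OF assms(2-4)] .
 define R where "R = mat_minus m n z (mat_mult m m n W (iso_mat m n))"
 define X where "X U = mat_inner m n (sigma_mat m n d) (mat_mult m m n (mat_mult m m m U W) (iso_mat m n))" for U
 define e where "e = k * real n * \<delta> * L2_set d {..<n}"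
 have zW: "z = mat_add m n (mat_mult m m n W (iso_mat m n)) R"
  unfolding R_def by (rule mat_minus_split[OF z])
 have diff: "\<bar>kexp m n k d U z - k * X U\<bar> <= e" if U: "U \<in> \<U> m" for U
 proof -
  have eq: "mat_inner m n (sigma_mat m n d) (mat_mult m m n U z) = X U + mat_inner m n (sigma_mat m n d) (mat_mult m m n U R)"
   by (subst zW) (simp add: mat_mult_add_right mat_inner_add_right X_def mat_mult_assoc)
  have "\<bar>mat_inner m n (sigma_mat m n d) (mat_mult m m n U R)\<bar> <= L2_set d {..<n} * (real n * \<delta>)"
  proof -
   have "\<bar>mat_inner m n (sigma_mat m n d) (mat_mult m m n U R)\<bar>
    <= mat_norm m n (sigma_mat m n d :: 'a fmat) * mat_norm m n (mat_mult m m n U R)"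
    by (rule mat_inner_le)
   also have "... <= L2_set d {..<n} * (real n * \<delta>)"
    using near U assms(2) by (simp add: mat_norm_unitary_left R_def mat_norm_sigma mult_left_mono)
   finally show ?thesis .
  qed
  from mult_left_mono[OF this \<open>k >= 0\<close>]
  have "k * \<bar>mat_inner m n (sigma_mat m n d) (mat_mult m m n U R)\<bar> <= e"
   by (simp add: e_def mult_ac)
  then have "\<bar>kexp m n k d U R\<bar> <= e"
   using \<open>k >= 0\<close> by (simp only: abs_mult abs_of_nonneg)
  with eq show ?thesis
   by (simp only: distrib_left add_diff_cancel_left')
 qed
 have Xint: "(\<integral>\<^sup>+U. eexp (k * X U) \<partial>\<mu>) = haar_K \<mu> m n k d"
 proof -
  have "(\<integral>\<^sup>+U. eexp (k * X U) \<partial>\<mu>)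
   = (\<integral>\<^sup>+U. eexp (k * mat_inner m n (sigma_mat m n d) (mat_mult m m n (mat_mult m m m (mat_mult m m m (mat_one m) U) W) (iso_mat m n))) \<partial>\<mu>)"
   by (intro nn_integral_cong) (simp add: X_def haar_space[OF \<mu>] mat_mult_one_left unitaryD)
  also have "... = haar_K \<mu> m n k d"
   unfolding haar_K_def by (rule haar_exp_two_sided[OF \<mu> _ _ unitary_one W]) auto
  finally show ?thesis .
 qed
 have Xm: "(%U. eexp (k * X U)) \<in> borel_measurable \<mu>"
  unfolding X_def mat_mult_assoc by (rule measurable_haar_exp[OF \<mu>]) auto
 have "eexp (- e) * haar_K \<mu> m n k d = (\<integral>\<^sup>+U. eexp (- e) * eexp (k * X U) \<partial>\<mu>)"
  by (subst nn_integral_cmult[OF Xm]) (simp add: Xint)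
 also have "... <= (\<integral>\<^sup>+U. eexp (kexp m n k d U z) \<partial>\<mu>)"
 proof (intro nn_integral_mono)
  fix U assume "U \<in> space \<mu>"
  then have "- e + k * X U <= kexp m n k d U z"
   using diff[of U] haar_space[OF \<mu>] by auto
  then show "eexp (- e) * eexp (k * X U) <= eexp (kexp m n k d U z)"
   by (simp add: ennreal_mult[symmetric] exp_add[symmetric])
 qed
 finally show ?lower by (simp add: e_def)
 have "(\<integral>\<^sup>+U. eexp (kexp m n k d U z) \<partial>\<mu>)
   <= (\<integral>\<^sup>+U. ennreal (exp e) * eexp (k * X U) \<partial>\<mu>)"
 proof (intro nn_integral_mono)
  fix U assume "U \<in> space \<mu>"
  then have "kexp m n k d U z <= e + k * X U"
   using diff[of U] haar_space[OF \<mu>] by auto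
  then show "eexp (kexp m n k d U z) <= ennreal (exp e) * eexp (k * X U)"
   by (simp add: ennreal_mult[symmetric] exp_add[symmetric])
 qed
 also have "... = ennreal (exp e) * haar_K \<mu> m n k d"
  by (subst nn_integral_cmult[OF Xm]) (simp add: Xint)
 finally show ?upper by (simp add: e_def)
qed

section \<open>Exponential asymptotics of the Stiefel average\<close>

definition gauss_col :: "nat => nat => (nat => real) => real => ('a::real_complex_quat) fmat => 'a fmat => 'a fmat" where
 "gauss_col m n T k A = mat_affine m n A (%p. sqrt (T (snd p) / k))"

lemma gauss_col_mats [simp]: "gauss_col m n T k A g \<in> mats m n"
 by (simp add: gauss_col_def)

lemma gauss_col_entry:
 "i < m ==> j < n ==> gauss_col m n T k A g (i, j) = A (i, j) + sqrt (T j / k) *\<^sub>R g (i, j)"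
 by (simp add: gauss_col_def)

lemma measurable_gauss_col [measurable (raw)]:
 "f \<in> M \<rightarrow>\<^sub>M mat_space m n ==> (%x. gauss_col m n T k A (f x)) \<in> M \<rightarrow>\<^sub>M mat_space m n"
 unfolding gauss_col_def by (rule measurable_mat_affine)

lemma gram_gauss_col:
 fixes g :: "('a::real_complex_quat) fmat"
 assumes "n <= m" "j < n" "l < n"
 shows "gram m n (gauss_col m n T k (sigma_mat m n a) g) (j, l) =
  (if j = l then of_real (a j * a j) else 0) + (a j * sqrt (T l / k)) *\<^sub>R g (j, l)
  + (a l * sqrt (T j / k)) *\<^sub>R conjugation (g (l, j)) + (sqrt (T j / k) * sqrt (T l / k)) *\<^sub>R gram m n g (j, l)"
proof -
 define u v where "u = sqrt (T j / k)" and "v = sqrt (T l / k)"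
 have "gram m n (gauss_col m n T k (sigma_mat m n a) g) (j, l)
  = (\<Sum>i<m. (if i = j then (if j = l then of_real (a j * a j) else 0) + (a j * v) *\<^sub>R g (j, l) else 0)
    + (if i = l then (a l * u) *\<^sub>R conjugation (g (l, j)) else 0)
    + (u * v) *\<^sub>R (conjugation (g (i, j)) * g (i, l)))"
  unfolding gram_entry[OF assms(2,3)]
 proof (intro sum.cong refl)
  fix i assume "i \<in> {..<m}"
  then show "conjugation (gauss_col m n T k (sigma_mat m n a) g (i, j)) * gauss_col m n T k (sigma_mat m n a) g (i, l)
   = (if i = j then (if j = l then of_real (a j * a j) else 0) + (a j * v) *\<^sub>R g (j, l) else 0)
    + (if i = l then (a l * u) *\<^sub>R conjugation (g (l, j)) else 0)
    + (u * v) *\<^sub>R (conjugation (g (i, j)) * g (i, l))"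
   using assms by (simp add: gauss_col_entry u_def[symmetric] v_def[symmetric] conjugation_add conjugation_scaleR)
    (simp add: of_real_def conjugation_scaleR algebra_simps)
 qed
 also have "... = (if j = l then of_real (a j * a j) else 0) + (a j * v) *\<^sub>R g (j, l)
  + (a l * u) *\<^sub>R conjugation (g (l, j)) + (u * v) *\<^sub>R gram m n g (j, l)"
  using assms by (simp add: sum.distrib gram_entry scaleR_sum_right[symmetric])
 finally show ?thesis by (simp add: u_def v_def)
qed

lemma good_gauss_gram:
 fixes g :: "('a::real_complex_quat) fmat"
 assumes g: "g \<in> good_gauss m n k \<eta>" and jl: "j < n" "l < n" and k: "k > 0" and \<eta>: "\<eta> >= 0"
 shows "norm (gram m n g (j, l) - (if j = l then of_real (2 * k) else 0)) <= 2 * real DIM('a) * \<eta> * k"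
proof (cases "j = l")
 case True
 have "norm (of_real (col_sq m g j - 2 * k) :: 'a) <= \<eta> * k"
  unfolding norm_of_real using g jl by (auto simp: good_gauss_def)
 also have "... <= 2 * real DIM('a) * \<eta> * k"
 proof -
  have "1 <= real DIM('a)" by (simp add: Suc_leI)
  then have "1 <= 2 * real DIM('a)" by linarith
  then have "1 * (\<eta> * k) <= 2 * real DIM('a) * (\<eta> * k)"
   using k \<eta> by (intro mult_right_mono) auto
  then show ?thesis by (simp only: mult_1 mult.assoc)
 qed
 finally show ?thesis using True jl by (simp add: gram_diag)
next
 case False
 have b: "\<bar>gram m n g (j, l) \<bullet> b\<bar> <= 2 * \<eta> * k" if "b \<in> Basis" for b
 proof -
  have "col_sq m (mat_mult m n n g (mixing_rotation n l j b)) l = (col_sq m g l + col_sq m g j) / 2 - b \<bullet> gram m n g (j, l)"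
   using col_sq_mixing[OF jl(2,1) _ that] False by auto
  moreover have "\<bar>col_sq m (mat_mult m n n g (mixing_rotation n l j b)) l - 2 * k\<bar> <= \<eta> * k"
   using g jl False that unfolding good_gauss_def by blast
  moreover have "\<bar>col_sq m g j - 2 * k\<bar> <= \<eta> * k" "\<bar>col_sq m g l - 2 * k\<bar> <= \<eta> * k"
   using g jl by (auto simp: good_gauss_def)
  ultimately show ?thesis by (simp add: inner_commute abs_le_iff algebra_simps)
 qed
 have "norm (gram m n g (j, l)) <= (\<Sum>b\<in>Basis. \<bar>gram m n g (j, l) \<bullet> b\<bar>)"
  by (rule norm_le_l1)
 also have "... <= (\<Sum>b\<in>(Basis :: 'a set). 2 * \<eta> * k)"
  by (intro sum_mono b)
 finally show ?thesis using False by simp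
qed

abbreviation shift_col where
 "shift_col m n T k d \<equiv> gauss_col m n T k (sigma_mat m n (%j. T j * d j))"

lemma good_gauss_near_iso:
 fixes g :: "('a::real_complex_quat) fmat"
 assumes "n <= m" and g: "g \<in> good_gauss m n k \<eta>" and k: "k > 0" and \<eta>: "\<eta> >= 0"
  and T: "!!j. j < n ==> 0 < T j & T j <= 1 / 2 & 0 <= d j & 2 * T j + (T j * d j)^2 = 1"
  and \<delta>: "real DIM('a) * \<eta> + 2 * sqrt \<eta> <= \<delta>"
 shows "shift_col m n T k d g \<in> near_iso m n \<delta>"
proof -
 have "norm (gram m n (shift_col m n T k d g) (j, l) - (if j = l then 1 else 0)) <= \<delta>"
  if jl: "j < n" "l < n" for j l
 proof -
  define u where "u j = sqrt (T j / k)" for j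
  define a where "a j = T j * d j" for j
  have a: "0 <= a j" "a j <= 1" if "j < n" for j
  proof -
   show "0 <= a j" using T[OF that] by (simp add: a_def)
   have "(a j)^2 <= 1\<^sup>2" using T[OF that] by (simp add: a_def)
   then show "a j <= 1" by (rule power2_le_imp_le) simp
  qed
  have u: "0 <= u j" "u j * sqrt (\<eta> * k) <= sqrt \<eta>" "u j * u j = T j / k" if "j < n" for j
  proof -
   show "0 <= u j" "u j * u j = T j / k" using T[OF that] k by (simp_all add: u_def)
   have "u j * sqrt (\<eta> * k) = sqrt (T j * \<eta>)"
    using k by (simp add: u_def real_sqrt_mult[symmetric])
   also have "... <= sqrt (1 * \<eta>)"
    using T[OF that] \<eta> by (intro real_sqrt_le_mono mult_right_mono) auto
   finally show "u j * sqrt (\<eta> * k) <= sqrt \<eta>" by simp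
  qed
  have ge: "norm (g (i, j)) <= sqrt (\<eta> * k)" if "i < n" "j < n" for i j
   using g that by (auto simp: good_gauss_def intro!: real_le_rsqrt)
  have X: "norm ((a i * u j) *\<^sub>R x) <= sqrt \<eta>" if "i < n" "j < n" "norm x <= sqrt (\<eta> * k)" for i j and x :: 'a
  proof -
   have "norm ((a i * u j) *\<^sub>R x) = a i * (u j * norm x)"
    using a[OF that(1)] u[OF that(2)] by (simp add: abs_mult)
   also have "... <= 1 * (u j * sqrt (\<eta> * k))"
    using a[OF that(1)] u[OF that(2)] that(3) by (intro mult_mono) auto
   also have "... <= sqrt \<eta>" using u[OF that(2)] by simp
   finally show ?thesis .
  qed
  have Y: "norm ((u j * u l) *\<^sub>R (gram m n g (j, l) - (if j = l then of_real (2 * k) else 0))) <= real DIM('a) * \<eta>"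
  proof -
   have "(u j * u l)^2 <= (1 / (2 * k))^2"
   proof -
    have "(u j * u l)^2 = (T j / k) * (T l / k)"
     using u(3)[OF jl(1)] u(3)[OF jl(2)] by (simp add: power2_eq_square mult_ac)
    also have "... <= (1 / 2 / k) * (1 / 2 / k)"
     using T[OF jl(1)] T[OF jl(2)] k by (intro mult_mono divide_right_mono) auto
    finally show ?thesis by (simp add: power2_eq_square)
   qed
   then have "u j * u l <= 1 / (2 * k)"
    by (rule power2_le_imp_le) (use k in simp)
   then have "norm ((u j * u l) *\<^sub>R (gram m n g (j, l) - (if j = l then of_real (2 * k) else 0)))
    <= 1 / (2 * k) * (2 * real DIM('a) * \<eta> * k)"
    using u(1)[OF jl(1)] u(1)[OF jl(2)] good_gauss_gram[OF g jl k \<eta>] k unfolding norm_scaleR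
    by (intro mult_mono) auto
   also have "... = real DIM('a) * \<eta>" using k by simp
   finally show ?thesis .
  qed
  have Z: "gram m n (gauss_col m n T k (sigma_mat m n a) g) (j, l) - (if j = l then 1 else 0)
   = (a j * u l) *\<^sub>R g (j, l) + (a l * u j) *\<^sub>R conjugation (g (l, j))
    + (u j * u l) *\<^sub>R (gram m n g (j, l) - (if j = l then of_real (2 * k) else 0))"
  proof (cases "j = l")
   case True
   have "a j * a j + u j * u j * (2 * k) = 1"
    using T[OF jl(1)] u(3)[OF jl(1)] k by (simp add: a_def power2_eq_square)
   then have "of_real (a j * a j) + of_real (u j * u j * (2 * k)) = (1 :: 'a)"
    by (metis of_real_1 of_real_add)
   then have "(1 :: 'a) = of_real (a j * a j) + (u j * u j) *\<^sub>R of_real (2 * k)"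
    by (simp add: scaleR_conv_of_real)
   then have one: "1 = of_real (a j * a j) + (u j * u l) *\<^sub>R (of_real (2 * k) :: 'a)"
    using True by simp
   have rearrange: "A + X + Y + B - 1 = X + Y + (B - C)" if "1 = A + C" for A B C X Y :: 'a
    unfolding that by simp
   show ?thesis
    unfolding gram_gauss_col[OF assms(1) jl] u_def[symmetric] if_P[OF True] scaleR_diff_right
    by (rule rearrange[OF one])
  next
   case False
   then show ?thesis
    by (simp add: gram_gauss_col[OF assms(1) jl] u_def[symmetric])
  qed
  have "norm (gram m n (gauss_col m n T k (sigma_mat m n a) g) (j, l) - (if j = l then 1 else 0))
   <= sqrt \<eta> + sqrt \<eta> + real DIM('a) * \<eta>"
   unfolding Z by (intro norm_triangle_mono X Y jl) (simp_all add: ge jl)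
  then show ?thesis
   using \<delta> unfolding a_def[abs_def] by linarith
 qed
 then show ?thesis by (simp add: near_iso_def)
qed

lemma gauss_near_iso_prob:
 assumes n: "n >= 1" and \<delta>: "\<delta> > 0"
 shows "\<forall>\<^sub>F m in sequentially. \<forall>T d. (\<forall>j<n. 0 < T j & T j <= 1 / 2 & 0 <= d j & 2 * T j + (T j * d j)^2 = 1) -->
  ennreal (1 / 2) <= (\<integral>\<^sup>+g. indicator (near_iso m n \<delta>)
   (shift_col m n T (kappa DIM('a) n m) d g) \<partial>(gauss_mat m n :: ('a::real_complex_quat) fmat measure))"
proof -
 define D where "D = real DIM('a) + 2"
 define \<eta> where "\<eta> = (min 1 (\<delta> / D))^2"
 have D: "D > 0" by (simp add: D_def)
 have \<eta>: "\<eta> > 0" using \<delta> D by (auto simp: \<eta>_def min_def)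
 have s: "sqrt \<eta> = min 1 (\<delta> / D)" unfolding \<eta>_def using \<delta> D by (intro real_sqrt_unique) auto
 have "\<eta> = sqrt \<eta> * sqrt \<eta>" using \<eta> by simp
 also have "... <= sqrt \<eta> * 1" by (intro mult_left_mono) (use s \<eta> \<delta> D in auto)
 finally have "real DIM('a) * \<eta> + 2 * sqrt \<eta> <= D * sqrt \<eta>"
  by (simp add: D_def distrib_right mult_left_mono)
 also have "... <= D * (\<delta> / D)" using s D by (intro mult_left_mono) auto
 finally have \<eta>\<delta>: "real DIM('a) * \<eta> + 2 * sqrt \<eta> <= \<delta>" using D by simp
 have "\<forall>\<^sub>F m in sequentially. 0 < kappa DIM('a) n m"
  using kappa_at_top[of "DIM('a)" n] by (simp add: filterlim_at_top_dense Suc_leI)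
 with gauss_good_prob[OF n \<eta>, where 'a='a] show ?thesis
  using eventually_ge_at_top[of n]
 proof (eventually_elim, intro allI impI)
  fix m :: nat and T d :: "nat => real"
  assume good: "(good_gauss m n (kappa DIM('a) n m) \<eta> :: 'a fmat set) \<in> sets (mat_space m n) &
   ennreal (1 / 2) <= emeasure (gauss_mat m n) (good_gauss m n (kappa DIM('a) n m) \<eta> :: 'a fmat set)"
   and k: "0 < kappa DIM('a) n m" and mn: "n <= m"
   and T: "\<forall>j<n. 0 < T j & T j <= 1 / 2 & 0 <= d j & 2 * T j + (T j * d j)^2 = 1"
  have "emeasure (gauss_mat m n) (good_gauss m n (kappa DIM('a) n m) \<eta> :: 'a fmat set)
   = (\<integral>\<^sup>+g. indicator (good_gauss m n (kappa DIM('a) n m) \<eta>) g \<partial>(gauss_mat m n :: 'a fmat measure))"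
   using good by simp
  also have "... <= (\<integral>\<^sup>+g. indicator (near_iso m n \<delta>)
   (shift_col m n T (kappa DIM('a) n m) d g) \<partial>(gauss_mat m n :: 'a fmat measure))"
  proof (rule nn_integral_mono)
   fix g :: "'a fmat"
   have "shift_col m n T (kappa DIM('a) n m) d g \<in> near_iso m n \<delta>"
    if "g \<in> good_gauss m n (kappa DIM('a) n m) \<eta>"
    by (rule good_gauss_near_iso[OF mn that k _ _ \<eta>\<delta>]) (use T \<eta> in auto)
   then show "indicator (good_gauss m n (kappa DIM('a) n m) \<eta>) g <= (indicator (near_iso m n \<delta>)
     (shift_col m n T (kappa DIM('a) n m) d g) :: ennreal)"
    by (simp add: indicator_def)
  qed
  finally show "ennreal (1 / 2) <= (\<integral>\<^sup>+g. indicator (near_iso m n \<delta>)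
   (shift_col m n T (kappa DIM('a) n m) d g) \<partial>(gauss_mat m n :: 'a fmat measure))"
   using good by (auto intro: order.trans)
 qed
qed

definition near_prob :: "'a::real_complex_quat itself => nat => nat => real => real => (nat => real) => ennreal" where
 "near_prob _ m n \<delta> k T = (\<integral>\<^sup>+g. indicator (near_iso m n \<delta>) (gauss_col m n T k (sigma_mat m n (%_. 0)) g)
  \<partial>(gauss_mat m n :: 'a fmat measure))"

lemma near_prob_le_1: "near_prob TYPE('a::real_complex_quat) m n \<delta> k T <= 1"
proof -
 interpret prob_space "gauss_mat m n :: 'a fmat measure" by (rule prob_space_gauss_mat)
 have "near_prob TYPE('a) m n \<delta> k T <= (\<integral>\<^sup>+g. 1 \<partial>(gauss_mat m n :: 'a fmat measure))"
  unfolding near_prob_def by (intro nn_integral_mono) (simp add: indicator_def)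
 then show ?thesis using emeasure_space_1 by simp
qed

lemma measurable_indicator_near:
 "(%g. indicator (near_iso m n \<delta>) (gauss_col m n T k A g) :: ennreal) \<in> borel_measurable (mat_space m n :: ('a::real_complex_quat) fmat measure)"
proof -
 have "(%g. gauss_col m n T k A g) \<in> mat_space m n \<rightarrow>\<^sub>M (mat_space m n :: 'a fmat measure)"
  by (intro measurable_gauss_col measurable_ident_sets refl)
 then show ?thesis
  by (rule measurable_compose) (rule borel_measurable_indicator[OF sets_near_iso])
qed

lemma prod_columns: "(\<Prod>p\<in>idx m n. f (snd p)) = (\<Prod>j<n. f j ^ m :: real)"
proof -
 have "(\<Prod>p\<in>idx m n. f (snd p)) = (\<Prod>i<m. \<Prod>j<n. f j)"
  by (simp only: prod.cartesian_product case_prod_beta' snd_conv)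
 then show ?thesis by (simp add: prod_power_distrib)
qed

lemma sum_columns: "(\<Sum>p\<in>idx m n. c (snd p) * (norm (g p))^2) = (\<Sum>j<n. c j * col_sq m g j)"
proof -
 have "(\<Sum>p\<in>idx m n. c (snd p) * (norm (g p))^2) = (\<Sum>i<m. \<Sum>j<n. c j * (norm (g (i, j)))^2)"
  by (simp only: sum.cartesian_product case_prod_beta' snd_conv prod.collapse)
 also have "... = (\<Sum>j<n. \<Sum>i<m. c j * (norm (g (i, j)))^2)" by (rule sum.swap)
 finally show ?thesis by (simp add: col_sq_def sum_distrib_left)
qed

abbreviation unit_col where
 "unit_col m n k \<equiv> gauss_col m n (%_. 1 / 2) k (sigma_mat m n (%_. 0))"

text \<open>The probability that the column-scaled Gaussian matrix is close to an isometry is compared with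
  the typical case in which all columns have variance 1/2.\<close>

lemma near_prob_ratio:
 assumes T: "!!j. j < n ==> 0 < T j" and k: "k > 0"
 shows "eexp (real (m * DIM('a)) / 2 * (\<Sum>j<n. ln (2 * T j))) * near_prob TYPE('a::real_complex_quat) m n \<delta> k T
  = (\<integral>\<^sup>+g. eexp (- k * (\<Sum>j<n. (1 / (2 * T j) - 1) * col_sq m (unit_col m n k g) j))
    * indicator (near_iso m n \<delta>) (unit_col m n k g)
   \<partial>(gauss_mat m n :: 'a fmat measure))"
proof -
 define s where "s p = sqrt (2 * T (snd p))" for p :: "nat \<times> nat"
 define F :: "'a fmat => ennreal" where
  "F g = indicator (near_iso m n \<delta>) (unit_col m n k g)" for g
 have spos: "s p > 0" if "p \<in> idx m n" for p using that T by (auto simp: s_def)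
 have "unit_col m n k (mat_affine m n (%_. 0) s g)
   = gauss_col m n T k (sigma_mat m n (%_. 0)) g" for g :: "'a fmat"
 proof (rule mat_eqI[of _ m n])
  fix i j assume ij: "i < m" "j < n"
  have "sqrt (1 / 2 / k) * sqrt (2 * T j) = sqrt (T j / k)"
   unfolding real_sqrt_mult[symmetric] by simp
  then show "unit_col m n k (mat_affine m n (%_. 0) s g) (i, j)
   = gauss_col m n T k (sigma_mat m n (%_. 0)) g (i, j)"
   using ij by (simp only: gauss_col_entry mat_affine_entry s_def snd_conv add_0 scaleR_scaleR)
 qed auto
 then have "(\<integral>\<^sup>+g. F (mat_affine m n (%_. 0) s g) \<partial>(gauss_mat m n :: 'a fmat measure)) = near_prob TYPE('a) m n \<delta> k T"
  unfolding near_prob_def F_def by simp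
 moreover have "(\<Prod>p\<in>idx m n. s p ^ DIM('a)) = exp (real (m * DIM('a)) / 2 * (\<Sum>j<n. ln (2 * T j)))"
 proof -
  have "(\<Prod>p\<in>idx m n. s p ^ DIM('a)) = (\<Prod>j<n. (sqrt (2 * T j) ^ DIM('a)) ^ m)"
   unfolding s_def by (rule prod_columns)
  also have "... = (\<Prod>j<n. exp (real (m * DIM('a)) / 2 * ln (2 * T j)))"
  proof (intro prod.cong refl)
   fix j assume "j \<in> {..<n}"
   then have t: "2 * T j > 0" using T by simp
   have "(sqrt (2 * T j) ^ DIM('a)) ^ m = exp (ln (sqrt (2 * T j))) ^ (m * DIM('a))"
    using t by (simp add: power_mult[symmetric] mult.commute)
   also have "... = exp (real (m * DIM('a)) * ln (sqrt (2 * T j)))"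
    by (simp only: exp_of_nat_mult)
   finally show "(sqrt (2 * T j) ^ DIM('a)) ^ m = exp (real (m * DIM('a)) / 2 * ln (2 * T j))"
    using t by (simp add: ln_sqrt)
  qed
  finally show ?thesis by (simp add: exp_sum sum_distrib_left)
 qed
 moreover have "(\<Sum>p\<in>idx m n. (1 - 1 / (s p)^2) * (norm (g p))^2) / 2
   = - k * (\<Sum>j<n. (1 / (2 * T j) - 1) * col_sq m (unit_col m n k g) j)" for g :: "'a fmat"
 proof -
  have "(\<Sum>p\<in>idx m n. (1 - 1 / (s p)^2) * (norm (g p))^2) = (\<Sum>p\<in>idx m n. (1 - 1 / (2 * T (snd p))) * (norm (g p))^2)"
   using T by (intro sum.cong refl) (auto simp: s_def less_imp_le)
  also have "... = (\<Sum>j<n. (1 - 1 / (2 * T j)) * col_sq m g j)"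
   by (rule sum_columns)
  also have "... = (\<Sum>j<n. (1 - 1 / (2 * T j)) * (2 * k * col_sq m (unit_col m n k g) j))"
  proof (intro sum.cong refl)
   fix j assume j: "j \<in> {..<n}"
   have "(norm (unit_col m n k g (i, j)))^2 = (norm (g (i, j)))^2 / (2 * k)"
    if "i < m" for i
    using that j k by (simp add: gauss_col_entry power_mult_distrib power_divide real_sqrt_divide)
   then have "2 * k * col_sq m (unit_col m n k g) j = col_sq m g j"
    unfolding col_sq_def using k by (simp add: sum_divide_distrib[symmetric])
   then show "(1 - 1 / (2 * T j)) * col_sq m g j = (1 - 1 / (2 * T j)) * (2 * k * col_sq m (unit_col m n k g) j)"
    by (simp only:)
  qed
  finally have "(\<Sum>p\<in>idx m n. (1 - 1 / (s p)^2) * (norm (g p))^2) / 2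
   = (\<Sum>j<n. (1 - 1 / (2 * T j)) * (2 * k * col_sq m (unit_col m n k g) j) / 2)"
   by (simp only: sum_divide_distrib)
  also have "... = (\<Sum>j<n. - k * ((1 / (2 * T j) - 1) * col_sq m (unit_col m n k g) j))"
  proof (intro sum.cong refl)
   have "(1 - r) * (2 * k * x) / 2 = - k * ((r - 1) * x)" for r x :: real
    by (simp add: field_simps)
   then show "(1 - 1 / (2 * T j)) * (2 * k * col_sq m (unit_col m n k g) j) / 2
    = - k * ((1 / (2 * T j) - 1) * col_sq m (unit_col m n k g) j)" for j .
  qed
  finally show ?thesis by (simp only: sum_distrib_left)
 qed
 ultimately show ?thesis
  using nn_integral_gauss_scale[of F m n s] spos measurable_indicator_near
  unfolding F_def by simp
qed

lemma near_prob_upper: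
 assumes T: "!!j. j < n ==> 0 < T j & T j <= 1 / 2" and k: "k > 0"
 shows "near_prob TYPE('a::real_complex_quat) m n \<delta> k T
  <= eexp (- k * (\<Sum>j<n. (1 / (2 * T j) - 1) * (1 - \<delta>)) - real (m * DIM('a)) / 2 * (\<Sum>j<n. ln (2 * T j)))"
proof -
 have T1: "!!j. j < n ==> 0 < T j" using T by blast
 define L where "L = real (m * DIM('a)) / 2 * (\<Sum>j<n. ln (2 * T j))"
 define E where "E = exp (- k * (\<Sum>j<n. (1 / (2 * T j) - 1) * (1 - \<delta>)))"
 let ?g = "unit_col m n k :: 'a fmat => 'a fmat"
 have ratio: "eexp (real (m * DIM('a)) / 2 * (\<Sum>j<n. ln (2 * T j))) * near_prob TYPE('a) m n \<delta> k T
  = (\<integral>\<^sup>+g. eexp (- k * (\<Sum>j<n. (1 / (2 * T j) - 1) * col_sq m (?g g) j))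
    * indicator (near_iso m n \<delta>) (?g g) \<partial>(gauss_mat m n :: 'a fmat measure))"
  by (rule near_prob_ratio[OF T1 k])
 have "ennreal (exp L) * near_prob TYPE('a) m n \<delta> k T
  <= (\<integral>\<^sup>+g. ennreal E * indicator (near_iso m n \<delta>) (?g g) \<partial>(gauss_mat m n :: 'a fmat measure))"
  unfolding L_def ratio
 proof (rule nn_integral_mono)
  fix g :: "'a fmat"
  show "eexp (- k * (\<Sum>j<n. (1 / (2 * T j) - 1) * col_sq m (?g g) j)) * indicator (near_iso m n \<delta>) (?g g)
   <= ennreal E * indicator (near_iso m n \<delta>) (?g g)"
  proof (cases "?g g \<in> near_iso m n \<delta>")
   case True
   have "(\<Sum>j<n. (1 / (2 * T j) - 1) * (1 - \<delta>)) <= (\<Sum>j<n. (1 / (2 * T j) - 1) * col_sq m (?g g) j)"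
    using T near_iso_col_sq[OF True]
    by (intro sum_mono mult_left_mono) (auto simp: abs_le_iff field_simps)
   then show ?thesis
    using k by (intro mult_right_mono ennreal_leI) (auto simp: E_def)
  qed simp
 qed
 also have "... = ennreal E * near_prob TYPE('a) m n \<delta> k (%_. 1 / 2)"
  unfolding near_prob_def by (rule nn_integral_cmult) (use measurable_indicator_near in simp)
 also have "... <= ennreal E * 1"
  by (intro mult_left_mono near_prob_le_1) simp
 finally have "eexp (- L) * (ennreal (exp L) * near_prob TYPE('a) m n \<delta> k T) <= eexp (- L) * ennreal E"
  by (intro mult_left_mono) auto
 moreover have "eexp (- L) * (ennreal (exp L) * near_prob TYPE('a) m n \<delta> k T) = near_prob TYPE('a) m n \<delta> k T"
  by (simp add: mult.assoc[symmetric] ennreal_mult[symmetric] exp_add[symmetric])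
 moreover have "eexp (x - L) = eexp (- L) * ennreal (exp x)" for x
  by (subst ennreal_mult[symmetric]) (simp_all add: exp_add[symmetric])
 ultimately show ?thesis
  unfolding L_def[symmetric] by (simp only: E_def mult.assoc)
qed

lemma near_prob_lower:
 assumes T: "!!j. j < n ==> 0 < T j & T j <= 1 / 2" and k: "k > 0"
 shows "eexp (- k * (\<Sum>j<n. (1 / (2 * T j) - 1) * (1 + \<delta>)) - real (m * DIM('a)) / 2 * (\<Sum>j<n. ln (2 * T j)))
   * near_prob TYPE('a) m n \<delta> k (%_. 1 / 2)
  <= near_prob TYPE('a::real_complex_quat) m n \<delta> k T"
proof -
 have T1: "!!j. j < n ==> 0 < T j" using T by blast
 define L where "L = real (m * DIM('a)) / 2 * (\<Sum>j<n. ln (2 * T j))"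
 define E where "E = exp (- k * (\<Sum>j<n. (1 / (2 * T j) - 1) * (1 + \<delta>)))"
 let ?g = "unit_col m n k :: 'a fmat => 'a fmat"
 have ratio: "eexp (real (m * DIM('a)) / 2 * (\<Sum>j<n. ln (2 * T j))) * near_prob TYPE('a) m n \<delta> k T
  = (\<integral>\<^sup>+g. eexp (- k * (\<Sum>j<n. (1 / (2 * T j) - 1) * col_sq m (?g g) j))
    * indicator (near_iso m n \<delta>) (?g g) \<partial>(gauss_mat m n :: 'a fmat measure))"
  by (rule near_prob_ratio[OF T1 k])
 have "ennreal E * near_prob TYPE('a) m n \<delta> k (%_. 1 / 2)
  = (\<integral>\<^sup>+g. ennreal E * indicator (near_iso m n \<delta>) (?g g) \<partial>(gauss_mat m n :: 'a fmat measure))"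
  unfolding near_prob_def by (rule nn_integral_cmult[symmetric]) (use measurable_indicator_near in simp)
 also have "... <= ennreal (exp L) * near_prob TYPE('a) m n \<delta> k T"
  unfolding L_def ratio
 proof (rule nn_integral_mono)
  fix g :: "'a fmat"
  show "ennreal E * indicator (near_iso m n \<delta>) (?g g)
   <= eexp (- k * (\<Sum>j<n. (1 / (2 * T j) - 1) * col_sq m (?g g) j)) * indicator (near_iso m n \<delta>) (?g g)"
  proof (cases "?g g \<in> near_iso m n \<delta>")
   case True
   have "(\<Sum>j<n. (1 / (2 * T j) - 1) * col_sq m (?g g) j) <= (\<Sum>j<n. (1 / (2 * T j) - 1) * (1 + \<delta>))"
    using T near_iso_col_sq[OF True]
    by (intro sum_mono mult_left_mono) (auto simp: abs_le_iff field_simps)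
   then show ?thesis
    using k by (intro mult_right_mono ennreal_leI) (auto simp: E_def)
  qed simp
 qed
 finally have "eexp (- L) * (ennreal E * near_prob TYPE('a) m n \<delta> k (%_. 1 / 2))
  <= eexp (- L) * (ennreal (exp L) * near_prob TYPE('a) m n \<delta> k T)"
  by (intro mult_left_mono) auto
 moreover have "eexp (- L) * (ennreal (exp L) * near_prob TYPE('a) m n \<delta> k T) = near_prob TYPE('a) m n \<delta> k T"
  by (simp add: mult.assoc[symmetric] ennreal_mult[symmetric] exp_add[symmetric])
 moreover have "eexp (x - L) = eexp (- L) * ennreal (exp x)" for x
  by (subst ennreal_mult[symmetric]) (simp_all add: exp_add[symmetric])
 ultimately show ?thesis
  unfolding L_def[symmetric] by (simp only: E_def mult.assoc)
qed

text \<open>The Gaussian comparison with column variances \<open>T\<close> costs the exponent \<open>c_fun T\<close> per column; it vanishes at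
  \<open>T = 1 / 2\<close>, where a Gaussian matrix of scale \<open>1 / \<kappa>\<close> already looks like an isometry.\<close>

definition c_fun :: "real => real" where
 "c_fun T = 1 / (2 * T) - 1 + ln (2 * T)"

lemma gauss_col_left:
 "mat_mult m m n U (gauss_col m n T k (sigma_mat m n (%_. 0)) g)
  = gauss_col m n T k (sigma_mat m n (%_. 0)) (mat_mult m m n U (g :: ('a::real_complex_quat) fmat))"
proof (rule mat_eqI[of _ m n])
 fix i j assume ij: "i < m" "j < n"
 have "mat_mult m m n U (gauss_col m n T k (sigma_mat m n (%_. 0)) g) (i, j)
  = (\<Sum>l<m. sqrt (T j / k) *\<^sub>R (U (i, l) * g (l, j)))"
  unfolding mat_mult_entry[OF ij] by (intro sum.cong refl) (use ij in \<open>simp add: gauss_col_entry\<close>)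
 then show "mat_mult m m n U (gauss_col m n T k (sigma_mat m n (%_. 0)) g) (i, j)
  = gauss_col m n T k (sigma_mat m n (%_. 0)) (mat_mult m m n U g) (i, j)"
  using ij by (simp add: gauss_col_entry scaleR_sum_right)
qed auto

text \<open>Expanding the square of a shifted Gaussian gives the exponential average; averaging from the left turns it into a Haar integral
  in which only the nearly isometric matrices matter.\<close>

lemma gauss_haar_identity:
 fixes \<mu> :: "('a::real_complex_quat) fmat measure"
 assumes \<mu>: "normalized_haar m \<mu>" and "n <= m" and k: "k > 0" and T: "!!j. j < n ==> 0 < T j"
 shows "(\<integral>\<^sup>+g. indicator (near_iso m n \<delta>) (gauss_col m n T k (sigma_mat m n (%_. 0)) g) *
   (\<integral>\<^sup>+U. eexp (k * mat_inner m n (sigma_mat m n d)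
    (mat_mult m m n U (gauss_col m n T k (sigma_mat m n (%_. 0)) g))) \<partial>\<mu>) \<partial>gauss_mat m n)
  = eexp (k * (\<Sum>j<n. T j * (d j)^2 / 2)) *
   (\<integral>\<^sup>+g. indicator (near_iso m n \<delta>) (shift_col m n T k d g)
    \<partial>(gauss_mat m n :: 'a fmat measure))"
proof -
 define z where "z = (gauss_col m n T k (sigma_mat m n (%_. 0)) :: 'a fmat => 'a fmat)"
 define A where "A = (sigma_mat m n (%j. k * d j * sqrt (T j / k)) :: 'a fmat)"
 define I where "I g = (indicator (near_iso m n \<delta>) (z g) :: ennreal)" for g
 have Im [measurable]: "I \<in> borel_measurable (mat_space m n)"
  unfolding I_def z_def by (rule measurable_indicator_near)
 have inner_A: "mat_inner m n A g = k * mat_inner m n (sigma_mat m n d) (z g)" for g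
  using \<open>n <= m\<close> by (simp add: A_def mat_inner_sigma z_def gauss_col_entry re_part_scaleR sum_distrib_left mult_ac)
 have norm_A: "(mat_norm m n A)^2 / 2 = k * (\<Sum>j<n. T j * (d j)^2 / 2)"
 proof -
  have "(mat_norm m n A)^2 = (\<Sum>j<n. (k * d j * sqrt (T j / k))\<^sup>2)"
   using \<open>n <= m\<close> by (simp add: A_def mat_norm_sigma L2_set_def sum_nonneg)
  also have "... = (\<Sum>j<n. k * (T j * (d j)^2))"
  proof (intro sum.cong refl)
   fix j assume "j \<in> {..<n}"
   then have "(sqrt (T j / k))^2 = T j / k" using k T by (simp add: less_imp_le)
   then show "(k * d j * sqrt (T j / k))^2 = k * (T j * (d j)^2)"
    using k by (simp add: power_mult_distrib power2_eq_square[of k])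
  qed
  finally show ?thesis by (simp add: sum_distrib_left sum_divide_distrib)
 qed
 have shift: "I (mat_add m n A g) = indicator (near_iso m n \<delta>) (shift_col m n T k d g)" for g
 proof -
  have "z (mat_add m n A g) = shift_col m n T k d g"
  proof (rule mat_eqI[of _ m n])
   fix i j assume ij: "i < m" "j < n"
   have "sqrt (T j / k) * (k * d j * sqrt (T j / k)) = (sqrt (T j / k) * sqrt (T j / k)) * (k * d j)"
    by (simp only: mult_ac)
   also have "sqrt (T j / k) * sqrt (T j / k) = T j / k"
    using T[OF ij(2)] k by simp
   finally have "sqrt (T j / k) * (k * d j * sqrt (T j / k)) = T j / k * (k * d j)" .
   then have "sqrt (T j / k) * (k * d j * sqrt (T j / k)) = T j * d j" using k by simp
   then have "sqrt (T j / k) *\<^sub>R (of_real (k * d j * sqrt (T j / k)) :: 'a) = of_real (T j * d j)"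
    by (metis of_real_mult scaleR_conv_of_real)
   then show "z (mat_add m n A g) (i, j) = shift_col m n T k d g (i, j)"
    using ij by (simp add: z_def gauss_col_entry A_def scaleR_add_right)
  qed (simp_all add: z_def)
  then show ?thesis by (simp add: I_def)
 qed
 have zU: "mat_mult m m n U (z g) = z (mat_mult m m n U g)" for U g
  unfolding z_def by (rule gauss_col_left)
 have expm: "(%g. eexp (mat_inner m n A g)) \<in> borel_measurable (mat_space m n)"
 proof -
  have "(%g. mat_inner m n A g) \<in> borel_measurable (mat_space m n)"
   by (intro measurable_mat_inner measurable_const_mat measurable_ident_sets refl) (simp add: A_def)
  then show ?thesis by measurable
 qed
 have "eexp ((mat_norm m n A)^2 / 2) * (\<integral>\<^sup>+g. I (mat_add m n A g) \<partial>gauss_mat m n)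
  = eexp ((mat_norm m n A)^2 / 2) * (\<integral>\<^sup>+g. eexp (- ((mat_norm m n A)^2 / 2)) * (eexp (mat_inner m n A g) * I g) \<partial>gauss_mat m n)"
  by (subst nn_integral_gauss_shift[OF Im])
   (simp_all add: A_def mult.assoc[symmetric] ennreal_mult[symmetric] exp_add[symmetric])
 also have "... = (\<integral>\<^sup>+g. eexp (mat_inner m n A g) * I g \<partial>gauss_mat m n)"
  using expm by (subst nn_integral_cmult)
   (auto simp: mult.assoc[symmetric] ennreal_mult[symmetric] exp_add[symmetric] intro!: borel_measurable_times_ennreal)
 also have "... = (\<integral>\<^sup>+g. \<integral>\<^sup>+U. eexp (mat_inner m n A (mat_mult m m n U g)) * I (mat_mult m m n U g) \<partial>\<mu> \<partial>gauss_mat m n)"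
  using expm by (intro gauss_left_average[OF \<mu>] borel_measurable_times_ennreal Im)
 also have "... = (\<integral>\<^sup>+g. I g * (\<integral>\<^sup>+U. eexp (kexp m n k d U (z g)) \<partial>\<mu>) \<partial>gauss_mat m n)"
 proof (rule nn_integral_cong)
  fix g :: "'a fmat"
  have "(\<integral>\<^sup>+U. eexp (mat_inner m n A (mat_mult m m n U g)) * I (mat_mult m m n U g) \<partial>\<mu>)
   = (\<integral>\<^sup>+U. I g * eexp (kexp m n k d U (z g)) \<partial>\<mu>)"
  proof (rule nn_integral_cong)
   fix U assume "U \<in> space \<mu>"
   then have U: "U \<in> \<U> m" by (simp add: haar_space[OF \<mu>])
   have "I (mat_mult m m n U g) = I g"
    unfolding I_def zU[symmetric] by (simp add: indicator_def near_iso_unitary_left[OF U] z_def)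
   then show "eexp (mat_inner m n A (mat_mult m m n U g)) * I (mat_mult m m n U g)
    = I g * eexp (kexp m n k d U (z g))"
    by (simp add: inner_A zU mult.commute)
  qed
  also have "... = I g * (\<integral>\<^sup>+U. eexp (kexp m n k d U (z g)) \<partial>\<mu>)"
   by (rule nn_integral_cmult[OF measurable_haar_exp[OF \<mu>]]) (simp_all add: z_def)
  finally show "(\<integral>\<^sup>+U. eexp (mat_inner m n A (mat_mult m m n U g)) * I (mat_mult m m n U g) \<partial>\<mu>)
   = I g * (\<integral>\<^sup>+U. eexp (kexp m n k d U (z g)) \<partial>\<mu>)" .
 qed
 finally show ?thesis
  unfolding I_def[symmetric] z_def[symmetric] shift[symmetric] norm_A[symmetric] ..
qed

lemma ennreal_le_divide:
 assumes "x * ennreal g <= ennreal b" "g > 0" "b >= 0"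
 shows "x <= ennreal (b / g)"
proof -
 have "x = x * ennreal g * ennreal (1 / g)"
  using assms(2) by (simp add: mult.assoc ennreal_mult[symmetric])
 also have "... <= ennreal b * ennreal (1 / g)"
  by (intro mult_right_mono assms) simp
 also have "... = ennreal (b / g)"
  using assms by (simp add: ennreal_mult[symmetric])
 finally show ?thesis .
qed

lemma ennreal_divide_le:
 assumes "ennreal b <= x * ennreal g" "g > 0" "b >= 0"
 shows "ennreal (b / g) <= x"
proof -
 have "ennreal (b / g) = ennreal b * ennreal (1 / g)"
  using assms by (simp add: ennreal_mult[symmetric])
 also have "... <= x * ennreal g * ennreal (1 / g)"
  by (intro mult_right_mono assms) simp
 also have "... = x"
  using assms(2) by (simp add: mult.assoc ennreal_mult[symmetric])
 finally show ?thesis .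
qed

abbreviation up_sum :: "nat => (nat => real) => (nat => real) => real => real" where
 "up_sum n T d e \<equiv> (\<Sum>j<n. T j * (d j)^2 / 2 + c_fun (T j) + e / (2 * T j))"

text \<open>The shifted Gaussian has total mass one. Restricting to nearly isometric matrices, where the Haar integral is almost \<open>haar_K\<close>, gives
  an upper bound for every choice of the variances \<open>T\<close>.\<close>

lemma haar_K_upper:
 assumes n: "n >= 1" and \<delta>: "\<delta> > 0"
 shows "\<forall>\<^sub>F m in sequentially. \<forall>(\<mu> :: ('a::real_complex_quat) fmat measure) T d. normalized_haar m \<mu> -->
  (\<forall>j<n. 0 < T j & T j <= 1 / 2) -->
  haar_K \<mu> m n (kappa DIM('a) n m) d <= ennreal (2 * exp (kappa DIM('a) n m *
   ((up_sum n T d \<delta>) + real n * \<delta> * L2_set d {..<n})))"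
proof -
 have "\<forall>\<^sub>F m in sequentially. 0 < kappa DIM('a) n m"
  using kappa_at_top[of "DIM('a)" n] by (simp add: filterlim_at_top_dense Suc_leI)
 with gauss_near_iso_prob[OF n \<delta>, where 'a='a] show ?thesis
  using eventually_ge_at_top[of n]
 proof (eventually_elim, intro allI impI)
  fix m :: nat and \<mu> :: "'a fmat measure" and T d :: "nat => real"
  let ?k = "kappa DIM('a) n m"
  assume typical: "\<forall>T d. (\<forall>j<n. 0 < T j & T j <= 1 / 2 & 0 <= d j & 2 * T j + (T j * d j)^2 = 1) -->
   ennreal (1 / 2) <= (\<integral>\<^sup>+g. indicator (near_iso m n \<delta>)
    (shift_col m n T ?k d g) \<partial>(gauss_mat m n :: 'a fmat measure))"
   and k: "0 < ?k" and mn: "n <= m" and \<mu>: "normalized_haar m \<mu>" and T: "\<forall>j<n. 0 < T j & T j <= 1 / 2"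
  define l where "l = L2_set d {..<n}"
  define L where "L = (\<Sum>j<n. ln (2 * T j))"
  define S where "S = (\<Sum>j<n. (1 / (2 * T j) - 1) * (1 + \<delta>))"
  define R where "R = (\<Sum>j<n. T j * (d j)^2 / 2)"
  define h where "h = real (m * DIM('a)) / 2"
  have h: "h >= ?k"
   unfolding h_def kappa_eq_shift[OF mn] using kappa_shift_nonneg[OF n] by simp
  have L: "L <= 0" unfolding L_def using T by (intro sum_nonpos) auto
  have half: "ennreal (1 / 2) <= near_prob TYPE('a) m n \<delta> ?k (%_. 1 / 2)"
   using typical[rule_format, of "%_. 1 / 2" "%_. 0"] by (simp add: near_prob_def)
  have lower: "ennreal (exp (- ?k * S - h * L) / 2) <= near_prob TYPE('a) m n \<delta> ?k T"
  proof -
   have "ennreal (exp (- ?k * S - h * L) / 2) = eexp (- ?k * S - h * L) * ennreal (1 / 2)"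
    by (subst ennreal_mult[symmetric]) simp_all
   also have "... <= eexp (- ?k * S - h * L) * near_prob TYPE('a) m n \<delta> ?k (%_. 1 / 2)"
    by (intro mult_left_mono half) simp
   also have "... <= near_prob TYPE('a) m n \<delta> ?k T"
    unfolding S_def L_def h_def by (rule near_prob_lower[OF _ k]) (use T in auto)
   finally show ?thesis .
  qed
  have "eexp (- ?k * real n * \<delta> * l) * haar_K \<mu> m n ?k d * near_prob TYPE('a) m n \<delta> ?k T
   = (\<integral>\<^sup>+g. indicator (near_iso m n \<delta>) (gauss_col m n T ?k (sigma_mat m n (%_. 0)) g) *
    (eexp (- ?k * real n * \<delta> * l) * haar_K \<mu> m n ?k d) \<partial>(gauss_mat m n :: 'a fmat measure))"
   unfolding near_prob_def using measurable_indicator_near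
   by (subst nn_integral_multc) (simp_all add: mult.commute)
  also have "... <= (\<integral>\<^sup>+g. indicator (near_iso m n \<delta>) (gauss_col m n T ?k (sigma_mat m n (%_. 0)) g) *
   (\<integral>\<^sup>+U. eexp (?k * mat_inner m n (sigma_mat m n d)
    (mat_mult m m n U (gauss_col m n T ?k (sigma_mat m n (%_. 0)) g))) \<partial>\<mu>) \<partial>gauss_mat m n)"
  proof (rule nn_integral_mono)
   fix g :: "'a fmat"
   let ?z = "gauss_col m n T ?k (sigma_mat m n (%_. 0)) g"
   show "indicator (near_iso m n \<delta>) ?z * (eexp (- ?k * real n * \<delta> * l) * haar_K \<mu> m n ?k d)
    <= indicator (near_iso m n \<delta>) ?z * (\<integral>\<^sup>+U. eexp (kexp m n ?k d U ?z) \<partial>\<mu>)"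
   proof (cases "?z \<in> near_iso m n \<delta>")
    case True
    show ?thesis
     unfolding l_def by (intro mult_left_mono haar_near_iso(1)[OF \<mu> mn True]) (use \<delta> k in auto)
   qed simp
  qed
  also have "... = eexp (?k * R) *
   (\<integral>\<^sup>+g. indicator (near_iso m n \<delta>) (shift_col m n T ?k d g)
    \<partial>(gauss_mat m n :: 'a fmat measure))"
   unfolding R_def by (rule gauss_haar_identity[OF \<mu> mn k]) (use T in auto)
  also have "... <= eexp (?k * R) * 1"
  proof (intro mult_left_mono)
   interpret prob_space "gauss_mat m n :: 'a fmat measure" by (rule prob_space_gauss_mat)
   have "(\<integral>\<^sup>+g. indicator (near_iso m n \<delta>) (shift_col m n T ?k d g) \<partial>(gauss_mat m n :: 'a fmat measure))
    <= (\<integral>\<^sup>+g. 1 \<partial>(gauss_mat m n :: 'a fmat measure))"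
    by (intro nn_integral_mono) (simp add: indicator_def)
   then show "(\<integral>\<^sup>+g. indicator (near_iso m n \<delta>) (shift_col m n T ?k d g) \<partial>(gauss_mat m n :: 'a fmat measure)) <= 1"
    using emeasure_space_1 by simp
  qed simp
  finally have main: "eexp (- ?k * real n * \<delta> * l) * haar_K \<mu> m n ?k d * near_prob TYPE('a) m n \<delta> ?k T <= eexp (?k * R)"
   by simp
  have "haar_K \<mu> m n ?k d * ennreal (exp (- ?k * real n * \<delta> * l) * (exp (- ?k * S - h * L) / 2))
   = eexp (- ?k * real n * \<delta> * l) * haar_K \<mu> m n ?k d * ennreal (exp (- ?k * S - h * L) / 2)"
   by (subst ennreal_mult) (simp_all add: mult_ac)
  also have "... <= eexp (- ?k * real n * \<delta> * l) * haar_K \<mu> m n ?k d * near_prob TYPE('a) m n \<delta> ?k T"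
   by (intro mult_left_mono lower) simp
  finally have "haar_K \<mu> m n ?k d <= ennreal (exp (?k * R) / (exp (- ?k * real n * \<delta> * l) * (exp (- ?k * S - h * L) / 2)))"
   using main by (intro ennreal_le_divide) (auto intro: order.trans)
  also have "exp (?k * R) / (exp (- ?k * real n * \<delta> * l) * (exp (- ?k * S - h * L) / 2))
   = 2 * exp (?k * R + ?k * real n * \<delta> * l + (?k * S + h * L))"
   by (simp add: exp_add exp_minus exp_diff field_simps)
  also have "... <= 2 * exp (?k * ((up_sum n T d \<delta>) + real n * \<delta> * l))"
  proof -
   have "h * L <= ?k * L" using h L by (rule mult_right_mono_neg)
   moreover have "R + S + L <= (up_sum n T d \<delta>)"
    unfolding R_def S_def L_def sum.distrib[symmetric]
   proof (rule sum_mono)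
    fix j
    have "(r - 1) * (1 + \<delta>) <= r - 1 + \<delta> * r" for r :: real
     using \<delta> by (simp add: algebra_simps)
    from this[of "1 / (2 * T j)"]
    show "T j * (d j)^2 / 2 + (1 / (2 * T j) - 1) * (1 + \<delta>) + ln (2 * T j)
      <= T j * (d j)^2 / 2 + c_fun (T j) + \<delta> / (2 * T j)"
     by (simp add: c_fun_def)
   qed
   then have "?k * (R + S + L) <= ?k * (up_sum n T d \<delta>)"
    using k by (intro mult_left_mono) auto
   ultimately show ?thesis by (simp add: algebra_simps)
  qed
  finally show "haar_K \<mu> m n ?k d <= ennreal (2 * exp (?k *
   ((up_sum n T d \<delta>) + real n * \<delta> * L2_set d {..<n})))"
   by (simp add: l_def ennreal_leI)
 qed
qed

abbreviation low_sum :: "nat => (nat => real) => (nat => real) => real => real" where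
 "low_sum n T d e \<equiv> (\<Sum>j<n. T j * (d j)^2 / 2 + c_fun (T j) - e / (2 * T j))"

text \<open>For the variances \<open>T\<close> that solve the quadratic equation the shifted Gaussian is concentrated on nearly isometric matrices, so
  the restriction loses at most half of the mass and the upper bound is sharp.\<close>

lemma haar_K_lower:
 assumes n: "n >= 1" and \<delta>: "\<delta> > 0"
 shows "\<forall>\<^sub>F m in sequentially. \<forall>(\<mu> :: ('a::real_complex_quat) fmat measure) T d. normalized_haar m \<mu> -->
  (\<forall>j<n. 0 < T j & T j <= 1 / 2 & 0 <= d j & 2 * T j + (T j * d j)^2 = 1) -->
  ennreal (1 / 2 * exp (kappa DIM('a) n m *
   ((low_sum n T d \<delta>) - real n * \<delta> * L2_set d {..<n})
   + kappa_shift DIM('a) n * (\<Sum>j<n. ln (2 * T j)))) <= haar_K \<mu> m n (kappa DIM('a) n m) d"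
proof -
 have "\<forall>\<^sub>F m in sequentially. 0 < kappa DIM('a) n m"
  using kappa_at_top[of "DIM('a)" n] by (simp add: filterlim_at_top_dense Suc_leI)
 with gauss_near_iso_prob[OF n \<delta>, where 'a='a] show ?thesis
  using eventually_ge_at_top[of n]
 proof (eventually_elim, intro allI impI)
  fix m :: nat and \<mu> :: "'a fmat measure" and T d :: "nat => real"
  let ?k = "kappa DIM('a) n m"
  assume typical: "\<forall>T d. (\<forall>j<n. 0 < T j & T j <= 1 / 2 & 0 <= d j & 2 * T j + (T j * d j)^2 = 1) -->
   ennreal (1 / 2) <= (\<integral>\<^sup>+g. indicator (near_iso m n \<delta>)
    (shift_col m n T ?k d g) \<partial>(gauss_mat m n :: 'a fmat measure))"
   and k: "0 < ?k" and mn: "n <= m" and \<mu>: "normalized_haar m \<mu>"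
   and T: "\<forall>j<n. 0 < T j & T j <= 1 / 2 & 0 <= d j & 2 * T j + (T j * d j)^2 = 1"
  define l where "l = L2_set d {..<n}"
  define L where "L = (\<Sum>j<n. ln (2 * T j))"
  define S where "S = (\<Sum>j<n. (1 / (2 * T j) - 1) * (1 - \<delta>))"
  define R where "R = (\<Sum>j<n. T j * (d j)^2 / 2)"
  define h where "h = real (m * DIM('a)) / 2"
  have h: "h = ?k + kappa_shift DIM('a) n"
   unfolding h_def by (rule kappa_eq_shift[OF mn])
  have upper: "near_prob TYPE('a) m n \<delta> ?k T <= eexp (- ?k * S - h * L)"
   unfolding S_def L_def h_def by (rule near_prob_upper[OF _ k]) (use T in auto)
  have "ennreal (exp (?k * R) * (1 / 2)) = eexp (?k * R) * ennreal (1 / 2)"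
   by (rule ennreal_mult) auto
  also have "... <= eexp (?k * R) *
   (\<integral>\<^sup>+g. indicator (near_iso m n \<delta>) (shift_col m n T ?k d g)
    \<partial>(gauss_mat m n :: 'a fmat measure))"
   by (intro mult_left_mono typical[rule_format]) (use T in auto)
  also have "... = (\<integral>\<^sup>+g. indicator (near_iso m n \<delta>) (gauss_col m n T ?k (sigma_mat m n (%_. 0)) g) *
   (\<integral>\<^sup>+U. eexp (?k * mat_inner m n (sigma_mat m n d)
    (mat_mult m m n U (gauss_col m n T ?k (sigma_mat m n (%_. 0)) g))) \<partial>\<mu>) \<partial>gauss_mat m n)"
   unfolding R_def by (rule gauss_haar_identity[OF \<mu> mn k, symmetric]) (use T in auto)
  also have "... <= (\<integral>\<^sup>+g. indicator (near_iso m n \<delta>) (gauss_col m n T ?k (sigma_mat m n (%_. 0)) g) *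
    (eexp (?k * real n * \<delta> * l) * haar_K \<mu> m n ?k d) \<partial>(gauss_mat m n :: 'a fmat measure))"
  proof (rule nn_integral_mono)
   fix g :: "'a fmat"
   let ?z = "gauss_col m n T ?k (sigma_mat m n (%_. 0)) g"
   show "indicator (near_iso m n \<delta>) ?z * (\<integral>\<^sup>+U. eexp (kexp m n ?k d U ?z) \<partial>\<mu>)
    <= indicator (near_iso m n \<delta>) ?z * (eexp (?k * real n * \<delta> * l) * haar_K \<mu> m n ?k d)"
   proof (cases "?z \<in> near_iso m n \<delta>")
    case True
    show ?thesis
     unfolding l_def by (intro mult_left_mono haar_near_iso(2)[OF \<mu> mn True]) (use \<delta> k in auto)
   qed simp
  qed
  also have "... = eexp (?k * real n * \<delta> * l) * haar_K \<mu> m n ?k d * near_prob TYPE('a) m n \<delta> ?k T"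
   unfolding near_prob_def using measurable_indicator_near
   by (subst nn_integral_multc) (simp_all add: mult.commute)
  also have "... <= eexp (?k * real n * \<delta> * l) * haar_K \<mu> m n ?k d * eexp (- ?k * S - h * L)"
   by (intro mult_left_mono upper) simp
  also have "... = haar_K \<mu> m n ?k d * ennreal (exp (?k * real n * \<delta> * l) * exp (- ?k * S - h * L))"
   by (subst ennreal_mult) (simp_all add: mult_ac)
  finally have fin: "ennreal (exp (?k * R) * (1 / 2) / (exp (?k * real n * \<delta> * l) * exp (- ?k * S - h * L))) <= haar_K \<mu> m n ?k d"
   by (rule ennreal_divide_le) auto
  have eq: "exp (?k * R) * (1 / 2) / (exp (?k * real n * \<delta> * l) * exp (- ?k * S - h * L))
   = 1 / 2 * exp (?k * R - ?k * real n * \<delta> * l + (?k * S + h * L))"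
   by (simp add: exp_add exp_minus exp_diff field_simps)
  have le: "1 / 2 * exp (?k * ((low_sum n T d \<delta>) - real n * \<delta> * l) + kappa_shift DIM('a) n * L)
   <= 1 / 2 * exp (?k * R - ?k * real n * \<delta> * l + (?k * S + h * L))"
  proof -
   have "(low_sum n T d \<delta>) <= R + S + L"
    unfolding R_def S_def L_def sum.distrib[symmetric]
   proof (rule sum_mono)
    fix j
    have "r - 1 - \<delta> * r <= (r - 1) * (1 - \<delta>)" for r :: real
     using \<delta> by (simp add: algebra_simps)
    from this[of "1 / (2 * T j)"]
    show "T j * (d j)^2 / 2 + c_fun (T j) - \<delta> / (2 * T j)
      <= T j * (d j)^2 / 2 + (1 / (2 * T j) - 1) * (1 - \<delta>) + ln (2 * T j)"
     by (simp add: c_fun_def)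
   qed
   then have "?k * (low_sum n T d \<delta>) <= ?k * (R + S + L)"
    using k by (intro mult_left_mono) auto
   then show ?thesis by (simp add: h algebra_simps)
  qed
  show "ennreal (1 / 2 * exp (?k *
   ((low_sum n T d \<delta>) - real n * \<delta> * L2_set d {..<n})
   + kappa_shift DIM('a) n * (\<Sum>j<n. ln (2 * T j)))) <= haar_K \<mu> m n ?k d"
   unfolding l_def[symmetric] L_def[symmetric] by (rule order.trans[OF ennreal_leI[OF le] fin[unfolded eq]])
 qed
qed

section \<open>Bounds for Bessel-type integrals\<close>

text \<open>The exponent that one singular value contributes to the upper bound for an orbit average: \<open>d\<close> is the product of the two
  singular values and \<open>e\<close> the loss from the finite net.\<close>

abbreviation lap :: "real => real => real => real" where
 "lap T e d \<equiv> T * d^2 / 2 + c_fun T + e / T + e * d"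

abbreviation haar_exp_bounded :: "'a::real_complex_quat itself => nat => real => real => nat => bool" where
 "haar_exp_bounded ty n e C m \<equiv> \<forall>(\<mu> :: 'a fmat measure) A B T.
  normalized_haar m \<mu> --> A \<in> mats m n --> B \<in> mats m n --> (\<forall>j<n. 0 < T j & T j <= 1 / 2) -->
  (\<integral>\<^sup>+U. eexp (kappa DIM('a) n m * mat_inner m n B (mat_mult m m n U A)) \<partial>\<mu>)
   <= ennreal (C * exp (kappa DIM('a) n m * (\<Sum>j<n. lap (T j) e (sing_vals m n A j * sing_vals m n B j))))"

lemma haar_exp_upper:
 assumes n: "n >= 1" and e: "e > 0"
 obtains C where "C > 0" "\<forall>\<^sub>F m in sequentially. haar_exp_bounded TYPE('a::real_complex_quat) n e C m"
proof -
 define e' where "e' = e / (4 * real n)"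
 define \<delta> where "\<delta> = e / (2 * real n)"
 have e': "e' > 0" and \<delta>: "\<delta> > 0" using e n by (simp_all add: e'_def \<delta>_def)
 obtain \<V> :: "'a fmat set" where net: "finite \<V>" "\<V> \<subseteq> \<U> n" "\<V> ~= {}"
  "!!V. V \<in> \<U> n ==> \<exists>V'\<in>\<V>. mat_norm n n (mat_minus n n V V') <= e'"
  using unitary_net[OF e'] by metis
 define C where "C = 2 * (real (card \<V>))^2"
 have C: "C > 0" using net(1,3) by (simp add: C_def card_gt_0_iff)
 have "\<forall>\<^sub>F m in sequentially. haar_exp_bounded TYPE('a) n e C m"
  using haar_K_upper[OF n \<delta>, where 'a='a] eventually_ge_at_top[of n]
 proof (eventually_elim, intro allI impI)
  fix m :: nat and \<mu> :: "'a fmat measure" and A B :: "'a fmat" and T :: "nat => real"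
  let ?k = "kappa DIM('a) n m"
  assume K: "\<forall>(\<mu> :: 'a fmat measure) T d. normalized_haar m \<mu> --> (\<forall>j<n. 0 < T j & T j <= 1 / 2) -->
   haar_K \<mu> m n ?k d <= ennreal (2 * exp (?k *
    ((\<Sum>j<n. T j * (d j)^2 / 2 + c_fun (T j) + \<delta> / (2 * T j)) + real n * \<delta> * L2_set d {..<n})))"
   and mn: "n <= m" and \<mu>: "normalized_haar m \<mu>" and A: "A \<in> mats m n" and B: "B \<in> mats m n"
   and T: "\<forall>j<n. 0 < T j & T j <= 1 / 2"
  have k: "?k >= 0" by (rule kappa_nonneg[OF mn]) (simp add: Suc_leI)
  define p where "p j = sing_vals m n A j * sing_vals m n B j" for j
  obtain UA VA UB VB where "sing_vals m n A \<in> chamber_B n" "sing_vals m n B \<in> chamber_B n"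
   using svd_sing_vals[OF A mn] svd_sing_vals[OF B mn] by metis
  then have p: "p j >= 0" if "j < n" for j
   using that by (simp add: p_def mem_chamber_B_iff)
  have L2: "L2_set p {..<n} <= (\<Sum>j<n. p j)"
   by (rule L2_set_le_sum) (use p in auto)
  have "(\<integral>\<^sup>+U. eexp (?k * mat_inner m n B (mat_mult m m n U A)) \<partial>\<mu>)
   <= ennreal ((real (card \<V>))^2 * exp (2 * ?k * real n * e' * L2_set p {..<n})) * haar_K \<mu> m n ?k p"
   unfolding p_def[abs_def] by (rule haar_exp_le[OF \<mu> mn A B k net(1,2,4)])
  also have "... <= ennreal ((real (card \<V>))^2 * exp (2 * ?k * real n * e' * L2_set p {..<n})) *
   ennreal (2 * exp (?k * ((\<Sum>j<n. T j * (p j)^2 / 2 + c_fun (T j) + \<delta> / (2 * T j)) + real n * \<delta> * L2_set p {..<n})))"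
   using K \<mu> T by (intro mult_left_mono) auto
  also have "... = ennreal (C * exp (?k * ((\<Sum>j<n. T j * (p j)^2 / 2 + c_fun (T j) + \<delta> / (2 * T j))
    + (2 * real n * e' + real n * \<delta>) * L2_set p {..<n})))"
   by (subst ennreal_mult[symmetric]) (simp_all add: C_def exp_add[symmetric] algebra_simps)
  also have "... <= ennreal (C * exp (?k * (\<Sum>j<n. T j * (p j)^2 / 2 + c_fun (T j) + e / T j + e * p j)))"
  proof -
   have "2 * real n * e' + real n * \<delta> = e" using n by (simp add: e'_def \<delta>_def)
   moreover have "e * L2_set p {..<n} <= (\<Sum>j<n. e * p j)"
    using L2 e by (simp add: sum_distrib_left[symmetric])
   moreover have "(\<Sum>j<n. T j * (p j)^2 / 2 + c_fun (T j) + \<delta> / (2 * T j)) <= (\<Sum>j<n. T j * (p j)^2 / 2 + c_fun (T j) + e / T j)"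
   proof (rule sum_mono)
    fix j assume "j \<in> {..<n}"
    then have t: "T j > 0" using T by simp
    have "\<delta> / 2 <= e" using e n by (simp add: \<delta>_def field_simps)
    then have "\<delta> / 2 / T j <= e / T j" using t by (intro divide_right_mono) auto
    then show "T j * (p j)^2 / 2 + c_fun (T j) + \<delta> / (2 * T j) <= T j * (p j)^2 / 2 + c_fun (T j) + e / T j"
     by simp
   qed
   ultimately have "(\<Sum>j<n. T j * (p j)^2 / 2 + c_fun (T j) + \<delta> / (2 * T j)) + (2 * real n * e' + real n * \<delta>) * L2_set p {..<n}
    <= (\<Sum>j<n. T j * (p j)^2 / 2 + c_fun (T j) + e / T j + e * p j)"
    by (simp add: sum.distrib)
   then show ?thesis
    using k C by (intro ennreal_leI) (simp add: mult_left_mono)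
  qed
  finally show "(\<integral>\<^sup>+U. eexp (?k * mat_inner m n B (mat_mult m m n U A)) \<partial>\<mu>)
   <= ennreal (C * exp (?k * (\<Sum>j<n. lap (T j) e (sing_vals m n A j * sing_vals m n B j))))"
   by (simp only: p_def)
 qed
 then show ?thesis using that C by blast
qed

text \<open>Finitely many translates of the ball cover the group and all have the same mass.\<close>

lemma haar_ball_pos:
 fixes \<nu> :: "('a::real_complex_quat) fmat measure"
 assumes \<nu>: "normalized_haar n \<nu>" and e: "e > 0"
 obtains c where "c > 0" "{V \<in> \<U> n. mat_norm n n (mat_minus n n V (mat_one n)) <= e} \<in> sets \<nu>"
  "ennreal c <= emeasure \<nu> {V \<in> \<U> n. mat_norm n n (mat_minus n n V (mat_one n)) <= e}"
proof -
 interpret prob_space \<nu> by (rule haar_prob[OF \<nu>])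
 obtain \<V> :: "'a fmat set" where net: "finite \<V>" "\<V> \<subseteq> \<U> n" "\<V> ~= {}"
  "!!V. V \<in> \<U> n ==> \<exists>V'\<in>\<V>. mat_norm n n (mat_minus n n V V') <= e"
  using unitary_net[OF e] by metis
 define S where "S V' = {V \<in> \<U> n. mat_norm n n (mat_minus n n V V') <= e}" for V' :: "'a fmat"
 have Sm: "S V' \<in> sets \<nu>" if "V' \<in> \<U> n" for V'
 proof -
  have "(%V. mat_norm n n (mat_minus n n V V')) \<in> borel_measurable \<nu>"
   using measurable_haar_ident[OF \<nu>] that
   by (intro measurable_mat_norm measurable_mat_add measurable_mat_scale measurable_const_mat) (auto simp: unitaryD)
  then have "{V \<in> space \<nu>. mat_norm n n (mat_minus n n V V') <= e} \<in> sets \<nu>" by measurable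
  then show ?thesis by (simp add: S_def haar_space[OF \<nu>])
 qed
 have eq: "emeasure \<nu> (S V') = emeasure \<nu> (S (mat_one n))" if V': "V' \<in> \<U> n" for V'
 proof -
  have "emeasure \<nu> (S (mat_one n)) = (\<integral>\<^sup>+V. indicator (S (mat_one n)) V \<partial>\<nu>)"
   using Sm[OF unitary_one] by simp
  also have "... = (\<integral>\<^sup>+V. indicator (S (mat_one n)) (mat_mult n n n (mat_adj n n V') V) \<partial>\<nu>)"
   by (rule haar_left[OF \<nu> _ unitary_adj[OF V'], symmetric]) (use Sm[OF unitary_one] in simp)
  also have "... = (\<integral>\<^sup>+V. indicator (S V') V \<partial>\<nu>)"
  proof (rule nn_integral_cong)
   fix V assume "V \<in> space \<nu>"
   then have V: "V \<in> \<U> n" by (simp add: haar_space[OF \<nu>])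
   have "mat_minus n n (mat_mult n n n (mat_adj n n V') V) (mat_one n)
    = mat_mult n n n (mat_adj n n V') (mat_minus n n V V')"
   proof -
    have "mat_mult n n n (mat_adj n n V') (mat_scale n n (-1) V') = mat_scale n n (-1) (mat_mult n n n (mat_adj n n V') V')"
     by (rule mat_eqI[of _ n n]) (auto simp: sum_negf)
    then show ?thesis using V' by (simp add: mat_mult_add_right unitaryD)
   qed
   then have "mat_norm n n (mat_minus n n (mat_mult n n n (mat_adj n n V') V) (mat_one n)) = mat_norm n n (mat_minus n n V V')"
    using unitary_adj[OF V'] by (simp add: mat_norm_unitary_left)
   then show "indicator (S (mat_one n)) (mat_mult n n n (mat_adj n n V') V) = (indicator (S V') V :: ennreal)"
    using V V' by (simp add: S_def indicator_def unitary_mult unitary_adj)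
  qed
  finally show ?thesis using Sm[OF V'] by simp
 qed
 have "1 = emeasure \<nu> (\<Union>V'\<in>\<V>. S V')"
 proof -
  have "(\<Union>V'\<in>\<V>. S V') = space \<nu>"
   using net(4) by (auto simp: S_def haar_space[OF \<nu>])
  then show ?thesis by (simp add: emeasure_space_1)
 qed
 also have "... <= (\<Sum>V'\<in>\<V>. emeasure \<nu> (S V'))"
  using net Sm by (intro emeasure_subadditive_finite) auto
 also have "... = (\<Sum>V'\<in>\<V>. emeasure \<nu> (S (mat_one n)))"
  by (intro sum.cong refl eq subsetD[OF net(2)])
 also have "... = emeasure \<nu> (S (mat_one n)) * ennreal (real (card \<V>))"
  by (simp add: ennreal_of_nat_eq_real_of_nat mult.commute)
 finally have "ennreal 1 <= emeasure \<nu> (S (mat_one n)) * ennreal (real (card \<V>))" by simp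
 then have "ennreal (1 / real (card \<V>)) <= emeasure \<nu> (S (mat_one n))"
  using net by (intro ennreal_divide_le) (auto simp: card_gt_0_iff)
 then show ?thesis
  using that[of "1 / real (card \<V>)"] Sm[OF unitary_one] net by (simp add: S_def card_gt_0_iff)
qed

lemma sigma_inner_K:
 assumes "n <= m"
 shows "mat_inner m n (sigma_mat m n w) (mat_mult m m n U (sigma_mat m n x))
  = mat_inner m n (sigma_mat m n (%i. x i * w i)) (mat_mult m m n U (iso_mat m n :: ('a::real_complex_quat) fmat))"
proof -
 have e: "mat_mult m m n U (sigma_mat m n f) (i, i) = f i *\<^sub>R U (i, i)" if "i < n" for f i and U :: "'a fmat"
 proof -
  have im: "i < m" using that assms by simp
  have "mat_mult m m n U (sigma_mat m n f) (i, i) = (\<Sum>l<m. if l = i then f i *\<^sub>R U (i, i) else 0)"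
   unfolding mat_mult_entry[OF im that] by (intro sum.cong refl) (use that in \<open>auto simp: of_real_def\<close>)
  then show ?thesis using im by simp
 qed
 show ?thesis
  unfolding mat_inner_sigma[OF assms] by (intro sum.cong refl) (simp add: e re_part_scaleR del: mat_mult_entry)
qed

text \<open>Restricting \<open>V\<close> to a small ball around the optimal unitary matrix leaves a fixed positive mass, and on this ball the exponent
  is almost the diagonal one.\<close>

lemma orbit_lower:
 fixes \<nu> :: "('a::real_complex_quat) fmat measure"
 assumes \<nu>: "normalized_haar n \<nu>" and e: "e > 0"
 obtains c where "c > 0" "!!m \<mu> \<L> x k. n <= m ==> normalized_haar m (\<mu> :: 'a fmat measure) ==> \<L> \<in> mats m n ==> 0 <= k ==>
  ennreal (c * exp (- k * e * L2_set (sing_vals m n \<L>) {..<n} * L2_set x {..<n})) *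
   haar_K \<mu> m n k (%i. x i * sing_vals m n \<L> i)
  <= (\<integral>\<^sup>+V. \<integral>\<^sup>+U. eexp (k * mat_inner m n \<L> (usv m n U x V)) \<partial>\<mu> \<partial>\<nu>)"
proof -
 define S where "S = {V \<in> \<U> n. mat_norm n n (mat_minus n n V (mat_one n :: 'a fmat)) <= e}"
 obtain c where c: "c > 0" "S \<in> sets \<nu>" "ennreal c <= emeasure \<nu> S"
  by (rule haar_ball_pos[OF \<nu> e], rule that) (simp_all only: S_def)
 show ?thesis
 proof (rule that[OF c(1)])
  fix m and \<mu> :: "'a fmat measure" and \<L> :: "'a fmat" and x k
  assume mn: "n <= m" and \<mu>: "normalized_haar m \<mu>" and \<L>: "\<L> \<in> mats m n" and k: "0 <= (k :: real)"
  interpret \<mu>: prob_space \<mu> by (rule haar_prob[OF \<mu>])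
  define w where "w = sing_vals m n \<L>"
  obtain U0 V0 where UV: "U0 \<in> \<U> m" "V0 \<in> \<U> n" "\<L> = usv m n U0 w V0"
   using svd_sing_vals[OF \<L> mn] unfolding w_def by metis
  define l where "l = L2_set w {..<n} * L2_set x {..<n}"
  define G where "G V = (\<integral>\<^sup>+U. eexp (k * mat_inner m n \<L> (usv m n U x V)) \<partial>\<mu>)" for V
  have Gm: "G \<in> borel_measurable \<nu>"
  proof -
   have "(%p. mat_inner m n \<L> (usv m n (snd p) x (fst p))) \<in> borel_measurable (\<nu> \<Otimes>\<^sub>M \<mu>)"
    by (intro measurable_mat_inner measurable_mat_mult measurable_mat_adj measurable_const_mat \<L> sigma_mat_mats
      measurable_compose[OF measurable_fst measurable_haar_ident[OF \<nu>]]
      measurable_compose[OF measurable_snd measurable_haar_ident[OF \<mu>]])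
   then have "(%p. eexp (k * mat_inner m n \<L> (usv m n (snd p) x (fst p)))) \<in> borel_measurable (\<nu> \<Otimes>\<^sub>M \<mu>)"
    by measurable
   then show ?thesis
    unfolding G_def by (intro \<mu>.borel_measurable_nn_integral) (simp add: case_prod_beta')
  qed
  have lower: "eexp (- k * e * l) * haar_K \<mu> m n k (%i. x i * w i) <= G (mat_mult n n n V0 V)" if V: "V \<in> S" for V
  proof -
   have Vu: "V \<in> \<U> n" and Vn: "mat_norm n n (mat_minus n n V (mat_one n)) <= e"
    using V by (auto simp: S_def)
   define R where "R = mat_minus n n (mat_adj n n V) (mat_one n)"
   have Rn: "mat_norm n n R <= e"
   proof -
    have "R = mat_adj n n (mat_minus n n V (mat_one n))"
     unfolding R_def
    proof (rule mat_eqI[of _ n n])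
     fix i j assume "i < n" "j < n"
     then show "mat_minus n n (mat_adj n n V) (mat_one n) (i, j) = mat_adj n n (mat_minus n n V (mat_one n)) (i, j)"
      by (auto simp: conjugation_add conjugation_scaleR conjugation_diff)
    qed auto
    then show ?thesis using Vn by (simp add: mat_norm_adj)
   qed
   define X where "X U = mat_mult m m n (mat_mult m m m (mat_adj m m U0) U) (sigma_mat m n x)" for U
   have inner: "mat_inner m n \<L> (usv m n U x (mat_mult n n n V0 V))
    = mat_inner m n (sigma_mat m n w) (X U) + mat_inner m n (sigma_mat m n w) (mat_mult m n n (X U) R)" for U
   proof -
    have "mat_inner m n \<L> (usv m n U x (mat_mult n n n V0 V))
     = mat_inner m n (mat_mult m n n (mat_mult m m n U0 (sigma_mat m n w)) (mat_adj n n V0))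
      (mat_mult m n n (mat_mult m n n (mat_mult m m n U (sigma_mat m n x)) (mat_adj n n V)) (mat_adj n n V0))"
     by (simp add: UV(3) mat_adj_mult mat_mult_assoc)
    also have "... = mat_inner m n (mat_mult m m n U0 (sigma_mat m n w)) (mat_mult m n n (mat_mult m m n U (sigma_mat m n x)) (mat_adj n n V))"
     by (rule mat_inner_unitary_right[OF unitary_adj[OF UV(2)]]) simp_all
    also have "... = mat_inner m n (sigma_mat m n w) (mat_mult m n n (X U) (mat_adj n n V))"
     by (simp add: mat_inner_adjoint_left X_def mat_mult_assoc)
    also have "mat_adj n n V = mat_add n n (mat_one n) R"
     unfolding R_def by (rule mat_minus_split) simp
    also have "mat_mult m n n (X U) (mat_add n n (mat_one n) R) = mat_add m n (X U) (mat_mult m n n (X U) R)"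
     by (simp add: mat_mult_add_right mat_mult_one_right X_def)
    finally show ?thesis by (simp add: mat_inner_add_right)
   qed
   have err: "- (e * l) <= mat_inner m n (sigma_mat m n w) (mat_mult m n n (X U) R)" if U: "U \<in> \<U> m" for U
   proof -
    have "mat_norm m n (X U) = L2_set x {..<n}"
     unfolding X_def using U UV mn by (simp add: mat_norm_unitary_left unitary_mult unitary_adj mat_norm_sigma)
    then have "mat_norm m n (mat_mult m n n (X U) R) <= L2_set x {..<n} * e"
     using mat_norm_mult[of m n n "X U" R] mult_left_mono[OF Rn, of "L2_set x {..<n}"] by simp
    then have "L2_set w {..<n} * mat_norm m n (mat_mult m n n (X U) R) <= L2_set w {..<n} * (L2_set x {..<n} * e)"
     by (intro mult_left_mono) simp_all
    moreover have "\<bar>mat_inner m n (sigma_mat m n w) (mat_mult m n n (X U) R)\<bar> <= L2_set w {..<n} * mat_norm m n (mat_mult m n n (X U) R)"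
     using mat_inner_le[of m n "sigma_mat m n w" "mat_mult m n n (X U) R"] mn by (simp add: mat_norm_sigma)
    ultimately show ?thesis by (simp add: l_def mult_ac)
   qed
   have Ka: "haar_K \<mu> m n k (%i. x i * w i) = (\<integral>\<^sup>+U. eexp (k * mat_inner m n (sigma_mat m n w) (X U)) \<partial>\<mu>)"
   proof -
    have "haar_K \<mu> m n k (%i. x i * w i)
     = (\<integral>\<^sup>+U. eexp (k * mat_inner m n (sigma_mat m n (%i. x i * w i)) (mat_mult m m n
       (mat_mult m m m (mat_mult m m m (mat_adj m m U0) U) (mat_one m)) (iso_mat m n))) \<partial>\<mu>)"
     unfolding haar_K_def using UV by (intro haar_exp_two_sided[OF \<mu>, symmetric] unitary_adj unitary_one) auto
    also have "... = (\<integral>\<^sup>+U. eexp (k * mat_inner m n (sigma_mat m n w) (X U)) \<partial>\<mu>)"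
    proof -
     have "mat_inner m n (sigma_mat m n w) (X U) = mat_inner m n (sigma_mat m n (%i. x i * w i))
       (mat_mult m m n (mat_mult m m m (mat_adj m m U0) U) (iso_mat m n))" for U
      unfolding X_def by (rule sigma_inner_K[OF mn])
     then show ?thesis by (simp only: mat_mult_one_right[OF mat_mult_mats])
    qed
    finally show ?thesis .
   qed
   have Xm: "(%U. eexp (k * mat_inner m n (sigma_mat m n w) (X U))) \<in> borel_measurable \<mu>"
   proof -
    have "(%U. mat_inner m n (sigma_mat m n w) (X U)) \<in> borel_measurable \<mu>"
     unfolding X_def by (intro measurable_mat_inner measurable_mat_mult measurable_const_mat sigma_mat_mats mat_adj_mats
       measurable_haar_ident[OF \<mu>])
    then show ?thesis by measurable
   qed
   have "eexp (- k * e * l) * haar_K \<mu> m n k (%i. x i * w i)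
    = (\<integral>\<^sup>+U. eexp (- k * e * l) * eexp (k * mat_inner m n (sigma_mat m n w) (X U)) \<partial>\<mu>)"
    unfolding Ka by (rule nn_integral_cmult[OF Xm, symmetric])
   also have "... <= G (mat_mult n n n V0 V)"
    unfolding G_def
   proof (rule nn_integral_mono)
    fix U assume "U \<in> space \<mu>"
    then have U: "U \<in> \<U> m" by (simp add: haar_space[OF \<mu>])
    have "- k * e * l + k * mat_inner m n (sigma_mat m n w) (X U)
     <= k * mat_inner m n \<L> (usv m n U x (mat_mult n n n V0 V))"
     using mult_left_mono[OF err[OF U] k] by (simp add: inner algebra_simps)
    then show "eexp (- k * e * l) * eexp (k * mat_inner m n (sigma_mat m n w) (X U))
     <= eexp (k * mat_inner m n \<L> (usv m n U x (mat_mult n n n V0 V)))"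
     by (simp add: ennreal_mult[symmetric] exp_add[symmetric])
   qed
   finally show ?thesis .
  qed
  have "ennreal (c * exp (- k * e * l)) * haar_K \<mu> m n k (%i. x i * w i)
   = ennreal c * (eexp (- k * e * l) * haar_K \<mu> m n k (%i. x i * w i))"
   using c(1) by (simp add: ennreal_mult mult.assoc)
  also have "... <= emeasure \<nu> S * (eexp (- k * e * l) * haar_K \<mu> m n k (%i. x i * w i))"
   by (intro mult_right_mono c(3)) simp
  also have "... = (\<integral>\<^sup>+V. (eexp (- k * e * l) * haar_K \<mu> m n k (%i. x i * w i)) * indicator S V \<partial>\<nu>)"
   using c(2) by (subst nn_integral_cmult_indicator) (simp_all only: mult.commute)
  also have "... <= (\<integral>\<^sup>+V. G (mat_mult n n n V0 V) \<partial>\<nu>)"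
   by (intro nn_integral_mono) (use lower in \<open>auto simp: indicator_def\<close>)
  also have "... = (\<integral>\<^sup>+V. G V \<partial>\<nu>)"
   by (rule haar_left[OF \<nu> Gm UV(2)])
  finally show "ennreal (c * exp (- k * e * L2_set (sing_vals m n \<L>) {..<n} * L2_set x {..<n})) *
    haar_K \<mu> m n k (%i. x i * sing_vals m n \<L> i)
   <= (\<integral>\<^sup>+V. \<integral>\<^sup>+U. eexp (k * mat_inner m n \<L> (usv m n U x V)) \<partial>\<mu> \<partial>\<nu>)"
   by (simp add: G_def l_def w_def mult.assoc)
 qed
qed

section \<open>Singular values are Borel\<close>

lemma closed_chamber: "closed (chamber_B n)"
proof -
 have "chamber_B n = (\<Inter>i\<in>- {..<n}. {x. x i = undefined}) \<inter> (\<Inter>i\<in>{..<n}. {x. 0 <= x i})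
   \<inter> (\<Inter>j\<in>{..<n}. \<Inter>i\<in>{..j}. {x. x j <= x i})"
  by (auto simp: mem_chamber_B_iff extensional_def set_eq_iff)
 moreover have "closed {x :: nat => real. x i = undefined}" "closed {x :: nat => real. 0 <= x i}" "closed {x :: nat => real. x j <= x i}" for i j
  by (intro closed_Collect_eq closed_Collect_le continuous_on_const continuous_on_product_coordinates)+
 ultimately show ?thesis
  by (auto intro!: closed_Int closed_INT)
qed

text \<open>The set is a countable union of compact sets, namely of the images under \<open>usv\<close> of bounded pieces.\<close>

lemma sets_sing_vals_closed:
 fixes F :: "(nat => real) set"
 assumes "n <= m" and F: "closed F"
 shows "{z \<in> mats m n. sing_vals m n z \<in> F} \<in> sets (mat_space m n :: ('a::real_complex_quat) fmat measure)"
proof -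
 define B where "B R = PiE UNIV (%i. if i < n then {0..real R} else {undefined})" for R
 define K where "K R = (\<U> m :: 'a fmat set) \<times> (F \<inter> chamber_B n \<inter> B R) \<times> (\<U> n :: 'a fmat set)" for R
 define f where "f p = usv m n (fst p) (fst (snd p)) (snd (snd p) :: 'a fmat)" for p
 have cK: "compact (K R)" for R
 proof -
  have "compact (B R)" unfolding B_def by (rule compact_PiE_UNIV) auto
  then have "compact (F \<inter> chamber_B n \<inter> B R)"
   using F closed_chamber by (intro closed_Int_compact closed_Int)
  then show ?thesis unfolding K_def by (intro compact_Times compact_unitary_group)
 qed
 have "continuous_on (K R) f" for R
  unfolding f_def
  by (intro continuous_on_mat_mult continuous_on_mat_adj continuous_on_sigma_mat
    continuous_on_fst continuous_on_snd continuous_on_id)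
 then have cI: "compact (f ` K R)" for R
  using cK by (rule compact_continuous_image)
 have eq: "{z \<in> mats m n. sing_vals m n z \<in> F} = mats m n \<inter> (\<Union>R. f ` K R)"
 proof (intro equalityI subsetI)
  fix z :: "'a fmat" assume z: "z \<in> {z \<in> mats m n. sing_vals m n z \<in> F}"
  then obtain U V where UV: "U \<in> \<U> m" "V \<in> \<U> n" "z = usv m n U (sing_vals m n z) V"
   and ch: "sing_vals m n z \<in> chamber_B n"
   using svd_sing_vals[OF _ assms(1), of z] by blast
  define x where "x = sing_vals m n z"
  obtain R where R: "(\<Sum>i<n. x i) <= real R" using real_arch_simple by blast
  have "x i <= real R" if "i < n" for i
   using ch that R member_le_sum[of i "{..<n}" x] by (auto simp: x_def mem_chamber_B_iff)
  then have "x \<in> B R"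
   using ch unfolding B_def x_def[symmetric] by (auto simp: mem_chamber_B_iff extensional_def)
  then have "(U, x, V) \<in> K R" using UV ch z by (auto simp: K_def x_def)
  moreover have "f (U, x, V) = z" using UV(3) by (simp add: f_def x_def)
  ultimately show "z \<in> mats m n \<inter> (\<Union>R. f ` K R)" using z by force
 next
  fix z :: "'a fmat" assume z: "z \<in> mats m n \<inter> (\<Union>R. f ` K R)"
  then obtain R U x V where "(U, x, V) \<in> K R" "z = f (U, x, V)" by auto
  then show "z \<in> {z \<in> mats m n. sing_vals m n z \<in> F}"
   using z by (auto simp: K_def f_def sing_vals_usv[OF assms(1)])
 qed
 have idb: "(%z. z) \<in> mat_space m n \<rightarrow>\<^sub>M (borel :: 'a fmat measure)"
 proof (rule measurable_coordinatewise_then_product)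
  fix p :: "nat \<times> nat"
  obtain i j where p: "p = (i, j)" by (cases p)
  show "(%z. z p) \<in> borel_measurable (mat_space m n :: 'a fmat measure)"
  proof (cases "i < m & j < n")
   case True
   then show ?thesis unfolding p by (intro measurable_mat_entry measurable_ident_sets refl) auto
  next
   case False
   then have "z p = undefined" if "z \<in> space (mat_space m n)" for z :: "'a fmat"
    using that by (auto simp: p mats_def PiE_def extensional_def)
   then show ?thesis by (subst measurable_cong[where g = "%_. undefined"]) simp_all
  qed
 qed
 have "(\<Union>R. f ` K R) \<in> sets borel"
  using cI by (intro sets.countable_UN) (auto intro: borel_compact)
 then have "(%z. z) -` (\<Union>R. f ` K R) \<inter> space (mat_space m n) \<in> sets (mat_space m n :: 'a fmat measure)"
  by (rule measurable_sets[OF idb])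
 then show ?thesis
  unfolding eq by (simp add: Int_commute)
qed

lemma measurable_sing_vals:
 assumes "n <= m" "j < n"
 shows "(%z. sing_vals m n z j) \<in> borel_measurable (mat_space m n :: ('a::real_complex_quat) fmat measure)"
 unfolding borel_measurable_iff_le
proof
 fix c :: real
 have "closed {x :: nat => real. x j <= c}"
  by (intro closed_Collect_le continuous_on_const continuous_on_product_coordinates)
 from sets_sing_vals_closed[OF assms(1) this]
 show "{z \<in> space (mat_space m n :: 'a fmat measure). sing_vals m n z j <= c} \<in> sets (mat_space m n)"
  by simp
qed

section \<open>The law of the process\<close>

text \<open>The coordinates are independent centred normal variables; regrouping the real coordinates gives the matrix entries.\<close>

lemma brownian_law:
 fixes W :: "real => 'w => ('a::real_complex_quat) fmat"
 assumes W: "mat_brownian_motion P m n W" and mn: "m >= 1" "n >= 1" and s: "s > 0"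
 shows "distr P (mat_space m n) (W s) = PiM (idx m n) (%_. density lborel (gauss_density s))"
proof -
 interpret prob_space P using W by (simp add: mat_brownian_motion_def)
 let ?N = "density lborel (%u. ennreal (normal_density 0 (sqrt s) u))"
 have Wm: "W s \<in> P \<rightarrow>\<^sub>M mat_space m n" using W s by (simp add: mat_brownian_motion_def)
 have Wkm: "(%\<omega>. W s \<omega> k) \<in> borel_measurable P" if "k \<in> idx m n" for k
  using that measurable_mat_entry[OF Wm, of "fst k" "snd k"] by auto
 have coordm: "(%\<omega>. W s \<omega> k \<bullet> b) \<in> borel_measurable P" if "k \<in> idx m n" for k b
  using Wkm[OF that] by measurable
 have coord: "distr P borel (%\<omega>. W s \<omega> k \<bullet> b) = ?N" if k: "k \<in> idx m n" and b: "b \<in> Basis" for k b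
 proof -
  have bm: "real_brownian_motion P (%s \<omega>. W s \<omega> k \<bullet> b)"
   using W k b unfolding mat_brownian_motion_def by blast
  have "\<forall>r\<ge>0. \<forall>t>r. distributed P lborel (%\<omega>. W t \<omega> k \<bullet> b - W r \<omega> k \<bullet> b) (normal_density 0 (sqrt (t - r)))"
   using bm unfolding real_brownian_motion_def by (elim conjE)
  from this[rule_format, of 0 s]
  have d: "distributed P lborel (%\<omega>. W s \<omega> k \<bullet> b - W 0 \<omega> k \<bullet> b) (normal_density 0 (sqrt s))"
   using s by simp
  have m0: "(%\<omega>. W 0 \<omega> k \<bullet> b) \<in> borel_measurable P" and z: "AE \<omega> in P. W 0 \<omega> k \<bullet> b = 0"
   using bm by (auto simp: real_brownian_motion_def)
  have "distr P borel (%\<omega>. W s \<omega> k \<bullet> b) = distr P borel (%\<omega>. W s \<omega> k \<bullet> b - W 0 \<omega> k \<bullet> b)"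
   using coordm[OF k] m0 z by (intro distr_cong_AE) auto
  also have "... = distr P lborel (%\<omega>. W s \<omega> k \<bullet> b - W 0 \<omega> k \<bullet> b)"
   by (intro distr_cong) auto
  also have "... = ?N"
   by (rule distributed_distr_eq_density[OF d])
  finally show ?thesis .
 qed
 have "indep_vars (%_. \<Pi>\<^sub>M s\<in>{0..}. borel) (%(k, b) \<omega>. \<lambda>s\<in>{0..}. W s \<omega> k \<bullet> b) (idx m n \<times> Basis)"
  using W by (simp add: mat_brownian_motion_def)
 then have "indep_vars (%_. borel) (%p \<omega>. ((%(k, b) \<omega>. \<lambda>s\<in>{0..}. W s \<omega> k \<bullet> b) p \<omega>) s) (idx m n \<times> Basis)"
  by (rule indep_vars_compose2[where Y = "%_ f. f s"]) (use s in \<open>auto intro: measurable_component_singleton\<close>)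
 moreover have "(%p \<omega>. ((%(k, b) \<omega>. \<lambda>s\<in>{0..}. W s \<omega> k \<bullet> b) p \<omega>) s) = (%p \<omega>. W s \<omega> (fst p) \<bullet> snd p)"
  using s by (auto simp: fun_eq_iff split_beta)
 ultimately have ind: "indep_vars (%_. borel) (%p \<omega>. W s \<omega> (fst p) \<bullet> snd p) (idx m n \<times> Basis)"
  by simp
 have entry: "distr P borel (%\<omega>. W s \<omega> k) = density lborel (gauss_density s)" if k: "k \<in> idx m n" for k
 proof -
  have "indep_vars (%b. PiM {(k, b)} (%_. borel)) (%b \<omega>. restrict (%p. W s \<omega> (fst p) \<bullet> snd p) {(k, b)}) Basis"
   by (rule indep_vars_restrict[OF ind, where K = "%b. {(k, b)}"]) (use k in \<open>auto simp: disjoint_family_on_def\<close>)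
  then have "indep_vars (%_. borel) (%b \<omega>. (restrict (%p. W s \<omega> (fst p) \<bullet> snd p) {(k, b)}) (k, b)) Basis"
   by (rule indep_vars_compose2[where Y = "%b f. f (k, b)"]) (auto intro: measurable_component_singleton)
  then have ib: "indep_vars (%_. borel) (%b \<omega>. W s \<omega> k \<bullet> b) Basis" by simp
  have "distr P (PiM Basis (%_. borel)) (%\<omega>. \<lambda>b\<in>Basis. W s \<omega> k \<bullet> b) = PiM Basis (%b. distr P borel (%\<omega>. W s \<omega> k \<bullet> b))"
   using ib coordm[OF k] by (subst (asm) indep_vars_iff_distr_eq_PiM') auto
  also have "... = PiM Basis (%_. ?N)"
   by (intro PiM_cong refl coord[OF k])
  finally have vec: "distr P (PiM Basis (%_. borel)) (%\<omega>. \<lambda>b\<in>Basis. W s \<omega> k \<bullet> b) = PiM Basis (%_. ?N)" .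
  have vm: "(%\<omega>. \<lambda>b\<in>Basis. W s \<omega> k \<bullet> b) \<in> P \<rightarrow>\<^sub>M PiM Basis (%_. borel)"
   by (intro measurable_restrict coordm[OF k])
  have hm: "(%f. \<Sum>b\<in>Basis. f b *\<^sub>R b :: 'a) \<in> PiM Basis (%_. borel) \<rightarrow>\<^sub>M borel"
   by measurable
  have "distr P borel (%\<omega>. W s \<omega> k) = distr P borel ((%f. \<Sum>b\<in>Basis. f b *\<^sub>R b) \<circ> (%\<omega>. \<lambda>b\<in>Basis. W s \<omega> k \<bullet> b))"
   by (simp add: comp_def euclidean_representation)
  also have "... = distr (distr P (PiM Basis (%_. borel)) (%\<omega>. \<lambda>b\<in>Basis. W s \<omega> k \<bullet> b)) borel (%f. \<Sum>b\<in>Basis. f b *\<^sub>R b)"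
   by (rule distr_distr[OF hm vm, symmetric])
  also have "... = density lborel (gauss_density s)"
   unfolding vec by (rule distr_normal_coordinates[OF s])
  finally show ?thesis .
 qed
 have "indep_vars (%k. PiM ({k} \<times> Basis) (%_. borel)) (%k \<omega>. restrict (%p. W s \<omega> (fst p) \<bullet> snd p) ({k} \<times> Basis)) (idx m n)"
  by (rule indep_vars_restrict[OF ind, where K = "%k. {k} \<times> Basis"]) (auto simp: disjoint_family_on_def)
 then have "indep_vars (%_. borel) (%k \<omega>. \<Sum>b\<in>Basis. (restrict (%p. W s \<omega> (fst p) \<bullet> snd p) ({k} \<times> Basis)) (k, b) *\<^sub>R b) (idx m n)"
 proof (rule indep_vars_compose2[where Y = "%k f. \<Sum>b\<in>Basis. f (k, b) *\<^sub>R b"])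
  fix k
  show "(%f. \<Sum>b\<in>Basis. f (k, b) *\<^sub>R b) \<in> borel_measurable (PiM ({k} \<times> Basis) (%_. borel))"
   by (intro borel_measurable_sum borel_measurable_scaleR measurable_const measurable_component_singleton) auto
 qed
 then have "indep_vars (%_. borel) (%k \<omega>. W s \<omega> k) (idx m n)"
  by (simp add: euclidean_representation)
 then have "distr P (PiM (idx m n) (%_. borel)) (%\<omega>. \<lambda>k\<in>idx m n. W s \<omega> k) = PiM (idx m n) (%k. distr P borel (%\<omega>. W s \<omega> k))"
  using Wkm mn by (subst (asm) indep_vars_iff_distr_eq_PiM') (auto simp: lessThan_empty_iff)
 also have "... = PiM (idx m n) (%_. density lborel (gauss_density s))"
  by (intro PiM_cong refl entry)
 also have "distr P (PiM (idx m n) (%_. borel)) (%\<omega>. \<lambda>k\<in>idx m n. W s \<omega> k) = distr P (mat_space m n) (W s)"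
 proof (rule distr_cong)
  fix \<omega> assume "\<omega> \<in> space P"
  then have "W s \<omega> \<in> mats m n" using measurable_space[OF Wm] by simp
  then show "(\<lambda>k\<in>idx m n. W s \<omega> k) = W s \<omega>"
   unfolding mats_def PiE_def by (intro extensional_restrict) simp
 qed (simp_all add: mat_space_def)
 finally show ?thesis .
qed

lemma start_and_brownian_indep:
 fixes P :: "'w measure" and B0 :: "'w => ('a::real_complex_quat) fmat" and W :: "real => 'w => 'a fmat"
 assumes P: "prob_space P" and B0: "B0 \<in> P \<rightarrow>\<^sub>M mat_space m n" and Wm: "!!s. s >= 0 ==> W s \<in> P \<rightarrow>\<^sub>M mat_space m n"
  and ind: "prob_space.indep_set P {B0 -` A \<inter> space P | A. A \<in> sets (mat_space m n)}
     {(%\<omega>. \<lambda>s\<in>{0..}. W s \<omega>) -` A \<inter> space P | A. A \<in> sets (\<Pi>\<^sub>M s\<in>{0..}. mat_space m n)}"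
  and s: "s >= (0 :: real)"
 shows "distr P (mat_space m n \<Otimes>\<^sub>M mat_space m n) (%\<omega>. (B0 \<omega>, W s \<omega>))
  = distr P (mat_space m n) B0 \<Otimes>\<^sub>M distr P (mat_space m n) (W s)"
proof -
 interpret prob_space P by fact
 let ?A = "{B0 -` A \<inter> space P | A. A \<in> sets (mat_space m n)}"
 let ?B = "{W s -` A \<inter> space P | A. A \<in> sets (mat_space m n)}"
 let ?C = "{(%\<omega>. \<lambda>s\<in>{0..}. W s \<omega>) -` A \<inter> space P | A. A \<in> sets (\<Pi>\<^sub>M s\<in>{0..}. mat_space m n)}"
 have path: "(%\<omega>. \<lambda>s\<in>{0..}. W s \<omega>) \<in> P \<rightarrow>\<^sub>M (\<Pi>\<^sub>M s\<in>{0..}. mat_space m n)"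
  by (intro measurable_restrict Wm) simp
 have sub: "?B \<subseteq> ?C"
 proof
  fix E assume "E \<in> ?B"
  then obtain A where A: "A \<in> sets (mat_space m n)" "E = W s -` A \<inter> space P" by blast
  let ?D = "(%f. f s) -` A \<inter> space (\<Pi>\<^sub>M s\<in>{0..}. mat_space m n)"
  have cs: "(%f. f s) \<in> (\<Pi>\<^sub>M s\<in>{0..}. mat_space m n) \<rightarrow>\<^sub>M (mat_space m n :: 'a fmat measure)"
   using s by (intro measurable_component_singleton) simp
  have "?D \<in> sets (\<Pi>\<^sub>M s\<in>{0..}. mat_space m n)"
   by (rule measurable_sets[OF cs A(1)])
  moreover have "E = (%\<omega>. \<lambda>s\<in>{0..}. W s \<omega>) -` ?D \<inter> space P"
   using A s measurable_space[OF path] by auto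
  ultimately show "E \<in> ?C" by blast
 qed
 have "indep_set ?A ?B"
  using ind unfolding indep_set_def
  by (rule indep_sets_mono_sets) (use sub in \<open>auto split: bool.split\<close>)
 then have "indep_set (sigma_sets (space P) ?A) (sigma_sets (space P) ?B)"
 proof (rule indep_set_sigma_sets)
  have "Int_stable {f -` A \<inter> space P | A. A \<in> sets (mat_space m n)}" for f :: "'w => 'a fmat"
  proof (rule Int_stableI)
   fix E F assume "E \<in> {f -` A \<inter> space P | A. A \<in> sets (mat_space m n)}" "F \<in> {f -` A \<inter> space P | A. A \<in> sets (mat_space m n)}"
   then obtain A A' where "A \<in> sets (mat_space m n)" "A' \<in> sets (mat_space m n)" "E = f -` A \<inter> space P" "F = f -` A' \<inter> space P"
    by blast
   then show "E \<inter> F \<in> {f -` A \<inter> space P | A. A \<in> sets (mat_space m n)}"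
    by (intro CollectI exI[of _ "A \<inter> A'"]) auto
  qed
  then show "Int_stable ?A" "Int_stable ?B" by this+
 qed
 then have "indep_var (mat_space m n) B0 (mat_space m n) (W s)"
  unfolding indep_var_eq using B0 Wm[OF s] by auto
 then show ?thesis
  unfolding indep_var_distribution_eq by simp
qed

abbreviation orbit_exp :: "('a::real_complex_quat) fmat measure => 'a fmat measure => nat => nat => (nat => real) => real => 'a fmat => ennreal" where
 "orbit_exp \<mu> \<nu> m n x r z \<equiv> (\<integral>\<^sup>+V. \<integral>\<^sup>+U. eexp (r * mat_inner m n z (usv m n U x V)) \<partial>\<mu> \<partial>\<nu>)"

lemma usv_norm:
 assumes "n <= m" "U \<in> \<U> m" "V \<in> \<U> n"
 shows "mat_norm m n (usv m n U x V) = L2_set x {..<n}"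
 using assms by (simp add: mat_norm_unitary_right unitary_adj mat_norm_unitary_left mat_norm_sigma)

lemma measurable_usv:
 assumes \<mu>: "normalized_haar m (\<mu> :: ('a::real_complex_quat) fmat measure)" and \<nu>: "normalized_haar n \<nu>"
 shows "(%p. usv m n (fst p) x (snd p)) \<in> \<mu> \<Otimes>\<^sub>M \<nu> \<rightarrow>\<^sub>M mat_space m n"
 by (intro measurable_mat_mult measurable_mat_adj measurable_const_mat sigma_mat_mats
   measurable_compose[OF measurable_fst measurable_haar_ident[OF \<mu>]]
   measurable_compose[OF measurable_snd measurable_haar_ident[OF \<nu>]])

lemma orbit_nn_integral:
 fixes H :: "nat => ('a::real_complex_quat) fmat measure"
 assumes \<mu>: "normalized_haar m (H m)" and \<nu>: "normalized_haar n (H n)" and f: "f \<in> borel_measurable (mat_space m n)"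
 shows "(\<integral>\<^sup>+y. f y \<partial>orbit_measure H m n x) = (\<integral>\<^sup>+V. \<integral>\<^sup>+U. f (usv m n U x V) \<partial>H m \<partial>H n)"
proof -
 interpret \<mu>: prob_space "H m" by (rule haar_prob[OF \<mu>])
 interpret \<nu>: prob_space "H n" by (rule haar_prob[OF \<nu>])
 interpret pair_sigma_finite "H m" "H n" ..
 have m: "(%(U, V). usv m n U x V) \<in> H m \<Otimes>\<^sub>M H n \<rightarrow>\<^sub>M mat_space m n"
  using measurable_usv[OF \<mu> \<nu>] by (simp add: case_prod_beta')
 have "(\<integral>\<^sup>+y. f y \<partial>orbit_measure H m n x) = (\<integral>\<^sup>+p. f (case p of (U, V) => usv m n U x V) \<partial>(H m \<Otimes>\<^sub>M H n))"
  unfolding orbit_measure_def by (rule nn_integral_distr[OF m]) (use f in simp)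
 also have "... = (\<integral>\<^sup>+V. \<integral>\<^sup>+U. f (case (U, V) of (U, V) => usv m n U x V) \<partial>H m \<partial>H n)"
  by (rule nn_integral_snd[symmetric]) (rule measurable_compose[OF m f])
 finally show ?thesis by simp
qed

lemma orbit_exp_bounds:
 fixes \<mu> \<nu> :: "('a::real_complex_quat) fmat measure"
 assumes \<mu>: "normalized_haar m \<mu>" and \<nu>: "normalized_haar n \<nu>" and "n <= m" "r >= 0"
 shows "eexp (- (r * (mat_norm m n z * L2_set x {..<n}))) <= orbit_exp \<mu> \<nu> m n x r z"
  and "orbit_exp \<mu> \<nu> m n x r z <= eexp (r * (mat_norm m n z * L2_set x {..<n}))"
proof -
 interpret \<mu>: prob_space \<mu> by (rule haar_prob[OF \<mu>])
 interpret \<nu>: prob_space \<nu> by (rule haar_prob[OF \<nu>])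
 have b: "\<bar>r * mat_inner m n z (usv m n U x V)\<bar> <= r * (mat_norm m n z * L2_set x {..<n})"
  if "U \<in> space \<mu>" "V \<in> space \<nu>" for U V
 proof -
  have "\<bar>mat_inner m n z (usv m n U x V)\<bar> <= mat_norm m n z * L2_set x {..<n}"
   using mat_inner_le[of m n z "usv m n U x V"] that
   by (simp add: usv_norm[OF \<open>n <= m\<close>] haar_space[OF \<mu>] haar_space[OF \<nu>])
  then show ?thesis using \<open>r >= 0\<close> by (simp add: abs_mult mult_left_mono)
 qed
 have "eexp (- (r * (mat_norm m n z * L2_set x {..<n})))
  = (\<integral>\<^sup>+V. \<integral>\<^sup>+U. eexp (- (r * (mat_norm m n z * L2_set x {..<n}))) \<partial>\<mu> \<partial>\<nu>)"
  by (simp add: \<mu>.emeasure_space_1 \<nu>.emeasure_space_1)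
 also have "... <= orbit_exp \<mu> \<nu> m n x r z"
  using b by (intro nn_integral_mono ennreal_leI) (force simp: abs_le_iff)
 finally show "eexp (- (r * (mat_norm m n z * L2_set x {..<n}))) <= orbit_exp \<mu> \<nu> m n x r z" .
 have "orbit_exp \<mu> \<nu> m n x r z
  <= (\<integral>\<^sup>+V. \<integral>\<^sup>+U. eexp (r * (mat_norm m n z * L2_set x {..<n})) \<partial>\<mu> \<partial>\<nu>)"
  using b by (intro nn_integral_mono ennreal_leI) (force simp: abs_le_iff)
 also have "... = eexp (r * (mat_norm m n z * L2_set x {..<n}))"
  by (simp add: \<mu>.emeasure_space_1 \<nu>.emeasure_space_1)
 finally show "orbit_exp \<mu> \<nu> m n x r z <= eexp (r * (mat_norm m n z * L2_set x {..<n}))" .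
qed

lemma tilted_normalizer:
 fixes H :: "nat => ('a::real_complex_quat) fmat measure"
 assumes \<mu>: "normalized_haar m (H m)" and \<nu>: "normalized_haar n (H n)" and mn: "n <= m" and k: "k >= 0"
  and \<L>: "\<L> \<in> mats m n"
 obtains Z where "Z > 0" "ennreal Z = orbit_exp (H m) (H n) m n x k \<L>"
  "tilted_orbit_measure H m n x (mat_scale m n k \<L>)
   = density (orbit_measure H m n x) (%y. ennreal (exp (k * mat_inner m n \<L> y) / Z))"
proof -
 define f where "f y = exp (k * mat_inner m n \<L> y)" for y :: "'a fmat"
 have "(%y. mat_inner m n \<L> y) \<in> borel_measurable (mat_space m n)"
  by (intro measurable_mat_inner measurable_const_mat \<L> measurable_ident_sets refl)
 then have fm: "f \<in> borel_measurable (mat_space m n)" unfolding f_def by measurable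
 have sets: "sets (orbit_measure H m n x) = sets (mat_space m n)"
  by (simp add: orbit_measure_def)
 then have fo: "f \<in> borel_measurable (orbit_measure H m n x)"
  using fm by (simp cong: measurable_cong_sets)
 define J where "J = orbit_exp (H m) (H n) m n x k \<L>"
 have I: "(\<integral>\<^sup>+y. ennreal (f y) \<partial>orbit_measure H m n x) = J"
  using orbit_nn_integral[where H = H, OF \<mu> \<nu> measurable_compose[OF fm measurable_ennreal], of x]
  by (simp only: J_def f_def)
 have Jb: "eexp (- (k * (mat_norm m n \<L> * L2_set x {..<n}))) <= J" "J < \<infinity>"
  using orbit_exp_bounds[OF \<mu> \<nu> mn k, of \<L> x] unfolding J_def by (auto intro: le_less_trans)
 define Z where "Z = (\<integral>y. f y \<partial>orbit_measure H m n x)"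
 have int: "integrable (orbit_measure H m n x) f"
  using fo I Jb by (intro integrableI_nonneg) (auto simp: f_def)
 have Z: "ennreal Z = J"
  unfolding Z_def I[symmetric] by (rule nn_integral_eq_integral[OF int, symmetric]) (simp add: f_def)
 have "0 < ennreal Z"
  unfolding Z by (rule less_le_trans[OF _ Jb(1)]) simp
 then have "Z > 0" by (simp add: ennreal_less_zero_iff)
 moreover have "tilted_orbit_measure H m n x (mat_scale m n k \<L>)
   = density (orbit_measure H m n x) (%y. ennreal (exp (k * mat_inner m n \<L> y) / Z))"
  unfolding tilted_orbit_measure_def Let_def Z_def f_def by (simp add: mat_inner_scale_left)
 ultimately show ?thesis using that Z by (simp add: J_def)
qed

lemma ennreal_scaled_product:
 assumes "Z > 0" "u >= 0" "v >= 0" "p >= 0" "q >= 0" "r >= 0" "u * v = p * (q * r)"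
 shows "ennreal (u / Z) * ennreal v = ennreal (p / Z) * (ennreal q * ennreal r)"
proof -
 have "ennreal (u / Z) * ennreal v = ennreal (u * v / Z)" using assms by (simp add: ennreal_mult'[symmetric])
 also have "... = ennreal (p / Z * (q * r))" using assms(7) by simp
 also have "... = ennreal (p / Z) * ennreal (q * r)" using assms by (intro ennreal_mult) simp_all
 also have "ennreal (q * r) = ennreal q * ennreal r" using assms by (intro ennreal_mult)
 finally show ?thesis .
qed

lemma mult_reassoc: "(p * (q * r)) * i = p * (i * q * r)" for p q r i :: ennreal
 by (simp only: mult_ac)

text \<open>The unnormalized law of the process: a Gaussian integral with a tilt by \<open>\<Lambda>\<close> and a Bessel factor that
  remembers the starting orbit.\<close>

abbreviation tilted_mass where
 "tilted_mass \<mu> \<nu> m n k t x \<L> A \<equiv> (\<integral>\<^sup>+g. indicator A (mat_scale m n (sqrt (t / k)) g) *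
  (eexp (k * mat_inner m n \<L> (mat_scale m n (sqrt (t / k)) g)) *
  orbit_exp \<mu> \<nu> m n x (k / t) (mat_scale m n (sqrt (t / k)) g)) \<partial>(gauss_mat m n :: ('a::real_complex_quat) fmat measure))"

text \<open>By Cameron and Martin's formula the tilt of the starting distribution and the drift combine to
  a single tilt of the Gaussian law; the starting point survives only in an orbit average.\<close>

lemma law_formula:
 fixes H :: "nat => ('a::real_complex_quat) fmat measure" and B :: "real => 'w => 'a fmat"
 assumes \<mu>: "normalized_haar m (H m)" and \<nu>: "normalized_haar n (H n)" and mn: "n <= m" and n: "n >= 1"
  and k: "k > 0" and t: "t > 0" and \<L>: "\<L> \<in> mats m n" and A: "A \<in> sets (mat_space m n)"
  and B: "mat_brownian_motion_from P m n (tilted_orbit_measure H m n x (mat_scale m n k \<L>)) B"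
 shows "emeasure P {\<omega> \<in> space P. mat_add m n (B (t / k) \<omega>) (mat_scale m n t \<L>) \<in> A}
   * orbit_exp (H m) (H n) m n x k \<L>
   * eexp (k * ((L2_set x {..<n})^2 / (2 * t) + t * (mat_norm m n \<L>)^2 / 2))
  = tilted_mass (H m) (H n) m n k t x \<L> A"
proof -
 interpret \<mu>: prob_space "H m" by (rule haar_prob[OF \<mu>])
 interpret \<nu>: prob_space "H n" by (rule haar_prob[OF \<nu>])
 interpret G: prob_space "gauss_mat m n :: 'a fmat measure" by (rule prob_space_gauss_mat)
 interpret HH: pair_sigma_finite "H m" "H n" ..
 interpret HHp: pair_prob_space "H m" "H n" ..
 interpret HG: pair_sigma_finite "H m \<Otimes>\<^sub>M H n" "gauss_mat m n :: 'a fmat measure" ..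
 define s where "s = t / k"
 have s: "s > 0" using k t by (simp add: s_def)
 define z where "z = (mat_scale m n (sqrt s) :: 'a fmat => 'a fmat)"
 let ?E = "k * ((L2_set x {..<n})^2 / (2 * t) + t * (mat_norm m n \<L>)^2 / 2)"
 let ?T = "tilted_orbit_measure H m n x (mat_scale m n k \<L>)"
 let ?G = "PiM (idx m n) (%_. density lborel (gauss_density s)) :: 'a fmat measure"
 define S where "S y w = mat_add m n (mat_add m n y w) (mat_scale m n t \<L>)" for y w :: "'a fmat"
 obtain B0 W where W: "mat_brownian_motion P m n W" and B0: "B0 \<in> P \<rightarrow>\<^sub>M mat_space m n"
  and law0: "distr P (mat_space m n) B0 = ?T"
  and ind: "prob_space.indep_set P {B0 -` A \<inter> space P | A. A \<in> sets (mat_space m n)}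
     {(%\<omega>. \<lambda>s\<in>{0..}. W s \<omega>) -` A \<inter> space P | A. A \<in> sets (\<Pi>\<^sub>M s\<in>{0..}. mat_space m n)}"
  and BW: "\<forall>s\<ge>0. \<forall>\<omega>\<in>space P. B s \<omega> = mat_add m n (B0 \<omega>) (W s \<omega>)"
  using B unfolding mat_brownian_motion_from_def by (elim exE conjE)
 have P: "prob_space P" using W by (simp add: mat_brownian_motion_def)
 interpret P: prob_space P by (rule P)
 have Wm: "W r \<in> P \<rightarrow>\<^sub>M mat_space m n" if "r >= 0" for r
  using W that by (simp add: mat_brownian_motion_def)
 have Wsm: "W s \<in> P \<rightarrow>\<^sub>M mat_space m n" using Wm s by simp
 obtain Z where Z: "Z > 0" "ennreal Z = orbit_exp (H m) (H n) m n x k \<L>"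
  and tilt: "?T
   = density (orbit_measure H m n x) (%y. ennreal (exp (k * mat_inner m n \<L> y) / Z))"
  by (rule tilted_normalizer[where H = H, OF \<mu> \<nu> mn less_imp_le[OF k] \<L>, of x], rule that)
 let ?c = "ennreal (exp (- ?E) / Z)"
 let ?d = "%y. ennreal (exp (k * mat_inner m n \<L> y) / Z)"
 let ?e = "%g. eexp (k * mat_inner m n \<L> (z g))"
 let ?J = "%g. orbit_exp (H m) (H n) m n x (k / t) (z g)"
 let ?u = "%g p. eexp (k / t * mat_inner m n (z g) (usv m n (fst p) x (snd p)))"
 have zm: "z \<in> mat_space m n \<rightarrow>\<^sub>M mat_space m n"
  unfolding z_def by (intro measurable_mat_scale measurable_ident_sets refl)
 have zm': "z \<in> gauss_mat m n \<rightarrow>\<^sub>M mat_space m n"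
  using zm by (simp cong: measurable_cong_sets)
 have zmats: "z g \<in> mats m n" for g by (simp add: z_def)
 have m12: "fst \<in> mat_space m n \<Otimes>\<^sub>M mat_space m n \<rightarrow>\<^sub>M (mat_space m n :: 'a fmat measure)"
  "snd \<in> mat_space m n \<Otimes>\<^sub>M mat_space m n \<rightarrow>\<^sub>M (mat_space m n :: 'a fmat measure)" by simp_all
 have Sm: "(%p. S (fst p) (snd p)) \<in> mat_space m n \<Otimes>\<^sub>M mat_space m n \<rightarrow>\<^sub>M mat_space m n"
  unfolding S_def by (intro measurable_mat_add measurable_const_mat mat_scale_mats m12)
 have indm: "(indicator A :: 'a fmat => ennreal) \<in> borel_measurable (mat_space m n)"
  using A by simp
 have FSm: "(%p. indicator A (S (fst p) (snd p)) :: ennreal) \<in> borel_measurable (mat_space m n \<Otimes>\<^sub>M mat_space m n)"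
  by (rule measurable_compose[OF Sm indm])
 define \<Phi> where "\<Phi> y = (\<integral>\<^sup>+g. indicator A (S y (z g)) \<partial>gauss_mat m n)" for y
 have \<Phi>m: "\<Phi> \<in> borel_measurable (mat_space m n)"
 proof -
  have "(%p. S (fst p) (z (snd p))) \<in> mat_space m n \<Otimes>\<^sub>M gauss_mat m n \<rightarrow>\<^sub>M mat_space m n"
   unfolding S_def
   by (intro measurable_mat_add measurable_const_mat mat_scale_mats measurable_fst measurable_compose[OF measurable_snd zm'])
  from measurable_compose[OF this indm] show ?thesis
   unfolding \<Phi>_def by (intro G.borel_measurable_nn_integral) (simp add: case_prod_beta')
 qed
 have law: "distr P (mat_space m n \<Otimes>\<^sub>M mat_space m n) (%\<omega>. (B0 \<omega>, W s \<omega>))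
  = ?T \<Otimes>\<^sub>M ?G"
 proof -
  have "distr P (mat_space m n \<Otimes>\<^sub>M mat_space m n) (%\<omega>. (B0 \<omega>, W s \<omega>))
   = distr P (mat_space m n) B0 \<Otimes>\<^sub>M distr P (mat_space m n) (W s)"
   by (rule start_and_brownian_indep[OF P B0 Wm ind less_imp_le[OF s]])
  then show ?thesis
   using brownian_law[OF W _ n s] mn n by (simp add: law0)
 qed
 have "emeasure P {\<omega> \<in> space P. mat_add m n (B (t / k) \<omega>) (mat_scale m n t \<L>) \<in> A}
  = (\<integral>\<^sup>+\<omega>. indicator A (S (fst (B0 \<omega>, W s \<omega>)) (snd (B0 \<omega>, W s \<omega>))) \<partial>P)"
 proof -
  have eq: "{\<omega> \<in> space P. mat_add m n (B (t / k) \<omega>) (mat_scale m n t \<L>) \<in> A} = {\<omega> \<in> space P. S (B0 \<omega>) (W s \<omega>) \<in> A}"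
   using BW s by (auto simp: S_def s_def)
  have "(%\<omega>. S (B0 \<omega>) (W s \<omega>)) \<in> P \<rightarrow>\<^sub>M mat_space m n"
   unfolding S_def by (intro measurable_mat_add measurable_const_mat mat_scale_mats B0 Wsm)
  from measurable_sets[OF this A] have "{\<omega> \<in> space P. S (B0 \<omega>) (W s \<omega>) \<in> A} \<in> sets P"
   by (simp add: vimage_def Int_def conj_commute)
  then have "emeasure P {\<omega> \<in> space P. S (B0 \<omega>) (W s \<omega>) \<in> A} = (\<integral>\<^sup>+\<omega>. indicator {\<omega> \<in> space P. S (B0 \<omega>) (W s \<omega>) \<in> A} \<omega> \<partial>P)"
   by simp
  also have "... = (\<integral>\<^sup>+\<omega>. indicator A (S (fst (B0 \<omega>, W s \<omega>)) (snd (B0 \<omega>, W s \<omega>))) \<partial>P)"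
   by (intro nn_integral_cong) (simp add: indicator_def)
  finally show ?thesis unfolding eq .
 qed
 also have "... = (\<integral>\<^sup>+p. indicator A (S (fst p) (snd p)) \<partial>distr P (mat_space m n \<Otimes>\<^sub>M mat_space m n) (%\<omega>. (B0 \<omega>, W s \<omega>)))"
  by (rule nn_integral_distr[symmetric]) (use B0 Wsm FSm in auto)
 also have "... = (\<integral>\<^sup>+y. \<integral>\<^sup>+w. indicator A (S y w) \<partial>?G
   \<partial>?T)"
 proof -
  interpret Ga: prob_space "?G"
   by (intro prob_space_PiM prob_space_gauss s)
  have st: "sets (?T) = sets (mat_space m n)"
   unfolding law0[symmetric] by simp
  have sg: "sets (?G :: 'a fmat measure) = sets (mat_space m n)"
   unfolding mat_space_def by (intro sets_PiM_cong) auto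
  have "(%p. indicator A (S (fst p) (snd p)) :: ennreal) \<in> borel_measurable
   (?T \<Otimes>\<^sub>M ?G)"
   using FSm by (simp add: st sg cong: measurable_cong_sets sets_pair_measure_cong)
  from Ga.nn_integral_fst[OF this] show ?thesis
   unfolding law by simp
 qed
 also have "... = (\<integral>\<^sup>+y. \<Phi> y \<partial>?T)"
 proof (rule nn_integral_cong)
  fix y assume "y \<in> space (?T)"
  then have y: "y \<in> mats m n" unfolding law0[symmetric] by simp
  have "(%w. S y w) \<in> mat_space m n \<rightarrow>\<^sub>M mat_space m n"
   unfolding S_def by (intro measurable_mat_add measurable_const_mat mat_scale_mats y measurable_ident_sets refl)
  from nn_integral_PiM_gauss_density[OF measurable_compose[OF this indm] s]
  show "(\<integral>\<^sup>+w. indicator A (S y w) \<partial>?G) = \<Phi> y"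
   by (simp add: \<Phi>_def z_def)
 qed
 also have "... = (\<integral>\<^sup>+y. ?d y * \<Phi> y \<partial>orbit_measure H m n x)"
 proof -
  have so: "sets (orbit_measure H m n x) = sets (mat_space m n)" by (simp add: orbit_measure_def)
  have "(%y. mat_inner m n \<L> y) \<in> borel_measurable (mat_space m n)"
   by (intro measurable_mat_inner measurable_const_mat \<L> measurable_ident_sets refl)
  then have "(%y. ?d y) \<in> borel_measurable (mat_space m n)" by measurable
  then show ?thesis
   unfolding tilt using \<Phi>m by (intro nn_integral_density) (simp_all add: so cong: measurable_cong_sets)
 qed
 also have "... = (\<integral>\<^sup>+p. ennreal (exp (k * mat_inner m n \<L> (usv m n (fst p) x (snd p))) / Z) * \<Phi> (usv m n (fst p) x (snd p)) \<partial>(H m \<Otimes>\<^sub>M H n))"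
 proof -
  have "(%y. mat_inner m n \<L> y) \<in> borel_measurable (mat_space m n)"
   by (intro measurable_mat_inner measurable_const_mat \<L> measurable_ident_sets refl)
  then have "(%y. ?d y * \<Phi> y) \<in> borel_measurable (mat_space m n)"
   using \<Phi>m by measurable
  then show ?thesis
   unfolding orbit_measure_def case_prod_beta' by (intro nn_integral_distr measurable_usv[OF \<mu> \<nu>]) simp
 qed
 also have "... = (\<integral>\<^sup>+p. \<integral>\<^sup>+g. ?c *
   (indicator A (z g) * ?e g *
   ?u g p) \<partial>gauss_mat m n \<partial>(H m \<Otimes>\<^sub>M H n))"
 proof (rule nn_integral_cong)
  fix p assume "p \<in> space (H m \<Otimes>\<^sub>M H n)"
  then have p: "fst p \<in> \<U> m" "snd p \<in> \<U> n"
   by (auto simp: space_pair_measure haar_space[OF \<mu>] haar_space[OF \<nu>])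
  define y where "y = usv m n (fst p) x (snd p)"
  have ym: "y \<in> mats m n" by (simp add: y_def)
  have yn: "mat_norm m n y = L2_set x {..<n}" unfolding y_def by (rule usv_norm[OF mn p])
  define a where "a = mat_scale m n (1 / sqrt s) (mat_add m n y (mat_scale m n t \<L>))"
  let ?a = "%g. eexp (mat_inner m n a g - (mat_norm m n a)\<^sup>2 / 2)"
  have Sz: "S y (z g) = z (mat_add m n a g)" for g
  proof (rule mat_eqI[of _ m n])
   fix i j assume "i < m" "j < n"
   then show "S y (z g) (i, j) = z (mat_add m n a g) (i, j)"
    using s by (simp add: S_def z_def a_def scaleR_add_right algebra_simps)
  qed (simp_all add: S_def z_def)
  have Azm: "(%g. indicator A (z g) :: ennreal) \<in> borel_measurable (mat_space m n)"
   by (rule measurable_compose[OF zm indm])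
  have f1: "\<Phi> y = (\<integral>\<^sup>+g. ?a g * indicator A (z g) \<partial>gauss_mat m n)"
   unfolding \<Phi>_def Sz by (rule nn_integral_gauss_shift[OF Azm]) (simp add: a_def)
  have f2: "?d y * ?a g
   = ?c *
    (?e g * eexp (k / t * mat_inner m n (z g) y))" for g
  proof -
   have i1: "mat_inner m n a g = k / t * mat_inner m n (z g) y + k * mat_inner m n \<L> (z g)"
   proof -
    have "k / t * (mat_inner m n g y * sqrt s) = (1 / sqrt s) * mat_inner m n g y"
    proof -
     have "k / t = 1 / (sqrt s * sqrt s)" using k t by (simp add: s_def)
     moreover have "1 / (r * r) * (u * r) = 1 / r * u" if "r > 0" for r u :: real
      using that by (simp add: field_simps)
     ultimately show ?thesis using s by (simp only: real_sqrt_gt_0_iff)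
    qed
    moreover have "k * (mat_inner m n \<L> g * sqrt s) = (1 / sqrt s) * (t * mat_inner m n \<L> g)"
    proof -
     have "k * (sqrt s * sqrt s) = t" using t k by (simp add: s_def)
     moreover have "k * (u * r) = 1 / r * (k * (r * r) * u)" if "r > 0" for r u :: real
      using that by (simp add: field_simps)
     ultimately show ?thesis using s by (metis real_sqrt_gt_0_iff)
    qed
    ultimately show ?thesis
     by (simp add: a_def z_def mat_inner_scale_left mat_inner_scale_right mat_inner_add_left
       mat_inner_commute[of m n y g] algebra_simps)
   qed
   have i2: "(mat_norm m n a)^2 / 2 = k / (2 * t) * ((L2_set x {..<n})^2 + 2 * t * mat_inner m n \<L> y + t^2 * (mat_norm m n \<L>)^2)"
   proof -
    have "(mat_norm m n a)^2 = (1 / sqrt s) * ((1 / sqrt s) * ((mat_norm m n y)^2 + 2 * t * mat_inner m n \<L> y + t^2 * (mat_norm m n \<L>)^2))"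
     unfolding mat_inner_self[symmetric] a_def
     by (simp add: mat_inner_scale_left mat_inner_scale_right mat_inner_add_left mat_inner_add_right
       mat_inner_commute[of m n y \<L>] power2_eq_square algebra_simps)
    also have "... = k / t * ((mat_norm m n y)^2 + 2 * t * mat_inner m n \<L> y + t^2 * (mat_norm m n \<L>)^2)"
     using k t by (simp add: s_def mult.assoc[symmetric])
    finally show ?thesis by (simp add: yn)
   qed
   have "k * mat_inner m n \<L> y + (mat_inner m n a g - (mat_norm m n a)\<^sup>2 / 2)
    = - ?E
     + (k * mat_inner m n \<L> (z g) + k / t * mat_inner m n (z g) y)"
    unfolding i1 i2 using t by (simp add: field_simps power2_eq_square)
   then have "exp (k * mat_inner m n \<L> y) * exp (mat_inner m n a g - (mat_norm m n a)\<^sup>2 / 2)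
    = exp (- ?E) *
     (exp (k * mat_inner m n \<L> (z g)) * exp (k / t * mat_inner m n (z g) y))"
    unfolding exp_add[symmetric] by (rule arg_cong)
   then show ?thesis
    by (rule ennreal_scaled_product[OF Z(1) exp_ge_zero exp_ge_zero exp_ge_zero exp_ge_zero exp_ge_zero])
  qed
  have f3: "?d y * (\<integral>\<^sup>+g. ?a g * indicator A (z g) \<partial>gauss_mat m n)
   = (\<integral>\<^sup>+g. ?d y * (?a g * indicator A (z g)) \<partial>gauss_mat m n)"
  proof (rule nn_integral_cmult[symmetric])
   have "(%g. mat_inner m n a g) \<in> borel_measurable (mat_space m n)"
    by (intro measurable_mat_inner measurable_const_mat measurable_ident_sets refl) (simp add: a_def)
   then have "(%g. ?a g) \<in> borel_measurable (mat_space m n)"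
    by measurable
   then have "(%g. ?a g * indicator A (z g)) \<in> borel_measurable (mat_space m n)"
    by (rule borel_measurable_times_ennreal[OF _ Azm])
   then show "(%g. ?a g * indicator A (z g)) \<in> borel_measurable (gauss_mat m n)"
    by (simp cong: measurable_cong_sets)
  qed
  show "ennreal (exp (k * mat_inner m n \<L> (usv m n (fst p) x (snd p))) / Z) * \<Phi> (usv m n (fst p) x (snd p))
   = (\<integral>\<^sup>+g. ?c *
   (indicator A (z g) * ?e g *
   ?u g p) \<partial>gauss_mat m n)"
   unfolding y_def[symmetric] f1 f3
  proof (rule nn_integral_cong)
   fix g :: "'a fmat"
   have "?d y * (?a g * indicator A (z g))
    = ?d y * ?a g * indicator A (z g)"
    by (rule mult.assoc[symmetric])
   then show "?d y * (?a g * indicator A (z g))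
    = ?c *
     (indicator A (z g) * ?e g * eexp (k / t * mat_inner m n (z g) y))"
    unfolding f2 using mult_reassoc by (rule trans)
  qed
 qed
 also have "... = (\<integral>\<^sup>+g. \<integral>\<^sup>+p. ?c *
   (indicator A (z g) * ?e g *
   ?u g p) \<partial>(H m \<Otimes>\<^sub>M H n) \<partial>gauss_mat m n)"
 proof (rule HG.Fubini'[symmetric])
  have zs: "(%q. z (snd q)) \<in> (H m \<Otimes>\<^sub>M H n) \<Otimes>\<^sub>M gauss_mat m n \<rightarrow>\<^sub>M mat_space m n"
   by (rule measurable_compose[OF measurable_snd zm'])
  have us: "(%q. usv m n (fst (fst q)) x (snd (fst q))) \<in> (H m \<Otimes>\<^sub>M H n) \<Otimes>\<^sub>M gauss_mat m n \<rightarrow>\<^sub>M mat_space m n"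
   by (rule measurable_compose[OF measurable_fst measurable_usv[OF \<mu> \<nu>]])
  have 1: "(%q. indicator A (z (snd q)) :: ennreal) \<in> borel_measurable ((H m \<Otimes>\<^sub>M H n) \<Otimes>\<^sub>M gauss_mat m n)"
   by (rule measurable_compose[OF zs indm])
  have "(%q. mat_inner m n \<L> (z (snd q))) \<in> borel_measurable ((H m \<Otimes>\<^sub>M H n) \<Otimes>\<^sub>M gauss_mat m n)"
   by (intro measurable_mat_inner measurable_const_mat \<L> zs)
  then have 2: "(%q. eexp (k * mat_inner m n \<L> (z (snd q)))) \<in> borel_measurable ((H m \<Otimes>\<^sub>M H n) \<Otimes>\<^sub>M gauss_mat m n)"
   by measurable
  have "(%q. mat_inner m n (z (snd q)) (usv m n (fst (fst q)) x (snd (fst q)))) \<in> borel_measurable ((H m \<Otimes>\<^sub>M H n) \<Otimes>\<^sub>M gauss_mat m n)"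
   by (intro measurable_mat_inner us zs)
  then have 3: "(%q. eexp (k / t * mat_inner m n (z (snd q)) (usv m n (fst (fst q)) x (snd (fst q))))) \<in> borel_measurable ((H m \<Otimes>\<^sub>M H n) \<Otimes>\<^sub>M gauss_mat m n)"
   by measurable
  show "(%(p, g). ?c *
   (indicator A (z g) * ?e g *
   ?u g p)) \<in> borel_measurable ((H m \<Otimes>\<^sub>M H n) \<Otimes>\<^sub>M gauss_mat m n)"
   unfolding case_prod_beta' by (intro borel_measurable_times_ennreal measurable_const 1 2 3) simp
 qed
 also have "... = (\<integral>\<^sup>+g. ?c *
   (indicator A (z g) * (?e g * ?J g)) \<partial>gauss_mat m n)"
 proof (rule nn_integral_cong)
  fix g :: "'a fmat"
  have "(%p. mat_inner m n (z g) (usv m n (fst p) x (snd p))) \<in> borel_measurable (H m \<Otimes>\<^sub>M H n)"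
   by (intro measurable_mat_inner measurable_const_mat zmats measurable_usv[OF \<mu> \<nu>])
  then have em: "(%p. ?u g p) \<in> borel_measurable (H m \<Otimes>\<^sub>M H n)"
   by measurable
  have "(\<integral>\<^sup>+p. ?u g p \<partial>(H m \<Otimes>\<^sub>M H n)) = ?J g"
   using HH.nn_integral_snd[OF em] by simp
  then show "(\<integral>\<^sup>+p. ?c *
   (indicator A (z g) * ?e g *
   ?u g p) \<partial>(H m \<Otimes>\<^sub>M H n))
   = ?c *
   (indicator A (z g) * (?e g * ?J g))"
   unfolding mult.assoc[symmetric] by (subst nn_integral_cmult[OF em]) (simp only:)
 qed
 also have "... = ?c * (\<integral>\<^sup>+g.
   (indicator A (z g) * (?e g * ?J g)) \<partial>gauss_mat m n)"
 proof (rule nn_integral_cmult)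
  have 1: "(%g. indicator A (z g) :: ennreal) \<in> borel_measurable (gauss_mat m n)"
   by (rule measurable_compose[OF zm' indm])
  have "(%g. mat_inner m n \<L> (z g)) \<in> borel_measurable (gauss_mat m n)"
   by (intro measurable_mat_inner measurable_const_mat \<L> zm')
  then have 2: "(%g. ?e g) \<in> borel_measurable (gauss_mat m n)"
   by measurable
  have 3: "(%g. ?J g) \<in> borel_measurable (gauss_mat m n)"
  proof -
   have "(%q. mat_inner m n (z (fst q)) (usv m n (fst (snd q)) x (snd (snd q)))) \<in> borel_measurable (gauss_mat m n \<Otimes>\<^sub>M (H m \<Otimes>\<^sub>M H n))"
    by (intro measurable_mat_inner measurable_compose[OF measurable_fst zm'] measurable_compose[OF measurable_snd measurable_usv[OF \<mu> \<nu>]])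
   then have "(%q. eexp (k / t * mat_inner m n (z (fst q)) (usv m n (fst (snd q)) x (snd (snd q))))) \<in> borel_measurable (gauss_mat m n \<Otimes>\<^sub>M (H m \<Otimes>\<^sub>M H n))"
    by measurable
   then have "(%g. \<integral>\<^sup>+p. ?u g p \<partial>(H m \<Otimes>\<^sub>M H n)) \<in> borel_measurable (gauss_mat m n)"
    by (intro HH.P.borel_measurable_nn_integral) (simp add: case_prod_beta')
   moreover have "(\<integral>\<^sup>+p. ?u g p \<partial>(H m \<Otimes>\<^sub>M H n)) = ?J g" for g
   proof -
    have "(%p. mat_inner m n (z g) (usv m n (fst p) x (snd p))) \<in> borel_measurable (H m \<Otimes>\<^sub>M H n)"
     by (intro measurable_mat_inner measurable_const_mat zmats measurable_usv[OF \<mu> \<nu>])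
    then have em: "(%p. ?u g p) \<in> borel_measurable (H m \<Otimes>\<^sub>M H n)"
     by measurable
    show ?thesis using HH.nn_integral_snd[OF em] by simp
   qed
   ultimately show ?thesis by simp
  qed
  show "(%g. indicator A (z g) * (?e g * ?J g)) \<in> borel_measurable (gauss_mat m n)"
   by (intro borel_measurable_times_ennreal 1 2 3)
 qed
 finally have main: "emeasure P {\<omega> \<in> space P. mat_add m n (B (t / k) \<omega>) (mat_scale m n t \<L>) \<in> A}
  = ?c * (\<integral>\<^sup>+g.
   (indicator A (z g) * (?e g * ?J g)) \<partial>gauss_mat m n)" .
 have cancel: "ennreal (exp (- r) / Z) * N * ennreal Z * ennreal (exp r) = N" for r N
 proof -
  have "ennreal (exp (- r) / Z) * N * ennreal Z * ennreal (exp r) = N * (ennreal (exp (- r) / Z) * ennreal Z * ennreal (exp r))"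
   by (simp only: mult_ac)
  also have "ennreal (exp (- r) / Z) * ennreal Z = ennreal (exp (- r) / Z * Z)"
   using Z(1) by (intro ennreal_mult[symmetric]) simp_all
  also have "ennreal (exp (- r) / Z * Z) * ennreal (exp r) = ennreal (exp (- r) / Z * Z * exp r)"
   using Z(1) by (intro ennreal_mult[symmetric]) simp_all
  also have "exp (- r) / Z * Z * exp r = 1"
   using Z(1) by (simp add: exp_minus)
  finally show ?thesis by simp
 qed
 show ?thesis
  unfolding main Z(2)[symmetric] cancel by (simp only: z_def s_def)
qed

section \<open>The exponents in one coordinate\<close>

definition lim_sq :: "real => real => real => real" where
 "lim_sq x w t = x^2 + w^2 * t^2 + 2 * t * sqrt (x^2 * w^2 + 1)"

abbreviation far_set :: "nat => nat => real => (nat => real) => (nat => real) => real => ('a::real_complex_quat) fmat set" where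
 "far_set m n \<epsilon> x w t \<equiv> {z \<in> mats m n. \<epsilon> <= L2_set (%i. sing_vals m n z i - sqrt (lim_sq (x i) (w i) t)) {..<n}}"

definition root_s :: "real => real => real" where
 "root_s x w = sqrt (x^2 * w^2 + 1)"

lemma root_s_ge_1: "1 <= root_s x w"
 by (simp add: root_s_def)

lemma root_s_sq: "(root_s x w)^2 = x^2 * w^2 + 1"
 by (simp add: root_s_def)

lemma lim_sq_ge: "t > 0 ==> 2 * t <= lim_sq x w t"
proof -
 assume "t > 0"
 then have "2 * t * 1 <= 2 * t * root_s x w"
  by (intro mult_left_mono root_s_ge_1) simp
 moreover have "0 <= x^2 + w^2 * t^2" by simp
 ultimately show ?thesis unfolding lim_sq_def root_s_def[symmetric] by linarith
qed

text \<open>The parameters below turn the upper bounds for both Bessel factors into equalities at the limit point. That the two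
  quadratic coefficients add up to \<open>1 / (2 * t) - 1 / y^2\<close> is what makes the weight a centred Gaussian with variances proportional to \<open>y^2\<close>.\<close>

lemma T_identities:
 fixes a b s t :: real
 assumes ab: "a >= 0" "b >= 0" and s: "s >= 1" "s^2 = 1 + a * b" and t: "t > 0"
 shows "a / (1 + s + a) + b / (1 + s + b) = 1 - 2 / (2 * s + a + b)"
  and "(1 + s + a) * (1 + s + b) = (1 + s) * (2 * s + a + b)"
  and "c_fun (1 / (1 + s + a)) + c_fun (1 / (1 + s + b)) + ln ((2 * s + a + b) / 2)
   = (a + b) / 2 + ((s - 1) / 2 + c_fun (1 / (1 + s)))"
proof -
 have sq: "a * b = s * s - 1" using s by (simp add: power2_eq_square)
 have "(1 + s + a) * (1 + s + b) = (1 + s) * (1 + s) + (1 + s) * (a + b) + a * b" by (simp add: algebra_simps)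
 also have "... = (1 + s) * (2 * s + a + b)" unfolding sq by (simp add: algebra_simps)
 finally show prod: "(1 + s + a) * (1 + s + b) = (1 + s) * (2 * s + a + b)" .
 have pos: "1 + s + a > 0" "1 + s + b > 0" "2 * s + a + b > 0" "1 + s > 0" using ab s by simp_all
 have "a / (1 + s + a) + b / (1 + s + b) = (a * (1 + s + b) + b * (1 + s + a)) / ((1 + s + a) * (1 + s + b))"
  using pos by (simp add: add_frac_eq)
 also have "a * (1 + s + b) + b * (1 + s + a) = (a + b) * (1 + s) + 2 * (a * b)" by (simp add: algebra_simps)
 also have "... = (1 + s) * (2 * s + a + b - 2)" unfolding sq by (simp add: algebra_simps)
 also have "(1 + s) * (2 * s + a + b - 2) / ((1 + s + a) * (1 + s + b)) = (2 * s + a + b - 2) / (2 * s + a + b)"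
  unfolding prod using pos by simp
 also have "... = 1 - 2 / (2 * s + a + b)" using pos by (simp add: diff_divide_distrib)
 finally show "a / (1 + s + a) + b / (1 + s + b) = 1 - 2 / (2 * s + a + b)" .
 have l: "c_fun (1 / r) = r / 2 - 1 + (ln 2 - ln r)" if "r > 0" for r :: real
  using that by (simp add: c_fun_def ln_div)
 have "ln (1 + s + a) + ln (1 + s + b) = ln ((1 + s + a) * (1 + s + b))"
  by (rule ln_mult_pos[symmetric]) (use pos in simp_all)
 also have "... = ln (1 + s) + ln (2 * s + a + b)"
  unfolding prod by (rule ln_mult_pos) (use pos in simp_all)
 finally have "ln (1 + s + a) + ln (1 + s + b) = ln (1 + s) + ln (2 * s + a + b)" .
 moreover have "ln ((2 * s + a + b) / 2) = ln (2 * s + a + b) - ln 2" using pos by (simp add: ln_div)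
 ultimately show "c_fun (1 / (1 + s + a)) + c_fun (1 / (1 + s + b)) + ln ((2 * s + a + b) / 2)
   = (a + b) / 2 + ((s - 1) / 2 + c_fun (1 / (1 + s)))"
  unfolding l[OF pos(1)] l[OF pos(2)] l[OF pos(4)] by (simp add: field_simps)
qed

text \<open>The first identity identifies the Gaussian weight, the second one is the optimality of the variances in the lower bound, and the third
  one says that the exponents of numerator and denominator cancel, as they must for a probability.\<close>

lemma coordinate_identities:
 fixes x w t :: real
 assumes t: "t > 0"
 defines "s \<equiv> root_s x w"
 defines "T1 \<equiv> 1 / (1 + s + t * w^2)" and "T2 \<equiv> 1 / (1 + s + x^2 / t)" and "T3 \<equiv> 1 / (1 + s)"
 shows "T1 * w^2 / 2 + T2 * (x / t)^2 / 2 = 1 / (2 * t) - 1 / lim_sq x w t"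
  and "2 * T3 + (T3 * (x * w))^2 = 1"
  and "c_fun T1 + c_fun T2 + ln (lim_sq x w t / (2 * t))
   = x^2 / (2 * t) + t * w^2 / 2 + (T3 * (x * w)^2 / 2 + c_fun T3)"
  and "0 < T1" "T1 <= 1 / 2" "0 < T2" "T2 <= 1 / 2" "0 < T3" "T3 <= 1 / 2"
proof -
 define a b where "a = t * w^2" and "b = x^2 / t"
 have ab: "a >= 0" "b >= 0" using t by (simp_all add: a_def b_def)
 have s1: "s >= 1" unfolding s_def by (rule root_s_ge_1)
 have abx: "a * b = x^2 * w^2" using t by (simp add: a_def b_def)
 have s2: "s^2 = 1 + a * b" by (simp add: s_def root_s_sq abx)
 note I = T_identities[OF ab s1 s2 t]
 have Y: "lim_sq x w t = t * (2 * s + a + b)"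
  using t by (simp add: lim_sq_def s_def root_s_def a_def b_def algebra_simps power2_eq_square)
 have Tw: "T1 = 1 / (1 + s + a)" "T2 = 1 / (1 + s + b)" by (simp_all add: T1_def T2_def a_def b_def)
 have Dp: "2 * s + a + b > 0" using s1 ab by simp
 have "T1 * w^2 / 2 + T2 * (x / t)^2 / 2 = (1 / (2 * t)) * (a / (1 + s + a) + b / (1 + s + b))"
  using t unfolding Tw by (simp add: a_def b_def power_divide algebra_simps power2_eq_square)
 also have "... = 1 / (2 * t) - 1 / lim_sq x w t"
 proof -
  have "1 / (2 * t) * (1 - 2 / D) = 1 / (2 * t) - 1 / (t * D)" if "D > 0" for D
   using that t by (simp add: field_simps)
  then show ?thesis unfolding I(1) Y using Dp .
 qed
 finally show "T1 * w^2 / 2 + T2 * (x / t)^2 / 2 = 1 / (2 * t) - 1 / lim_sq x w t" .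
 have p: "1 + s > 0" using s1 by simp
 have xw: "(x * w)^2 = (s - 1) * (1 + s)" using s2 abx by (simp add: power_mult_distrib algebra_simps power2_eq_square)
 have T3xw: "T3 * (x * w)^2 = s - 1" unfolding xw T3_def using p by simp
 have "2 * T3 + (T3 * (x * w))^2 = T3 * (2 + T3 * (x * w)^2)" by (simp add: power2_eq_square algebra_simps)
 also have "... = 1" unfolding T3xw using p by (simp add: T3_def)
 finally show "2 * T3 + (T3 * (x * w))^2 = 1" .
 have "lim_sq x w t / (2 * t) = (2 * s + a + b) / 2" unfolding Y using t by simp
 then show "c_fun T1 + c_fun T2 + ln (lim_sq x w t / (2 * t))
   = x^2 / (2 * t) + t * w^2 / 2 + (T3 * (x * w)^2 / 2 + c_fun T3)"
 proof -
  assume L: "lim_sq x w t / (2 * t) = (2 * s + a + b) / 2"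
  have "(a + b) / 2 = x^2 / (2 * t) + t * w^2 / 2" using t by (simp add: a_def b_def field_simps)
  then show ?thesis unfolding L T3xw using I(3) by (simp add: Tw T3_def)
 qed
 have "2 <= 1 + s + a" "2 <= 1 + s + b" "2 <= 1 + s" using s1 ab by simp_all
 then show "0 < T1" "T1 <= 1 / 2" "0 < T2" "T2 <= 1 / 2" "0 < T3" "T3 <= 1 / 2"
  unfolding Tw T3_def by (auto intro!: divide_left_mono simp: field_simps)
qed

lemma neg_ln_one_minus_le:
 fixes v :: real
 assumes "-1 <= v" "v <= 1 / 2"
 shows "- ln (1 - v) <= v + 2 * v^2"
proof (cases "v >= 0")
 case True
 from ln_one_minus_pos_lower_bound[OF this assms(2)] show ?thesis by simp
next
 case False
 from abs_ln_one_plus_x_minus_x_bound_nonneg[of "- v"] False assms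
 have "\<bar>ln (1 - v) + v\<bar> <= v^2" by simp
 then show ?thesis by (simp add: abs_le_iff)
qed

section \<open>Quadratic exponentials of the singular values\<close>

lemma col_sq_proj: "j < n ==> col_sq m A j = (mat_norm m n (mat_mult m n n A (sigma_mat n n (%i. if i = j then 1 else 0))))^2"
proof -
 assume j: "j < n"
 have "(mat_norm m n (mat_mult m n n A (sigma_mat n n (%i. if i = j then 1 else 0))))^2
  = (\<Sum>i<m. \<Sum>l<n. if l = j then (norm (A (i, j)))\<^sup>2 else 0)"
  unfolding mat_norm_sq
 proof (intro sum.cong refl)
  fix i l assume il: "i \<in> {..<m}" "l \<in> {..<n}"
  have "mat_mult m n n A (sigma_mat n n (%i. if i = j then 1 else 0)) (i, l)
   = (\<Sum>q<n. if q = l then A (i, q) * of_real (if q = j then 1 else 0) else 0)"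
   unfolding mat_mult_entry[OF il(1)[simplified] il(2)[simplified]]
   by (rule sum.cong) (use il in auto)
  also have "... = A (i, l) * of_real (if l = j then 1 else 0)" using il by simp
  finally show "(norm (mat_mult m n n A (sigma_mat n n (%i. if i = j then 1 else 0)) (i, l)))^2 = (if l = j then (norm (A (i, j)))\<^sup>2 else 0)"
   by simp
 qed
 then show ?thesis using j by (simp add: col_sq_def)
qed

lemma sum_col_sq: "(\<Sum>j<n. col_sq m A j) = (mat_norm m n A)^2"
 unfolding col_sq_def mat_norm_sq by (rule sum.swap)

lemma col_sq_usv:
 assumes "n <= m" "U \<in> \<U> m" "V \<in> \<U> n" "j < n"
 shows "col_sq m (mat_mult m n n (usv m n U p V) V) j = (p j)^2"
proof -
 let ?E = "sigma_mat n n (%i. if i = j then 1 else 0) :: 'a fmat"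
 have "mat_mult m n n (usv m n U p V) V = mat_mult m m n U (sigma_mat m n p)"
  by (rule unitary_cancel_right(1)[OF assms(3)]) simp
 then have "col_sq m (mat_mult m n n (usv m n U p V) V) j
  = (mat_norm m n (mat_mult m m n U (mat_mult m n n (sigma_mat m n p) ?E)))^2"
  by (simp add: col_sq_proj[OF assms(4)] mat_mult_assoc)
 also have "... = (mat_norm m n (mat_mult m n n (sigma_mat m n p) ?E))^2"
  by (simp add: mat_norm_unitary_left[OF assms(2)])
 also have "... = col_sq m (sigma_mat m n p :: 'a fmat) j" by (rule col_sq_proj[OF assms(4), symmetric])
 also have "... = (\<Sum>i<m. if i = j then (p j)\<^sup>2 else 0)"
  unfolding col_sq_def using assms by (intro sum.cong) auto
 finally show ?thesis using assms by simp
qed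

lemma col_sq_perturb:
 assumes V: "V \<in> \<U> n" "V' \<in> \<U> n" and e: "mat_norm n n (mat_minus n n V V') <= e"
  and z: "z \<in> mats m n" and j: "j < n"
 shows "\<bar>col_sq m (mat_mult m n n z V) j - col_sq m (mat_mult m n n z V') j\<bar> <= 2 * e * (mat_norm m n z)^2"
proof -
 let ?E = "sigma_mat n n (%i. if i = j then 1 else 0) :: 'a fmat"
 define N where "N = mat_norm m n z"
 define c where "c A = mat_norm m n (mat_mult m n n (mat_mult m n n z A) ?E)" for A
 have N0: "0 <= N" unfolding N_def by (rule mat_norm_ge_0)
 have "(mat_norm n n ?E)^2 = col_sq n (mat_one n :: 'a fmat) j"
  unfolding col_sq_proj[OF j] by (simp add: mat_mult_one_left)
 also have "... = (\<Sum>i<n. if i = j then 1 else 0)"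
  unfolding col_sq_def using j by (intro sum.cong) auto
 finally have "(mat_norm n n ?E)^2 = 1\<^sup>2" using j by simp
 then have E: "mat_norm n n ?E = 1"
  by (rule power2_eq_imp_eq) (simp_all add: mat_norm_ge_0)
 have cb: "c A <= N * mat_norm n n A" for A
 proof -
  have "c A <= mat_norm m n (mat_mult m n n z A) * mat_norm n n ?E" unfolding c_def by (rule mat_norm_mult)
  also have "... <= N * mat_norm n n A" using mat_norm_mult[of m n n z A] by (simp add: E N_def)
  finally show ?thesis .
 qed
 have cu: "c A <= N" if "A \<in> \<U> n" for A
 proof -
  have "c A <= mat_norm m n (mat_mult m n n z A) * mat_norm n n ?E" unfolding c_def by (rule mat_norm_mult)
  then show ?thesis using mat_norm_unitary_right[OF that z] by (simp add: E N_def)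
 qed
 have tri: "c A <= c B + N * mat_norm n n (mat_minus n n A B)" if "A \<in> mats n n" for A B
 proof -
  have "c A = mat_norm m n (mat_add m n (mat_mult m n n (mat_mult m n n z B) ?E) (mat_mult m n n (mat_mult m n n z (mat_minus n n A B)) ?E))"
   unfolding c_def mat_mult_add_left[symmetric] mat_mult_add_right[symmetric]
   by (subst mat_minus_split[OF that, of B]) (rule refl)
  also have "... <= c B + c (mat_minus n n A B)" unfolding c_def by (rule mat_norm_add)
  finally show ?thesis using cb[of "mat_minus n n A B"] by simp
 qed
 have sym: "mat_norm n n (mat_minus n n V' V) = mat_norm n n (mat_minus n n V V')"
 proof -
  have "(mat_norm n n (mat_minus n n V' V))^2 = (mat_norm n n (mat_minus n n V V'))^2"
   unfolding mat_norm_sq by (intro sum.cong refl) (simp add: norm_minus_commute)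
  then show ?thesis by (rule power2_eq_imp_eq) (simp_all add: mat_norm_ge_0)
 qed
 have Vm: "V \<in> mats n n" "V' \<in> mats n n" using V by (simp_all add: unitary_group_def)
 have "\<bar>c V - c V'\<bar> <= N * mat_norm n n (mat_minus n n V V')"
  using tri[OF Vm(1), of V'] tri[OF Vm(2), of V] by (simp add: sym abs_le_iff)
 also have "... <= N * e" using e N0 by (intro mult_left_mono)
 finally have d: "\<bar>c V - c V'\<bar> <= N * e" .
 have c0: "0 <= c A" for A unfolding c_def by (rule mat_norm_ge_0)
 have s: "\<bar>c V + c V'\<bar> <= 2 * N" using cu[OF V(1)] cu[OF V(2)] c0[of V] c0[of V'] by simp
 have "\<bar>(c V)\<^sup>2 - (c V')\<^sup>2\<bar> = \<bar>c V - c V'\<bar> * \<bar>c V + c V'\<bar>"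
  by (simp add: abs_mult[symmetric] power2_eq_square algebra_simps)
 also have "... <= (N * e) * (2 * N)" using d s N0 by (intro mult_mono) (auto intro: order.trans[OF abs_ge_zero])
 also have "... = 2 * e * N^2" by (simp add: power2_eq_square)
 finally show ?thesis by (simp add: col_sq_proj[OF j] c_def[symmetric] N_def)
qed

text \<open>In the right singular basis the squared singular values are squared column norms; the basis ranges over a compact group, so
  it can be taken from a finite net.\<close>

lemma exp_sing_vals_le_net:
 assumes nm: "n <= m" and z: "z \<in> mats m n" and k: "k >= 0"
  and net: "finite \<V>" "\<V> \<subseteq> \<U> n"
   "!!V. V \<in> \<U> n ==> \<exists>V'\<in>\<V>. mat_norm n n (mat_minus n n V V') <= e"
  and \<gamma>: "!!j. j < n ==> \<bar>\<gamma> j\<bar> <= G" "e >= 0"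
 shows "exp (k * (\<Sum>j<n. \<gamma> j * (sing_vals m n z j)^2))
  <= (\<Sum>V'\<in>\<V>. exp (k * (\<Sum>j<n. (\<gamma> j + 2 * real n * G * e) * col_sq m (mat_mult m n n z V') j)))"
proof -
 let ?p = "sing_vals m n z"
 obtain U V where UV: "U \<in> \<U> m" "V \<in> \<U> n" "z = usv m n U ?p V"
  by (rule svd_sing_vals[OF z nm])
 obtain V' where V': "V' \<in> \<V>" "mat_norm n n (mat_minus n n V V') <= e" using net(3)[OF UV(2)] by blast
 have V'u: "V' \<in> \<U> n" using V' net(2) by blast
 let ?a = "%j. col_sq m (mat_mult m n n z V) j"
 let ?b = "%j. col_sq m (mat_mult m n n z V') j"
 have pa: "(?p j)^2 = ?a j" if "j < n" for j
 proof -
  have "col_sq m (mat_mult m n n (usv m n U ?p V) V) j = (?p j)^2"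
   by (rule col_sq_usv[OF nm UV(1,2) that])
  then show ?thesis unfolding UV(3)[symmetric] by (rule sym)
 qed
 have sb: "(\<Sum>j<n. ?b j) = (mat_norm m n z)^2"
  unfolding sum_col_sq by (simp add: mat_norm_unitary_right[OF V'u z])
 have "(\<Sum>j<n. \<gamma> j * (?p j)^2) <= (\<Sum>j<n. \<gamma> j * ?b j + G * (2 * e * (mat_norm m n z)^2))"
 proof (rule sum_mono)
  fix j assume "j \<in> {..<n}"
  then have j: "j < n" by simp
  have "\<gamma> j * (?a j - ?b j) <= \<bar>\<gamma> j\<bar> * \<bar>?a j - ?b j\<bar>"
   by (metis abs_ge_self abs_mult)
  also have "... <= G * (2 * e * (mat_norm m n z)^2)"
   using \<gamma>(1)[OF j] col_sq_perturb[OF UV(2) V'u V'(2) z j] by (intro mult_mono) auto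
  finally show "\<gamma> j * (?p j)^2 <= \<gamma> j * ?b j + G * (2 * e * (mat_norm m n z)^2)"
   unfolding pa[OF j] by (simp add: algebra_simps)
 qed
 also have "... = (\<Sum>j<n. (\<gamma> j + 2 * real n * G * e) * ?b j)"
 proof -
  have "(\<Sum>j<n. \<gamma> j * ?b j + G * (2 * e * S)) = (\<Sum>j<n. \<gamma> j * ?b j) + 2 * real n * G * e * S" for S
   by (simp add: sum.distrib)
  then have "(\<Sum>j<n. \<gamma> j * ?b j + G * (2 * e * (mat_norm m n z)^2))
   = (\<Sum>j<n. \<gamma> j * ?b j) + 2 * real n * G * e * (\<Sum>j<n. ?b j)" by (simp only: sb)
  then show ?thesis by (simp only: sum.distrib distrib_right sum_distrib_left)
 qed
 finally have "exp (k * (\<Sum>j<n. \<gamma> j * (?p j)^2)) <= exp (k * (\<Sum>j<n. (\<gamma> j + 2 * real n * G * e) * ?b j))"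
  using k by (simp add: mult_left_mono)
 also have "... <= (\<Sum>V'\<in>\<V>. exp (k * (\<Sum>j<n. (\<gamma> j + 2 * real n * G * e) * col_sq m (mat_mult m n n z V') j)))"
  by (rule member_le_sum[OF V'(1) _ net(1)]) simp
 finally show ?thesis .
qed

lemma gauss_columns_mgf:
 assumes u: "!!j. j < n ==> u j > 0"
 shows "(\<integral>\<^sup>+g. eexp ((\<Sum>j<n. (1 - u j) * col_sq m g j) / 2) \<partial>(gauss_mat m n :: ('a::real_complex_quat) fmat measure))
  = eexp (real (m * DIM('a)) / 2 * (\<Sum>j<n. - ln (u j)))"
proof -
 define s where "s p = u (snd p) powr (- 1 / 2)" for p :: "nat \<times> nat"
 have sp: "s p > 0" if "p \<in> idx m n" for p using u that by (auto simp: s_def intro!: powr_gt_zero[THEN iffD2] less_imp_neq[symmetric])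
 have s2: "1 - 1 / (s p)^2 = 1 - u (snd p)" if "p \<in> idx m n" for p
 proof -
  have up: "u (snd p) > 0" using u that by auto
  have "(s p)^2 = u (snd p) powr (- 1)"
   unfolding s_def using up by (subst powr_power) simp_all
  then show ?thesis using up by (simp add: powr_minus inverse_eq_divide)
 qed
 have "(\<Sum>p\<in>idx m n. (1 - 1 / (s p)^2) * (norm (g p))^2) = (\<Sum>j<n. (1 - u j) * col_sq m g j)" for g :: "'a fmat"
 proof -
  have "(\<Sum>p\<in>idx m n. (1 - 1 / (s p)^2) * (norm (g p))^2) = (\<Sum>p\<in>idx m n. (1 - u (snd p)) * (norm (g p))^2)"
   by (intro sum.cong refl) (simp only: s2)
  also have "... = (\<Sum>j<n. (1 - u j) * col_sq m g j)" by (rule sum_columns)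
  finally show ?thesis .
 qed
 with nn_integral_gauss_quadratic[of m n s, where 'a='a, OF sp]
 have "(\<integral>\<^sup>+g. eexp ((\<Sum>j<n. (1 - u j) * col_sq m g j) / 2) \<partial>(gauss_mat m n :: 'a fmat measure))
  = ennreal (\<Prod>p\<in>idx m n. s p ^ DIM('a))" by simp
 also have "(\<Prod>p\<in>idx m n. s p ^ DIM('a)) = (\<Prod>j<n. ((u j powr (- 1 / 2)) ^ DIM('a)) ^ m)"
  unfolding s_def by (rule prod_columns)
 also have "... = (\<Prod>j<n. exp (real (m * DIM('a)) / 2 * - ln (u j)))"
 proof (intro prod.cong refl)
  fix j assume "j \<in> {..<n}"
  then have "u j > 0" using u by simp
  then show "((u j powr (- 1 / 2)) ^ DIM('a)) ^ m = exp (real (m * DIM('a)) / 2 * - ln (u j))"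
   by (simp add: powr_def power_mult[symmetric] exp_of_nat_mult[symmetric] mult_ac)
 qed
 also have "... = exp (\<Sum>j<n. real (m * DIM('a)) / 2 * - ln (u j))"
  by (rule exp_sum[symmetric]) simp
 finally show ?thesis by (simp only: sum_distrib_left)
qed

lemma gauss_sing_vals_mgf:
 fixes \<V> :: "('a::real_complex_quat) fmat set"
 assumes nm: "n <= m" and k: "k > 0" and t: "t > 0"
  and net: "finite \<V>" "\<V> \<subseteq> \<U> n"
   "!!V. V \<in> \<U> n ==> \<exists>V'\<in>\<V>. mat_norm n n (mat_minus n n V V') <= e"
  and \<gamma>: "!!j. j < n ==> \<bar>\<gamma> j\<bar> <= G" "e >= 0"
  and u: "!!j. j < n ==> u j > 0" "!!j. j < n ==> u j = 1 - 2 * t * (\<gamma> j + 2 * real n * G * e)"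
 shows "(\<integral>\<^sup>+g. eexp (k * (\<Sum>j<n. \<gamma> j * (sing_vals m n (mat_scale m n (sqrt (t / k)) g) j)^2)) \<partial>(gauss_mat m n :: 'a fmat measure))
  <= ennreal (real (card \<V>) * exp (real (m * DIM('a)) / 2 * (\<Sum>j<n. - ln (u j))))"
proof -
 have sc: "mat_mult m n n (mat_scale m n r g) V = mat_scale m n r (mat_mult m n n g V)" for r and g V :: "'a fmat"
  by (rule mat_eqI[of _ m n]) (simp_all add: scaleR_sum_right)
 have cs: "col_sq m (mat_scale m n (sqrt (t / k)) g) j = t / k * col_sq m g j" if "j < n" for g :: "'a fmat" and j
  using that t k by (simp add: col_sq_def power_mult_distrib sum_distrib_left)
 have ex: "k * (\<Sum>j<n. (\<gamma> j + 2 * real n * G * e) * col_sq m (mat_mult m n n (mat_scale m n (sqrt (t / k)) g) V) j)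
  = (\<Sum>j<n. (1 - u j) * col_sq m (mat_mult m n n g V) j) / 2" for g V :: "'a fmat"
  unfolding sc sum_distrib_left sum_divide_distrib
 proof (intro sum.cong refl)
  fix j assume "j \<in> {..<n}"
  then have j: "j < n" by simp
  show "k * ((\<gamma> j + 2 * real n * G * e) * col_sq m (mat_scale m n (sqrt (t / k)) (mat_mult m n n g V)) j)
   = (1 - u j) * col_sq m (mat_mult m n n g V) j / 2"
   unfolding cs[OF j] u(2)[OF j] using k by (simp add: field_simps)
 qed
 let ?F = "%g. eexp ((\<Sum>j<n. (1 - u j) * col_sq m g j) / 2)"
 have Fm: "?F \<in> borel_measurable (mat_space m n :: 'a fmat measure)"
 proof -
  have "(%g. \<Sum>j<n. (1 - u j) * col_sq m g j) \<in> borel_measurable (mat_space m n :: 'a fmat measure)"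
   by (intro borel_measurable_sum borel_measurable_times borel_measurable_const measurable_col_sq[OF measurable_ident_sets[OF refl]]) simp
  then show ?thesis by measurable
 qed
 have "(\<integral>\<^sup>+g. eexp (k * (\<Sum>j<n. \<gamma> j * (sing_vals m n (mat_scale m n (sqrt (t / k)) g) j)^2)) \<partial>(gauss_mat m n :: 'a fmat measure))
  <= (\<integral>\<^sup>+g. (\<Sum>V\<in>\<V>. ?F (mat_mult m n n g V)) \<partial>gauss_mat m n)"
 proof (rule nn_integral_mono)
  fix g :: "'a fmat"
  have "exp (k * (\<Sum>j<n. \<gamma> j * (sing_vals m n (mat_scale m n (sqrt (t / k)) g) j)^2))
   <= (\<Sum>V'\<in>\<V>. exp (k * (\<Sum>j<n. (\<gamma> j + 2 * real n * G * e) * col_sq m (mat_mult m n n (mat_scale m n (sqrt (t / k)) g) V') j)))"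
   by (rule exp_sing_vals_le_net[OF nm _ less_imp_le[OF k] net \<gamma>]) simp_all
  then show "eexp (k * (\<Sum>j<n. \<gamma> j * (sing_vals m n (mat_scale m n (sqrt (t / k)) g) j)^2))
   <= (\<Sum>V\<in>\<V>. ?F (mat_mult m n n g V))"
   unfolding ex by (subst sum_ennreal) (simp_all add: ennreal_leI)
 qed
 also have "... = (\<Sum>V\<in>\<V>. \<integral>\<^sup>+g. ?F (mat_mult m n n g V) \<partial>gauss_mat m n)"
 proof (rule nn_integral_sum)
  fix V assume "V \<in> \<V>"
  then have V: "V \<in> mats n n" using net(2) by (auto simp: unitary_group_def)
  have "(%g. mat_mult m n n g V) \<in> mat_space m n \<rightarrow>\<^sub>M mat_space m n"
   by (intro measurable_mat_mult measurable_const_mat V measurable_ident_sets refl)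
  from measurable_compose[OF this Fm]
  show "(%g. ?F (mat_mult m n n g V)) \<in> borel_measurable (gauss_mat m n)"
   by (simp cong: measurable_cong_sets)
 qed
 also have "... = (\<Sum>V\<in>\<V>. eexp (real (m * DIM('a)) / 2 * (\<Sum>j<n. - ln (u j))))"
 proof (intro sum.cong refl)
  fix V assume "V \<in> \<V>"
  then have V: "V \<in> \<U> n" using net(2) by auto
  show "(\<integral>\<^sup>+g. ?F (mat_mult m n n g V) \<partial>gauss_mat m n) = eexp (real (m * DIM('a)) / 2 * (\<Sum>j<n. - ln (u j)))"
   unfolding nn_integral_gauss_unitary_right[OF Fm V] by (rule gauss_columns_mgf[OF u(1)])
 qed
 also have "... = ennreal (real (card \<V>) * exp (real (m * DIM('a)) / 2 * (\<Sum>j<n. - ln (u j))))"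
  by (simp add: ennreal_mult ennreal_of_nat_eq_real_of_nat)
 finally show ?thesis .
qed

section \<open>The Bessel factors bounded by a Gaussian weight\<close>

lemma usv_scale:
 "usv m n U (\<lambda>i\<in>{..<n}. x i / t) V = mat_scale m n (1 / t) (usv m n U x V)"
proof -
 have "sigma_mat m n (\<lambda>i\<in>{..<n}. x i / t) = (mat_scale m n (1 / t) (sigma_mat m n x) :: 'a fmat)"
  by (rule mat_eqI[of _ m n]) (auto simp: scaleR_conv_of_real of_real_divide[symmetric] of_real_mult[symmetric] simp del: of_real_divide of_real_mult)
 moreover have "mat_mult m m n U (mat_scale m n r A) = mat_scale m n r (mat_mult m m n U A)" for r and A :: "'a fmat"
  by (rule mat_eqI[of _ m n]) (simp_all add: scaleR_sum_right)
 moreover have "mat_mult m n n (mat_scale m n r A) C = mat_scale m n r (mat_mult m n n A C)" for r and A C :: "'a fmat"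
  by (rule mat_eqI[of _ m n]) (simp_all add: scaleR_sum_right)
 ultimately show ?thesis by simp
qed

lemma orbit_exp_upper:
 fixes \<mu> \<nu> :: "('a::real_complex_quat) fmat measure"
 assumes nm: "n <= m" and \<nu>: "normalized_haar n \<nu>"
  and t: "t > 0" and x: "x \<in> chamber_B n"
  and up: "!!A. A \<in> mats m n ==> (\<integral>\<^sup>+U. eexp (k * mat_inner m n z (mat_mult m m n U A)) \<partial>\<mu>) <= F (sing_vals m n A)"
 shows "orbit_exp \<mu> \<nu> m n x (k / t) z <= F (\<lambda>i\<in>{..<n}. x i / t)"
proof -
 interpret \<nu>: prob_space \<nu> by (rule haar_prob[OF \<nu>])
 define x' where "x' = (\<lambda>i\<in>{..<n}. x i / t)"
 have x': "x' \<in> chamber_B n"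
  using x t by (auto simp: mem_chamber_B_iff x'_def divide_right_mono)
 have "orbit_exp \<mu> \<nu> m n x (k / t) z <= (\<integral>\<^sup>+V. F x' \<partial>\<nu>)"
 proof (rule nn_integral_mono)
  fix V assume "V \<in> space \<nu>"
  then have V: "V \<in> \<U> n" by (simp add: haar_space[OF \<nu>])
  define A :: "'a fmat" where "A = mat_mult m n n (sigma_mat m n x') (mat_adj n n V)"
  have "usv m n (mat_one m) x' V = A" by (simp add: A_def mat_mult_one_left)
  then have sA: "sing_vals m n A = x'"
   using sing_vals_usv[OF nm unitary_one V x'] by simp
  have "k / t * mat_inner m n z (usv m n U x V) = k * mat_inner m n z (mat_mult m m n U A)" for U
  proof -
   have "mat_mult m m n U A = mat_scale m n (1 / t) (usv m n U x V)"
    unfolding A_def mat_mult_assoc[symmetric] x'_def by (rule usv_scale)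
   then show ?thesis by (simp add: mat_inner_scale_right)
  qed
  then show "(\<integral>\<^sup>+U. eexp (k / t * mat_inner m n z (usv m n U x V)) \<partial>\<mu>) <= F x'"
   using up[of A] by (simp add: A_def sA[unfolded A_def])
 qed
 then show ?thesis by (simp add: \<nu>.emeasure_space_1 x'_def)
qed

abbreviation gauss_majorant where
 "gauss_majorant m n k t x w A C e T1 T2 \<equiv> (\<integral>\<^sup>+g. indicator A (mat_scale m n (sqrt (t / k)) g) *
  ennreal (C^2 * exp (k * (\<Sum>j<n. lap (T1 j) e (sing_vals m n (mat_scale m n (sqrt (t / k)) g) j * w j)
   + lap (T2 j) e (x j / t * sing_vals m n (mat_scale m n (sqrt (t / k)) g) j))))
  \<partial>(gauss_mat m n :: ('a::real_complex_quat) fmat measure))"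

abbreviation numerator_bounded :: "'a::real_complex_quat itself => nat => real => real => nat => bool" where
 "numerator_bounded ty n e C m \<equiv> \<forall>(\<mu> :: 'a fmat measure) \<nu> x t \<L> A T1 T2.
  normalized_haar m \<mu> --> normalized_haar n \<nu> --> x \<in> chamber_B n --> t > 0 --> \<L> \<in> mats m n -->
  A \<in> sets (mat_space m n) --> (\<forall>U\<in>\<U> m. \<forall>z\<in>mats m n. mat_mult m m n U z \<in> A \<longleftrightarrow> z \<in> A) -->
  (\<forall>j<n. 0 < T1 j & T1 j <= 1 / 2) --> (\<forall>j<n. 0 < T2 j & T2 j <= 1 / 2) -->
  tilted_mass \<mu> \<nu> m n (kappa DIM('a) n m) t x \<L> A
  <= gauss_majorant m n (kappa DIM('a) n m) t x (sing_vals m n \<L>) A C e T1 T2"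

text \<open>The Bessel factor depends on the singular values only, so after averaging from the left the tilt by \<open>\<Lambda>\<close> becomes a second Bessel
  factor. Both are replaced by their upper bounds.\<close>

lemma numerator_bound:
 assumes n: "n >= 1" and e: "e > 0"
 obtains C where "C > 0" "\<forall>\<^sub>F m in sequentially. numerator_bounded TYPE('a::real_complex_quat) n e C m"
proof -
 obtain C where C: "C > 0" and ev: "\<forall>\<^sub>F m in sequentially. haar_exp_bounded TYPE('a) n e C m"
  by (rule haar_exp_upper[OF n e, where 'a='a])
 show ?thesis
 proof (rule that[OF C], rule eventually_mono[OF eventually_conj[OF ev eventually_ge_at_top[of n]]], intro allI impI, elim conjE)
  fix m :: nat and \<mu> \<nu> :: "'a fmat measure" and x T1 T2 :: "nat => real" and t :: real and \<L> :: "'a fmat" and A :: "'a fmat set"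
  define k where "k = kappa DIM('a) n m"
  assume nm: "n <= m" and up: "haar_exp_bounded TYPE('a) n e C m"
   and \<mu>: "normalized_haar m \<mu>" and \<nu>: "normalized_haar n \<nu>" and x: "x \<in> chamber_B n" and t: "t > 0"
   and \<L>: "\<L> \<in> mats m n" and A: "A \<in> sets (mat_space m n)"
   and inv: "\<forall>U\<in>\<U> m. \<forall>z\<in>mats m n. mat_mult m m n U z \<in> A \<longleftrightarrow> z \<in> A"
   and T1: "\<forall>j<n. 0 < T1 j & T1 j <= 1 / 2" and T2: "\<forall>j<n. 0 < T2 j & T2 j <= 1 / 2"
  define s where "s = sqrt (t / k)"
  define w where "w = sing_vals m n \<L>"
  define z where "z = (mat_scale m n s :: 'a fmat => 'a fmat)"
  define F1 where "F1 p = C * exp (k * (\<Sum>j<n. lap (T1 j) e (p j * w j)))" for p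
  define F2 where "F2 p = C * exp (k * (\<Sum>j<n. lap (T2 j) e (x j / t * p j)))" for p
  have zm: "z g \<in> mats m n" for g by (simp add: z_def)
  have u1: "(\<integral>\<^sup>+U. eexp (k * mat_inner m n \<L> (mat_mult m m n U y)) \<partial>\<mu>) <= ennreal (F1 (sing_vals m n y))"
   if "y \<in> mats m n" for y
   using up[rule_format, OF \<mu> that \<L> T1[rule_format]] unfolding F1_def k_def w_def .
  have u2: "orbit_exp \<mu> \<nu> m n x (k / t) y <= ennreal (F2 (sing_vals m n y))" if y: "y \<in> mats m n" for y
  proof -
   have "orbit_exp \<mu> \<nu> m n x (k / t) y <= ennreal (C * exp (k * (\<Sum>j<n. lap (T2 j) e ((\<lambda>i\<in>{..<n}. x i / t) j * sing_vals m n y j))))"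
   proof (rule orbit_exp_upper[OF nm \<nu> t x])
    fix A' :: "'a fmat" assume "A' \<in> mats m n"
    from up[rule_format, OF \<mu> this y T2[rule_format]]
    show "(\<integral>\<^sup>+U. eexp (k * mat_inner m n y (mat_mult m m n U A')) \<partial>\<mu>)
     <= ennreal (C * exp (k * (\<Sum>j<n. lap (T2 j) e (sing_vals m n A' j * sing_vals m n y j))))"
     unfolding k_def .
   qed
   also have "(\<Sum>j<n. lap (T2 j) e ((\<lambda>i\<in>{..<n}. x i / t) j * sing_vals m n y j))
    = (\<Sum>j<n. lap (T2 j) e (x j / t * sing_vals m n y j))"
    by (intro sum.cong refl) simp
   finally show ?thesis unfolding F2_def .
  qed
  define G where "G y = indicator A y * ennreal (F2 (sing_vals m n y))" for y
  have F2m: "(%y. ennreal (F2 (sing_vals m n y))) \<in> borel_measurable (mat_space m n :: 'a fmat measure)"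
  proof -
   have "(%y. \<Sum>j<n. lap (T2 j) e (x j / t * sing_vals m n y j))
    \<in> borel_measurable (mat_space m n :: 'a fmat measure)"
    by (intro borel_measurable_sum borel_measurable_add borel_measurable_divide borel_measurable_times
      borel_measurable_power borel_measurable_const measurable_sing_vals[OF nm]) simp_all
   then show ?thesis unfolding F2_def by measurable
  qed
  have Gm: "G \<in> borel_measurable (mat_space m n)"
   unfolding G_def using A by (intro borel_measurable_times_ennreal F2m) simp
  have Gi: "G (mat_mult m m n U y) = G y" if "U \<in> \<U> m" "y \<in> mats m n" for U y
  proof -
   have "mat_mult m m n U y \<in> A \<longleftrightarrow> y \<in> A" using inv that by blast
   then show ?thesis unfolding G_def sing_vals_unitary_left[OF that(2) nm that(1)] by (simp add: indicator_def)
  qed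
  have zz: "z \<in> mat_space m n \<rightarrow>\<^sub>M mat_space m n"
   unfolding z_def by (intro measurable_mat_scale measurable_ident_sets refl)
  have "(\<integral>\<^sup>+g. indicator A (z g) * (eexp (k * mat_inner m n \<L> (z g)) * orbit_exp \<mu> \<nu> m n x (k / t) (z g)) \<partial>gauss_mat m n)
   <= (\<integral>\<^sup>+g. G (z g) * eexp (k * mat_inner m n \<L> (z g)) \<partial>gauss_mat m n)"
  proof (rule nn_integral_mono)
   fix g :: "'a fmat"
   have "indicator A (z g) * (E * orbit_exp \<mu> \<nu> m n x (k / t) (z g))
    <= indicator A (z g) * (E * ennreal (F2 (sing_vals m n (z g))))" for E
    by (intro mult_left_mono u2 zm) simp_all
   also have "indicator A (z g) * (E * ennreal (F2 (sing_vals m n (z g)))) = G (z g) * E" for E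
    unfolding G_def by (simp only: mult_ac)
   finally show "indicator A (z g) * (eexp (k * mat_inner m n \<L> (z g)) * orbit_exp \<mu> \<nu> m n x (k / t) (z g))
    <= G (z g) * eexp (k * mat_inner m n \<L> (z g))" .
  qed
  also have "... = (\<integral>\<^sup>+g. \<integral>\<^sup>+U. G (z (mat_mult m m n U g)) * eexp (k * mat_inner m n \<L> (z (mat_mult m m n U g))) \<partial>\<mu> \<partial>gauss_mat m n)"
  proof (rule gauss_left_average[OF \<mu>])
   have "(%g. mat_inner m n \<L> (z g)) \<in> borel_measurable (mat_space m n)"
    by (intro measurable_mat_inner measurable_const_mat \<L> zz)
   then have "(%g. eexp (k * mat_inner m n \<L> (z g))) \<in> borel_measurable (mat_space m n)" by measurable
   then show "(%g. G (z g) * eexp (k * mat_inner m n \<L> (z g))) \<in> borel_measurable (mat_space m n)"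
    by (intro borel_measurable_times_ennreal measurable_compose[OF zz Gm])
  qed
  also have "... <= (\<integral>\<^sup>+g. indicator A (z g) * ennreal (C^2 * exp (k * (\<Sum>j<n.
     (lap (T1 j) e (sing_vals m n (z g) j * w j))
     + (lap (T2 j) e (x j / t * sing_vals m n (z g) j))))) \<partial>gauss_mat m n)"
  proof (rule nn_integral_mono)
   fix g :: "'a fmat"
   have zU: "z (mat_mult m m n U g) = mat_mult m m n U (z g)" for U
    unfolding z_def by (rule mat_eqI[of _ m n]) (simp_all add: scaleR_sum_right)
   have "(\<integral>\<^sup>+U. G (z (mat_mult m m n U g)) * eexp (k * mat_inner m n \<L> (z (mat_mult m m n U g))) \<partial>\<mu>)
    = (\<integral>\<^sup>+U. G (z g) * eexp (k * mat_inner m n \<L> (mat_mult m m n U (z g))) \<partial>\<mu>)"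
    unfolding zU by (rule nn_integral_cong) (simp add: Gi zm haar_space[OF \<mu>])
   also have "... = G (z g) * (\<integral>\<^sup>+U. eexp (k * mat_inner m n \<L> (mat_mult m m n U (z g))) \<partial>\<mu>)"
    by (rule nn_integral_cmult[OF measurable_haar_exp[OF \<mu> zm \<L>]])
   also have "... <= G (z g) * ennreal (F1 (sing_vals m n (z g)))"
    by (rule mult_left_mono[OF u1[OF zm]]) simp
   also have "... = indicator A (z g) * (ennreal (F2 (sing_vals m n (z g))) * ennreal (F1 (sing_vals m n (z g))))"
    unfolding G_def by (simp only: mult.assoc)
   also have "ennreal (F2 (sing_vals m n (z g))) * ennreal (F1 (sing_vals m n (z g))) = ennreal (F2 (sing_vals m n (z g)) * F1 (sing_vals m n (z g)))"
    using C by (intro ennreal_mult[symmetric]) (simp_all add: F1_def F2_def)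
   also have "F2 p * F1 p = C^2 * exp (k * (\<Sum>j<n. (lap (T1 j) e (p j * w j))
     + (lap (T2 j) e (x j / t * p j))))" for p
   proof -
    have "C * exp (k * b) * (C * exp (k * a)) = C^2 * exp (k * (a + b))" for a b
     by (simp add: power2_eq_square distrib_left exp_add)
    then show ?thesis unfolding F1_def F2_def by (simp only: sum.distrib)
   qed
   finally show "(\<integral>\<^sup>+U. G (z (mat_mult m m n U g)) * eexp (k * mat_inner m n \<L> (z (mat_mult m m n U g))) \<partial>\<mu>)
    <= indicator A (z g) * ennreal (C^2 * exp (k * (\<Sum>j<n.
     (lap (T1 j) e (sing_vals m n (z g) j * w j))
     + (lap (T2 j) e (x j / t * sing_vals m n (z g) j)))))" .
  qed
  finally show "tilted_mass \<mu> \<nu> m n (kappa DIM('a) n m) t x \<L> A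
  <= gauss_majorant m n (kappa DIM('a) n m) t x (sing_vals m n \<L>) A C e T1 T2"
   unfolding z_def s_def k_def w_def .
 qed
qed

section \<open>One term of the Chernoff bound\<close>

text \<open>After the replacement of singular values by column norms the integral factorizes over the columns. The factor \<open>Y j / (2 * t)\<close> is the
  variance of the limiting Gaussian, and the second order term of the logarithm costs \<open>4 * \<theta>^2\<close>.\<close>

lemma chernoff_term:
 fixes \<V> :: "('a::real_complex_quat) fmat set"
 defines "c0 \<equiv> kappa_shift DIM('a)"
 assumes n: "n >= 1" and nm: "n <= m" and k: "kappa DIM('a) n m > 0" and t: "t > 0"
  and net: "finite \<V>" "\<V> \<subseteq> \<U> n"
   "!!V. V \<in> \<U> n ==> \<exists>V'\<in>\<V>. mat_norm n n (mat_minus n n V V') <= e1"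
  and e1: "e1 >= 0" "2 * real n * G * e1 = e" "e >= 0"
  and Y: "!!j. j < n ==> 2 * t <= Y j & Y j <= Ym"
  and i: "i < n" and \<sigma>: "\<sigma> = 1 \<or> \<sigma> = -1" and \<theta>: "0 <= \<theta>" "\<theta> <= 1 / 4" and r: "r >= 0" "Ym * (r + e) <= 1 / 4"
  and \<gamma>: "!!j. j < n ==> \<gamma> j = 1 / (2 * t) - 1 / Y j + r + (if j = i then \<theta> * \<sigma> / Y j else 0)"
  and G: "!!j. j < n ==> \<bar>\<gamma> j\<bar> <= G"
 shows "(\<integral>\<^sup>+g. eexp (kappa DIM('a) n m * (\<Sum>j<n. \<gamma> j * (sing_vals m n (mat_scale m n (sqrt (t / kappa DIM('a) n m)) g) j)^2))
    \<partial>(gauss_mat m n :: 'a fmat measure))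
  <= ennreal (real (card \<V>) * exp (kappa DIM('a) n m * ((\<Sum>j<n. ln (Y j / (2 * t))) + \<theta> * \<sigma> + 4 * \<theta>^2 + 2 * real n * (Ym * (r + e)))
    + c0 n * ((\<Sum>j<n. ln (Y j / (2 * t))) + real n)))"
proof -
 define k where "k = kappa DIM('a) n m"
 define v where "v j = (if j = i then \<theta> * \<sigma> else 0) + Y j * (r + e)" for j
 define u where "u j = 2 * t / Y j * (1 - v j)" for j
 have Yp: "Y j > 0" if "j < n" for j using Y[OF that] t by simp
 have \<eta>: "0 <= Y j * (r + e)" "Y j * (r + e) <= Ym * (r + e)" if "j < n" for j
  using Yp[OF that] Y[OF that] r e1 by (auto intro!: mult_right_mono)
 have v: "-1 <= v j" "v j <= 1 / 2" "v j + 2 * (v j)^2 <= (if j = i then \<theta> * \<sigma> + 4 * \<theta>^2 else 0) + 2 * (Ym * (r + e))" if j: "j < n" for j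
 proof -
  define q where "q = Y j * (r + e)"
  define s where "s = (if j = i then \<theta> * \<sigma> else 0)"
  have q: "0 <= q" "q <= Ym * (r + e)" "q <= 1 / 4" using \<eta>[OF j] r(2) by (auto simp: q_def)
  have s: "\<bar>s\<bar> <= 1 / 4" "s^2 = (if j = i then \<theta>\<^sup>2 else 0)" using \<sigma> \<theta> by (auto simp: s_def power_mult_distrib)
  have vj: "v j = s + q" by (simp add: v_def s_def q_def)
  show "-1 <= v j" "v j <= 1 / 2" using q s(1) unfolding vj by auto
  have "2 * (s + q)^2 <= 4 * s^2 + 4 * q^2"
   using sum_squares_ge_zero[of "s - q" 0] by (simp add: power2_eq_square algebra_simps)
  moreover have "4 * q^2 <= q" using q mult_left_mono[of q "1/4" q] by (simp add: power2_eq_square)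
  ultimately have "v j + 2 * (v j)^2 <= s + 4 * s^2 + 2 * q" unfolding vj by simp
  then show "v j + 2 * (v j)^2 <= (if j = i then \<theta> * \<sigma> + 4 * \<theta>^2 else 0) + 2 * (Ym * (r + e))"
   using q(2) unfolding s(2) unfolding s_def by (cases "j = i") simp_all
 qed
 have u: "u j > 0" if "j < n" for j using v(2)[OF that] Yp[OF that] t by (simp add: u_def)
 have ue: "u j = 1 - 2 * t * (\<gamma> j + 2 * real n * G * e1)" if j: "j < n" for j
  unfolding u_def v_def \<gamma>[OF j] e1(2) using Yp[OF j] t by (cases "j = i") (simp_all add: field_simps)
 define L where "L j = ln (Y j / (2 * t))" for j
 have lu: "- ln (u j) <= L j + (v j + 2 * (v j)^2)" if j: "j < n" for j
 proof -
  have pos: "2 * t / Y j > 0" "1 - v j > 0" using Yp[OF j] t v(2)[OF j] by simp_all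
  have "ln (u j) = ln (2 * t / Y j) + ln (1 - v j)" unfolding u_def by (rule ln_mult_pos[OF pos])
  moreover have "ln (2 * t / Y j) = - L j" unfolding L_def using Yp[OF j] t by (simp add: ln_div)
  ultimately show ?thesis using neg_ln_one_minus_le[OF v(1,2)[OF j]] by simp
 qed
 have v1: "v j + 2 * (v j)^2 <= 1" if j: "j < n" for j
 proof -
  have "\<bar>v j\<bar> <= 1 / 2"
  proof -
   have "- (1/4) <= v j" using \<eta>(1)[OF j] \<sigma> \<theta> by (auto simp: v_def)
   then show ?thesis using v(2)[OF j] by simp
  qed
  then have "(v j)^2 <= (1 / 2)^2" by (simp only: abs_le_square_iff[symmetric])
  then show ?thesis using v(2)[OF j] by (simp add: power2_eq_square)
 qed
 have S1: "(\<Sum>j<n. - ln (u j)) <= (\<Sum>j<n. L j) + \<theta> * \<sigma> + 4 * \<theta>^2 + 2 * real n * (Ym * (r + e))"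
 proof -
  have "(\<Sum>j<n. - ln (u j)) <= (\<Sum>j<n. L j + ((if j = i then \<theta> * \<sigma> + 4 * \<theta>^2 else 0) + 2 * (Ym * (r + e))))"
   by (intro sum_mono order.trans[OF lu add_left_mono[OF v(3)]]) simp_all
  also have "... = (\<Sum>j<n. L j) + \<theta> * \<sigma> + 4 * \<theta>^2 + 2 * real n * (Ym * (r + e))"
   using i by (simp add: sum.distrib)
  finally show ?thesis .
 qed
 have S2: "(\<Sum>j<n. - ln (u j)) <= (\<Sum>j<n. L j) + real n"
 proof -
  have "(\<Sum>j<n. - ln (u j)) <= (\<Sum>j<n. L j + 1)"
   by (intro sum_mono order.trans[OF lu add_left_mono[OF v1]]) simp_all
  then show ?thesis by (simp add: sum.distrib)
 qed
 have c0: "c0 n >= 0" using kappa_shift_nonneg[OF n] by (simp add: c0_def)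
 have "real (m * DIM('a)) / 2 * (\<Sum>j<n. - ln (u j)) = k * (\<Sum>j<n. - ln (u j)) + c0 n * (\<Sum>j<n. - ln (u j))"
  unfolding kappa_eq_shift[OF nm] by (simp add: k_def c0_def distrib_right)
 also have "... <= k * ((\<Sum>j<n. L j) + \<theta> * \<sigma> + 4 * \<theta>^2 + 2 * real n * (Ym * (r + e))) + c0 n * ((\<Sum>j<n. L j) + real n)"
  using S1 S2 c0 k by (intro add_mono mult_left_mono) (simp_all add: k_def)
 finally have E: "real (m * DIM('a)) / 2 * (\<Sum>j<n. - ln (u j))
  <= k * ((\<Sum>j<n. L j) + \<theta> * \<sigma> + 4 * \<theta>^2 + 2 * real n * (Ym * (r + e))) + c0 n * ((\<Sum>j<n. L j) + real n)" .
 have "(\<integral>\<^sup>+g. eexp (k * (\<Sum>j<n. \<gamma> j * (sing_vals m n (mat_scale m n (sqrt (t / k)) g) j)^2)) \<partial>(gauss_mat m n :: 'a fmat measure))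
  <= ennreal (real (card \<V>) * exp (real (m * DIM('a)) / 2 * (\<Sum>j<n. - ln (u j))))"
  by (rule gauss_sing_vals_mgf[OF nm k[folded k_def] t net G e1(1) u ue])
 also have "... <= ennreal (real (card \<V>) * exp (k * ((\<Sum>j<n. L j) + \<theta> * \<sigma> + 4 * \<theta>^2 + 2 * real n * (Ym * (r + e))) + c0 n * ((\<Sum>j<n. L j) + real n)))"
  using E by (intro ennreal_leI mult_left_mono) simp_all
 finally show ?thesis unfolding k_def L_def .
qed

section \<open>Bounds that are uniform over compact parameter sets\<close>

lemma parameter_bounds:
 fixes x w t R :: real
 assumes R: "R >= 1" and x: "0 <= x" "x <= R" and w: "0 <= w" "w <= R" and t: "1 / R <= t" "t <= R"
 shows "1 + root_s x w + t * w^2 <= 2 + R^2 + R^3" "1 + root_s x w + x^2 / t <= 2 + R^2 + R^3" "1 + root_s x w <= 2 + R^2 + R^3"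
  and "lim_sq x w t <= R^2 + R^2 * R^2 + 2 * R * (1 + R^2)" "w + x / t <= R + R^2" "1 / t <= R" "t > 0"
proof -
 have tp: "t > 0" using t R by (intro less_le_trans[OF _ t(1)]) simp
 show "t > 0" by (rule tp)
 have it: "1 / t <= R" using t(1) tp R by (simp add: field_simps)
 show "1 / t <= R" by (rule it)
 have sq: "x^2 <= R^2" "w^2 <= R^2" "t^2 <= R^2" using x w t tp by (auto intro!: power_mono)
 have xw: "x * w <= R^2" using x w R by (simp add: power2_eq_square mult_mono)
 have "root_s x w <= x * w + 1"
  unfolding root_s_def using x w by (intro real_le_lsqrt) (simp_all add: power2_eq_square algebra_simps)
 then have s: "root_s x w <= 1 + R^2" using xw by simp
 have "t * w^2 <= R * R^2" using t tp sq by (intro mult_mono) auto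
 moreover have "x^2 * (1 / t) <= R^2 * R" using tp sq it by (intro mult_mono) auto
 moreover have "R * R^2 = R^3" by (simp add: power2_eq_square power3_eq_cube)
 moreover have "0 <= R^3" using R by (intro zero_le_power) simp
 ultimately show "1 + root_s x w + t * w^2 <= 2 + R^2 + R^3" "1 + root_s x w + x^2 / t <= 2 + R^2 + R^3" "1 + root_s x w <= 2 + R^2 + R^3"
  using s by (simp_all only: divide_inverse mult_1_left mult.commute[of _ R])
 have "w^2 * t^2 <= R^2 * R^2" using sq by (intro mult_mono) auto
 moreover have "2 * t * root_s x w <= 2 * R * (1 + R^2)" using s t tp root_s_ge_1[of x w] R by (intro mult_mono) auto
 ultimately show "lim_sq x w t <= R^2 + R^2 * R^2 + 2 * R * (1 + R^2)"
  using sq(1) unfolding lim_sq_def root_s_def by linarith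
 have "x * (1 / t) <= R * R" using x it tp R by (intro mult_mono) auto
 then show "w + x / t <= R + R^2" using w by (simp add: power2_eq_square)
qed

lemma L2_set_le_bound:
 assumes "!!i. i < n ==> 0 <= f i & f i <= (R :: real)"
 shows "L2_set f {..<n} <= real n * R"
proof -
 have "L2_set f {..<n} <= (\<Sum>i<n. f i)" by (rule L2_set_le_sum) (use assms in auto)
 also have "... <= real n * R" using sum_bounded_above[of "{..<n}" f R] assms by simp
 finally show ?thesis .
qed

section \<open>The exponential bound for deviations\<close>

text \<open>The variances that are optimal for the tilt by the drift, for the starting orbit and for the normalizing constant, respectively.\<close>

definition T_drift :: "real => real => real => real" where
 "T_drift x w t = 1 / (1 + root_s x w + t * w^2)"

definition T_start :: "real => real => real => real" where
 "T_start x w t = 1 / (1 + root_s x w + x^2 / t)"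

definition T_both :: "real => real => real" where
 "T_both x w = 1 / (1 + root_s x w)"

lemma bad_coordinate:
 fixes p Y :: "nat => real"
 assumes n: "n >= 1" and p: "!!i. i < n ==> p i >= 0" and Y: "!!i. i < n ==> 0 < Y i & Y i <= Ym"
  and bad: "\<epsilon> <= L2_set (%i. p i - sqrt (Y i)) {..<n}" and \<delta>: "\<delta> <= \<epsilon> / (real n * sqrt Ym)" and \<epsilon>: "\<epsilon> > 0"
 obtains i \<sigma> where "i < n" "\<sigma> \<in> {1, -1 :: real}" "\<delta> <= \<sigma> * ((p i)^2 / Y i - 1)"
proof -
 have "\<exists>i<n. \<epsilon> / real n <= \<bar>p i - sqrt (Y i)\<bar>"
 proof (rule ccontr)
  assume "\<not> (\<exists>i<n. \<epsilon> / real n <= \<bar>p i - sqrt (Y i)\<bar>)"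
  then have lt: "\<bar>p i - sqrt (Y i)\<bar> < \<epsilon> / real n" if "i < n" for i using that by force
  have "L2_set (%i. p i - sqrt (Y i)) {..<n} <= (\<Sum>i<n. \<bar>p i - sqrt (Y i)\<bar>)" by (rule L2_set_le_sum_abs)
  also have "... < (\<Sum>i<n. \<epsilon> / real n)" using n lt by (intro sum_strict_mono) (auto simp: lessThan_empty_iff)
  finally show False using bad n by simp
 qed
 then obtain i where i: "i < n" "\<epsilon> / real n <= \<bar>p i - sqrt (Y i)\<bar>" by blast
 define y where "y = sqrt (Y i)"
 have y: "y > 0" "y^2 = Y i" "y <= sqrt Ym" "sqrt Ym > 0" using Y[OF i(1)] by (simp_all add: y_def)
 have pi: "p i >= 0" using p i by simp
 have "\<delta> <= \<epsilon> / real n / sqrt Ym" using \<delta> by simp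
 also have "... <= \<epsilon> / real n / y" using y \<epsilon> by (intro divide_left_mono mult_pos_pos) auto
 also have "... <= \<bar>p i - y\<bar> / y" using i(2) y by (intro divide_right_mono) (simp_all add: y_def)
 also have "... = \<bar>p i - y\<bar> * y / y^2" unfolding power2_eq_square using y(1) by simp
 also have "... <= \<bar>p i - y\<bar> * (p i + y) / y^2"
  using pi y(1) by (intro divide_right_mono mult_left_mono) simp_all
 also have "\<bar>p i - y\<bar> * (p i + y) = \<bar>(p i)\<^sup>2 - y\<^sup>2\<bar>"
 proof -
  have "\<bar>(p i - y) * (p i + y)\<bar> = \<bar>p i - y\<bar> * (p i + y)" using pi y by (simp add: abs_mult)
  then show ?thesis by (simp add: power2_eq_square algebra_simps)
 qed
 also have "\<bar>(p i)\<^sup>2 - y\<^sup>2\<bar> / y^2 = \<bar>(p i)\<^sup>2 / Y i - 1\<bar>"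
 proof -
  have "(p i)^2 / Y i - 1 = ((p i)^2 - y\<^sup>2) / y^2" unfolding y(2)[symmetric] diff_divide_distrib using y(1) by simp
  then show ?thesis by (simp add: abs_divide)
 qed
 finally have "\<delta> <= \<bar>(p i)\<^sup>2 / Y i - 1\<bar>" .
 then have "\<delta> <= 1 * ((p i)^2 / Y i - 1) \<or> \<delta> <= -1 * ((p i)^2 / Y i - 1)" by (auto simp: abs_if split: if_splits)
 then show ?thesis using that i(1) by blast
qed

lemma chernoff_integrand:
 fixes p Y :: "nat => real"
 assumes k: "k >= 0" and \<theta>: "\<theta> >= 0" and i: "i < n" "\<sigma> \<in> {1, -1 :: real}" "\<delta> <= \<sigma> * ((p i)^2 / Y i - 1)"
  and \<Phi>: "\<Phi> <= c + (\<Sum>j<n. \<beta> j * (p j)^2)"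
 shows "exp (k * \<Phi>) <= (\<Sum>(i, \<sigma>)\<in>{..<n} \<times> {1, -1}. exp (k * (c - \<theta> * \<sigma> - \<theta> * \<delta>)) *
   exp (k * (\<Sum>j<n. (\<beta> j + (if j = i then \<theta> * \<sigma> / Y j else 0)) * (p j)^2)))"
proof -
 have s: "(\<Sum>j<n. (\<beta> j + (if j = i then \<theta> * \<sigma> / Y j else 0)) * (p j)^2) = (\<Sum>j<n. \<beta> j * (p j)^2) + \<theta> * \<sigma> / Y i * (p i)^2"
 proof -
  have "(\<Sum>j<n. (\<beta> j + (if j = i then \<theta> * \<sigma> / Y j else 0)) * (p j)^2) = (\<Sum>j<n. \<beta> j * (p j)^2 + (if j = i then \<theta> * \<sigma> / Y j * (p j)^2 else 0))"
   by (intro sum.cong refl) (simp add: distrib_right)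
  then show ?thesis using i(1) by (simp add: sum.distrib)
 qed
 have "0 <= \<theta> * (\<sigma> * ((p i)^2 / Y i - 1) - \<delta>)" using \<theta> i(3) by simp
 then have "\<Phi> <= (c - \<theta> * \<sigma> - \<theta> * \<delta>) + (\<Sum>j<n. (\<beta> j + (if j = i then \<theta> * \<sigma> / Y j else 0)) * (p j)^2)"
  using \<Phi> unfolding s by (simp add: algebra_simps)
 then have "k * \<Phi> <= k * ((c - \<theta> * \<sigma> - \<theta> * \<delta>) + (\<Sum>j<n. (\<beta> j + (if j = i then \<theta> * \<sigma> / Y j else 0)) * (p j)^2))"
  by (rule mult_left_mono[OF _ k])
 then have "exp (k * \<Phi>) <= exp (k * (c - \<theta> * \<sigma> - \<theta> * \<delta>)) *
   exp (k * (\<Sum>j<n. (\<beta> j + (if j = i then \<theta> * \<sigma> / Y j else 0)) * (p j)^2))"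
  by (simp only: exp_add[symmetric] exp_le_cancel_iff distrib_left)
 also have "... <= (\<Sum>(i, \<sigma>)\<in>{..<n} \<times> {1, -1}. exp (k * (c - \<theta> * \<sigma> - \<theta> * \<delta>)) *
   exp (k * (\<Sum>j<n. (\<beta> j + (if j = i then \<theta> * \<sigma> / Y j else 0)) * (p j)^2)))"
  using i(1,2) by (intro member_le_sum[of "(i, \<sigma>)" _ "%(i, \<sigma>). exp (k * (c - \<theta> * \<sigma> - \<theta> * \<delta>)) *
   exp (k * (\<Sum>j<n. (\<beta> j + (if j = i then \<theta> * \<sigma> / Y j else 0)) * (p j)^2))", simplified]) auto
 finally show ?thesis .
qed

lemma exponent_coordinate:
 fixes x w t p e :: real
 assumes R: "R >= 1" and x: "0 <= x" "x <= R" and w: "0 <= w" "w <= R" and t: "1 / R <= t" "t <= R"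
  and p: "p >= 0" and e: "e >= 0"
 shows "(T_drift x w t * (p * w)^2 / 2 + c_fun (T_drift x w t) + e / T_drift x w t + e * (p * w))
   + (T_start x w t * (x / t * p)^2 / 2 + c_fun (T_start x w t) + e / T_start x w t + e * (x / t * p))
  <= (c_fun (T_drift x w t) + c_fun (T_start x w t) + e * (2 * (2 + R^2 + R^3) + (R + R^2)))
   + (1 / (2 * t) - 1 / lim_sq x w t + e * (R + R^2)) * p^2"
proof -
 note pb = parameter_bounds[OF R x w t]
 define a where "a = T_drift x w t"
 define b where "b = T_start x w t"
 have "(a * w^2 / 2 + b * (x / t)^2 / 2) * p^2 = (1 / (2 * t) - 1 / lim_sq x w t) * p^2"
  using coordinate_identities(1)[OF pb(7), of x w] by (simp add: a_def b_def T_drift_def T_start_def)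
 then have q: "a * (p * w)^2 / 2 + b * (x / t * p)^2 / 2 = (1 / (2 * t) - 1 / lim_sq x w t) * p^2"
 proof -
  have "a * (p * w)^2 / 2 + b * (r * p)^2 / 2 = (a * w^2 / 2 + b * r^2 / 2) * p^2" for r
   by (simp add: power_mult_distrib algebra_simps)
  from this[of "x / t"] show ?thesis by (simp only: \<open>(a * w^2 / 2 + b * (x / t)^2 / 2) * p^2 = (1 / (2 * t) - 1 / lim_sq x w t) * p\<^sup>2\<close>)
 qed
 have "1 / a <= 2 + R^2 + R^3" "1 / b <= 2 + R^2 + R^3" using pb(1,2) by (simp_all add: a_def b_def T_drift_def T_start_def)
 from this[THEN mult_left_mono[OF _ e]] have i: "e / a <= e * (2 + R^2 + R^3)" "e / b <= e * (2 + R^2 + R^3)" by simp_all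
 have "p <= 1 + p^2"
 proof -
  have "0 <= (p - 1)^2" by simp
  then have "2 * p <= 1 + p^2" by (simp add: power2_eq_square algebra_simps)
  then show ?thesis using p by simp
 qed
 moreover have "0 <= w + x / t" using x w pb(7) by simp
 ultimately have "(w + x / t) * p <= (R + R^2) * (1 + p^2)" using pb(5) p by (intro mult_mono) simp_all
 from mult_left_mono[OF this e] have "e * (p * w) + e * (x / t * p) <= e * (R + R^2) + e * (R + R^2) * p^2"
  by (simp only: distrib_left distrib_right mult_ac mult_1_right)
 then show ?thesis
  unfolding a_def[symmetric] b_def[symmetric] using i q by (simp add: algebra_simps)
qed

lemma bad_set:
 assumes "n <= m"
 shows "{z \<in> mats m n. \<epsilon> <= L2_set (%i. sing_vals m n z i - y i) {..<n}} \<in> sets (mat_space m n :: ('a::real_complex_quat) fmat measure)"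
  and "U \<in> \<U> m ==> z \<in> mats m n ==>
   (mat_mult m m n U z :: 'a fmat) \<in> {z \<in> mats m n. \<epsilon> <= L2_set (%i. sing_vals m n z i - y i) {..<n}}
   \<longleftrightarrow> z \<in> {z \<in> mats m n. \<epsilon> <= L2_set (%i. sing_vals m n z i - y i) {..<n}}"
proof -
 have "closed {p. \<epsilon> <= L2_set (%i. p i - y i) {..<n}}"
  unfolding L2_set_def
  by (intro closed_Collect_le continuous_on_const continuous_on_real_sqrt continuous_on_sum continuous_on_power
    continuous_on_diff continuous_on_product_coordinates)
 from sets_sing_vals_closed[OF assms this, where 'a='a]
 show "{z \<in> mats m n. \<epsilon> <= L2_set (%i. sing_vals m n z i - y i) {..<n}} \<in> sets (mat_space m n :: 'a fmat measure)" by simp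
 show "U \<in> \<U> m ==> z \<in> mats m n ==>
   (mat_mult m m n U z :: 'a fmat) \<in> {z \<in> mats m n. \<epsilon> <= L2_set (%i. sing_vals m n z i - y i) {..<n}}
   \<longleftrightarrow> z \<in> {z \<in> mats m n. \<epsilon> <= L2_set (%i. sing_vals m n z i - y i) {..<n}}"
  using sing_vals_unitary_left[OF _ assms, of z U] by simp
qed

lemma sing_vals_nonneg:
 assumes "z \<in> mats m n" "n <= m" "j < n"
 shows "0 <= sing_vals m n (z :: ('a::real_complex_quat) fmat) j"
proof -
 obtain U V where "sing_vals m n z \<in> chamber_B n" by (rule svd_sing_vals[OF assms(1,2)])
 then show ?thesis using assms(3) by (simp add: mem_chamber_B_iff)
qed

lemma mat_norm_sing_vals:
 assumes "z \<in> mats m n" "n <= m"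
 shows "mat_norm m n (z :: ('a::real_complex_quat) fmat) = L2_set (sing_vals m n z) {..<n}"
proof -
 obtain U V where UV: "U \<in> \<U> m" "V \<in> \<U> n" "z = usv m n U (sing_vals m n z) V"
  by (rule svd_sing_vals[OF assms])
 show ?thesis using usv_norm[OF assms(2) UV(1,2), of "sing_vals m n z"] unfolding UV(3)[symmetric] .
qed

abbreviation normalizer_bounded :: "'a::real_complex_quat itself => 'a fmat measure => nat => real => real => real => real => nat => bool" where
 "normalizer_bounded ty \<nu> n R e E c m \<equiv> \<forall>(\<mu> :: 'a fmat measure) \<L> x. normalized_haar m \<mu> --> \<L> \<in> mats m n -->
  (\<forall>j<n. 0 <= x j & x j <= R & sing_vals m n \<L> j <= R) -->
  ennreal (c * exp (kappa DIM('a) n m * ((\<Sum>j<n. T_both (x j) (sing_vals m n \<L> j) * (x j * sing_vals m n \<L> j)^2 / 2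
     + c_fun (T_both (x j) (sing_vals m n \<L> j)))
    - e * E)))
   <= orbit_exp \<mu> \<nu> m n x (kappa DIM('a) n m) \<L>"

lemma normalizer_lower:
 fixes \<nu> :: "('a::real_complex_quat) fmat measure"
 assumes n: "n >= 1" and \<nu>: "normalized_haar n \<nu>" and e: "e > 0" and R: "R >= 1"
 obtains c where "c > 0" "\<forall>\<^sub>F m in sequentially. normalizer_bounded TYPE('a) \<nu> n R e (real n * R * (real n * R) + real n * (2 + R^2 + R^3) + real n * (real n * R^2)) (c) m"
proof -
 obtain c where c: "c > 0" and ol: "!!m \<mu> \<L> x k. n <= m ==> normalized_haar m (\<mu> :: 'a fmat measure) ==> \<L> \<in> mats m n ==> 0 <= k ==>
  ennreal (c * exp (- k * e * L2_set (sing_vals m n \<L>) {..<n} * L2_set x {..<n})) * haar_K \<mu> m n k (%i. x i * sing_vals m n \<L> i)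
  <= orbit_exp \<mu> \<nu> m n x k \<L>"
  using orbit_lower[OF \<nu> e] by blast
 define G0 where "G0 = 2 + R^2 + R^3"
 define c0 where "c0 = kappa_shift DIM('a) n"
 have c0: "c0 >= 0" unfolding c0_def by (rule kappa_shift_nonneg[OF n])
 show ?thesis
 proof (rule that[of "c / 2 * exp (- (c0 * (real n * G0)))"])
  show "c / 2 * exp (- (c0 * (real n * G0))) > 0" using c by simp
  show "\<forall>\<^sub>F m in sequentially. normalizer_bounded TYPE('a) \<nu> n R e (real n * R * (real n * R) + real n * (2 + R^2 + R^3) + real n * (real n * R^2)) (c / 2 * exp (- (c0 * (real n * G0)))) m"
  proof (rule eventually_mono[OF eventually_conj[OF haar_K_lower[OF n e, where 'a='a] eventually_ge_at_top[of n]]], intro allI impI, elim conjE)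
   fix m :: nat and \<mu> :: "'a fmat measure" and \<L> :: "'a fmat" and x :: "nat => real"
   define k where "k = kappa DIM('a) n m"
   define w where "w = sing_vals m n \<L>"
   assume nm: "n <= m" and \<mu>: "normalized_haar m \<mu>" and \<L>: "\<L> \<in> mats m n"
    and b: "\<forall>j<n. 0 <= x j & x j <= R & sing_vals m n \<L> j <= R"
    and Kl: "\<forall>(\<mu> :: 'a fmat measure) T d. normalized_haar m \<mu> -->
     (\<forall>j<n. 0 < T j & T j <= 1 / 2 & 0 <= d j & 2 * T j + (T j * d j)^2 = 1) -->
     ennreal (1 / 2 * exp (kappa DIM('a) n m * ((low_sum n T d e) - real n * e * L2_set d {..<n})
      + kappa_shift DIM('a) n * (\<Sum>j<n. ln (2 * T j)))) <= haar_K \<mu> m n (kappa DIM('a) n m) d"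
   have k: "k >= 0" unfolding k_def by (rule kappa_nonneg[OF nm]) (simp add: Suc_leI)
   have xb: "0 <= x j & x j <= R" and wb: "0 <= w j & w j <= R" if "j < n" for j
    using b that sing_vals_nonneg[OF \<L> nm that] by (auto simp: w_def)
   define T where "T j = T_both (x j) (w j)" for j
   define d where "d j = x j * w j" for j
   have db: "0 <= d j & d j <= R^2" if "j < n" for j
    using xb[OF that] wb[OF that] R by (auto simp: d_def power2_eq_square intro!: mult_mono)
   have T: "0 < T j" "T j <= 1 / 2" "2 * T j + (T j * d j)^2 = 1" if "j < n" for j
    using coordinate_identities(8,9,2)[where t = 1 and x = "x j" and w = "w j"] by (simp_all add: T_def T_both_def d_def)
   have iT: "1 / T j <= G0" if "j < n" for j
   proof -
    have "1 / R <= 1" using R by simp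
    from parameter_bounds(3)[OF R _ _ _ _ this R, of "x j" "w j"] show ?thesis
     using xb[OF that] wb[OF that] by (simp add: T_def T_both_def G0_def)
   qed
   define S where "S = (\<Sum>j<n. T j * (d j)^2 / 2 + c_fun (T j))"
   define E3 where "E3 = real n * R * (real n * R) + real n * G0 + real n * (real n * R^2)"
   have l2w: "L2_set w {..<n} <= real n * R" and l2x: "L2_set x {..<n} <= real n * R" and l2d: "L2_set d {..<n} <= real n * R^2"
    by (rule L2_set_le_bound[OF wb] L2_set_le_bound[OF xb] L2_set_le_bound[OF db]; assumption)+
   have A1: "S - e * (real n * G0 + real n * (real n * R^2)) <= (low_sum n T d e) - real n * e * L2_set d {..<n}"
   proof -
    have "(\<Sum>j<n. T j * (d j)^2 / 2 + c_fun (T j) - e * G0) <= (low_sum n T d e)"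
    proof (rule sum_mono)
     fix j assume "j \<in> {..<n}"
     then have j: "j < n" by simp
     have "e * (1 / T j) <= e * G0" by (rule mult_left_mono[OF iT[OF j]]) (use e in simp)
     moreover have "e / (2 * T j) <= e * (1 / T j)" using e T(1)[OF j] by (simp add: field_simps)
     ultimately show "T j * (d j)^2 / 2 + c_fun (T j) - e * G0 <= T j * (d j)^2 / 2 + c_fun (T j) - e / (2 * T j)" by simp
    qed
    moreover have "(\<Sum>j<n. T j * (d j)^2 / 2 + c_fun (T j) - e * G0) = S - e * (real n * G0)"
     unfolding S_def by (simp add: sum_subtractf)
    moreover have "real n * e * L2_set d {..<n} <= real n * e * (real n * R^2)" by (rule mult_left_mono[OF l2d]) (use e in simp)
    ultimately show ?thesis by (simp add: algebra_simps)
   qed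
   have A2: "- (real n * G0) <= (\<Sum>j<n. ln (2 * T j))"
   proof -
    have "(\<Sum>j<n. - G0) <= (\<Sum>j<n. ln (2 * T j))"
    proof (rule sum_mono)
     fix j assume "j \<in> {..<n}"
     then have j: "j < n" by simp
     have "- ln (2 * T j) = ln (1 / (2 * T j))" using T(1)[OF j] by (simp add: ln_div ln_mult)
     also have "... <= 1 / (2 * T j) - 1" by (rule ln_le_minus_one) (use T(1)[OF j] in simp)
     also have "... <= 1 / T j" using T(1)[OF j] by (simp add: field_simps)
     finally show "- G0 <= ln (2 * T j)" using iT[OF j] by simp
    qed
    then show ?thesis by simp
   qed
   have A3: "k * e * (L2_set w {..<n} * L2_set x {..<n}) <= k * e * (real n * R * (real n * R))"
    using k e l2w l2x R by (intro mult_left_mono mult_mono) simp_all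
   have "c / 2 * exp (- (c0 * (real n * G0))) * exp (k * (S - e * E3))
    <= c * exp (- k * e * L2_set w {..<n} * L2_set x {..<n}) *
     (1 / 2 * exp (k * ((low_sum n T d e) - real n * e * L2_set d {..<n}) + c0 * (\<Sum>j<n. ln (2 * T j))))"
   proof -
    have "- (c0 * (real n * G0)) + k * (S - e * E3)
     <= - k * e * L2_set w {..<n} * L2_set x {..<n}
      + (k * ((low_sum n T d e) - real n * e * L2_set d {..<n}) + c0 * (\<Sum>j<n. ln (2 * T j)))"
     using mult_left_mono[OF A1 k] mult_left_mono[OF A2 c0] A3 unfolding E3_def by (simp add: algebra_simps)
    then have "c / 2 * exp (- (c0 * (real n * G0)) + k * (S - e * E3))
     <= c / 2 * exp (- k * e * L2_set w {..<n} * L2_set x {..<n}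
      + (k * ((low_sum n T d e) - real n * e * L2_set d {..<n}) + c0 * (\<Sum>j<n. ln (2 * T j))))"
     using c by (intro mult_left_mono) simp_all
    then show ?thesis by (simp only: exp_add mult_ac times_divide_eq_left times_divide_eq_right mult_1_left)
   qed
   then have "ennreal (c / 2 * exp (- (c0 * (real n * G0))) * exp (k * (S - e * E3)))
    <= ennreal (c * exp (- k * e * L2_set w {..<n} * L2_set x {..<n})) *
     ennreal (1 / 2 * exp (k * ((low_sum n T d e) - real n * e * L2_set d {..<n}) + c0 * (\<Sum>j<n. ln (2 * T j))))"
    using c by (subst ennreal_mult[symmetric]) (simp_all add: ennreal_leI)
   also have "... <= ennreal (c * exp (- k * e * L2_set w {..<n} * L2_set x {..<n})) * haar_K \<mu> m n k d"
   proof (rule mult_left_mono)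
    have "\<forall>j<n. 0 < T j & T j <= 1 / 2 & 0 <= d j & 2 * T j + (T j * d j)^2 = 1" using T db by blast
    with Kl \<mu> show "ennreal (1 / 2 * exp (k * ((low_sum n T d e) - real n * e * L2_set d {..<n}) + c0 * (\<Sum>j<n. ln (2 * T j)))) <= haar_K \<mu> m n k d"
     unfolding k_def c0_def by blast
   qed simp
   also have "... <= orbit_exp \<mu> \<nu> m n x k \<L>"
    using ol[OF nm \<mu> \<L> k, of x] unfolding d_def w_def .
   finally show "ennreal (c / 2 * exp (- (c0 * (real n * G0))) * exp (kappa DIM('a) n m * ((\<Sum>j<n. T_both (x j) (sing_vals m n \<L> j) * (x j * sing_vals m n \<L> j)^2 / 2
     + c_fun (T_both (x j) (sing_vals m n \<L> j)))
    - e * (real n * R * (real n * R) + real n * (2 + R^2 + R^3) + real n * (real n * R^2)))))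
    <= orbit_exp \<mu> \<nu> m n x (kappa DIM('a) n m) \<L>"
    unfolding S_def E3_def T_def d_def w_def k_def G0_def .
  qed
 qed
qed

abbreviation deviation_integral_bounded :: "'a::real_complex_quat itself => nat => real => real => real => real => real => real => nat => bool" where
 "deviation_integral_bounded ty n R \<epsilon> \<delta> e E C m \<equiv> \<forall>(\<mu> :: 'a fmat measure) \<nu> x t \<L>.
  normalized_haar m \<mu> --> normalized_haar n \<nu> --> x \<in> chamber_B n --> 1 / R <= t --> t <= R --> \<L> \<in> mats m n -->
  (\<forall>j<n. x j <= R & sing_vals m n \<L> j <= R) -->
  tilted_mass \<mu> \<nu> m n (kappa DIM('a) n m) t x \<L> (far_set m n \<epsilon> x (sing_vals m n \<L>) t)
  <= ennreal (C * exp (kappa DIM('a) n m * ((\<Sum>j<n. c_fun (T_drift (x j) (sing_vals m n \<L> j) t) + c_fun (T_start (x j) (sing_vals m n \<L> j) t)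
     + ln (lim_sq (x j) (sing_vals m n \<L> j) t / (2 * t)))
    - \<delta>\<^sup>2 / 16 + e * E)))"

text \<open>If one ratio \<open>p i ^2 / y i ^2\<close> is at distance \<open>\<delta>\<close> from 1, an exponential tilt by \<open>\<theta> = \<delta> / 8\<close> in the right direction exceeds 1. The
  resulting exponent \<open>4 * \<theta>^2 - \<theta> * \<delta>\<close> equals \<open>- \<delta>^2 / 16\<close>.\<close>

lemma deviation_integral_bound:
 assumes n: "n >= 1" and R: "R >= 1" and e: "e > 0" "e <= 1" and \<delta>: "0 < \<delta>" "\<delta> <= 1"
  and Ym: "Ym = R^2 + R^2 * R^2 + 2 * R * (1 + R^2)" and eY: "Ym * (e * (R + R^2) + e) <= 1 / 4"
  and \<epsilon>: "\<epsilon> > 0" "\<delta> <= \<epsilon> / (real n * sqrt Ym)"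
 obtains C where "C > 0" "\<forall>\<^sub>F m in sequentially. deviation_integral_bounded TYPE('a::real_complex_quat) n R \<epsilon> \<delta> e (real n * (2 * (2 + R^2 + R^3) + (R + R^2)) + 2 * real n * (Ym * ((R + R^2) + 1))) C m"
proof -
 define b0 where "b0 = R + R^2"
 define G0 where "G0 = 2 + R^2 + R^3"
 define \<theta> where "\<theta> = \<delta> / 8"
 define G where "G = 4 * R + b0"
 define e1 where "e1 = e / (2 * real n * G)"
 define c0 where "c0 = kappa_shift DIM('a) n"
 have b0: "b0 >= 0" and G: "G > 0" using R by (simp_all add: b0_def G_def add_pos_nonneg)
 have \<theta>: "0 <= \<theta>" "\<theta> <= 1 / 8" using \<delta> by (simp_all add: \<theta>_def)
 have e1: "e1 > 0" "2 * real n * G * e1 = e" using e n G by (simp_all add: e1_def)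
 have c0: "c0 >= 0" unfolding c0_def by (rule kappa_shift_nonneg[OF n])
 have Ym0: "Ym > 0" using R by (simp add: Ym add_pos_nonneg add_nonneg_pos)
 obtain \<V> :: "'a fmat set" where net: "finite \<V>" "\<V> \<subseteq> \<U> n" "\<V> ~= {}"
  "!!V. V \<in> \<U> n ==> \<exists>V'\<in>\<V>. mat_norm n n (mat_minus n n V V') <= e1"
  using unitary_net[OF e1(1)] by metis
 have cV: "card \<V> > 0" using net by (simp add: card_gt_0_iff)
 obtain C1 where C1: "C1 > 0" and num: "\<forall>\<^sub>F m in sequentially. numerator_bounded TYPE('a) n e C1 m"
  by (rule numerator_bound[OF n e(1), where 'a='a])
 define Lm where "Lm = Ym * R / 2"
 define K where "K = C1^2 * real (card \<V>) * exp (c0 * (real n * Lm + real n))"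
 have K: "K > 0" using C1 cV by (simp add: K_def)
 have ev0: "\<forall>\<^sub>F m in sequentially. 0 < kappa DIM('a) n m"
  using kappa_at_top[of "DIM('a)" n] by (simp add: filterlim_at_top_dense Suc_leI)
 show ?thesis
 proof (rule that[of "2 * real n * K"], use n K in simp,
   rule eventually_mono[OF eventually_conj[OF num eventually_conj[OF ev0 eventually_ge_at_top[of n]]]], intro allI impI, elim conjE)
  fix m :: nat and \<mu> \<nu> :: "'a fmat measure" and x :: "nat => real" and t :: real and \<L> :: "'a fmat"
  define k where "k = kappa DIM('a) n m"
  define w where "w = sing_vals m n \<L>"
  define z where "z = (mat_scale m n (sqrt (t / k)) :: 'a fmat => 'a fmat)"
  define Y where "Y j = lim_sq (x j) (w j) t" for j
  define T1 where "T1 j = T_drift (x j) (w j) t" for j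
  define T2 where "T2 j = T_start (x j) (w j) t" for j
  define A :: "'a fmat set" where "A = {z \<in> mats m n. \<epsilon> <= L2_set (%i. sing_vals m n z i - sqrt (Y i)) {..<n}}"
  define p where "p g = sing_vals m n (z g)" for g
  define \<Phi> where "\<Phi> g = (\<Sum>j<n. (lap (T1 j) e (p g j * w j))
     + (lap (T2 j) e (x j / t * p g j)))" for g
  assume num: "numerator_bounded TYPE('a) n e C1 m"
   and kp: "0 < kappa DIM('a) n m" and nm: "n <= m"
   and \<mu>: "normalized_haar m \<mu>" and \<nu>: "normalized_haar n \<nu>" and x: "x \<in> chamber_B n"
   and t: "1 / R <= t" "t <= R" and \<L>: "\<L> \<in> mats m n"
   and bd: "\<forall>j<n. x j <= R & sing_vals m n \<L> j <= R"
  have k: "k > 0" using kp by (simp add: k_def)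
  have xb: "0 <= x j" "x j <= R" and wb: "0 <= w j" "w j <= R" if "j < n" for j
   using bd that x sing_vals_nonneg[OF \<L> nm that] by (auto simp: w_def mem_chamber_B_iff)
  note pb = parameter_bounds[OF R xb wb t]
  have "0 < n" using n by simp
  note tp = pb(7)[OF this this this this]
  have Yb: "2 * t <= Y j & Y j <= Ym" if "j < n" for j
   using pb(4)[OF that that that that] lim_sq_ge[OF tp, of "x j" "w j"] by (simp add: Y_def Ym)
  have Yp: "0 < Y j" if "j < n" for j using Yb[OF that] tp by simp
  have YY: "0 < Y j & Y j <= Ym" if "j < n" for j using Yb[OF that] Yp[OF that] by simp
  have zm: "z g \<in> mats m n" for g by (simp add: z_def)
  have pn: "0 <= p g j" if "j < n" for g j unfolding p_def by (rule sing_vals_nonneg[OF zm nm that])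
  have Tb: "\<forall>j<n. 0 < T1 j & T1 j <= 1 / 2" "\<forall>j<n. 0 < T2 j & T2 j <= 1 / 2"
   using coordinate_identities(4-7)[OF tp] by (simp_all add: T1_def T2_def T_drift_def T_start_def)
  define cc where "cc = (\<Sum>j<n. c_fun (T1 j) + c_fun (T2 j) + e * (2 * G0 + b0))"
  define \<beta> where "\<beta> j = 1 / (2 * t) - 1 / Y j + e * b0" for j
  define \<gamma> where "\<gamma> i \<sigma> j = \<beta> j + (if j = i then \<theta> * \<sigma> / Y j else 0)" for i \<sigma> j
  have \<Phi>: "\<Phi> g <= cc + (\<Sum>j<n. \<beta> j * (p g j)^2)" for g
  proof -
   have "\<Phi> g <= (\<Sum>j<n. (c_fun (T1 j) + c_fun (T2 j) + e * (2 * G0 + b0)) + \<beta> j * (p g j)^2)"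
    unfolding \<Phi>_def
   proof (rule sum_mono)
    fix j assume "j \<in> {..<n}"
    then have j: "j < n" by simp
    show "(lap (T1 j) e (p g j * w j))
     + (lap (T2 j) e (x j / t * p g j))
     <= (c_fun (T1 j) + c_fun (T2 j) + e * (2 * G0 + b0)) + \<beta> j * (p g j)^2"
     using exponent_coordinate[OF R xb[OF j] wb[OF j] t pn[OF j] less_imp_le[OF e(1)], of g]
     unfolding T1_def T2_def \<beta>_def G0_def b0_def Y_def .
   qed
   then show ?thesis by (simp only: cc_def sum.distrib)
  qed
  let ?Q = "{..<n} \<times> {1, -1 :: real}"
  have q: "indicator A (z g) * ennreal (C1^2 * exp (k * \<Phi> g))
   <= (\<Sum>q\<in>?Q. ennreal (C1^2 * exp (k * (cc - \<theta> * snd q - \<theta> * \<delta>))) * eexp (k * (\<Sum>j<n. \<gamma> (fst q) (snd q) j * (p g j)^2)))" for g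
  proof (cases "z g \<in> A")
   case True
   then have bad: "\<epsilon> <= L2_set (%i. p g i - sqrt (Y i)) {..<n}" by (simp add: A_def p_def)
   obtain i \<sigma> where i: "i < n" "\<sigma> \<in> {1, -1 :: real}" "\<delta> <= \<sigma> * ((p g i)^2 / Y i - 1)"
    by (rule bad_coordinate[OF n pn YY bad \<epsilon>(2,1)])
   have "C1^2 * exp (k * \<Phi> g) <= C1^2 * (\<Sum>(i, \<sigma>)\<in>?Q. exp (k * (cc - \<theta> * \<sigma> - \<theta> * \<delta>)) * exp (k * (\<Sum>j<n. \<gamma> i \<sigma> j * (p g j)^2)))"
    unfolding \<gamma>_def by (intro mult_left_mono chernoff_integrand[where p = "p g" and Y = Y and \<beta> = \<beta>, OF less_imp_le[OF k] \<theta>(1) i \<Phi>]) simp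
   also have "... = (\<Sum>q\<in>?Q. C1\<^sup>2 * exp (k * (cc - \<theta> * snd q - \<theta> * \<delta>)) * exp (k * (\<Sum>j<n. \<gamma> (fst q) (snd q) j * (p g j)^2)))"
    by (simp only: sum_distrib_left case_prod_beta' mult.assoc)
   finally have "ennreal (C1^2 * exp (k * \<Phi> g)) <= ennreal (\<Sum>q\<in>?Q. C1\<^sup>2 * exp (k * (cc - \<theta> * snd q - \<theta> * \<delta>)) * exp (k * (\<Sum>j<n. \<gamma> (fst q) (snd q) j * (p g j)^2)))"
    by (rule ennreal_leI)
   also have "... = (\<Sum>q\<in>?Q. ennreal (C1^2 * exp (k * (cc - \<theta> * snd q - \<theta> * \<delta>)) * exp (k * (\<Sum>j<n. \<gamma> (fst q) (snd q) j * (p g j)^2))))"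
    by (rule sum_ennreal[symmetric]) simp
   also have "... = (\<Sum>q\<in>?Q. ennreal (C1^2 * exp (k * (cc - \<theta> * snd q - \<theta> * \<delta>))) * eexp (k * (\<Sum>j<n. \<gamma> (fst q) (snd q) j * (p g j)^2)))"
    by (intro sum.cong refl ennreal_mult) simp_all
   finally show ?thesis using True by simp
  qed simp
  have pm: "(%g. p g j) \<in> borel_measurable (gauss_mat m n)" if "j < n" for j
  proof -
   have "z \<in> mat_space m n \<rightarrow>\<^sub>M mat_space m n"
    unfolding z_def by (intro measurable_mat_scale measurable_ident_sets refl)
   from measurable_compose[OF this measurable_sing_vals[OF nm that]]
   show ?thesis unfolding p_def by (simp cong: measurable_cong_sets)
  qed
  have Em: "(%g. eexp (k * (\<Sum>j<n. \<gamma> i \<sigma> j * (p g j)^2))) \<in> borel_measurable (gauss_mat m n)" for i \<sigma>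
  proof -
   have "(%g. \<Sum>j<n. \<gamma> i \<sigma> j * (p g j)^2) \<in> borel_measurable (gauss_mat m n)"
    by (intro borel_measurable_sum borel_measurable_times borel_measurable_const borel_measurable_power pm) simp
   then show ?thesis by measurable
  qed
  define D where "D = (\<Sum>j<n. c_fun (T1 j) + c_fun (T2 j) + ln (Y j / (2 * t))) - \<delta>\<^sup>2 / 16
   + e * (real n * (2 * G0 + b0) + 2 * real n * (Ym * (b0 + 1)))"
  have summand: "ennreal (C1^2 * exp (k * (cc - \<theta> * \<sigma> - \<theta> * \<delta>))) * (\<integral>\<^sup>+g. eexp (k * (\<Sum>j<n. \<gamma> i \<sigma> j * (p g j)^2)) \<partial>gauss_mat m n)
   <= ennreal (K * exp (k * D))" if i: "i < n" and \<sigma>: "\<sigma> = 1 \<or> \<sigma> = -1" for i \<sigma>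
  proof -
   define L where "L = (\<Sum>j<n. ln (Y j / (2 * t)))"
   have iY: "1 / Y j <= R" "1 / (2 * t) <= R" if "j < n" for j
   proof -
    have "1 / t <= R" using pb(6)[OF \<open>0 < n\<close> \<open>0 < n\<close> \<open>0 < n\<close> \<open>0 < n\<close>] .
    moreover have "1 / (2 * t) <= 1 / t" using tp by (simp add: field_simps)
    moreover have "1 / Y j <= 1 / (2 * t)" using Yb[OF that] tp by (intro divide_left_mono) auto
    ultimately show "1 / Y j <= R" "1 / (2 * t) <= R" by simp_all
   qed
   have \<gamma>G: "\<bar>\<gamma> i \<sigma> j\<bar> <= G" if j: "j < n" for j
   proof -
    have "\<bar>\<theta> * \<sigma> / Y j\<bar> = \<theta> * (1 / Y j)" using \<sigma> \<theta> Yp[OF j] by (auto simp: abs_mult)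
    also have "... <= 1 * R" using \<theta> iY(1)[OF j] Yp[OF j] by (intro mult_mono) auto
    finally have 1: "\<bar>if j = i then \<theta> * \<sigma> / Y j else 0\<bar> <= R" using R by (cases "j = i") simp_all
    have "e * b0 <= 1 * b0" using e b0 by (intro mult_right_mono)
    moreover have "0 <= e * b0" using e b0 by simp
    moreover have "0 < 1 / Y j" "0 < 1 / (2 * t)" using Yp[OF j] tp by simp_all
    ultimately show ?thesis using 1 iY[OF j] R unfolding \<gamma>_def \<beta>_def G_def by (simp only: abs_le_iff) linarith
   qed
   have g: "\<theta> <= 1 / 4" "0 <= e * b0" "Ym * (e * b0 + e) <= 1 / 4"
    using \<theta> e b0 eY by (simp_all add: b0_def)
   have \<gamma>e: "\<gamma> i \<sigma> j = 1 / (2 * t) - 1 / Y j + e * b0 + (if j = i then \<theta> * \<sigma> / Y j else 0)" if "j < n" for j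
    by (simp only: \<gamma>_def \<beta>_def)
   have "(\<integral>\<^sup>+g. eexp (k * (\<Sum>j<n. \<gamma> i \<sigma> j * (p g j)^2)) \<partial>gauss_mat m n)
    <= ennreal (real (card \<V>) * exp (k * (L + \<theta> * \<sigma> + 4 * \<theta>^2 + 2 * real n * (Ym * (e * b0 + e))) + c0 * (L + real n)))"
    unfolding L_def c0_def k_def p_def z_def
    by (rule chernoff_term[where Y = Y and \<gamma> = "\<gamma> i \<sigma>", OF n nm kp tp net(1,2,4) less_imp_le[OF e1(1)] e1(2) less_imp_le[OF e(1)] Yb i \<sigma> \<theta>(1) g \<gamma>e \<gamma>G])
   then have "ennreal (C1^2 * exp (k * (cc - \<theta> * \<sigma> - \<theta> * \<delta>))) * (\<integral>\<^sup>+g. eexp (k * (\<Sum>j<n. \<gamma> i \<sigma> j * (p g j)^2)) \<partial>gauss_mat m n)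
    <= ennreal (C1^2 * exp (k * (cc - \<theta> * \<sigma> - \<theta> * \<delta>))) *
     ennreal (real (card \<V>) * exp (k * (L + \<theta> * \<sigma> + 4 * \<theta>^2 + 2 * real n * (Ym * (e * b0 + e))) + c0 * (L + real n)))"
    by (rule mult_left_mono) simp
   also have "... = ennreal (C1^2 * exp (k * (cc - \<theta> * \<sigma> - \<theta> * \<delta>)) *
     (real (card \<V>) * exp (k * (L + \<theta> * \<sigma> + 4 * \<theta>^2 + 2 * real n * (Ym * (e * b0 + e))) + c0 * (L + real n))))"
    by (rule ennreal_mult[symmetric]) simp_all
   also have "C1^2 * exp (k * (cc - \<theta> * \<sigma> - \<theta> * \<delta>)) *
     (real (card \<V>) * exp (k * (L + \<theta> * \<sigma> + 4 * \<theta>^2 + 2 * real n * (Ym * (e * b0 + e))) + c0 * (L + real n)))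
    = C1^2 * real (card \<V>) * exp (c0 * (L + real n)) * exp (k * D)"
   proof -
    have "cc - \<theta> * \<sigma> - \<theta> * \<delta> + (L + \<theta> * \<sigma> + 4 * \<theta>^2 + 2 * real n * (Ym * (e * b0 + e))) = D"
     unfolding cc_def D_def L_def \<theta>_def by (simp add: sum.distrib power2_eq_square algebra_simps)
    then have "k * D = k * (cc - \<theta> * \<sigma> - \<theta> * \<delta>) + k * (L + \<theta> * \<sigma> + 4 * \<theta>^2 + 2 * real n * (Ym * (e * b0 + e)))"
     by (simp only: distrib_left[symmetric])
    then show ?thesis by (simp only: exp_add mult_ac)
   qed
   also have "ennreal (C1^2 * real (card \<V>) * exp (c0 * (L + real n)) * exp (k * D)) <= ennreal (K * exp (k * D))"
   proof -
    have "L <= (\<Sum>j<n. Lm)" unfolding L_def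
    proof (rule sum_mono)
     fix j assume "j \<in> {..<n}"
     then have j: "j < n" by simp
     have "ln (Y j / (2 * t)) <= Y j / (2 * t) - 1" by (rule ln_le_minus_one) (use Yp[OF j] tp in simp)
     also have "... <= Y j / 2 * (1 / t)" by simp
     also have "... <= Ym / 2 * R" using Yb[OF j] Yp[OF j] tp pb(6)[OF j j j j] by (intro mult_mono) auto
     finally show "ln (Y j / (2 * t)) <= Lm" by (simp add: Lm_def)
    qed
    then have "c0 * (L + real n) <= c0 * (real n * Lm + real n)" using c0 by (intro mult_left_mono) simp_all
    then show ?thesis unfolding K_def by (intro ennreal_leI mult_right_mono mult_left_mono) simp_all
   qed
   finally show ?thesis .
  qed
  have "(\<integral>\<^sup>+g. indicator A (z g) * (eexp (k * mat_inner m n \<L> (z g)) * orbit_exp \<mu> \<nu> m n x (k / t) (z g)) \<partial>gauss_mat m n)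
   <= (\<integral>\<^sup>+g. indicator A (z g) * ennreal (C1^2 * exp (k * \<Phi> g)) \<partial>gauss_mat m n)"
  proof -
   have A1: "A \<in> sets (mat_space m n)"
    unfolding A_def by (rule bad_set(1)[OF nm])
   have A2: "\<forall>U\<in>\<U> m. \<forall>z\<in>mats m n. mat_mult m m n U z \<in> A \<longleftrightarrow> z \<in> A"
    unfolding A_def by (intro ballI bad_set(2)[OF nm])
   from num[THEN spec, THEN spec, THEN spec, THEN spec, THEN spec, THEN spec, THEN spec, THEN spec,
     THEN mp, OF \<mu>, THEN mp, OF \<nu>, THEN mp, OF x, THEN mp, OF tp, THEN mp, OF \<L>, THEN mp, OF A1, THEN mp, OF A2,
     THEN mp, OF Tb(1), THEN mp, OF Tb(2)]
   show ?thesis unfolding \<Phi>_def p_def z_def w_def k_def by simp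
  qed
  also have "... <= (\<integral>\<^sup>+g. (\<Sum>q\<in>?Q. ennreal (C1^2 * exp (k * (cc - \<theta> * snd q - \<theta> * \<delta>))) * eexp (k * (\<Sum>j<n. \<gamma> (fst q) (snd q) j * (p g j)^2))) \<partial>gauss_mat m n)"
   by (rule nn_integral_mono) (rule q)
  also have "... = (\<Sum>q\<in>?Q. \<integral>\<^sup>+g. ennreal (C1^2 * exp (k * (cc - \<theta> * snd q - \<theta> * \<delta>))) * eexp (k * (\<Sum>j<n. \<gamma> (fst q) (snd q) j * (p g j)^2)) \<partial>gauss_mat m n)"
   by (rule nn_integral_sum) (intro borel_measurable_times_ennreal Em measurable_const, simp)
  also have "... = (\<Sum>q\<in>?Q. ennreal (C1^2 * exp (k * (cc - \<theta> * snd q - \<theta> * \<delta>))) * (\<integral>\<^sup>+g. eexp (k * (\<Sum>j<n. \<gamma> (fst q) (snd q) j * (p g j)^2)) \<partial>gauss_mat m n))"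
   by (intro sum.cong refl nn_integral_cmult Em)
  also have "... <= (\<Sum>q\<in>?Q. ennreal (K * exp (k * D)))"
   by (intro sum_mono summand) auto
  also have "... = ennreal (2 * real n * K * exp (k * D))"
  proof -
   have "(\<Sum>q\<in>?Q. ennreal (K * exp (k * D))) = ennreal (\<Sum>q\<in>?Q. K * exp (k * D))"
    by (rule sum_ennreal) (use K in simp)
   then show ?thesis by (simp add: mult_ac)
  qed
  finally show "tilted_mass \<mu> \<nu> m n (kappa DIM('a) n m) t x \<L> (far_set m n \<epsilon> x (sing_vals m n \<L>) t)
  <= ennreal (2 * real n * K * exp (kappa DIM('a) n m * ((\<Sum>j<n. c_fun (T_drift (x j) (sing_vals m n \<L> j) t) + c_fun (T_start (x j) (sing_vals m n \<L> j) t)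
     + ln (lim_sq (x j) (sing_vals m n \<L> j) t / (2 * t)))
    - \<delta>\<^sup>2 / 16 + e * (real n * (2 * (2 + R^2 + R^3) + (R + R^2)) + 2 * real n * (Ym * ((R + R^2) + 1))))))"
   unfolding A_def z_def D_def T1_def T2_def Y_def w_def k_def G0_def b0_def .
 qed
qed

lemma limit_point_entry: "i < n ==> limit_point n x w t i = sqrt (lim_sq (x i) (w i) t)"
 by (simp add: limit_point_def lim_sq_def)

lemma L2_set_sq: "(L2_set f {..<n})^2 = (\<Sum>i<n. (f i)\<^sup>2)"
 by (simp add: L2_set_def sum_nonneg)

lemma deviation_event:
 "deviation_prob P n (%\<omega>. sing_vals m n (mat_add m n (S \<omega>) (T \<omega>))) (limit_point n x w t) \<epsilon>
  = emeasure P {\<omega> \<in> space P. mat_add m n (S \<omega>) (T \<omega>) \<in> (far_set m n \<epsilon> x w t)}"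
proof -
 have "L2_set (%i. p i - limit_point n x w t i) {..<n} = L2_set (%i. p i - sqrt (lim_sq (x i) (w i) t)) {..<n}" for p
  by (rule L2_set_cong) (simp_all add: limit_point_entry)
 then show ?thesis by (simp add: deviation_prob_def)
qed

text \<open>Numerator and denominator have the same leading exponent, and \<open>e\<close> is chosen so small that all losses together use up at most half of
  the gain \<open>\<delta>^2 / 16\<close>. All constants depend on the parameters only through \<open>R\<close>.\<close>

lemma deviation_bound:
 fixes H :: "nat => ('a::real_complex_quat) fmat measure"
 assumes n: "n >= 1" and haar: "!!j. j >= 1 ==> normalized_haar j (H j)" and R: "R >= 1" and \<epsilon>: "\<epsilon> > 0"
 obtains C \<eta> where "\<eta> > 0" "\<forall>\<^sub>F m in sequentially. \<forall>x w t \<L> (P :: 'w measure) B.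
  x \<in> chamber_B n --> (\<forall>j<n. x j <= R & w j <= R) --> 1 / R <= t --> t <= R -->
  \<L> \<in> mats m n --> sing_vals m n \<L> = w -->
  mat_brownian_motion_from P m n (tilted_orbit_measure H m n x (mat_scale m n (kappa DIM('a) n m) \<L>)) B -->
  deviation_prob P n (%\<omega>. sing_vals m n (mat_add m n (B (t / kappa DIM('a) n m) \<omega>) (mat_scale m n t \<L>)))
   (limit_point n x w t) \<epsilon> <= ennreal (C * exp (- \<eta> * kappa DIM('a) n m))"
proof -
 define Ym where "Ym = R^2 + R^2 * R^2 + 2 * R * (1 + R^2)"
 define \<delta> where "\<delta> = min 1 (\<epsilon> / (real n * sqrt Ym))"
 define E2 where "E2 = real n * (2 * (2 + R^2 + R^3) + (R + R^2)) + 2 * real n * (Ym * ((R + R^2) + 1))"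
 define E3 where "E3 = real n * R * (real n * R) + real n * (2 + R^2 + R^3) + real n * (real n * R^2)"
 define q where "q = Ym * ((R + R^2) + 1)"
 define e where "e = min 1 (min (1 / (4 * q)) (\<delta>^2 / (32 * (E2 + E3))))"
 have Ym: "Ym > 0" using R by (simp add: Ym_def add_nonneg_pos)
 have q: "q > 0" using R Ym by (simp add: q_def add_nonneg_pos)
 have \<delta>: "0 < \<delta>" "\<delta> <= 1" "\<delta> <= \<epsilon> / (real n * sqrt Ym)" using \<epsilon> n Ym by (simp_all add: \<delta>_def)
 have E: "E2 + E3 > 0"
 proof -
  have "0 <= R^3" using R by simp
  then have "0 < real n * (2 + R^2 + R^3)" using n by (simp add: add_pos_nonneg)
  moreover have "0 <= real n * R * (real n * R)" "0 <= real n * (real n * R^2)" using R by simp_all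
  moreover have "0 <= 2 * real n * q" using q by simp
  moreover have "0 <= real n * (2 * (2 + R^2 + R^3) + (R + R^2))" using R \<open>0 <= R^3\<close> by simp
  ultimately show ?thesis unfolding E2_def E3_def q_def by linarith
 qed
 have e: "e > 0" "e <= 1" using q \<delta>(1) E by (simp_all add: e_def)
 have "e * q <= 1 / (4 * q) * q" using q by (intro mult_right_mono) (simp_all add: e_def)
 then have eq: "e * q <= 1 / 4" using q by simp
 then have eY: "Ym * (e * (R + R^2) + e) <= 1 / 4" by (simp add: q_def algebra_simps)
 have "e * (E2 + E3) <= \<delta>^2 / (32 * (E2 + E3)) * (E2 + E3)" using E by (intro mult_right_mono) (simp_all add: e_def)
 also have "... = \<delta>^2 / 32"
 proof -
  have "\<delta>^2 / (32 * X) * X = \<delta>^2 / 32" if "X > 0" for X :: real using that by simp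
  then show ?thesis using E .
 qed
 finally have eE: "e * E2 + e * E3 <= \<delta>^2 / 32" by (simp only: distrib_left)
 obtain C where C: "C > 0" and num: "\<forall>\<^sub>F m in sequentially. deviation_integral_bounded TYPE('a) n R \<epsilon> \<delta> e E2 C m"
  unfolding E2_def by (rule deviation_integral_bound[OF n R e \<delta>(1,2) Ym_def eY \<epsilon> \<delta>(3), where 'a='a])
 obtain c where c: "c > 0" and den: "\<forall>\<^sub>F m in sequentially. normalizer_bounded TYPE('a) (H n) n R e E3 (c) m"
  unfolding E3_def by (rule normalizer_lower[OF n haar[OF n] e(1) R])
 have ev0: "\<forall>\<^sub>F m in sequentially. 0 < kappa DIM('a) n m"
  using kappa_at_top[of "DIM('a)" n] by (simp add: filterlim_at_top_dense Suc_leI)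
 show ?thesis
 proof (rule that[of "\<delta>^2 / 32" "C / c"], use \<delta>(1) in simp,
   rule eventually_mono[OF eventually_conj[OF num eventually_conj[OF den eventually_conj[OF ev0 eventually_ge_at_top[of n]]]]],
   intro allI impI, elim conjE)
  fix m x w t \<L> and P :: "'w measure" and B
  define k where "k = kappa DIM('a) n m"
  assume num: "deviation_integral_bounded TYPE('a) n R \<epsilon> \<delta> e E2 C m"
   and den: "normalizer_bounded TYPE('a) (H n) n R e E3 (c) m"
   and kp: "0 < kappa DIM('a) n m" and nm: "n <= m" and x: "x \<in> chamber_B n"
   and bd: "\<forall>j<n. x j <= R & w j <= R" and t: "1 / R <= t" "t <= R" and \<L>: "\<L> \<in> mats m n" and w: "sing_vals m n \<L> = w"
   and B: "mat_brownian_motion_from P m n (tilted_orbit_measure H m n x (mat_scale m n (kappa DIM('a) n m) \<L>)) B"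
  have m: "m >= 1" using n nm by simp
  note \<mu> = haar[OF m] and \<nu> = haar[OF n]
  have tp: "t > 0" using t(1) R by (intro less_le_trans[OF _ t(1)]) simp
  define A :: "'a fmat set" where "A = (far_set m n \<epsilon> x w t)"
  have A: "A \<in> sets (mat_space m n)" unfolding A_def by (rule bad_set(1)[OF nm])
  define pr where "pr = emeasure P {\<omega> \<in> space P. mat_add m n (B (t / k) \<omega>) (mat_scale m n t \<L>) \<in> A}"
  define F3 where "F3 = (\<Sum>j<n. T_both (x j) (w j) * (x j * w j)^2 / 2 + c_fun (T_both (x j) (w j)))"
  define S0 where "S0 = (L2_set x {..<n})^2 / (2 * t) + t * (mat_norm m n \<L>)^2 / 2"
  define D where "D = (\<Sum>j<n. c_fun (T_drift (x j) (w j) t) + c_fun (T_start (x j) (w j) t) + ln (lim_sq (x j) (w j) t / (2 * t)))"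
  have bdw: "\<forall>j<n. x j <= R & sing_vals m n \<L> j <= R" using bd by (simp add: w)
  have bd0: "\<forall>j<n. 0 <= x j & x j <= R & sing_vals m n \<L> j <= R" using bd x by (auto simp: w mem_chamber_B_iff)
  have DS: "D = S0 + F3"
  proof -
   have "D = (\<Sum>j<n. (x j)\<^sup>2 / (2 * t) + t * (w j)^2 / 2 + (T_both (x j) (w j) * (x j * w j)^2 / 2 + c_fun (T_both (x j) (w j))))"
    unfolding D_def using coordinate_identities(3)[OF tp]
    by (intro sum.cong refl) (simp only: T_drift_def T_start_def T_both_def)
   also have "... = S0 + F3"
    unfolding S0_def F3_def mat_norm_sing_vals[OF \<L> nm] w L2_set_sq
    by (simp only: sum.distrib sum_divide_distrib sum_distrib_left)
   finally show ?thesis .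
  qed
  have up: "pr * orbit_exp (H m) (H n) m n x k \<L> * eexp (k * S0) <= ennreal (C * exp (k * (D - \<delta>\<^sup>2 / 16 + e * E2)))"
  proof -
   have "pr * orbit_exp (H m) (H n) m n x k \<L> * eexp (k * S0)
    = tilted_mass (H m) (H n) m n k t x \<L> A"
    unfolding pr_def S0_def
    by (rule law_formula[where H = H, OF \<mu> \<nu> nm n kp[folded k_def] tp \<L> A B[folded k_def]])
   also have "... <= ennreal (C * exp (k * (D - \<delta>\<^sup>2 / 16 + e * E2)))"
    using num[THEN spec, THEN spec, THEN spec, THEN spec, THEN spec, THEN mp, OF \<mu>, THEN mp, OF \<nu>, THEN mp, OF x,
      THEN mp, OF t(1), THEN mp, OF t(2), THEN mp, OF \<L>, THEN mp, OF bdw]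
    unfolding w A_def D_def k_def .
   finally show ?thesis .
  qed
  have lo: "ennreal (c * exp (k * (F3 - e * E3))) <= orbit_exp (H m) (H n) m n x k \<L>"
   using den[THEN spec, THEN spec, THEN spec, THEN mp, OF \<mu>, THEN mp, OF \<L>, THEN mp, OF bd0]
   unfolding w F3_def k_def .
  have "pr * ennreal (c * exp (k * (F3 - e * E3)) * exp (k * S0)) = pr * ennreal (c * exp (k * (F3 - e * E3))) * eexp (k * S0)"
   using c by (simp add: ennreal_mult mult.assoc)
  also have "... <= pr * orbit_exp (H m) (H n) m n x k \<L> * eexp (k * S0)"
   by (intro mult_right_mono mult_left_mono lo) simp_all
  also note up
  finally have "pr <= ennreal (C * exp (k * (D - \<delta>\<^sup>2 / 16 + e * E2)) / (c * exp (k * (F3 - e * E3)) * exp (k * S0)))"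
   by (rule ennreal_le_divide) (use c C in simp_all)
  also have "... <= ennreal (C / c * exp (- (\<delta>^2 / 32) * k))"
  proof (rule ennreal_leI)
   have "k * (D - \<delta>\<^sup>2 / 16 + e * E2) - k * (F3 - e * E3) - k * S0 = k * (- (\<delta>^2 / 16) + (e * E2 + e * E3))"
    unfolding DS by (simp add: algebra_simps)
   also have "... <= k * (- (\<delta>^2 / 32))"
    using eE kp by (intro mult_left_mono) (simp_all add: k_def)
   finally have x: "exp (k * (D - \<delta>\<^sup>2 / 16 + e * E2) - k * (F3 - e * E3) - k * S0) <= exp (- (\<delta>^2 / 32) * k)"
    by (simp add: mult.commute)
   have "C * exp a / (c * exp b * exp d) = C / c * exp (a - b - d)" for a b d :: real
    by (simp add: exp_diff)
   then show "C * exp (k * (D - \<delta>\<^sup>2 / 16 + e * E2)) / (c * exp (k * (F3 - e * E3)) * exp (k * S0)) <= C / c * exp (- (\<delta>^2 / 32) * k)"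
    using mult_left_mono[OF x, of "C / c"] C c by simp
  qed
  finally show "deviation_prob P n (%\<omega>. sing_vals m n (mat_add m n (B (t / kappa DIM('a) n m) \<omega>) (mat_scale m n t \<L>)))
   (limit_point n x w t) \<epsilon> <= ennreal (C / c * exp (- (\<delta>^2 / 32) * kappa DIM('a) n m))"
   unfolding deviation_event pr_def A_def k_def .
 qed
qed

section \<open>The limit theorem\<close>

lemma limit_point_chamber:
 assumes "x \<in> chamber_B n" "w \<in> chamber_B n" "t >= 0"
 shows "limit_point n x w t \<in> chamber_B n"
proof -
 have x: "0 <= x i" "0 <= w i" if "i < n" for i using assms that by (auto simp: mem_chamber_B_iff)
 have mono: "limit_point n x w t j <= limit_point n x w t i" if ij: "i <= j" "j < n" for i j
 proof -
  have le: "x j <= x i" "w j <= w i" using assms ij by (auto simp: mem_chamber_B_iff)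
  have j: "0 <= x j" "0 <= w j" using x ij by auto
  have sq: "(x j)^2 <= (x i)^2" "(w j)^2 <= (w i)^2" using le j by (auto intro: power_mono)
  have "(x j)^2 * (w j)^2 <= (x i)^2 * (w i)^2" by (intro mult_mono sq) simp_all
  then have "2 * t * sqrt ((x j)^2 * (w j)^2 + 1) <= 2 * t * sqrt ((x i)^2 * (w i)^2 + 1)"
   using assms(3) by (intro mult_left_mono) simp_all
  moreover have "(w j)^2 * t^2 <= (w i)^2 * t^2" by (intro mult_right_mono sq) simp
  ultimately have "lim_sq (x j) (w j) t <= lim_sq (x i) (w i) t" unfolding lim_sq_def using sq(1) by linarith
  then show ?thesis using ij by (simp add: limit_point_entry)
 qed
 have "0 <= limit_point n x w t i" if "i < n" for i
 proof -
  have "0 <= lim_sq (x i) (w i) t" unfolding lim_sq_def using assms(3) by (intro add_nonneg_nonneg mult_nonneg_nonneg) simp_all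
  then show ?thesis using that by (simp add: limit_point_entry)
 qed
 then show ?thesis using mono by (auto simp: mem_chamber_B_iff limit_point_def)
qed

text \<open>At time zero the process sits on the orbit, where the singular values are exactly \<open>x\<close>.\<close>

lemma deviation_prob_start:
 fixes H :: "nat => ('a::real_complex_quat) fmat measure" and B :: "real => 'w => 'a fmat"
 assumes \<mu>: "normalized_haar m (H m)" and \<nu>: "normalized_haar n (H n)" and nm: "n <= m"
  and k: "k >= 0" and \<L>: "\<L> \<in> mats m n" and x: "x \<in> chamber_B n" and \<epsilon>: "\<epsilon> > 0"
  and B: "mat_brownian_motion_from P m n (tilted_orbit_measure H m n x (mat_scale m n k \<L>)) B"
 shows "deviation_prob P n (%\<omega>. sing_vals m n (mat_add m n (B (0 / k) \<omega>) (mat_scale m n 0 \<L>))) (limit_point n x w 0) \<epsilon> = 0"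
proof -
 define A :: "'a fmat set" where "A = {z \<in> mats m n. \<epsilon> <= L2_set (%i. sing_vals m n z i - sqrt (lim_sq (x i) (w i) 0)) {..<n}}"
 have A: "A \<in> sets (mat_space m n)" unfolding A_def by (rule bad_set(1)[OF nm])
 obtain B0 W where W: "mat_brownian_motion P m n W" and B0: "B0 \<in> P \<rightarrow>\<^sub>M mat_space m n"
  and law0: "distr P (mat_space m n) B0 = tilted_orbit_measure H m n x (mat_scale m n k \<L>)"
  and BW: "\<forall>s\<ge>0. \<forall>\<omega>\<in>space P. B s \<omega> = mat_add m n (B0 \<omega>) (W s \<omega>)"
  using B unfolding mat_brownian_motion_from_def by (elim exE conjE)
 have usvA: "usv m n U x V \<notin> A" if "U \<in> \<U> m" "V \<in> \<U> n" for U V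
 proof -
  have "L2_set (%i. x i - sqrt (lim_sq (x i) (w i) 0)) {..<n} = L2_set (%i. 0) {..<n}"
   using x by (intro L2_set_cong) (simp_all add: lim_sq_def mem_chamber_B_iff)
  then show ?thesis using \<epsilon> sing_vals_usv[OF nm that x] by (simp add: A_def L2_set_def)
 qed
 have "emeasure (orbit_measure H m n x) A = (\<integral>\<^sup>+y. indicator A y \<partial>orbit_measure H m n x)"
  using A by (simp add: orbit_measure_def)
 also have "... = (\<integral>\<^sup>+V. \<integral>\<^sup>+U. indicator A (usv m n U x V) \<partial>H m \<partial>H n)"
  by (rule orbit_nn_integral[where H = H, OF \<mu> \<nu>]) (use A in simp)
 also have "... = (\<integral>\<^sup>+V. \<integral>\<^sup>+U. 0 \<partial>H m \<partial>H n)"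
  by (intro nn_integral_cong) (simp add: haar_space[OF \<mu>] haar_space[OF \<nu>] usvA)
 finally have "A \<in> null_sets (orbit_measure H m n x)" using A by (simp add: null_sets_def orbit_measure_def)
 then have ae: "AE y in orbit_measure H m n x. y \<notin> A" by (rule AE_not_in)
 have "AE y in tilted_orbit_measure H m n x (mat_scale m n k \<L>). y \<notin> A"
 proof -
  obtain Z where Z: "tilted_orbit_measure H m n x (mat_scale m n k \<L>)
   = density (orbit_measure H m n x) (%y. ennreal (exp (k * mat_inner m n \<L> y) / Z))"
   by (rule tilted_normalizer[where H = H, OF \<mu> \<nu> nm k \<L>, of x])
  have "(%y. mat_inner m n \<L> y) \<in> borel_measurable (mat_space m n)"
   by (intro measurable_mat_inner measurable_const_mat \<L> measurable_ident_sets refl)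
  then have "(%y. ennreal (exp (k * mat_inner m n \<L> y) / Z)) \<in> borel_measurable (mat_space m n)" by measurable
  then have "(%y. ennreal (exp (k * mat_inner m n \<L> y) / Z)) \<in> borel_measurable (orbit_measure H m n x)"
   by (simp add: orbit_measure_def)
  from AE_density[OF this] show ?thesis unfolding Z using ae by (auto elim: eventually_mono)
 qed
 then have aeB: "AE \<omega> in P. B0 \<omega> \<notin> A" unfolding law0[symmetric] by (rule AE_distrD[OF B0])
 have "AE \<omega> in P. \<forall>p\<in>idx m n. \<forall>b\<in>Basis. W 0 \<omega> p \<bullet> b = 0"
  using W by (intro AE_finite_allI) (auto simp: mat_brownian_motion_def real_brownian_motion_def)
 from aeB this AE_space[of P] have "AE \<omega> in P. \<not> (mat_add m n (B (0 / k) \<omega>) (mat_scale m n 0 \<L>) \<in> A)"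
 proof eventually_elim
  case (elim \<omega>)
  note True = elim(3)
  show ?case
  proof -
   have W0: "W 0 \<omega> p = 0" if "p \<in> idx m n" for p
    using bspec[OF elim(2) that] by (rule iffD1[OF euclidean_all_zero_iff])
   have "B0 \<omega> \<in> mats m n" using measurable_space[OF B0 True] by simp
   have B0s: "B (0 / k) \<omega> = mat_add m n (B0 \<omega>) (W 0 \<omega>)" using BW True by simp
   have "mat_add m n (B (0 / k) \<omega>) (mat_scale m n 0 \<L>) = B0 \<omega>"
   proof (rule mat_eqI[of _ m n])
    fix i j assume "i < m" "j < n"
    then show "mat_add m n (B (0 / k) \<omega>) (mat_scale m n 0 \<L>) (i, j) = B0 \<omega> (i, j)"
     using W0[of "(i, j)"] unfolding B0s by simp
   qed (use \<open>B0 \<omega> \<in> mats m n\<close> in simp_all)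
   then show ?thesis using elim(1) by simp
  qed
 qed
 from emeasure_eq_0_AE[OF this] show ?thesis unfolding deviation_event A_def .
qed

lemma compact_parameter_box:
 assumes U: "compact U" "U \<subseteq> chamber_B n \<times> chamber_B n \<times> {0<..}"
 obtains R :: real where "R >= 1"
  "!!x w t. (x, w, t) \<in> U ==> (\<forall>j<n. x j <= R & w j <= R) & 1 / R <= t & t <= R"
proof -
 define f where "f u = (\<Sum>j<n. fst u j + fst (snd u) j) + (snd (snd u) + 1 / snd (snd u))" for u :: "(nat => real) \<times> (nat => real) \<times> real"
 have c1: "continuous_on U (%u. fst u j)" for j
  by (rule continuous_on_compose2[OF continuous_on_product_coordinates continuous_on_fst[OF continuous_on_id] subset_UNIV])
 have c2: "continuous_on U (%u. fst (snd u) j)" for j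
  by (rule continuous_on_compose2[OF continuous_on_product_coordinates continuous_on_fst[OF continuous_on_snd[OF continuous_on_id]] subset_UNIV])
 have c3: "continuous_on U (%u. snd (snd u))"
  by (rule continuous_on_snd[OF continuous_on_snd[OF continuous_on_id]])
 have "\<forall>u\<in>U. snd (snd u) ~= 0" using U(2) by auto
 then have "continuous_on U f"
  unfolding f_def by (intro continuous_on_add continuous_on_sum continuous_on_divide continuous_on_const c1 c2 c3)
 then have "compact (f ` U)" by (rule compact_continuous_image[OF _ U(1)])
 then obtain b where b: "!!u. u \<in> U ==> f u <= b"
  using bounded_imp_bdd_above[OF compact_imp_bounded] by (metis bdd_above.unfold image_eqI)
 show ?thesis
 proof (rule that[of "max 1 b"], simp)
  fix x w t assume u: "(x, w, t) \<in> U"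
  then have x: "x \<in> chamber_B n" "w \<in> chamber_B n" and t: "t > 0" using U(2) by auto
  have nn: "0 <= x j" "0 <= w j" if "j < n" for j using x that by (auto simp: mem_chamber_B_iff)
  have s: "(\<Sum>j<n. x j + w j) + (t + 1 / t) <= b" using b[OF u] by (simp add: f_def)
  have "0 <= (\<Sum>j<n. x j + w j)" using nn by (intro sum_nonneg) (simp add: add_nonneg_nonneg)
  then have t': "t <= b" "1 / t <= b" using s t by (auto intro: order.trans[rotated])
  have "x j <= b & w j <= b" if j: "j < n" for j
  proof -
   have "x j + w j <= (\<Sum>j<n. x j + w j)" using nn j by (intro member_le_sum) (auto simp: add_nonneg_nonneg)
   moreover have "0 < t + 1 / t" using t by (simp add: add_pos_pos)
   ultimately show ?thesis using s nn[OF j] by linarith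
  qed
  moreover have "1 / max 1 b <= t"
  proof -
   have "1 / t <= max 1 b" using t' by simp
   then show ?thesis using t by (simp add: field_simps)
  qed
  ultimately show "(\<forall>j<n. x j <= max 1 b & w j <= max 1 b) & 1 / max 1 b <= t & t <= max 1 b"
   using t' by (auto simp: le_max_iff_disj)
 qed
qed

lemma exponential_bound_tendsto_0:
 assumes "\<eta> > 0" "d >= 1"
 shows "(%m. ennreal (C * exp (- \<eta> * kappa d n m))) \<longlonglongrightarrow> 0"
proof -
 have "filterlim (%m. \<eta> * kappa d n m) at_top sequentially"
  by (rule filterlim_tendsto_pos_mult_at_top[OF tendsto_const assms(1) kappa_at_top[OF assms(2)]])
 then have "filterlim (%m. - (\<eta> * kappa d n m)) at_bot sequentially" by (simp add: filterlim_uminus_at_top)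
 then have "(%m. exp (- (\<eta> * kappa d n m))) \<longlonglongrightarrow> 0" by (rule filterlim_compose[OF exp_at_bot])
 from tendsto_ennrealI[OF tendsto_mult_left[OF this, of C]] show ?thesis by simp
qed

theorem corollary5p8:
  fixes N :: nat
    and H :: "nat \<Rightarrow> ('a::real_complex_quat) fmat measure"
    and \<Lambda> :: "nat \<Rightarrow> (nat \<Rightarrow> real) \<Rightarrow> (nat \<Rightarrow> real) \<Rightarrow> real \<Rightarrow> 'a fmat"
    and P :: "nat \<Rightarrow> (nat \<Rightarrow> real) \<Rightarrow> (nat \<Rightarrow> real) \<Rightarrow> real \<Rightarrow> 'w measure"
    and B :: "nat \<Rightarrow> (nat \<Rightarrow> real) \<Rightarrow> (nat \<Rightarrow> real) \<Rightarrow> real \<Rightarrow> real \<Rightarrow> 'w \<Rightarrow> 'a fmat"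
    and \<kappa> :: "nat \<Rightarrow> real"
    and Y :: "nat \<Rightarrow> (nat \<Rightarrow> real) \<Rightarrow> (nat \<Rightarrow> real) \<Rightarrow> real \<Rightarrow> 'w \<Rightarrow> nat \<Rightarrow> real"
  defines "\<kappa> \<equiv> kappa DIM('a) N"
    and "Y \<equiv> (\<lambda>M x w t \<omega>.
      sing_vals M N (mat_add M N (B M x w t (t / \<kappa> M) \<omega>) (mat_scale M N t (\<Lambda> M x w t))))"
  assumes N: "N \<ge> 1"
    and haar: "\<And>n. n \<ge> 1 \<Longrightarrow> normalized_haar n (H n)"
    and Lambda: "\<And>M x w t. M \<ge> N \<Longrightarrow> x \<in> chamber_B N \<Longrightarrow> w \<in> chamber_B N \<Longrightarrow> t \<ge> 0 \<Longrightarrow>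
      \<Lambda> M x w t \<in> mats M N \<and> sing_vals M N (\<Lambda> M x w t) = w"
    and brownian: "\<And>M x w t. M \<ge> N \<Longrightarrow> x \<in> chamber_B N \<Longrightarrow> w \<in> chamber_B N \<Longrightarrow> t \<ge> 0 \<Longrightarrow>
      mat_brownian_motion_from (P M x w t) M N
        (tilted_orbit_measure H M N x (mat_scale M N (\<kappa> M) (\<Lambda> M x w t))) (B M x w t)"
  shows "(\<forall>x\<in>chamber_B N. \<forall>w\<in>chamber_B N. \<forall>t\<ge>0.
        limit_point N x w t \<in> chamber_B N \<and>
        (\<forall>\<epsilon>>0. (\<lambda>M. deviation_prob (P M x w t) N (Y M x w t) (limit_point N x w t) \<epsilon>)
           \<longlonglongrightarrow> 0)) \<and>
      (\<forall>\<epsilon>>0. \<forall>U. compact U \<and> U \<subseteq> chamber_B N \<times> chamber_B N \<times> {0<..} \<longrightarrow>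
        (\<lambda>M. SUP (x, w, t)\<in>U. deviation_prob (P M x w t) N (Y M x w t) (limit_point N x w t) \<epsilon>)
          \<longlonglongrightarrow> 0)"
proof -
 have d: "DIM('a) \<ge> 1" by (simp add: Suc_leI)
 have uniform: "(%M. SUP (x, w, t)\<in>U. deviation_prob (P M x w t) N (Y M x w t) (limit_point N x w t) \<epsilon>) \<longlonglongrightarrow> 0"
  if \<epsilon>: "\<epsilon> > 0" and U: "compact U" "U \<subseteq> chamber_B N \<times> chamber_B N \<times> {0<..}" for \<epsilon> U
 proof -
  obtain R where R: "R \<ge> 1"
   "\<And>x w t. (x, w, t) \<in> U ==> (\<forall>j<N. x j <= R \<and> w j <= R) \<and> 1 / R <= t \<and> t <= R"
   by (rule compact_parameter_box[OF U]) blast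
  obtain C \<eta> where \<eta>: "\<eta> > 0" and bound: "\<forall>\<^sub>F m in sequentially. \<forall>x w t \<Lambda> (P :: 'w measure) B.
   x \<in> chamber_B N --> (\<forall>j<N. x j <= R \<and> w j <= R) --> 1 / R <= t --> t <= R -->
   \<Lambda> \<in> mats m N --> sing_vals m N \<Lambda> = w -->
   mat_brownian_motion_from P m N (tilted_orbit_measure H m N x (mat_scale m N (kappa DIM('a) N m) \<Lambda>)) B -->
   deviation_prob P N (%\<omega>. sing_vals m N (mat_add m N (B (t / kappa DIM('a) N m) \<omega>) (mat_scale m N t \<Lambda>)))
    (limit_point N x w t) \<epsilon> <= ennreal (C * exp (- \<eta> * kappa DIM('a) N m))"
   by (rule deviation_bound[OF N haar R(1) \<epsilon>])
  have "\<forall>\<^sub>F M in sequentially. (SUP (x, w, t)\<in>U. deviation_prob (P M x w t) N (Y M x w t) (limit_point N x w t) \<epsilon>)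
   <= ennreal (C * exp (- \<eta> * kappa DIM('a) N M))"
   using bound eventually_ge_at_top[of N]
  proof eventually_elim
   case (elim M)
   show ?case
   proof (rule SUP_least, clarify)
    fix x w t assume u: "(x, w, t) \<in> U"
    then have x: "x \<in> chamber_B N" "w \<in> chamber_B N" "t \<ge> 0" using U(2) by auto
    note L = Lambda[OF elim(2) x] and B = brownian[OF elim(2) x]
    show "deviation_prob (P M x w t) N (Y M x w t) (limit_point N x w t) \<epsilon> <= ennreal (C * exp (- \<eta> * kappa DIM('a) N M))"
     unfolding Y_def \<kappa>_def
     using elim(1) x(1) R(2)[OF u] L B unfolding \<kappa>_def by blast
   qed
  qed
  from tendsto_sandwich[OF _ this tendsto_const exponential_bound_tendsto_0[OF \<eta> d]]
  show ?thesis by simp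
 qed
 have pointwise: "(%M. deviation_prob (P M x w t) N (Y M x w t) (limit_point N x w t) \<epsilon>) \<longlonglongrightarrow> 0"
  if x: "x \<in> chamber_B N" "w \<in> chamber_B N" "t \<ge> 0" and \<epsilon>: "\<epsilon> > 0" for x w t \<epsilon>
 proof (cases "t = 0")
  case False
  have "(%M. SUP (x, w, t)\<in>{(x, w, t)}. deviation_prob (P M x w t) N (Y M x w t) (limit_point N x w t) \<epsilon>) \<longlonglongrightarrow> 0"
   by (rule uniform[OF \<epsilon>]) (use x False in auto)
  then show ?thesis by simp
 next
  case True
  have "\<forall>\<^sub>F M in sequentially. deviation_prob (P M x w t) N (Y M x w t) (limit_point N x w t) \<epsilon> = 0"
   using eventually_ge_at_top[of N]
  proof eventually_elim
   case (elim M)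
   note L = Lambda[OF elim x] and B = brownian[OF elim x]
   have "deviation_prob (P M x w t) N (%\<omega>. sing_vals M N (mat_add M N (B M x w t (0 / \<kappa> M) \<omega>) (mat_scale M N 0 (\<Lambda> M x w t)))) (limit_point N x w 0) \<epsilon> = 0"
    by (rule deviation_prob_start[where H = H, OF haar haar elim _ conjunct1[OF L] x(1) \<epsilon> B])
     (use N elim kappa_nonneg[OF elim d] in \<open>simp_all add: \<kappa>_def\<close>)
   then show ?case unfolding Y_def True .
  qed
  then show ?thesis by (rule tendsto_eventually)
 qed
 show ?thesis using limit_point_chamber pointwise uniform by blast
qed

end
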